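(* Suppose that the density $p\in\mathcal{C}^2(\mathcal{M})$ satisfies $0<p_{\min}\le p(x)\le p_{\max}$ for all $x\in\mathcal{M}$ (for some constants $p_{\min},p_{\max}$), and that the integers $k_n\in\{1,\dots,n\}$ satisfy $$\lim_{n\to+\infty}\frac{k_n}{n}=0\qquad\text{and}\qquad \lim_{n\to+\infty}\frac1n\left(\frac{k_n}{n}\right)^{-1-2/d}\log\left(\frac{k_n}{n}\right)=0 .$$ Then, with probability $1$, for all $f\in\mathcal{C}^3(\mathcal{M})$, as $n\to\infty$, $$\sup_{x\in\mathcal{M}}\left|\mathcal{A}_n^{\mathrm{kNN}}(f)(x)-\mathcal{A}(f)(x)\right| = O\left(\sqrt{\log\left(\frac{n}{k_n}\right)}\,\frac{1}{\sqrt{k_n}}\left(\frac{n}{k_n}\right)^{1/d}+\left(\frac{k_n}{n}\right)^{1/d}\right).$$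
   Context: $\mathcal{M}$ is a compact smooth $d$-dimensional submanifold without boundary of $\mathbb{R}^m$, with the Riemannian structure induced by $\mathbb{R}^m$; $\|\cdot\|_2$ is the Euclidean norm of $\mathbb{R}^m$ and $\mu$ the Riemannian volume measure on $\mathcal{M}$. $(X_i)_{i\ge1}$ are i.i.d. points of $\mathcal{M}$ with law $p(x)\mu(\mathrm{d}x)$, where $p$ is a probability density with respect to $\mu$. For $x\in\mathcal{M}$ and $1\le k\le n$, the distance from $x$ to its $k$-th nearest neighbor is $$R_{n,k}(x)=\inf\Big\{r\ge0:\ \sum_{i=1}^n\mathbf{1}_{\|x-X_i\|_2\le r}\ge k\Big\},$$ and the $k$NN Laplacian is $$\mathcal{A}_n^{\mathrm{kNN}}(f)(x)=\frac{1}{n R_{n,k_n}^{d+2}(x)}\sum_{i=1}^n\mathbf{1}_{[0,1]}\left(\frac{\|X_i-x\|_2}{R_{n,k_n}(x)}\right)(f(X_i)-f(x)).$$ The limit operator is $$\mathcal{A}(f)=c_0\Big(\langle\nabla_{\mathcal{M}}(p),\nabla_{\mathcal{M}}(f)\rangle+\tfrac12\,p\,\Delta_{\mathcal{M}}(f)\Big),\qquad c_0=\frac1d\int_{\mathbb{R}^d}K(\|v\|_2)\|v\|_2^2\,\mathrm{d}v\quad\text{with } K=\mathbf{1}_{[0,1]},$$ where $\nabla_{\mathcal{M}}$ and $\Delta_{\mathcal{M}}$ are the Riemannian gradient and the Laplace–Beltrami operator (the divergence of the gradient) of $\mathcal{M}$. The implicit constant in $O(\cdot)$ may depend on $f$ and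 on the random realization, but not on $n$. *)

theory Defs
  imports "HOL-Probability.Probability"
begin

section \<open>Differentiability classes on open subsets of Euclidean space\<close>

fun Ck_on :: "nat \<Rightarrow> 'a::real_normed_vector set \<Rightarrow> ('a \<Rightarrow> 'b::real_normed_vector) \<Rightarrow> bool" where
  "Ck_on 0 S f \<longleftrightarrow> continuous_on S f"
| "Ck_on (Suc k) S f \<longleftrightarrow>
     (\<forall>x\<in>S. f differentiable (at x)) \<and> (\<forall>v. Ck_on k S (\<lambda>x. frechet_derivative f (at x) v))"

definition smooth_on :: "'a::real_normed_vector set \<Rightarrow> ('a \<Rightarrow> 'b::real_normed_vector) \<Rightarrow> bool" where
  "smooth_on S f \<longleftrightarrow> (\<forall>k. Ck_on k S f)"


section \<open>Submanifolds\<close>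

text \<open>The dimension of the submanifold is the cardinality of the index type \<open>'d\<close>, hence at least 1.\<close>

definition local_param :: "(real^'m) set \<Rightarrow> (real^'d) set \<Rightarrow> (real^'d \<Rightarrow> real^'m) \<Rightarrow> bool" where
  "local_param M V \<phi> \<longleftrightarrow>
     open V \<and> smooth_on V \<phi> \<and> (\<forall>u\<in>V. inj (frechet_derivative \<phi> (at u))) \<and>
     openin (top_of_set M) (\<phi> ` V) \<and> (\<exists>\<psi>. homeomorphism V (\<phi> ` V) \<phi> \<psi>)"

definition smooth_submanifold :: "'d::finite itself \<Rightarrow> (real^'m) set \<Rightarrow> bool" where
  "smooth_submanifold _ M \<longleftrightarrow>
     (\<forall>x\<in>M. \<exists>V (\<phi> :: real^'d \<Rightarrow> real^'m). local_param M V \<phi> \<and> x \<in> \<phi> ` V)"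

text \<open>A function on \<open>M\<close> is represented by a function on the ambient space; the notions below only
  depend on its values on \<open>M\<close>.\<close>

definition Ck_manifold :: "'d::finite itself \<Rightarrow> nat \<Rightarrow> (real^'m) set \<Rightarrow> (real^'m \<Rightarrow> real) \<Rightarrow> bool" where
  "Ck_manifold _ k M f \<longleftrightarrow>
     (\<forall>V (\<phi> :: real^'d \<Rightarrow> real^'m). local_param M V \<phi> \<longrightarrow> Ck_on k V (f \<circ> \<phi>))"


section \<open>Riemannian structure induced by the ambient space\<close>

definition metric_matrix :: "(real^'d \<Rightarrow> real^'m) \<Rightarrow> real^'d \<Rightarrow> real^'d^'d" where
  "metric_matrix \<phi> u =
     (\<chi> i j. frechet_derivative \<phi> (at u) (axis i 1) \<bullet> frechet_derivative \<phi> (at u) (axis j 1))"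

text \<open>The Riemannian volume measure is the Borel measure on \<open>M\<close> that is given in every local
  parametrization by the density \<open>sqrt (det g)\<close>. This determines it uniquely, as \<open>M\<close> is
  covered by countably many parametrized pieces.\<close>

definition riemannian_volume :: "'d::finite itself \<Rightarrow> (real^'m) set \<Rightarrow> (real^'m) measure \<Rightarrow> bool" where
  "riemannian_volume _ M \<mu> \<longleftrightarrow>
     space \<mu> = M \<and> sets \<mu> = sets (restrict_space borel M) \<and>
     (\<forall>V (\<phi> :: real^'d \<Rightarrow> real^'m). local_param M V \<phi> \<longrightarrow>
        (\<forall>B\<in>sets \<mu>. B \<subseteq> \<phi> ` V \<longrightarrow>
           emeasure \<mu> B =
             (\<integral>\<^sup>+u\<in>{u\<in>V. \<phi> u \<in> B}. ennreal (sqrt (det (metric_matrix \<phi> u))) \<partial>lborel)))"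

definition tangent_space :: "(real^'m) set \<Rightarrow> real^'m \<Rightarrow> (real^'m) set" where
  "tangent_space M x =
     {v. \<exists>\<gamma> \<epsilon>. \<epsilon> > 0 \<and> \<gamma> 0 = x \<and> (\<forall>t\<in>{-\<epsilon><..<\<epsilon>}. \<gamma> t \<in> M) \<and>
                (\<gamma> has_vector_derivative v) (at (0::real))}"

text \<open>The differential at \<open>x\<close> of a map \<open>F\<close> on \<open>M\<close>, applied to a tangent vector. The
  derivative within \<open>M\<close> is not unique as a linear map on the ambient space, but its restriction
  to the tangent space is, so the definition should only be used for tangent \<open>v\<close>.\<close>

definition differential ::
  "(real^'m) set \<Rightarrow> (real^'m \<Rightarrow> 'b::real_normed_vector) \<Rightarrow> real^'m \<Rightarrow> real^'m \<Rightarrow> 'b" where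
  "differential M F x v = frechet_derivative F (at x within M) v"

definition riemannian_gradient :: "(real^'m) set \<Rightarrow> (real^'m \<Rightarrow> real) \<Rightarrow> real^'m \<Rightarrow> real^'m" where
  "riemannian_gradient M f x =
     (THE w. w \<in> tangent_space M x \<and> (\<forall>v\<in>tangent_space M x. w \<bullet> v = differential M f x v))"

text \<open>The Levi-Civita connection of the induced metric: the orthogonal projection onto the tangent
  space of the ambient derivative of the vector field \<open>Y\<close> along \<open>v\<close>.\<close>

definition levi_civita ::
  "(real^'m) set \<Rightarrow> (real^'m \<Rightarrow> real^'m) \<Rightarrow> real^'m \<Rightarrow> real^'m \<Rightarrow> real^'m" where
  "levi_civita M Y x v = closest_point (tangent_space M x) (differential M Y x v)"

definition orthonormal_basis :: "(real^'m) set \<Rightarrow> (real^'m) set \<Rightarrow> bool" where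
  "orthonormal_basis T B \<longleftrightarrow>
     B \<subseteq> T \<and> pairwise orthogonal B \<and> (\<forall>b\<in>B. norm b = 1) \<and> span B = T"

text \<open>The divergence of a tangent field \<open>Y\<close> is the trace of \<open>v \<mapsto> \<nabla>\<^sub>v Y\<close> on the tangent space,
  which may be computed in any orthonormal basis.\<close>

definition riemannian_divergence :: "(real^'m) set \<Rightarrow> (real^'m \<Rightarrow> real^'m) \<Rightarrow> real^'m \<Rightarrow> real" where
  "riemannian_divergence M Y x =
     (\<Sum>b\<in>(SOME B. orthonormal_basis (tangent_space M x) B). levi_civita M Y x b \<bullet> b)"

definition laplace_beltrami :: "(real^'m) set \<Rightarrow> (real^'m \<Rightarrow> real) \<Rightarrow> real^'m \<Rightarrow> real" where
  "laplace_beltrami M f = riemannian_divergence M (riemannian_gradient M f)"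


section \<open>The kNN Laplacian and its limit\<close>

definition kernel :: "real \<Rightarrow> real" where
  "kernel = indicat_real {0..1}"

definition knn_radius :: "(nat \<Rightarrow> real^'m) \<Rightarrow> nat \<Rightarrow> nat \<Rightarrow> real^'m \<Rightarrow> real" where
  "knn_radius X n k x =
     Inf {r. r \<ge> 0 \<and> (\<Sum>i=1..n. of_bool (norm (x - X i) \<le> r)) \<ge> real k}"

definition knn_laplacian ::
  "nat \<Rightarrow> (nat \<Rightarrow> real^'m) \<Rightarrow> nat \<Rightarrow> nat \<Rightarrow> (real^'m \<Rightarrow> real) \<Rightarrow> real^'m \<Rightarrow> real" where
  "knn_laplacian d X n k f x =
     1 / (real n * knn_radius X n k x ^ (d + 2)) *
     (\<Sum>i=1..n. kernel (norm (X i - x) / knn_radius X n k x) * (f (X i) - f x))"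

definition limit_const :: "'d::finite itself \<Rightarrow> real" where
  "limit_const _ =
     1 / real CARD('d) * (\<integral>v. kernel (norm v) * norm v ^ 2 \<partial>(lborel :: (real^'d) measure))"

definition limit_operator ::
  "'d::finite itself \<Rightarrow> (real^'m) set \<Rightarrow> (real^'m \<Rightarrow> real) \<Rightarrow> (real^'m \<Rightarrow> real) \<Rightarrow> real^'m \<Rightarrow> real" where
  "limit_operator D M p f x =
     limit_const D *
     (riemannian_gradient M p x \<bullet> riemannian_gradient M f x + 1 / 2 * p x * laplace_beltrami M f x)"

end

theory Submission
  imports Defs "HOL-Real_Asymp.Real_Asymp"
begin

text \<open>Let \<open>h = (k\<^sub>n/n)\<^sup>1\<^sup>/\<^sup>d\<close>. Around each point of \<open>M\<close> a local parametrization is precomposed with a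
  quadratic map so that its differential at the origin is an isometry and its second derivative there is
  normal to \<open>M\<close>. In such a chart chord lengths are \<open>|v| + O(|v|\<^sup>3)\<close> and the volume density is
  \<open>1 + O(|v|\<^sup>2)\<close>, so by symmetry of balls the mean of \<open>f(X) - f(x)\<close> over the ball of radius \<open>r\<close> is
  \<open>r\<^sup>d\<^sup>+\<^sup>2 Af(x) + O(r\<^sup>d\<^sup>+\<^sup>3)\<close>, uniformly by compactness.

  A Taylor expansion of \<open>f\<close> in the ambient space reduces all \<open>f\<close> simultaneously to the first and second
  moments of the sample in balls. These are compared over polynomially many centres and radii, so
  Bernstein's inequality and the Borel-Cantelli lemma bound the fluctuations, relative to \<open>n h\<^sup>d\<^sup>+\<^sup>2\<close>, by a multiple
  of \<open>\<lambda> = sqrt (ln n / (n h\<^sup>d\<^sup>+\<^sup>2))\<close>. The same estimates confine the random radius to \<open>[a h, b h]\<close>.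

  Finally \<open>\<lambda>\<close> is dominated by the claimed rate: either \<open>\<lambda> \<le> h\<close>, or \<open>n h\<^sup>d\<^sup>+\<^sup>4 < ln n\<close>, and then
  \<open>n/k\<^sub>n\<close> exceeds a fixed power of \<open>n\<close>, so that \<open>ln n = O(ln (n/k\<^sub>n))\<close>.\<close>

section \<open>Calculus of \<open>C\<^sup>k\<close> maps\<close>

text \<open>The error budget dictates the construction. On a ball of mass about \<open>h^d\<close>
  the increment of \<open>f\<close> has size \<open>h\<close>, and the limit appears at order
  \<open>h^(d+2)\<close>, one order finer than the linear term that symmetry cancels. An error
  \<open>O(h^(d+3))\<close> thus allows a chart to deform the sphere of radius \<open>r\<close> by
  \<open>O(r^3)\<close> but not by \<open>O(r^2)\<close>, as a general chart does. Geodesic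
  coordinates would be accurate enough; correcting a chart by a quadratic map reaches the same order
  by algebra alone. The second obstacle is the order of quantifiers: one null set has to serve all
  \<open>f\<close>. So only finitely many tests per \<open>n\<close>, none depending on
  \<open>f\<close>, are made to concentrate, and \<open>f\<close> enters afterwards through the
  coefficients of its expansion. The variance of a test is its squared size \<open>h^2\<close> times
  the mass \<open>h^d\<close>, whence the scale \<open>n h^(d+2)\<close>. Centres and radii are
  discretized at mesh \<open>h^3\<close>, because a shell of that thickness has mass
  \<open>O(h^(d+2))\<close> and moments have size \<open>h\<close> on it. Uniformity in the radius
  makes it harmless that the nearest neighbour radius depends on the sample.\<close>

lemma has_derivative_cong_open:
  assumes "open S" "x \<in> S" "\<And>y. y \<in> S \<Longrightarrow> f y = g y"
  shows "(f has_derivative f') (at x) \<longleftrightarrow> (g has_derivative f') (at x)"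
  using has_derivative_transform_within_open[OF _ assms(1,2)] assms(3) by metis

lemma frechet_derivative_cong_open:
  assumes "open S" "x \<in> S" "\<And>y. y \<in> S \<Longrightarrow> f y = g y"
  shows "frechet_derivative f (at x) = frechet_derivative g (at x)"
  unfolding frechet_derivative_def using has_derivative_cong_open[OF assms] by simp

lemma Ck_on_cong:
  assumes "open S" "\<And>y. y \<in> S \<Longrightarrow> f y = g y"
  shows "Ck_on k S f \<longleftrightarrow> Ck_on k S g"
  using assms(2)
proof (induction k arbitrary: f g)
  case 0
  then show ?case by (simp cong: continuous_on_cong)
next
  case (Suc k)
  have 1: "f differentiable (at x) \<longleftrightarrow> g differentiable (at x)" if "x \<in> S" for x
    unfolding differentiable_def using has_derivative_cong_open[OF assms(1) that] Suc.prems by blast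
  have 2: "Ck_on k S (\<lambda>x. frechet_derivative f (at x) v) \<longleftrightarrow> Ck_on k S (\<lambda>x. frechet_derivative g (at x) v)" for v
    by (rule Suc.IH) (use frechet_derivative_cong_open[OF assms(1)] Suc.prems in metis)
  show ?case using 1 2 by simp
qed

text \<open>The recursion of \<open>Ck_on\<close> is phrased with \<open>frechet_derivative\<close>;
  on an open set derivatives are unique, so a formula from a product or chain rule may take its
  place.\<close>

lemma Ck_on_SucI:
  assumes "open S" "\<And>x. x \<in> S \<Longrightarrow> (f has_derivative f' x) (at x)" "\<And>v. Ck_on k S (\<lambda>x. f' x v)"
  shows "Ck_on (Suc k) S f"
proof -
  have "frechet_derivative f (at x) = f' x" if "x \<in> S" for x
    using frechet_derivative_at[OF assms(2)[OF that]] by simp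
  then have "Ck_on k S (\<lambda>x. frechet_derivative f (at x) v)" for v
    using Ck_on_cong[OF assms(1), of "\<lambda>x. frechet_derivative f (at x) v" "\<lambda>x. f' x v"] assms(3) by simp
  then show ?thesis using assms(2) by (auto simp: differentiable_def)
qed

lemma Ck_on_SucD:
  assumes "Ck_on (Suc k) S f" "x \<in> S"
  shows "(f has_derivative frechet_derivative f (at x)) (at x)"
  using assms frechet_derivative_works by auto

lemma Ck_on_deriv: "Ck_on (Suc k) S f \<Longrightarrow> Ck_on k S (\<lambda>x. frechet_derivative f (at x) v)"
  by simp

lemma Ck_on_continuous:
  assumes "Ck_on k S f" shows "continuous_on S f"
proof (cases k)
  case (Suc j)
  then show ?thesis using assms
    by (auto intro!: continuous_at_imp_continuous_on differentiable_imp_continuous_within)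
qed (use assms in simp)

lemma Ck_on_Suc_imp: "Ck_on (Suc k) S f \<Longrightarrow> Ck_on k S f"
proof (induction k arbitrary: f)
  case 0
  then show ?case using Ck_on_continuous by fastforce
next
  case (Suc k)
  then show ?case by (metis Ck_on.simps(2))
qed

lemma Ck_on_mono: "Ck_on k S f \<Longrightarrow> j \<le> k \<Longrightarrow> Ck_on j S f"
  by (induction k) (auto simp del: Ck_on.simps simp: le_Suc_eq dest: Ck_on_Suc_imp)

declare Ck_on.simps(2) [simp del]

lemma Ck_on_const:
  assumes "open S" shows "Ck_on k S (\<lambda>x. c)"
proof (induction k arbitrary: c)
  case (Suc k)
  show ?case by (rule Ck_on_SucI[OF assms, where f'="\<lambda>_ _. 0"]) (use Suc in auto)
qed simp

lemma Ck_on_add: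
  assumes "open S" "Ck_on k S f" "Ck_on k S g" shows "Ck_on k S (\<lambda>x. f x + g x)"
  using assms(2,3)
proof (induction k arbitrary: f g)
  case 0
  then show ?case by (simp add: continuous_on_add)
next
  case (Suc k)
  show ?case
    by (rule Ck_on_SucI[OF assms(1)], rule has_derivative_add,
        rule Ck_on_SucD[OF Suc.prems(1)], assumption, rule Ck_on_SucD[OF Suc.prems(2)], assumption,
        intro Suc.IH Ck_on_deriv Suc.prems)
qed

lemma Ck_on_sum:
  assumes "open S" "\<And>i. i \<in> I \<Longrightarrow> Ck_on k S (f i)" shows "Ck_on k S (\<lambda>x. \<Sum>i\<in>I. f i x)"
  using assms(2) by (induction I rule: infinite_finite_induct) (auto intro: Ck_on_const Ck_on_add assms(1))

lemma Ck_on_bounded_linear: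
  assumes "open S" "Ck_on k S f" "bounded_linear A" shows "Ck_on k S (\<lambda>x. A (f x))"
  using assms(2)
proof (induction k arbitrary: f)
  case 0
  then show ?case using assms(3) by (simp add: bounded_linear.continuous_on)
next
  case (Suc k)
  show ?case
    by (rule Ck_on_SucI[OF assms(1)], rule bounded_linear.has_derivative[OF assms(3)],
        rule Ck_on_SucD[OF Suc.prems],
        assumption, intro Suc.IH Ck_on_deriv Suc.prems)
qed

lemma Ck_on_scaleR:
  fixes f :: "'a::real_normed_vector \<Rightarrow> real"
  assumes "open S" "Ck_on k S f" "Ck_on k S g" shows "Ck_on k S (\<lambda>x. f x *\<^sub>R g x)"
  using assms(2,3)
proof (induction k arbitrary: f g)
  case 0
  then show ?case by (simp add: continuous_on_scaleR)
next
  case (Suc k)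
  have f: "Ck_on k S f" and g: "Ck_on k S g" using Suc.prems Ck_on_Suc_imp by blast+
  show ?case
  proof (rule Ck_on_SucI[OF assms(1)])
    show "((\<lambda>x. f x *\<^sub>R g x) has_derivative
        (\<lambda>v. f x *\<^sub>R frechet_derivative g (at x) v + frechet_derivative f (at x) v *\<^sub>R g x)) (at x)"
      if "x \<in> S" for x
      by (intro has_derivative_scaleR Ck_on_SucD[OF Suc.prems(1) that] Ck_on_SucD[OF Suc.prems(2) that])
    show "Ck_on k S (\<lambda>x. f x *\<^sub>R frechet_derivative g (at x) v + frechet_derivative f (at x) v *\<^sub>R g x)" for v
      by (intro Ck_on_add assms(1) Suc.IH f g Ck_on_deriv Suc.prems)
  qed
qed

text \<open>Expanding the chain rule in the standard basis keeps the induction inside the class: the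
  derivative of the composite is a finite sum of scalar components of \<open>g'\<close> times
  partial derivatives of \<open>f\<close> composed with \<open>g\<close>, and the latter fall under
  the induction hypothesis for \<open>k\<close>.\<close>

lemma Ck_on_compose:
  fixes f :: "'b::euclidean_space \<Rightarrow> 'c::real_normed_vector"
  assumes "open S" "open T" "g ` S \<subseteq> T" "Ck_on k S g" "Ck_on k T f"
  shows "Ck_on k S (f \<circ> g)"
  using assms(4,5)
proof (induction k arbitrary: f)
  case 0
  then show ?case using assms(3) continuous_on_compose continuous_on_subset by (metis Ck_on.simps(1))
next
  case (Suc k)
  let ?f' = "\<lambda>y. frechet_derivative f (at y)" and ?g' = "\<lambda>x. frechet_derivative g (at x)"
  have d: "((f \<circ> g) has_derivative (\<lambda>v. \<Sum>b\<in>Basis. (?g' x v \<bullet> b) *\<^sub>R ?f' (g x) b)) (at x)" if "x \<in> S" for x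
  proof -
    have g: "(g has_derivative ?g' x) (at x)" using Ck_on_SucD[OF Suc.prems(1) that] .
    have f: "(f has_derivative ?f' (g x)) (at (g x))" using Ck_on_SucD[OF Suc.prems(2)] that assms(3) by blast
    have l: "linear (?f' (g x))" using f has_derivative_linear by blast
    have "?f' (g x) w = (\<Sum>b\<in>Basis. (w \<bullet> b) *\<^sub>R ?f' (g x) b)" for w
    proof -
      have "?f' (g x) w = ?f' (g x) (\<Sum>b\<in>Basis. (w \<bullet> b) *\<^sub>R b)" by (simp add: euclidean_representation)
      then show ?thesis by (simp only: linear_sum[OF l] linear_cmul[OF l])
    qed
    then have "(?f' (g x) \<circ> ?g' x) = (\<lambda>v. \<Sum>b\<in>Basis. (?g' x v \<bullet> b) *\<^sub>R ?f' (g x) b)"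
      unfolding o_def by blast
    with diff_chain_at[OF g f] show ?thesis by (simp only:)
  qed
  show ?case
  proof (rule Ck_on_SucI[OF assms(1) d])
    fix v
    have 1: "Ck_on k S (\<lambda>x. ?g' x v \<bullet> b)" for b
      using Suc.prems(1) Ck_on_deriv by (intro Ck_on_bounded_linear[OF assms(1), of _ _ "\<lambda>y. y \<bullet> b"]) (auto intro: bounded_linear_inner_left)
    have 2: "Ck_on k S (\<lambda>x. ?f' (g x) b)" for b
      using Suc.IH[of "\<lambda>y. ?f' y b"] Suc.prems Ck_on_Suc_imp Ck_on_deriv unfolding o_def by blast
    show "Ck_on k S (\<lambda>x. \<Sum>b\<in>Basis. (?g' x v \<bullet> b) *\<^sub>R ?f' (g x) b)"
      by (intro Ck_on_sum Ck_on_scaleR assms(1) 1 2)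
  qed
qed

lemma Ck_on_linear:
  assumes "open S" "bounded_linear A" shows "Ck_on k S A"
proof (cases k)
  case (Suc j)
  show ?thesis unfolding Suc
    by (rule Ck_on_SucI[OF assms(1), where f'="\<lambda>_. A"])
      (use assms in \<open>auto intro: bounded_linear_imp_has_derivative Ck_on_const\<close>)
qed (use assms in \<open>simp add: linear_continuous_on\<close>)

lemma Ck_on_quadratic:
  assumes "open S" "bounded_bilinear B" shows "Ck_on k S (\<lambda>x. B x x)"
proof (cases k)
  case 0
  then show ?thesis using bounded_bilinear.continuous_on[OF assms(2) continuous_on_id continuous_on_id] by simp
next
  case (Suc j)
  interpret bounded_bilinear B by fact
  show ?thesis unfolding Suc
  proof (rule Ck_on_SucI[OF assms(1)])
    show "((\<lambda>x. B x x) has_derivative (\<lambda>s. B x s + B s x)) (at x)" for x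
      by (auto intro!: derivative_eq_intros FDERIV)
    show "Ck_on j S (\<lambda>x. B x v + B v x)" for v
      by (intro Ck_on_linear assms(1) bounded_linear_add bounded_linear_left bounded_linear_right)
  qed
qed

text \<open>The derivative in direction \<open>s\<close> of \<open>DF\<close> applied to
  \<open>t\<close>. \<open>Ck_on\<close> speaks of derivatives in fixed directions only, so
  \<open>t\<close> is expanded in the basis and just the partial derivatives are differentiated;
  linearity in \<open>t\<close> then holds by construction.\<close>

definition hess :: "('a::euclidean_space \<Rightarrow> 'b::real_normed_vector) \<Rightarrow> 'a \<Rightarrow> 'a \<Rightarrow> 'a \<Rightarrow> 'b" where
  "hess F u s t = (\<Sum>b\<in>Basis. (t \<bullet> b) *\<^sub>R frechet_derivative (\<lambda>y. frechet_derivative F (at y) b) (at u) s)"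

lemma linear_bound_Basis:
  fixes A :: "'a::euclidean_space \<Rightarrow> 'b::real_normed_vector"
  assumes "linear A" "\<And>b. b \<in> Basis \<Longrightarrow> norm (A b) \<le> C b"
  shows "norm (A t) \<le> (\<Sum>b\<in>Basis. C b) * norm t"
proof -
  have "A t = (\<Sum>b\<in>Basis. (t \<bullet> b) *\<^sub>R A b)"
  proof -
    have "A t = A (\<Sum>b\<in>Basis. (t \<bullet> b) *\<^sub>R b)" by (simp add: euclidean_representation)
    then show ?thesis by (simp only: linear_sum[OF assms(1)] linear_cmul[OF assms(1)])
  qed
  also have "norm \<dots> \<le> (\<Sum>b\<in>Basis. norm t * C b)"
    by (rule sum_norm_le) (auto intro!: mult_mono assms(2) simp: Basis_le_norm)
  finally show ?thesis by (simp add: sum_distrib_left mult.commute)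
qed

lemma frechet_linear:
  assumes "Ck_on (Suc k) V F" "u \<in> V" shows "linear (frechet_derivative F (at u))"
  using Ck_on_SucD[OF assms] has_derivative_linear by blast

lemma hess_bilinear:
  assumes "Ck_on (Suc (Suc k)) V F" "u \<in> V"
  shows "bounded_bilinear (hess F u)"
proof -
  have l: "linear (frechet_derivative (\<lambda>y. frechet_derivative F (at y) b) (at u))" for b
    using frechet_linear[OF Ck_on_deriv[OF assms(1)] assms(2)] .
  have "bilinear (hess F u)"
    unfolding bilinear_def
  proof safe
    fix x show "linear (hess F u x)"
      by (auto simp: hess_def linear_iff algebra_simps sum.distrib scaleR_sum_right)
  next
    fix y show "linear (\<lambda>x. hess F u x y)"
      unfolding hess_def by (intro linear_compose_sum ballI linear_compose_scale_right l)
  qed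
  then show ?thesis using bilinear_conv_bounded_bilinear by blast
qed

text \<open>Compactness bounds the derivative on each basis vector separately, which is all the
  continuity that \<open>Ck_on\<close> offers, and \<open>linear_bound_Basis\<close> assembles these
  into an operator bound. Convexity is there for the mean value inequality.\<close>

lemma C1_bounds:
  fixes F :: "'a::euclidean_space \<Rightarrow> 'b::real_normed_vector"
  assumes "Ck_on (Suc k) V F" "open V" "compact S" "convex S" "S \<subseteq> V"
  obtains C where "C \<ge> 0" "\<And>u t. u \<in> S \<Longrightarrow> norm (frechet_derivative F (at u) t) \<le> C * norm t"
    "\<And>u w. u \<in> S \<Longrightarrow> w \<in> S \<Longrightarrow> norm (F w - F u) \<le> C * norm (w - u)"
proof -
  have "\<exists>C. \<forall>u\<in>S. norm (frechet_derivative F (at u) b) \<le> C" for b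
  proof -
    have "continuous_on S (\<lambda>u. frechet_derivative F (at u) b)"
      using assms Ck_on_continuous by (metis Ck_on_deriv continuous_on_subset)
    then have "bounded ((\<lambda>u. frechet_derivative F (at u) b) ` S)"
      using assms(3) compact_continuous_image compact_imp_bounded by blast
    then show ?thesis by (auto simp: bounded_iff)
  qed
  then obtain c where c: "\<And>b u. u \<in> S \<Longrightarrow> norm (frechet_derivative F (at u) b) \<le> c b" by metis
  define C where "C = \<bar>\<Sum>b\<in>Basis. c b\<bar>"
  have 1: "norm (frechet_derivative F (at u) t) \<le> C * norm t" if "u \<in> S" for u t
    using linear_bound_Basis[OF frechet_linear[OF assms(1)], of u c t] c that assms(5)
    by (smt (verit) C_def mult_right_mono norm_ge_zero subsetD)
  have 2: "norm (F w - F u) \<le> C * norm (w - u)" if "u \<in> S" "w \<in> S" for u w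
  proof (rule differentiable_bound[OF assms(4)])
    show "(F has_derivative frechet_derivative F (at x)) (at x within S)" if "x \<in> S" for x
      using Ck_on_SucD[OF assms(1)] that assms(5) has_derivative_at_withinI by blast
    show "onorm (frechet_derivative F (at x)) \<le> C" if "x \<in> S" for x
      by (rule onorm_bound) (use 1 that in \<open>auto simp: C_def\<close>)
  qed (use that in auto)
  show ?thesis using that[of C] 1 2 by (auto simp: C_def)
qed

lemma C2_bounds:
  fixes F :: "'a::euclidean_space \<Rightarrow> 'b::real_normed_vector"
  assumes "Ck_on (Suc (Suc k)) V F" "open V" "compact S" "convex S" "S \<subseteq> V"
  obtains C where "C \<ge> 0" "\<And>u t. u \<in> S \<Longrightarrow> norm (frechet_derivative F (at u) t) \<le> C * norm t"
    "\<And>u w. u \<in> S \<Longrightarrow> w \<in> S \<Longrightarrow> norm (F w - F u) \<le> C * norm (w - u)"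
    "\<And>u w t. u \<in> S \<Longrightarrow> w \<in> S \<Longrightarrow>
      norm (frechet_derivative F (at w) t - frechet_derivative F (at u) t) \<le> C * norm (w - u) * norm t"
    "\<And>u s t. u \<in> S \<Longrightarrow> norm (hess F u s t) \<le> C * norm s * norm t"
    "\<And>u w. u \<in> S \<Longrightarrow> w \<in> S \<Longrightarrow>
      norm (F w - F u - frechet_derivative F (at u) (w - u)) \<le> C * norm (w - u) ^ 2"
proof -
  let ?D = "\<lambda>u. frechet_derivative F (at u)"
  obtain C1 where C1: "C1 \<ge> 0" "\<And>u t. u \<in> S \<Longrightarrow> norm (?D u t) \<le> C1 * norm t"
    "\<And>u w. u \<in> S \<Longrightarrow> w \<in> S \<Longrightarrow> norm (F w - F u) \<le> C1 * norm (w - u)"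
    using C1_bounds[OF assms] by blast
  have "\<exists>C\<ge>0. (\<forall>u\<in>S. \<forall>t. norm (frechet_derivative (\<lambda>y. ?D y b) (at u) t) \<le> C * norm t) \<and>
      (\<forall>u\<in>S. \<forall>w\<in>S. norm (?D w b - ?D u b) \<le> C * norm (w - u))" for b
    using C1_bounds[of k V "\<lambda>y. ?D y b" S] assms by (metis Ck_on_deriv)
  then obtain c where c: "\<And>b. c b \<ge> 0" "\<And>b u t. u \<in> S \<Longrightarrow> norm (frechet_derivative (\<lambda>y. ?D y b) (at u) t) \<le> c b * norm t"
    "\<And>b u w. u \<in> S \<Longrightarrow> w \<in> S \<Longrightarrow> norm (?D w b - ?D u b) \<le> c b * norm (w - u)" by metis
  define C2 where "C2 = (\<Sum>b\<in>Basis. c b)"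
  have C2: "C2 \<ge> 0" by (auto simp: C2_def intro: sum_nonneg c)
  have 1: "norm (?D w t - ?D u t) \<le> C2 * norm (w - u) * norm t" if "u \<in> S" "w \<in> S" for u w t
  proof -
    have "norm (?D w t - ?D u t) \<le> (\<Sum>b\<in>Basis. c b * norm (w - u)) * norm t"
      by (rule linear_bound_Basis[of "\<lambda>t. ?D w t - ?D u t"])
        (use c that assms frechet_linear in \<open>blast intro: linear_compose_sub\<close>)+
    then show ?thesis by (simp add: C2_def sum_distrib_right)
  qed
  have 2: "norm (hess F u s t) \<le> C2 * norm s * norm t" if "u \<in> S" for u s t
  proof -
    have "norm (hess F u s t) \<le> (\<Sum>b\<in>Basis. norm t * (c b * norm s))"
      unfolding hess_def
      by (rule sum_norm_le) (auto intro!: mult_mono c that simp: Basis_le_norm)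
    then show ?thesis by (simp add: C2_def sum_distrib_right sum_distrib_left ac_simps)
  qed
  have 3: "norm (F w - F u - ?D u (w - u)) \<le> C2 * norm (w - u) ^ 2" if "u \<in> S" "w \<in> S" for u w
  proof -
    \<comment> \<open>Cutting down to the ball of radius \<open>norm (w - u)\<close> makes the
      derivative of \<open>?G\<close>, which is \<open>DF(x) - DF(u)\<close>, at most
      \<open>C2 * norm (w - u)\<close> throughout; the mean value inequality supplies the second
      factor.\<close>
    let ?S = "S \<inter> cball u (norm (w - u))" let ?G = "\<lambda>y. F y - ?D u (y - u)"
    have bl: "bounded_linear (?D u)"
      using Ck_on_SucD[OF assms(1)] that assms(5) has_derivative_bounded_linear by blast
    have "norm (?G w - ?G u) \<le> (C2 * norm (w - u)) * norm (w - u)"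
    proof (rule differentiable_bound)
      show "convex ?S" using assms(4) by (simp add: convex_Int)
      show "(?G has_derivative (\<lambda>t. ?D x t - ?D u t)) (at x within ?S)" if "x \<in> ?S" for x
      proof -
        have "(F has_derivative ?D x) (at x within ?S)"
          using Ck_on_SucD[OF assms(1)] that assms(5) has_derivative_at_withinI by blast
        moreover have "((\<lambda>y. ?D u (y - u)) has_derivative (\<lambda>t. ?D u t)) (at x within ?S)"
          by (rule bounded_linear.has_derivative[OF bl]) (auto intro!: derivative_eq_intros)
        ultimately show ?thesis by (rule has_derivative_diff)
      qed
      show "onorm (\<lambda>t. ?D x t - ?D u t) \<le> C2 * norm (w - u)" if "x \<in> ?S" for x
      proof (rule onorm_bound)
        fix t
        have "norm (?D x t - ?D u t) \<le> C2 * norm (x - u) * norm t" using 1 that \<open>u \<in> S\<close> by blast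
        also have "\<dots> \<le> C2 * norm (w - u) * norm t"
          using that C2 by (intro mult_right_mono mult_left_mono) (auto simp: dist_norm norm_minus_commute)
        finally show "norm (?D x t - ?D u t) \<le> C2 * norm (w - u) * norm t" .
      qed (use C2 in auto)
    qed (use that in \<open>auto simp: dist_norm norm_minus_commute\<close>)
    moreover have "?D u 0 = 0" using bl linear_simps(3) by blast
    ultimately show ?thesis by (simp add: power2_eq_square algebra_simps)
  qed
  have le: "x \<le> C1 * a \<Longrightarrow> a \<ge> 0 \<Longrightarrow> x \<le> (C1 + C2) * a" "x \<le> C2 * a \<Longrightarrow> a \<ge> 0 \<Longrightarrow> x \<le> (C1 + C2) * a" for x a
    using C1(1) C2 by (smt (verit) mult_right_mono)+
  show ?thesis
  proof (rule that[of "C1 + C2"])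
    show "norm (hess F u s t) \<le> (C1 + C2) * norm s * norm t" if "u \<in> S" for u s t
      using le(2)[of _ "norm s * norm t"] 2[OF that, of s t] by (simp add: mult.assoc)
    show "norm (?D w t - ?D u t) \<le> (C1 + C2) * norm (w - u) * norm t" if "u \<in> S" "w \<in> S" for u w t
      using le(2)[of _ "norm (w - u) * norm t"] 1[OF that, of t] by (simp add: mult.assoc)
  qed (use C1 C2 2 3 le in auto)
qed

text \<open>The Taylor remainder bound of \<open>C2_bounds\<close> applied to every partial
  derivative of \<open>F\<close> and summed over the basis.\<close>

lemma C3_bound_deriv:
  fixes F :: "'a::euclidean_space \<Rightarrow> 'b::real_normed_vector"
  assumes "Ck_on (Suc (Suc (Suc k))) V F" "open V" "compact S" "convex S" "S \<subseteq> V"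
  obtains C where "C \<ge> 0"
    "\<And>u w t. u \<in> S \<Longrightarrow> w \<in> S \<Longrightarrow>
      norm (frechet_derivative F (at w) t - frechet_derivative F (at u) t - hess F u (w - u) t) \<le> C * norm (w - u) ^ 2 * norm t"
proof -
  let ?D = "\<lambda>u. frechet_derivative F (at u)"
  have "\<exists>C\<ge>0. (\<forall>u\<in>S. \<forall>w\<in>S. norm (?D w b - ?D u b - frechet_derivative (\<lambda>y. ?D y b) (at u) (w - u)) \<le> C * norm (w - u) ^ 2)" for b
    using C2_bounds[of k V "\<lambda>y. ?D y b" S] assms by (metis Ck_on_deriv)
  then obtain c where c: "\<And>b. c b \<ge> 0" 
    "\<And>b u w. u \<in> S \<Longrightarrow> w \<in> S \<Longrightarrow> norm (?D w b - ?D u b - frechet_derivative (\<lambda>y. ?D y b) (at u) (w - u)) \<le> c b * norm (w - u) ^ 2" by metis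
  define C2 where "C2 = (\<Sum>b\<in>Basis. c b)"
  have C2: "C2 \<ge> 0" by (auto simp: C2_def intro: sum_nonneg c)
  have 1: "norm (?D w t - ?D u t - hess F u (w - u) t) \<le> C2 * norm (w - u)^2 * norm t" if "u \<in> S" "w \<in> S" for u w t
  proof -
    have bb: "bounded_bilinear (hess F u)" using hess_bilinear[OF assms(1)] that assms(5) by blast
    have hb: "hess F u s b = frechet_derivative (\<lambda>y. ?D y b) (at u) s" if "b \<in> Basis" for b s
    proof -
      have "hess F u s b = (\<Sum>c\<in>Basis. (if c = b then frechet_derivative (\<lambda>y. ?D y b) (at u) s else 0))"
        unfolding hess_def by (intro sum.cong) (auto simp: inner_Basis that)
      then show ?thesis using that by simp
    qed
    have "norm (?D w t - ?D u t - hess F u (w - u) t) \<le> (\<Sum>b\<in>Basis. c b * norm (w - u)^2) * norm t"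
    proof (rule linear_bound_Basis[of "\<lambda>t. ?D w t - ?D u t - hess F u (w - u) t"])
      show "linear (\<lambda>t. ?D w t - ?D u t - hess F u (w - u) t)"
        by (intro linear_compose_sub frechet_linear[OF assms(1)] bounded_linear.linear bounded_bilinear.bounded_linear_right[OF bb])
          (use that assms in auto)
      show "norm (?D w b - ?D u b - hess F u (w - u) b) \<le> c b * (norm (w - u))\<^sup>2" if "b \<in> Basis" for b
        using c(2)[of u w b] \<open>u \<in> S\<close> \<open>w \<in> S\<close> hb that by simp
    qed
    then show ?thesis by (simp add: C2_def sum_distrib_right)
  qed
  show ?thesis using that[OF C2 1] .
qed

text \<open>The second difference \<open>\<Delta> s t\<close> is symmetric and equals
  \<open>hess F u s t\<close> up to a cubic error. Evaluated at \<open>r s\<close> and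
  \<open>r t\<close>, the Hessians scale like \<open>r^2\<close> and the error like
  \<open>r^3\<close>, so the asymmetry vanishes as \<open>r\<close> tends to 0.\<close>

lemma hess_sym:
  fixes F :: "'a::euclidean_space \<Rightarrow> 'b::real_normed_vector"
  assumes "Ck_on (Suc (Suc (Suc k))) V F" "open V" "u \<in> V"
  shows "hess F u s t = hess F u t s"
proof -
  let ?D = "\<lambda>u. frechet_derivative F (at u)" let ?H = "hess F u"
  obtain e where e: "e > 0" "cball u e \<subseteq> V" using assms open_contains_cball by blast
  obtain C where C: "C \<ge> 0" "\<And>w t. w \<in> cball u e \<Longrightarrow>
      norm (?D w t - ?D u t - hess F u (w - u) t) \<le> C * norm (w - u) ^ 2 * norm t"
    using C3_bound_deriv[OF assms(1,2) compact_cball convex_cball e(2)] e(1)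
    by (metis centre_in_cball less_eq_real_def)
  interpret H: bounded_bilinear ?H using hess_bilinear[OF assms(1,3)] .
  define \<Delta> where "\<Delta> s t = F (u + s + t) - F (u + t) - F (u + s) + F u" for s t
  have key: "norm (\<Delta> s t - ?H s t) \<le> 2 * C * (norm s + norm t)^2 * norm t" if st: "norm s + norm t \<le> e" for s t
  proof -
    \<comment> \<open>With \<open>s\<close> frozen, the derivative of \<open>?g\<close> compares the
      first-order expansions of \<open>DF\<close> at \<open>u + s + x\<close> and at
      \<open>u + x\<close>; their linear parts differ by exactly \<open>?H s\<close>, so only the
      two quadratic remainders survive.\<close>
    let ?g = "\<lambda>t. F (u + s + t) - F (u + t) - ?H s t"
    have "norm (?g t - ?g 0) \<le> (2 * C * (norm s + norm t)^2) * norm (t - 0)"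
    proof (rule differentiable_bound[OF convex_cball[of 0 "norm t"]])
      fix x assume x: "x \<in> cball (0::'a) (norm t)"
      have nx: "norm (s + x) \<le> e" "norm x \<le> e"
        using st x norm_triangle_ineq[of s x] norm_ge_zero[of s] unfolding mem_cball_0 by linarith+
      have in1: "u + s + x \<in> cball u e" "u + x \<in> cball u e"
        using nx by (metis add.assoc add_diff_cancel_left' dist_commute dist_norm mem_cball)+
      show "(?g has_derivative (\<lambda>z. ?D (u + s + x) z - ?D (u + x) z - ?H s z)) (at x within cball 0 (norm t))"
      proof (intro has_derivative_diff H.bounded_linear_right[THEN bounded_linear_imp_has_derivative])
        have "(F has_derivative ?D (u + s + x)) (at (u + s + x))" using Ck_on_SucD[OF assms(1)] in1 e by blast
        then show "((\<lambda>t. F (u + s + t)) has_derivative ?D (u + s + x)) (at x within cball 0 (norm t))"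
          by (rule has_derivative_compose[where f="\<lambda>t. u + s + t" and f'="\<lambda>z. z", rotated])
            (auto intro!: derivative_eq_intros)
        have "(F has_derivative ?D (u + x)) (at (u + x))" using Ck_on_SucD[OF assms(1)] in1 e by blast
        then show "((\<lambda>t. F (u + t)) has_derivative ?D (u + x)) (at x within cball 0 (norm t))"
          by (rule has_derivative_compose[where f="\<lambda>t. u + t" and f'="\<lambda>z. z", rotated])
            (auto intro!: derivative_eq_intros)
      qed
      show "onorm (\<lambda>z. ?D (u + s + x) z - ?D (u + x) z - ?H s z) \<le> 2 * C * (norm s + norm t)\<^sup>2"
      proof (rule onorm_bound)
        fix z
        have n1: "norm (s + x) \<le> norm s + norm t" "norm x \<le> norm s + norm t" using x norm_triangle_ineq[of s x] by (auto intro: order_trans)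
        have a: "norm (?D (u + s + x) z - ?D u z - ?H (s + x) z) \<le> C * norm (s + x) ^ 2 * norm z"
          using C(2)[OF in1(1), of z] by (simp add: add.assoc)
        have b: "norm (?D (u + x) z - ?D u z - ?H x z) \<le> C * norm x ^ 2 * norm z"
          using C(2)[OF in1(2), of z] by simp
        have "?D (u + s + x) z - ?D (u + x) z - ?H s z = (?D (u + s + x) z - ?D u z - ?H (s + x) z) - (?D (u + x) z - ?D u z - ?H x z)"
          by (simp add: H.add_left)
        then have "norm (?D (u + s + x) z - ?D (u + x) z - ?H s z) \<le> C * norm (s + x) ^ 2 * norm z + C * norm x ^ 2 * norm z"
          using norm_triangle_ineq4 a b by (smt (verit))
        also have "\<dots> \<le> C * (norm s + norm t) ^ 2 * norm z + C * (norm s + norm t) ^ 2 * norm z"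
          using n1 C(1) by (intro add_mono mult_right_mono mult_left_mono power_mono) auto
        finally show "norm (?D (u + s + x) z - ?D (u + x) z - ?H s z) \<le> 2 * C * (norm s + norm t)\<^sup>2 * norm z" by (simp add: algebra_simps)
      qed (use C in auto)
    qed auto
    moreover have "?g t - ?g 0 = \<Delta> s t - ?H s t" by (simp add: \<Delta>_def H.zero_right)
    ultimately show ?thesis by (simp only: diff_zero)
  qed
  have sym: "\<Delta> s t = \<Delta> t s" for s t by (simp add: \<Delta>_def algebra_simps)
  define K where "K = 2 * C * (norm s + norm t)^2 * (norm s + norm t)"
  have small: "norm (?H s t - ?H t s) \<le> K * r" if r: "0 < r" "r * (norm s + norm t) \<le> e" for r
  proof -
    have rr: "norm (r *\<^sub>R s) + norm (r *\<^sub>R t) = r * (norm s + norm t)" using r by (simp add: algebra_simps)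
    have "norm (\<Delta> (r *\<^sub>R s) (r *\<^sub>R t) - ?H (r *\<^sub>R s) (r *\<^sub>R t)) \<le> 2 * C * (r * (norm s + norm t))^2 * (r * norm t)"
      using key[of "r *\<^sub>R s" "r *\<^sub>R t"] rr r by simp
    moreover have "norm (\<Delta> (r *\<^sub>R s) (r *\<^sub>R t) - ?H (r *\<^sub>R t) (r *\<^sub>R s)) \<le> 2 * C * (r * (norm s + norm t))^2 * (r * norm s)"
      using key[of "r *\<^sub>R t" "r *\<^sub>R s"] rr r sym by (simp add: add.commute)
    ultimately have "norm (?H (r *\<^sub>R s) (r *\<^sub>R t) - ?H (r *\<^sub>R t) (r *\<^sub>R s)) \<le> 2 * C * (r * (norm s + norm t))^2 * (r * norm t) + 2 * C * (r * (norm s + norm t))^2 * (r * norm s)"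
      by (smt (verit, best) norm_minus_commute norm_diff_triangle_le)
    also have "\<dots> = r^2 * (K * r)" by (simp add: K_def algebra_simps power2_eq_square)
    also have "?H (r *\<^sub>R s) (r *\<^sub>R t) - ?H (r *\<^sub>R t) (r *\<^sub>R s) = r^2 *\<^sub>R (?H s t - ?H t s)"
      by (simp add: H.scaleR_left H.scaleR_right power2_eq_square scaleR_diff_right)
    finally have "r^2 * norm (?H s t - ?H t s) \<le> r^2 * (K * r)" by simp
    then show ?thesis using r by simp
  qed
  have "((\<lambda>r. K * r) \<longlongrightarrow> K * 0) (at_right 0)" by (intro tendsto_intros)
  moreover have "\<forall>\<^sub>F r in at_right 0. norm (?H s t - ?H t s) \<le> K * r"
  proof -
    have "\<forall>\<^sub>F r in at_right (0::real). r \<in> {0<..<e / (norm s + norm t + 1)}"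
      by (rule eventually_at_right_real) (use e in \<open>auto intro!: divide_pos_pos add_nonneg_pos\<close>)
    then show ?thesis
    proof eventually_elim
      case (elim r)
      have "r * (norm s + norm t) \<le> r * (norm s + norm t + 1)" using elim by simp
      also have "\<dots> \<le> e" using elim add_nonneg_pos[of "norm s + norm t" 1] by (auto simp: field_simps)
      finally show ?case using small elim by auto
    qed
  qed
  ultimately have "norm (?H s t - ?H t s) \<le> K * 0"
    by (intro tendsto_lowerbound) auto
  then show ?thesis by simp
qed

lemma C3_bounds:
  fixes F :: "'a::euclidean_space \<Rightarrow> 'b::real_normed_vector"
  assumes "Ck_on (Suc (Suc (Suc k))) V F" "open V" "compact S" "convex S" "S \<subseteq> V"
  obtains C where "C \<ge> 0"
    "\<And>u w t. u \<in> S \<Longrightarrow> w \<in> S \<Longrightarrow>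
      norm (frechet_derivative F (at w) t - frechet_derivative F (at u) t - hess F u (w - u) t) \<le> C * norm (w - u) ^ 2 * norm t"
    "\<And>u w. u \<in> S \<Longrightarrow> w \<in> S \<Longrightarrow>
      norm (F w - F u - frechet_derivative F (at u) (w - u) - (1/2) *\<^sub>R hess F u (w - u) (w - u)) \<le> C * norm (w - u) ^ 3"
proof -
  let ?D = "\<lambda>u. frechet_derivative F (at u)"
  obtain C where C: "C \<ge> 0" and C1: "\<And>u w t. u \<in> S \<Longrightarrow> w \<in> S \<Longrightarrow>
      norm (?D w t - ?D u t - hess F u (w - u) t) \<le> C * norm (w - u) ^ 2 * norm t"
    using C3_bound_deriv[OF assms] by blast
  have 3: "norm (F w - F u - ?D u (w - u) - (1/2) *\<^sub>R hess F u (w - u) (w - u)) \<le> C * norm (w - u) ^ 3"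
    if uw: "u \<in> S" "w \<in> S" for u w
  proof -
    let ?S = "S \<inter> cball u (norm (w - u))"
    let ?G = "\<lambda>y. F y - ?D u (y - u) - (1/2) *\<^sub>R hess F u (y - u) (y - u)"
    have uV: "u \<in> V" using that assms by auto
    interpret H: bounded_bilinear "hess F u" using hess_bilinear[OF assms(1) uV] .
    have bl: "bounded_linear (?D u)"
      using Ck_on_SucD[OF assms(1)] uV has_derivative_bounded_linear by blast
    have "norm (?G w - ?G u) \<le> (C * norm (w - u) ^ 2) * norm (w - u)"
    proof (rule differentiable_bound)
      show "convex ?S" using assms(4) by (simp add: convex_Int)
      show "(?G has_derivative (\<lambda>t. ?D x t - ?D u t - hess F u (x - u) t)) (at x within ?S)" if "x \<in> ?S" for x
      proof (rule has_derivative_diff[OF has_derivative_diff])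
        show "(F has_derivative ?D x) (at x within ?S)"
          using Ck_on_SucD[OF assms(1)] that assms(5) has_derivative_at_withinI by blast
        show "((\<lambda>y. ?D u (y - u)) has_derivative (\<lambda>t. ?D u t)) (at x within ?S)"
          by (rule bounded_linear.has_derivative[OF bl]) (auto intro!: derivative_eq_intros)
        have 1: "((\<lambda>y. hess F u (y - u) (y - u)) has_derivative (\<lambda>t. hess F u (x - u) t + hess F u t (x - u))) (at x within ?S)"
          by (rule H.FDERIV) (auto intro!: derivative_eq_intros)
        \<comment> \<open>Symmetry of the Hessian enters here: both halves of the product rule
          coincide, and the factor 1/2 turns their sum into \<open>hess F u (x - u)\<close>.\<close>
        have "(\<lambda>t. (1/2) *\<^sub>R (hess F u (x - u) t + hess F u t (x - u))) = (\<lambda>t. hess F u (x - u) t)"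
          using hess_sym[OF assms(1,2) uV, of _ "x - u"] by (auto simp: fun_eq_iff scaleR_add_right[symmetric] simp flip: scaleR_2)
        then show "((\<lambda>y. (1/2) *\<^sub>R hess F u (y - u) (y - u)) has_derivative (\<lambda>t. hess F u (x - u) t)) (at x within ?S)"
          using has_derivative_scaleR_right[OF 1, of "1/2"] by simp
      qed
      show "onorm (\<lambda>t. ?D x t - ?D u t - hess F u (x - u) t) \<le> C * norm (w - u) ^ 2" if "x \<in> ?S" for x
      proof (rule onorm_bound)
        fix t
        have "norm (?D x t - ?D u t - hess F u (x - u) t) \<le> C * norm (x - u) ^ 2 * norm t" using C1 that uw by blast
        also have "\<dots> \<le> C * norm (w - u) ^ 2 * norm t"
          using that C by (intro mult_right_mono mult_left_mono power_mono) (auto simp: dist_norm norm_minus_commute)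
        finally show "norm (?D x t - ?D u t - hess F u (x - u) t) \<le> C * norm (w - u) ^ 2 * norm t" .
      qed (use C in auto)
    qed (use that in \<open>auto simp: dist_norm norm_minus_commute\<close>)
    moreover have "?D u 0 = 0" using bl linear_simps(3) by blast
    ultimately show ?thesis by (simp add: power2_eq_square power3_eq_cube algebra_simps H.zero_left)
  qed
  show ?thesis using that[OF C C1 3] .
qed

section \<open>Local parametrizations\<close>

lemma local_paramD:
  assumes "local_param M V \<phi>"
  shows "open V" "Ck_on k V \<phi>" "openin (top_of_set M) (\<phi> ` V)"
    "u \<in> V \<Longrightarrow> inj (frechet_derivative \<phi> (at u))"
    "u \<in> V \<Longrightarrow> (\<phi> has_derivative frechet_derivative \<phi> (at u)) (at u)"
    "u \<in> V \<Longrightarrow> linear (frechet_derivative \<phi> (at u))"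
    "u \<in> V \<Longrightarrow> \<phi> u \<in> M"
proof -
  have s: "Ck_on k V \<phi>" for k using assms by (auto simp: local_param_def smooth_on_def)
  show "open V" "Ck_on k V \<phi>" "openin (top_of_set M) (\<phi> ` V)"
    "u \<in> V \<Longrightarrow> inj (frechet_derivative \<phi> (at u))"
    using assms by (auto simp: local_param_def smooth_on_def)
  show "u \<in> V \<Longrightarrow> (\<phi> has_derivative frechet_derivative \<phi> (at u)) (at u)"
    using Ck_on_SucD s by blast
  then show "u \<in> V \<Longrightarrow> linear (frechet_derivative \<phi> (at u))"
    using has_derivative_linear by blast
  show "u \<in> V \<Longrightarrow> \<phi> u \<in> M"
    using assms openin_imp_subset[of euclidean M "\<phi> ` V"] by (auto simp: local_param_def)
qed

text \<open>Any left inverse \<open>A\<close> of the derivative of the chart serves. Left inverses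
  differ off the tangent space, which a derivative within \<open>M\<close> does not see. Applying
  \<open>A\<close> to the first-order expansion of \<open>\<phi>\<close> bounds the error by
  \<open>norm (w - u)\<close>, and continuity of the inverse makes \<open>w\<close> close enough to
  \<open>u\<close> for that bound to be expressed by \<open>norm (y - \<phi> u)\<close>.\<close>

lemma local_param_inverse_has_derivative:
  fixes \<phi> :: "real^'d \<Rightarrow> real^'m"
  assumes lp: "local_param M V \<phi>" and u: "u \<in> V"
    and A: "linear A" "\<And>s. A (frechet_derivative \<phi> (at u) s) = s"
    and \<psi>: "homeomorphism V (\<phi> ` V) \<phi> \<psi>"
  shows "(\<psi> has_derivative A) (at (\<phi> u) within M)"
proof -
  let ?D = "frechet_derivative \<phi> (at u)" let ?x = "\<phi> u"
  have blA: "bounded_linear A" using A(1) linear_conv_bounded_linear by blast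
  obtain K where K: "K > 0" "\<And>z. norm (A z) \<le> K * norm z"
    using bounded_linear.pos_bounded[OF blA] by (metis mult.commute)
  have \<psi>u: "\<psi> ?x = u" and \<psi>\<phi>: "\<And>w. w \<in> V \<Longrightarrow> \<psi> (\<phi> w) = w"
    using \<psi> u by (auto simp: homeomorphism_def)
  obtain T where T: "open T" "\<phi> ` V = M \<inter> T" using local_paramD(3)[OF lp] by (auto simp: openin_open)
  have "?x \<in> T" using T u by blast
  then obtain d2 where d2: "d2 > 0" "ball ?x d2 \<subseteq> T" using T(1) open_contains_ball by blast
  show ?thesis
    unfolding has_derivative_within_alt
  proof (intro conjI allI impI)
    fix e :: real assume e: "e > 0"
    \<comment> \<open>The first entry gives \<open>K * e' \<le> 1/2\<close>, so that the error is
      absorbed and \<open>norm (w - u)\<close> is at most twice \<open>norm (A (y - ?x))\<close>;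
      the second turns the resulting factor \<open>2 * K * K * e'\<close> into at most
      \<open>e\<close>.\<close>
    define e' where "e' = min (1 / (2 * K)) (e / (2 * K * K))"
    have e': "e' > 0" "K * e' \<le> 1/2" "2 * K * K * e' \<le> e"
    proof -
      show "e' > 0" using e K by (simp add: e'_def)
      have "e' \<le> 1 / (2 * K)" "e' \<le> e / (2 * K * K)" by (auto simp: e'_def)
      then show "K * e' \<le> 1/2" "2 * K * K * e' \<le> e" using K by (auto simp: field_simps)
    qed
    obtain d' where d': "d' > 0" "\<And>w. norm (w - u) < d' \<Longrightarrow> norm (\<phi> w - \<phi> u - ?D (w - u)) \<le> e' * norm (w - u)"
      using local_paramD(5)[OF lp u] e'(1) unfolding has_derivative_within_alt by auto
    have "continuous_on (\<phi> ` V) \<psi>" using \<psi> by (auto simp: homeomorphism_def)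
    then obtain d where d: "d > 0" "\<And>y. y \<in> \<phi> ` V \<Longrightarrow> dist y ?x < d \<Longrightarrow> dist (\<psi> y) u < d'"
      unfolding continuous_on_iff using u d'(1) \<psi>u by (metis imageI)
    show "\<exists>d>0. \<forall>y\<in>M. norm (y - ?x) < d \<longrightarrow> norm (\<psi> y - \<psi> ?x - A (y - ?x)) \<le> e * norm (y - ?x)"
    proof (intro exI[of _ "min d d2"] conjI ballI impI)
      fix y assume y: "y \<in> M" "norm (y - ?x) < min d d2"
      then have "y \<in> T" using d2 by (auto simp: dist_norm norm_minus_commute)
      then have yV: "y \<in> \<phi> ` V" using T y by blast
      then obtain w where w: "w \<in> V" "y = \<phi> w" by blast
      have wu: "norm (w - u) < d'" using d(2)[OF yV] y w \<psi>\<phi> by (simp add: dist_norm)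
      have eq: "A (y - ?x) - (w - u) = A (\<phi> w - \<phi> u - ?D (w - u))"
        using A(2)[of "w - u"] linear_diff[OF A(1)] w by simp
      have b: "norm (A (y - ?x) - (w - u)) \<le> K * e' * norm (w - u)"
      proof -
        have "norm (A (y - ?x) - (w - u)) \<le> K * (norm (\<phi> w - \<phi> u - ?D (w - u)))" using eq K by simp
        also have "\<dots> \<le> K * (e' * norm (w - u))" using d'(2)[OF wu] K by simp
        finally show ?thesis by simp
      qed
      have "K * e' * norm (w - u) \<le> 1/2 * norm (w - u)" using e'(2) by (intro mult_right_mono) auto
      then have "norm (w - u) \<le> 2 * norm (A (y - ?x))" using b norm_triangle_sub[of "w - u" "A (y - ?x)"]
        by (simp add: norm_minus_commute)
      also have "\<dots> \<le> 2 * (K * norm (y - ?x))" using K by simp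
      finally have "K * e' * norm (w - u) \<le> K * e' * (2 * (K * norm (y - ?x)))" using K e' by (intro mult_left_mono) auto
      also have "\<dots> = (2 * K * K * e') * norm (y - ?x)" by simp
      also have "\<dots> \<le> e * norm (y - ?x)" using e' by (intro mult_right_mono) auto
      finally show "norm (\<psi> y - \<psi> ?x - A (y - ?x)) \<le> e * norm (y - ?x)"
        using b w \<psi>\<phi>[OF w(1)] \<psi>u by (simp add: norm_minus_commute)
    qed (use d d2 in auto)
  qed (rule blA)
qed

lemma local_param_left_inverse:
  assumes "local_param M V \<phi>" "u \<in> V"
  obtains A where "linear A" "\<And>s. A (frechet_derivative \<phi> (at u) s) = s"
  using linear_injective_left_inverse[OF local_paramD(6)[OF assms] local_paramD(4)[OF assms]]
  by (metis comp_apply id_apply)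

lemma local_param_curve:
  fixes \<phi> :: "real^'d \<Rightarrow> real^'m"
  assumes lp: "local_param M V \<phi>" and u: "u \<in> V"
  obtains e where "e > 0" "\<And>t. t \<in> {-e<..<e} \<Longrightarrow> u + t *\<^sub>R s \<in> V"
    "((\<lambda>t. \<phi> (u + t *\<^sub>R s)) has_derivative (\<lambda>t. frechet_derivative \<phi> (at u) (t *\<^sub>R s))) (at 0)"
proof -
  have l: "((\<lambda>t. u + t *\<^sub>R s) has_derivative (\<lambda>t. t *\<^sub>R s)) (at 0)"
    by (auto intro!: derivative_eq_intros)
  have "open ((\<lambda>t. u + t *\<^sub>R s) -` V)"
    by (intro continuous_open_vimage local_paramD(1)[OF lp] continuous_intros)
  moreover have "0 \<in> (\<lambda>t. u + t *\<^sub>R s) -` V" using u by simp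
  ultimately obtain e where e: "e > 0" "ball 0 e \<subseteq> (\<lambda>t. u + t *\<^sub>R s) -` V"
    using open_contains_ball by blast
  show ?thesis
  proof (rule that[of e])
    show "u + t *\<^sub>R s \<in> V" if "t \<in> {-e<..<e}" for t
      using that e(2) by (auto simp: subset_iff abs_less_iff)
    show "((\<lambda>t. \<phi> (u + t *\<^sub>R s)) has_derivative (\<lambda>t. frechet_derivative \<phi> (at u) (t *\<^sub>R s))) (at 0)"
      using has_derivative_compose[OF l, of \<phi> "frechet_derivative \<phi> (at u)"] local_paramD(5)[OF lp u] by simp
  qed (use e in auto)
qed

text \<open>For the inclusion into the range, a curve in \<open>M\<close> is locally
  \<open>\<phi> \<circ> \<psi> \<circ> \<gamma>\<close>; the chain rule through the inverse chart
  gives its velocity as \<open>?D (A v)\<close>, and uniqueness of derivatives identifies this with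
  \<open>v\<close>. The other inclusion uses images of straight lines.\<close>

lemma tangent_space_local_param:
  fixes \<phi> :: "real^'d \<Rightarrow> real^'m"
  assumes lp: "local_param M V \<phi>" and u: "u \<in> V"
  shows "tangent_space M (\<phi> u) = range (frechet_derivative \<phi> (at u))" (is "_ = range ?D")
proof
  show "range ?D \<subseteq> tangent_space M (\<phi> u)"
  proof safe
    fix s
    obtain e where e: "e > 0" "\<And>t. t \<in> {-e<..<e} \<Longrightarrow> u + t *\<^sub>R s \<in> V"
      "((\<lambda>t. \<phi> (u + t *\<^sub>R s)) has_derivative (\<lambda>t. ?D (t *\<^sub>R s))) (at 0)"
      using local_param_curve[OF lp u] by blast
    have "((\<lambda>t. \<phi> (u + t *\<^sub>R s)) has_vector_derivative ?D s) (at 0)"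
      using e(3) linear_cmul[OF local_paramD(6)[OF lp u]] by (simp add: has_vector_derivative_def)
    then show "?D s \<in> tangent_space M (\<phi> u)"
      using e local_paramD(7)[OF lp] unfolding tangent_space_def
      by (intro CollectI exI[of _ "\<lambda>t. \<phi> (u + t *\<^sub>R s)"] exI[of _ e]) auto
  qed
next
  obtain A where A: "linear A" "\<And>s. A (?D s) = s" using local_param_left_inverse[OF lp u] by blast
  obtain \<psi> where \<psi>: "homeomorphism V (\<phi> ` V) \<phi> \<psi>" using lp by (auto simp: local_param_def)
  show "tangent_space M (\<phi> u) \<subseteq> range ?D"
  proof
    fix v assume "v \<in> tangent_space M (\<phi> u)"
    then obtain \<gamma> e where \<gamma>: "e > 0" "\<gamma> 0 = \<phi> u" "\<And>t. t \<in> {-e<..<e} \<Longrightarrow> \<gamma> t \<in> M"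
      "(\<gamma> has_vector_derivative v) (at (0::real))" unfolding tangent_space_def by blast
    let ?S = "{-e<..<e}"
    have d\<gamma>: "(\<gamma> has_derivative (\<lambda>t. t *\<^sub>R v)) (at 0 within ?S)"
      using \<gamma>(4) has_derivative_at_withinI by (auto simp: has_vector_derivative_def)
    have "(\<psi> has_derivative A) (at (\<gamma> 0) within \<gamma> ` ?S)"
      using local_param_inverse_has_derivative[OF lp u A \<psi>] \<gamma> by (auto intro: has_derivative_subset)
    from has_derivative_in_compose[OF d\<gamma> this]
    have d\<psi>: "((\<lambda>t. \<psi> (\<gamma> t)) has_derivative (\<lambda>t. A (t *\<^sub>R v))) (at 0 within ?S)" .
    have "\<psi> (\<gamma> 0) = u" using \<psi> u \<gamma>(2) by (auto simp: homeomorphism_def)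
    then have "(\<phi> has_derivative ?D) (at (\<psi> (\<gamma> 0)))" using local_paramD(5)[OF lp u] by simp
    from has_derivative_compose[OF d\<psi> this]
    have d\<phi>: "((\<lambda>t. \<phi> (\<psi> (\<gamma> t))) has_derivative (\<lambda>t. ?D (A (t *\<^sub>R v)))) (at 0 within ?S)" .
    have at: "at 0 within ?S = at (0::real)" by (rule at_within_open) (use \<gamma>(1) in auto)
    obtain T where T: "open T" "\<phi> ` V = M \<inter> T" using local_paramD(3)[OF lp] by (auto simp: openin_open)
    have "\<gamma> 0 \<in> T" using T u \<gamma>(2) by auto
    have "isCont \<gamma> 0" using \<gamma>(4) has_vector_derivative_continuous by blast
    then have "\<forall>\<^sub>F t in at 0. \<gamma> t \<in> T" using \<open>\<gamma> 0 \<in> T\<close> T(1)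
      by (metis continuous_at topological_tendstoD)
    moreover have "\<forall>\<^sub>F t in at (0::real). t \<in> ?S" using \<gamma>(1) by (intro eventually_at_in_open') auto
    ultimately have "\<forall>\<^sub>F t in at 0. \<phi> (\<psi> (\<gamma> t)) = \<gamma> t"
    proof eventually_elim
      case (elim t)
      then have "\<gamma> t \<in> \<phi> ` V" using \<gamma>(3) T(2) by blast
      then show ?case using \<psi> by (auto simp: homeomorphism_def)
    qed
    moreover have "\<phi> (\<psi> (\<gamma> 0)) = \<gamma> 0" using \<psi> u \<gamma>(2) by (auto simp: homeomorphism_def)
    ultimately have "(\<gamma> has_derivative (\<lambda>t. ?D (A (t *\<^sub>R v)))) (at 0)"
      using has_derivative_transform_eventually[of _ _ 0 UNIV \<gamma>] d\<phi> at by auto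
    then have "(\<lambda>t. ?D (A (t *\<^sub>R v))) = (\<lambda>t. t *\<^sub>R v)"
      using has_derivative_unique \<gamma>(4) unfolding has_vector_derivative_def by blast
    then have "?D (A (1 *\<^sub>R v)) = 1 *\<^sub>R v" by metis
    then show "v \<in> range ?D" by (metis rangeI scaleR_one)
  qed
qed

text \<open>\<open>frechet_derivative\<close> within \<open>M\<close> is an arbitrary choice among
  several linear maps. It is enough that some derivative exists, which the inverse chart provides:
  composed with the curve \<open>\<phi> (u + t s)\<close>, the chosen one must agree with
  \<open>G\<close> by uniqueness of derivatives on the line.\<close>

lemma differential_local_param:
  fixes \<phi> :: "real^'d \<Rightarrow> real^'m" and F :: "real^'m \<Rightarrow> 'b::real_normed_vector"
  assumes lp: "local_param M V \<phi>" and u: "u \<in> V" and G: "((F \<circ> \<phi>) has_derivative G) (at u)"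
  shows "differential M F (\<phi> u) (frechet_derivative \<phi> (at u) s) = G s"
proof -
  let ?D = "frechet_derivative \<phi> (at u)"
  obtain A where A: "linear A" "\<And>s. A (?D s) = s" using local_param_left_inverse[OF lp u] by blast
  obtain \<psi> where \<psi>: "homeomorphism V (\<phi> ` V) \<phi> \<psi>" using lp by (auto simp: local_param_def)
  have \<psi>u: "\<psi> (\<phi> u) = u" using \<psi> u by (auto simp: homeomorphism_def)
  have "((\<lambda>y. (F \<circ> \<phi>) (\<psi> y)) has_derivative (\<lambda>y. G (A y))) (at (\<phi> u) within M)"
    by (rule has_derivative_compose[OF local_param_inverse_has_derivative[OF lp u A \<psi>]]) (use G \<psi>u in \<open>simp add: o_def\<close>)
  note d1 = this
  obtain T where T: "open T" "\<phi> ` V = M \<inter> T" using local_paramD(3)[OF lp] by (auto simp: openin_open)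
  then have "\<phi> u \<in> T" using u by blast
  then obtain d where d: "d > 0" "ball (\<phi> u) d \<subseteq> T" using T(1) open_contains_ball by blast
  have eq: "(F \<circ> \<phi>) (\<psi> y) = F y" if "y \<in> M" "dist y (\<phi> u) < d" for y
  proof -
    have "y \<in> \<phi> ` V" using that d(2) T(2) by (auto simp: dist_commute)
    then show ?thesis using \<psi> by (auto simp: homeomorphism_def)
  qed
  have "(F has_derivative (\<lambda>y. G (A y))) (at (\<phi> u) within M)"
    by (rule has_derivative_transform_within[OF d1 d(1) local_paramD(7)[OF lp u] eq])
  then have F': "(F has_derivative frechet_derivative F (at (\<phi> u) within M)) (at (\<phi> u) within M)"
    using differentiableI frechet_derivative_works by blast
  let ?F' = "frechet_derivative F (at (\<phi> u) within M)"
  obtain e where e: "e > 0" "\<And>t. t \<in> {-e<..<e} \<Longrightarrow> u + t *\<^sub>R s \<in> V"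
      "((\<lambda>t. \<phi> (u + t *\<^sub>R s)) has_derivative (\<lambda>t. ?D (t *\<^sub>R s))) (at 0)"
    using local_param_curve[OF lp u] by blast
  let ?S = "{-e<..<e}"
  have at: "at 0 within ?S = at (0::real)" by (rule at_within_open) (use e(1) in auto)
  have "((\<lambda>t. F (\<phi> (u + t *\<^sub>R s))) has_derivative (\<lambda>t. ?F' (?D (t *\<^sub>R s)))) (at 0 within ?S)"
  proof (rule has_derivative_in_compose[where f="\<lambda>t. \<phi> (u + t *\<^sub>R s)" and g=F and g'="?F'"])
    show "((\<lambda>t. \<phi> (u + t *\<^sub>R s)) has_derivative (\<lambda>t. ?D (t *\<^sub>R s))) (at 0 within ?S)"
      using e(3) has_derivative_at_withinI by blast
    show "(F has_derivative ?F') (at (\<phi> (u + 0 *\<^sub>R s)) within (\<lambda>t. \<phi> (u + t *\<^sub>R s)) ` ?S)"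
      using F' e(2) local_paramD(7)[OF lp] by (auto intro: has_derivative_subset)
  qed
  moreover have "((\<lambda>t. (F \<circ> \<phi>) (u + t *\<^sub>R s)) has_derivative (\<lambda>t. G (t *\<^sub>R s))) (at 0)"
    by (rule has_derivative_compose[where f="\<lambda>t. u + t *\<^sub>R s" and f'="\<lambda>t. t *\<^sub>R s"])
      (use G in \<open>auto intro!: derivative_eq_intros simp: o_def\<close>)
  ultimately have "(\<lambda>t. ?F' (?D (t *\<^sub>R s))) = (\<lambda>t. G (t *\<^sub>R s))"
    unfolding o_def at by (rule has_derivative_unique)
  then have "?F' (?D (1 *\<^sub>R s)) = G (1 *\<^sub>R s)" by metis
  then show ?thesis by (simp add: differential_def)
qed

lemma riemannian_gradient_eqI:
  fixes \<phi> :: "real^'d \<Rightarrow> real^'m"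
  assumes lp: "local_param M V \<phi>" and u: "u \<in> V" and G: "((f \<circ> \<phi>) has_derivative G) (at u)"
    and w: "\<And>s. frechet_derivative \<phi> (at u) c \<bullet> frechet_derivative \<phi> (at u) s = G s"
  shows "riemannian_gradient M f (\<phi> u) = frechet_derivative \<phi> (at u) c"
  unfolding riemannian_gradient_def
proof (rule the_equality)
  let ?D = "frechet_derivative \<phi> (at u)"
  show "?D c \<in> tangent_space M (\<phi> u) \<and> (\<forall>v\<in>tangent_space M (\<phi> u). ?D c \<bullet> v = differential M f (\<phi> u) v)"
    unfolding tangent_space_local_param[OF lp u] using differential_local_param[OF lp u G] w by auto
  fix y assume y: "y \<in> tangent_space M (\<phi> u) \<and> (\<forall>v\<in>tangent_space M (\<phi> u). y \<bullet> v = differential M f (\<phi> u) v)"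
  then obtain a where a: "y = ?D a" unfolding tangent_space_local_param[OF lp u] by auto
  have "y \<bullet> ?D s = ?D c \<bullet> ?D s" for s
    using y differential_local_param[OF lp u G] w unfolding tangent_space_local_param[OF lp u] by auto
  then have "(y - ?D c) \<bullet> ?D (a - c) = 0" by (simp add: inner_diff_left)
  then have "(y - ?D c) \<bullet> (y - ?D c) = 0"
    using linear_diff[OF local_paramD(6)[OF lp u]] a by simp
  then show "y = ?D c" by simp
qed

lemma inner_sum_Basis:
  fixes G :: "'a::euclidean_space \<Rightarrow> real"
  assumes "linear G" shows "(\<Sum>b\<in>Basis. G b *\<^sub>R b) \<bullet> s = G s"
proof -
  have "(\<Sum>b\<in>Basis. G b *\<^sub>R b) \<bullet> s = (\<Sum>b\<in>Basis. G b * (b \<bullet> s))" by (simp add: inner_sum_left)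
  also have "\<dots> = (\<Sum>b\<in>Basis. (s \<bullet> b) *\<^sub>R G b)" by (simp add: inner_commute mult.commute)
  also have "\<dots> = G (\<Sum>b\<in>Basis. (s \<bullet> b) *\<^sub>R b)" by (simp add: linear_sum[OF assms] linear_cmul[OF assms])
  finally show ?thesis by (simp add: euclidean_representation)
qed

text \<open>\<open>adjoint ?D \<circ> ?D\<close> is the metric tensor at \<open>u\<close>. It is
  injective because \<open>?D\<close> is, hence onto, and \<open>c\<close> is its inverse applied to
  the coordinate gradient.\<close>

lemma local_param_gradient_coeff:
  fixes \<phi> :: "real^'d \<Rightarrow> real^'m"
  assumes lp: "local_param M V \<phi>" and u: "u \<in> V" and G: "linear G"
  obtains c where "\<And>s. frechet_derivative \<phi> (at u) c \<bullet> frechet_derivative \<phi> (at u) s = (G s :: real)"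
proof -
  let ?D = "frechet_derivative \<phi> (at u)"
  have lD: "linear ?D" using local_paramD(6)[OF lp u] .
  have ad: "adjoint ?D a \<bullet> b = a \<bullet> ?D b" for a b using adjoint_works[OF lD] by (simp add: inner_commute)
  let ?N = "\<lambda>s. adjoint ?D (?D s)"
  have lN: "linear ?N" using linear_compose[OF lD adjoint_linear[OF lD]] by (simp add: o_def)
  have "inj ?N"
  proof (subst linear_injective_0[OF lN], safe)
    fix s assume "?N s = 0"
    then have "?D s \<bullet> ?D s = 0" using ad[of "?D s" s] by simp
    then show "s = 0" using local_paramD(4)[OF lp u] linear_injective_0[OF lD] by auto
  qed
  then have "surj ?N" using linear_injective_imp_surjective lN by blast
  then obtain c where c: "(\<Sum>b\<in>Basis. G b *\<^sub>R b) = ?N c" by (rule surjE)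
  have "?D c \<bullet> ?D s = G s" for s
  proof -
    have "?D c \<bullet> ?D s = (\<Sum>b\<in>Basis. G b *\<^sub>R b) \<bullet> s" using ad[of "?D c" s] unfolding c by simp
    also have "\<dots> = G s" by (rule inner_sum_Basis[OF G])
    finally show ?thesis .
  qed
  then show ?thesis using that by blast
qed

section \<open>Gradient and Laplace-Beltrami operator at the centre of a normal chart\<close>

lemma norm_le_inner_bound:
  fixes x :: "'a::real_inner"
  assumes "\<And>s. x \<bullet> s \<le> B * norm s" "B \<ge> 0" shows "norm x \<le> B"
proof (cases "x = 0")
  case False
  have "norm x * norm x \<le> B * norm x" using assms(1)[of x] by (simp add: norm_eq_sqrt_inner)
  then show ?thesis using False by simp
qed (use assms in simp)

lemma isometry_inner:
  assumes "linear E" "\<And>s. norm (E s) = norm s" shows "E s \<bullet> E t = s \<bullet> t"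
  using dot_norm[of "E s" "E t"] dot_norm[of s t] linear_add[OF assms(1)] assms(2) by metis

lemma has_derivative_quadratic_bound:
  fixes f :: "'a::euclidean_space \<Rightarrow> 'b::real_normed_vector"
  assumes "linear L" "e > 0" "\<And>v. norm v < e \<Longrightarrow> norm (f v - f 0 - L v) \<le> K * norm v ^ 2"
  shows "(f has_derivative L) (at 0)"
  unfolding has_derivative_at_alt
proof (intro conjI allI impI)
  show "bounded_linear L" using assms(1) linear_conv_bounded_linear by blast
  fix \<epsilon> :: real assume \<epsilon>: "\<epsilon> > 0"
  show "\<exists>d>0. \<forall>y. norm (y - 0) < d \<longrightarrow> norm (f y - f 0 - L (y - 0)) \<le> \<epsilon> * norm (y - 0)"
  proof (intro exI[of _ "min e (\<epsilon> / (\<bar>K\<bar> + 1))"] conjI allI impI)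
    fix y :: 'a assume y: "norm (y - 0) < min e (\<epsilon> / (\<bar>K\<bar> + 1))"
    then have "K * norm y \<le> \<bar>K\<bar> * norm y" "norm y * (\<bar>K\<bar> + 1) \<le> \<epsilon>"
      by (auto intro: mult_right_mono simp: field_simps)
    then have "K * norm y \<le> \<epsilon>" using norm_ge_zero[of y] unfolding distrib_left mult.commute[of "norm y"] by linarith
    then have "K * norm y ^ 2 \<le> \<epsilon> * norm y" by (simp add: power2_eq_square mult_right_mono flip: mult.assoc)
    then show "norm (f y - f 0 - L (y - 0)) \<le> \<epsilon> * norm (y - 0)" using assms(3)[of y] y by simp
  qed (use assms \<epsilon> in auto)
qed

text \<open>Here \<open>E\<close> is an isometry, \<open>h\<close> is of first order but takes
  values orthogonal to the range of \<open>E\<close>, and the rest is of second order. The cross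
  terms of \<open>E\<close> with \<open>h\<close>, the only first-order ones, vanish; hence the
  metric differs from the Euclidean one at second order only.\<close>

lemma almost_isometry:
  fixes E h D :: "'a::real_inner \<Rightarrow> 'b::real_inner"
  assumes E: "\<And>a b. E a \<bullet> E b = a \<bullet> b" and h: "\<And>a b. h a \<bullet> E b = 0"
    and hb: "\<And>a. norm (h a) \<le> K * r * norm a" and K: "K \<ge> 0" "0 \<le> r" "r \<le> 1"
    and D: "\<And>a. norm (D a - E a - h a) \<le> K * r ^ 2 * norm a"
  shows "\<bar>D a \<bullet> D b - a \<bullet> b\<bar> \<le> (4 * K ^ 2 + 2 * K) * r ^ 2 * (norm a * norm b)"
proof -
  define R where "R a = D a - E a - h a" for a
  have Da: "D a = E a + h a + R a" for a by (simp add: R_def)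
  have Eh: "E a \<bullet> h b = 0" for a b using h[of b a] by (simp add: inner_commute)
  have nE: "norm (E a) = norm a" for a using E[of a a] by (simp add: norm_eq_sqrt_inner)
  have r2: "r ^ 2 \<le> r" using K by (simp add: power2_eq_square mult_left_le)
  have Rn: "norm (R a) \<le> K * r ^ 2 * norm a" for a using D R_def by simp
  have hb1: "norm (h a) \<le> K * norm a" for a
    using hb[of a] K mult_right_mono[of "K * r" K "norm a"] by (smt (verit) mult_left_le norm_ge_zero)
  have Rn1: "norm (R a) \<le> K * norm a" for a
    using Rn[of a] K r2 mult_right_mono[of "K * r^2" K "norm a"] by (smt (verit) mult_left_le norm_ge_zero)
  have "D a \<bullet> D b - a \<bullet> b = h a \<bullet> h b + (E a + h a) \<bullet> R b + R a \<bullet> (E b + h b + R b)"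
    using E[of a b] Eh[of a b] h[of a b] by (simp add: Da inner_add_left inner_add_right)
  also have "\<bar>\<dots>\<bar> \<le> norm (h a) * norm (h b) + norm (E a + h a) * norm (R b) + norm (R a) * norm (E b + h b + R b)"
    by (smt (verit) Cauchy_Schwarz_ineq2)
  also have "\<dots> \<le> (K * r * norm a) * (K * r * norm b) + ((1 + K) * norm a) * (K * r^2 * norm b)
      + (K * r^2 * norm a) * ((1 + 2 * K) * norm b)"
  proof (intro add_mono mult_mono)
    show "norm (E a + h a) \<le> (1 + K) * norm a"
      using norm_triangle_ineq[of "E a" "h a"] nE[of a] hb1[of a] by (simp add: algebra_simps)
    show "norm (E b + h b + R b) \<le> (1 + 2 * K) * norm b"
      using norm_triangle_ineq[of "E b" "h b"] norm_triangle_ineq[of "E b + h b" "R b"] nE[of b] hb1[of b] Rn1[of b]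
      by (simp add: algebra_simps)
  qed (use K hb Rn in auto)
  also have "\<dots> = (4 * K ^ 2 + 2 * K) * r ^ 2 * (norm a * norm b)"
    by (simp add: algebra_simps power2_eq_square)
  finally show ?thesis .
qed

text \<open>\<open>riemannian_divergence\<close> sums over an orthonormal basis picked by
  \<open>SOME\<close>. Parseval's identity in \<open>B\<close>, pulled back through
  \<open>E\<close>, shows that the sum is the trace of \<open>Q\<close> for every choice.\<close>

lemma orthonormal_trace:
  fixes E :: "real^'d \<Rightarrow> real^'m"
  assumes B: "orthonormal_basis (range E) B" and lE: "linear E" and E: "\<And>s. norm (E s) = norm s"
    and A: "\<And>s. A (E s) = E (Q s)" and Q: "linear Q"
  shows "(\<Sum>b\<in>B. A b \<bullet> b) = (\<Sum>i\<in>Basis. Q i \<bullet> i)"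
proof -
  have Ei: "E s \<bullet> E t = s \<bullet> t" for s t using isometry_inner[OF lE E] .
  have Bp: "B \<subseteq> range E" "pairwise orthogonal B" "\<And>b. b \<in> B \<Longrightarrow> norm b = 1" "span B = range E"
    using B by (auto simp: orthonormal_basis_def)
  have "0 \<notin> B" using Bp(3) by fastforce
  then have fB: "finite B" using pairwise_orthogonal_imp_finite Bp(2) by blast
  have exB: "(\<Sum>b\<in>B. (E s \<bullet> b) * (E t \<bullet> b)) = s \<bullet> t" for s t
  proof -
    have "(\<Sum>b\<in>B. (E s \<bullet> b) *\<^sub>R b) = E s"
      by (rule orthonormal_basis_expand[OF Bp(2,3) _ fB]) (use Bp(4) in auto)
    then have "E s \<bullet> E t = (\<Sum>b\<in>B. (E s \<bullet> b) *\<^sub>R b) \<bullet> E t" by simp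
    also have "\<dots> = (\<Sum>b\<in>B. (E s \<bullet> b) * (b \<bullet> E t))" by (simp add: inner_sum_left)
    finally show ?thesis by (simp add: Ei inner_commute[of _ "E t"] inner_commute[of t])
  qed
  have Ab: "A b \<bullet> b = (\<Sum>i\<in>Basis. \<Sum>j\<in>Basis. ((E i \<bullet> b) * (E j \<bullet> b)) * (Q i \<bullet> j))" if b: "b \<in> B" for b
  proof -
    obtain s where s: "b = E s" using Bp(1) b by blast
    have "A b \<bullet> b = Q s \<bullet> s" using A Ei s by simp
    also have "\<dots> = (\<Sum>j\<in>Basis. (Q s \<bullet> j) * (s \<bullet> j))" by (rule euclidean_inner)
    also have "\<dots> = (\<Sum>j\<in>Basis. (Q (\<Sum>i\<in>Basis. (s \<bullet> i) *\<^sub>R i) \<bullet> j) * (s \<bullet> j))"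
      by (simp add: euclidean_representation)
    also have "\<dots> = (\<Sum>j\<in>Basis. \<Sum>i\<in>Basis. (s \<bullet> i) * (Q i \<bullet> j) * (s \<bullet> j))"
      by (simp only: linear_sum[OF Q] linear_cmul[OF Q] inner_sum_left sum_distrib_right inner_scaleR_left)
    also have "\<dots> = (\<Sum>i\<in>Basis. \<Sum>j\<in>Basis. (s \<bullet> i) * (Q i \<bullet> j) * (s \<bullet> j))" by (rule sum.swap)
    finally show ?thesis unfolding s Ei by (simp add: inner_commute ac_simps)
  qed
  have "(\<Sum>b\<in>B. A b \<bullet> b) = (\<Sum>b\<in>B. \<Sum>i\<in>Basis. \<Sum>j\<in>Basis. ((E i \<bullet> b) * (E j \<bullet> b)) * (Q i \<bullet> j))"
    by (rule sum.cong) (use Ab in auto)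
  also have "\<dots> = (\<Sum>i\<in>Basis. \<Sum>j\<in>Basis. \<Sum>b\<in>B. ((E i \<bullet> b) * (E j \<bullet> b)) * (Q i \<bullet> j))"
    by (subst sum.swap, subst (2) sum.swap, rule refl)
  also have "\<dots> = (\<Sum>i\<in>Basis. \<Sum>j\<in>Basis. (i \<bullet> j) * (Q i \<bullet> j))"
    by (simp only: sum_distrib_right[symmetric] exB)
  also have "\<dots> = (\<Sum>i\<in>Basis. Q i \<bullet> i)"
  proof (rule sum.cong)
    fix i :: "real^'d" assume i: "i \<in> Basis"
    have "(\<Sum>j\<in>Basis. (i \<bullet> j) * (Q i \<bullet> j)) = i \<bullet> Q i" by (rule euclidean_inner[symmetric])
    then show "(\<Sum>j\<in>Basis. (i \<bullet> j) * (Q i \<bullet> j)) = Q i \<bullet> i" by (simp add: inner_commute)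
  qed simp
  finally show ?thesis .
qed

text \<open>The hypotheses say that the metric is the identity up to second order at 0, so
  Christoffel symbols vanish there and both operators take their flat form. For the Laplacian, the
  derivative of the gradient field at 0 along \<open>v\<close> is
  \<open>E (Q v) + hess \<Phi> 0 v (g 0)\<close>, with \<open>Q\<close> the Hessian of
  \<open>f \<circ> \<Phi>\<close> as an operator; the second summand is normal and is removed by the
  projection in \<open>levi_civita\<close>, and the trace of \<open>Q\<close> remains.\<close>

lemma
  fixes \<Phi> :: "real^'d \<Rightarrow> real^'m" and f :: "real^'m \<Rightarrow> real"
  assumes lp: "local_param M V \<Phi>" and z: "0 \<in> V"
    and iso: "\<And>s. norm (frechet_derivative \<Phi> (at 0) s) = norm s"
    and perp: "\<And>s t r. hess \<Phi> 0 s t \<bullet> frechet_derivative \<Phi> (at 0) r = 0"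
  shows riemannian_gradient_normal_chart: "Ck_on 1 V (f \<circ> \<Phi>) \<Longrightarrow> riemannian_gradient M f (\<Phi> 0) =
      frechet_derivative \<Phi> (at 0) (\<Sum>i\<in>Basis. frechet_derivative (f \<circ> \<Phi>) (at 0) i *\<^sub>R i)"
    and laplace_beltrami_normal_chart: "Ck_on 3 V (f \<circ> \<Phi>) \<Longrightarrow> laplace_beltrami M f (\<Phi> 0) = (\<Sum>i\<in>Basis. hess (f \<circ> \<Phi>) 0 i i)"
proof -
  let ?D = "\<lambda>v. frechet_derivative \<Phi> (at v)" let ?E = "?D 0" let ?F = "f \<circ> \<Phi>" let ?H = "hess \<Phi> 0"
  let ?DF = "\<lambda>v. frechet_derivative ?F (at v)"
  have oV: "open V" and CP: "\<And>k. Ck_on k V \<Phi>" using local_paramD[OF lp] by auto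
  have lE: "linear ?E" using local_paramD(6)[OF lp z] .
  have Ei: "?E s \<bullet> ?E t = s \<bullet> t" for s t using isometry_inner[OF lE iso] .
  define g where "g v = (\<Sum>b\<in>Basis. ?DF v b *\<^sub>R b)" for v
  have gi: "g v \<bullet> s = ?DF v s" if "linear (?DF v)" for v s
    unfolding g_def by (rule inner_sum_Basis[OF that])
  show "riemannian_gradient M f (\<Phi> 0) = ?E (\<Sum>i\<in>Basis. ?DF 0 i *\<^sub>R i)" if "Ck_on 1 V ?F"
  proof -
    have d: "(?F has_derivative ?DF 0) (at 0)" using Ck_on_SucD[of 0 V] that z by simp
    show ?thesis
      using riemannian_gradient_eqI[OF lp z d, of "g 0"] gi[OF has_derivative_linear[OF d]] Ei by (simp add: g_def)
  qed
  assume "Ck_on 3 V ?F"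
  then have CF: "Ck_on (Suc (Suc (Suc 0))) V ?F" by (simp add: numeral_3_eq_3)
  have dF: "(?F has_derivative ?DF v) (at v)" if "v \<in> V" for v using Ck_on_SucD[OF CF that] .
  have lF: "linear (?DF v)" if "v \<in> V" for v using dF[OF that] has_derivative_linear by blast
  \<comment> \<open>\<open>c v\<close> holds the coordinates of the gradient at
    \<open>\<Phi> v\<close>; \<open>g v\<close> is the plain coordinate gradient. They would agree
    if the metric were exactly Euclidean.\<close>
  obtain c where c: "\<And>v s. v \<in> V \<Longrightarrow> ?D v (c v) \<bullet> ?D v s = ?DF v s"
  proof -
    have "\<forall>v\<in>V. \<exists>c. \<forall>s. ?D v c \<bullet> ?D v s = ?DF v s"
      using local_param_gradient_coeff[OF lp _ lF] by blast
    then show ?thesis using that by metis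
  qed
  define Y where "Y = riemannian_gradient M f"
  have Y: "Y (\<Phi> v) = ?D v (c v)" if "v \<in> V" for v
    unfolding Y_def using riemannian_gradient_eqI[OF lp that dF[OF that]] c that by blast
  interpret H: bounded_bilinear ?H using hess_bilinear[OF CP z] .
  interpret HF: bounded_bilinear "hess ?F 0" using hess_bilinear[OF CF z] .
  define Q where "Q s = (\<Sum>b\<in>Basis. hess ?F 0 s b *\<^sub>R b)" for s
  have Qi: "Q s \<bullet> t = hess ?F 0 s t" for s t
  proof -
    have l: "linear (hess ?F 0 s)" using HF.bounded_linear_right bounded_linear.linear by blast
    then show ?thesis unfolding Q_def by (rule inner_sum_Basis)
  qed
  have lQ: "linear Q" unfolding Q_def
    by (auto simp: linear_iff HF.add_left HF.scaleR_left algebra_simps sum.distrib scaleR_sum_right)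
  obtain e0 where e0: "e0 > 0" "cball 0 e0 \<subseteq> V" using open_contains_cball oV z by blast
  define S where "S = cball (0::real^'d) (min e0 1)"
  have S: "compact S" "convex S" "S \<subseteq> V" "0 \<in> S" using e0 by (auto simp: S_def)
  obtain C1 where C1: "C1 \<ge> 0" "\<And>v t. v \<in> S \<Longrightarrow> norm (?D v t - ?E t - ?H v t) \<le> C1 * norm v ^ 2 * norm t"
    using C3_bounds[OF CP oV S(1-3)] S(4) by (metis diff_zero)
  obtain C2 where C2: "C2 \<ge> 0" "\<And>s t. norm (?H s t) \<le> C2 * norm s * norm t"
    using C2_bounds[OF CP oV S(1-3)] S(4) by metis
  obtain C3 where C3: "C3 \<ge> 0" "\<And>v t. v \<in> S \<Longrightarrow> norm (?DF v t - ?DF 0 t - hess ?F 0 v t) \<le> C3 * norm v ^ 2 * norm t"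
    using C3_bounds[OF CF oV S(1-3)] S(4) by (metis diff_zero)
  obtain C4 where C4: "C4 \<ge> 0" "\<And>v t. v \<in> S \<Longrightarrow> norm (?DF v t) \<le> C4 * norm t"
     "\<And>v t. v \<in> S \<Longrightarrow> norm (?DF v t - ?DF 0 t) \<le> C4 * norm v * norm t"
    using C2_bounds[OF CF oV S(1-3)] S(4) by (metis diff_zero)
  define K where "K = C1 + C2"
  have K: "K \<ge> 0" "C1 \<le> K" "C2 \<le> K" using C1(1) C2(1) by (auto simp: K_def)
  define K1 where "K1 = 4 * K ^ 2 + 2 * K"
  have K1: "K1 \<ge> 0" using K by (simp add: K1_def)
  have iso1: "\<bar>?D v a \<bullet> ?D v b - a \<bullet> b\<bar> \<le> K1 * norm v ^ 2 * (norm a * norm b)" if v: "v \<in> S" for v a b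
    unfolding K1_def
  proof (rule almost_isometry[of ?E "?H v"])
    show "norm (?H v a) \<le> K * norm v * norm a" for a
      using C2(2)[of v a] K by (smt (verit) mult_right_mono norm_ge_zero)
    show "norm (?D v a - ?E a - ?H v a) \<le> K * norm v ^ 2 * norm a" for a
      using C1(2)[OF v, of a] K by (smt (verit) mult_right_mono norm_ge_zero zero_le_power2)
  qed (use Ei perp K v in \<open>auto simp: S_def\<close>)
  have ng: "norm (g v) \<le> C4" if "v \<in> S" for v
    by (rule norm_le_inner_bound) (use C4 that gi lF S in \<open>auto simp: subset_iff abs_le_iff\<close>)
  have g1: "norm (g v - g 0) \<le> C4 * norm v" if v: "v \<in> S" for v
  proof (rule norm_le_inner_bound)
    fix s
    have "(g v - g 0) \<bullet> s = ?DF v s - ?DF 0 s" using gi[OF lF] v S by (auto simp: inner_diff_left subset_iff)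
    then show "(g v - g 0) \<bullet> s \<le> C4 * norm v * norm s" using C4(3)[OF v, of s] by simp
  qed (use C4 in auto)
  have g2: "norm (g v - g 0 - Q v) \<le> C3 * norm v ^ 2" if v: "v \<in> S" for v
  proof (rule norm_le_inner_bound)
    fix s
    have "(g v - g 0 - Q v) \<bullet> s = ?DF v s - ?DF 0 s - hess ?F 0 v s" using gi[OF lF] v S Qi by (auto simp: inner_diff_left subset_iff)
    then show "(g v - g 0 - Q v) \<bullet> s \<le> C3 * norm v ^ 2 * norm s" using C3(2)[OF v, of s] by simp
  qed (use C3 in auto)
  \<comment> \<open>Small enough for \<open>K1 * norm v ^ 2 \<le> 1/2\<close>, which lets the
    self-referential bound \<open>c1\<close> on \<open>c v - g v\<close> be solved for
    \<open>norm (c v)\<close>.\<close>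
  define e where "e = min (min e0 1) (1 / (2 * K1 + 1))"
  have e: "e > 0" using e0 K1 by (simp add: e_def)
  have vS: "v \<in> S" "v \<in> V" "norm v \<le> 1" "K1 * norm v ^ 2 \<le> 1/2" if "norm v < e" for v
  proof -
    show "v \<in> S" "norm v \<le> 1" using that by (auto simp: S_def e_def)
    then show "v \<in> V" using S by auto
    have "norm v * (2 * K1 + 1) \<le> 1" using that K1 by (auto simp: e_def field_simps)
    then have "2 * (K1 * norm v) \<le> 1" using norm_ge_zero[of v]
      unfolding distrib_left mult_1_right mult.commute[of "norm v"] by linarith
    moreover have "K1 * norm v ^ 2 \<le> K1 * norm v" using \<open>norm v \<le> 1\<close> K1
      by (intro mult_left_mono) (auto simp: power2_eq_square mult_left_le)
    ultimately show "K1 * norm v ^ 2 \<le> 1/2" by simp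
  qed
  have c1: "norm (c v - g v) \<le> K1 * norm v ^ 2 * norm (c v)" if "norm v < e" for v
  proof -
    let ?b = "c v - g v" note v = vS[OF that]
    have "?b \<bullet> ?b = c v \<bullet> ?b - ?D v (c v) \<bullet> ?D v ?b"
      using c[OF v(2), of ?b] gi[OF lF[OF v(2)]] by (simp add: inner_diff_left)
    also have "\<dots> \<le> K1 * norm v ^ 2 * (norm (c v) * norm ?b)" using iso1[OF v(1), of "c v" ?b] by linarith
    finally have "norm ?b * norm ?b \<le> (K1 * norm v ^ 2 * norm (c v)) * norm ?b"
      by (simp add: dot_square_norm power2_eq_square mult.assoc)
    then show ?thesis using K1 by (cases "norm ?b = 0") (auto simp: mult_le_cancel_right)
  qed
  have c2: "norm (c v) \<le> 2 * C4" if "norm v < e" for v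
  proof -
    note v = vS[OF that]
    have "K1 * norm v ^ 2 * norm (c v) \<le> 1/2 * norm (c v)" using v by (intro mult_right_mono) auto
    then have "norm (c v) \<le> norm (g v) + 1/2 * norm (c v)" using c1[OF that] norm_triangle_sub[of "c v" "g v"] by linarith
    then show ?thesis using ng[OF v(1)] by simp
  qed
  have c3: "norm (c v - g v) \<le> 2 * C4 * K1 * norm v ^ 2" if "norm v < e" for v
    using c1[OF that] mult_left_mono[OF c2[OF that], of "K1 * norm v ^ 2"] K1 by (simp add: algebra_simps)
  define KK where "KK = 2 * C4 * C1 + 2 * C4 * K1 + C2 * (2 * C4 * K1) + C3 + C2 * C4"
  \<comment> \<open>The coefficients \<open>c\<close> were chosen point by point, without any
    regularity. Differentiability of the gradient field at 0 is therefore read off from this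
    quadratic remainder.\<close>
  have main: "norm (Y (\<Phi> v) - Y (\<Phi> 0) - (?E (Q v) + ?H v (g 0))) \<le> KK * norm v ^ 2" if "norm v < e" for v
  proof -
    note v = vS[OF that]
    have Y0: "Y (\<Phi> 0) = ?E (g 0)"
    proof -
      have "norm (c 0 - g 0) \<le> 0" using c3[of 0] e by simp
      then show ?thesis using Y[OF z] by simp
    qed
    \<comment> \<open>Three replacements are made in turn: the derivative of the chart by its
      first-order expansion (\<open>a1\<close>), \<open>c v\<close> by \<open>g v\<close>
      (\<open>a2\<close>, \<open>a3\<close>), and \<open>g v\<close> by its own expansion
      (\<open>a4\<close>, \<open>a5\<close>). Each costs \<open>O(norm v ^ 2)\<close>.\<close>
    define a1 a2 a3 a4 a5 where "a1 = ?D v (c v) - ?E (c v) - ?H v (c v)" and "a2 = ?E (c v - g v)"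
      and "a3 = ?H v (c v - g v)" and "a4 = ?E (g v - g 0 - Q v)" and "a5 = ?H v (g v - g 0)"
    have "Y (\<Phi> v) - Y (\<Phi> 0) - (?E (Q v) + ?H v (g 0)) = a1 + a2 + a3 + a4 + a5"
      unfolding Y[OF v(2)] Y0 a1_def a2_def a3_def a4_def a5_def linear_diff[OF lE] H.diff_right by simp
    then have "norm (Y (\<Phi> v) - Y (\<Phi> 0) - (?E (Q v) + ?H v (g 0))) \<le> norm a1 + norm a2 + norm a3 + norm a4 + norm a5"
      by (auto intro!: norm_triangle_le add_mono)
    also have "\<dots> = norm a1 + norm (c v - g v) + norm a3 + norm (g v - g 0 - Q v) + norm a5"
      unfolding a2_def a4_def iso ..
    also have "\<dots> \<le> 2 * C4 * C1 * norm v ^ 2 + 2 * C4 * K1 * norm v ^ 2 + C2 * (2 * C4 * K1) * norm v ^ 2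
       + C3 * norm v ^ 2 + C2 * C4 * norm v ^ 2"
    proof (intro add_mono c3 that g2 v)
      show "norm a1 \<le> 2 * C4 * C1 * norm v ^ 2"
        using C1(2)[OF v(1), of "c v"] mult_left_mono[OF c2[OF that], of "C1 * norm v ^ 2"] C1(1) by (simp add: a1_def algebra_simps)
      have "C2 * norm v * norm (c v - g v) \<le> C2 * 1 * (2 * C4 * K1 * norm v ^ 2)"
        using C2(1) v c3[OF that] by (intro mult_mono) auto
      then show "norm a3 \<le> C2 * (2 * C4 * K1) * norm v ^ 2" using C2(2)[of v "c v - g v"] by (simp add: a3_def algebra_simps)
      have "C2 * norm v * norm (g v - g 0) \<le> C2 * norm v * (C4 * norm v)"
        using C2(1) g1[OF v(1)] by (intro mult_left_mono) auto
      then show "norm a5 \<le> C2 * C4 * norm v ^ 2" using C2(2)[of v "g v - g 0"]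
        by (simp add: a5_def algebra_simps power2_eq_square)
    qed
    also have "\<dots> = KK * norm v ^ 2" by (simp add: KK_def algebra_simps)
    finally show ?thesis .
  qed
  have lQH: "linear (\<lambda>v. ?E (Q v) + ?H v (g 0))"
    using linear_compose[OF lQ lE] H.bounded_linear_left[THEN bounded_linear.linear]
    by (intro linear_compose_add) (auto simp: o_def)
  have dY: "((Y \<circ> \<Phi>) has_derivative (\<lambda>v. ?E (Q v) + ?H v (g 0))) (at 0)"
    by (rule has_derivative_quadratic_bound[OF lQH e]) (use main in auto)
  have T: "tangent_space M (\<Phi> 0) = range ?E" using tangent_space_local_param[OF lp z] .
  have sub: "subspace (range ?E)" using linear_subspace_image[OF lE subspace_UNIV] .
  have lc: "levi_civita M Y (\<Phi> 0) (?E s) = ?E (Q s)" for s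
  proof -
    have "?E (Q s) = closest_point (range ?E) (?E (Q s) + ?H s (g 0))"
    proof (rule closest_point_unique)
      show "convex (range ?E)" "closed (range ?E)" using sub subspace_imp_convex closed_subspace by auto
      show "\<forall>z\<in>range ?E. dist (?E (Q s) + ?H s (g 0)) (?E (Q s)) \<le> dist (?E (Q s) + ?H s (g 0)) z"
      proof safe
        fix r
        have eq: "?E (Q s) + ?H s (g 0) - ?E r = ?E (Q s - r) + ?H s (g 0)" by (simp add: linear_diff[OF lE])
        have "norm (?E (Q s - r) + ?H s (g 0)) ^ 2 = norm (?E (Q s - r)) ^ 2 + norm (?H s (g 0)) ^ 2"
          by (rule norm_add_Pythagorean) (simp add: orthogonal_def inner_commute perp)
        then have "norm (?H s (g 0)) ^ 2 \<le> norm (?E (Q s) + ?H s (g 0) - ?E r) ^ 2" unfolding eq by simp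
        then have "norm (?H s (g 0)) \<le> norm (?E (Q s) + ?H s (g 0) - ?E r)" by (rule power2_le_imp_le) simp
        then show "dist (?E (Q s) + ?H s (g 0)) (?E (Q s)) \<le> dist (?E (Q s) + ?H s (g 0)) (?E r)"
          by (simp add: dist_norm)
      qed
    qed simp
    then show ?thesis unfolding levi_civita_def T differential_local_param[OF lp z dY] by simp
  qed
  define B where "B = (SOME B. orthonormal_basis (tangent_space M (\<Phi> 0)) B)"
  obtain B0 where "B0 \<subseteq> range ?E" "pairwise orthogonal B0" "\<And>x. x \<in> B0 \<Longrightarrow> norm x = 1" "span B0 = range ?E"
    using orthonormal_basis_subspace[OF sub] by metis
  then have "orthonormal_basis (tangent_space M (\<Phi> 0)) B0" unfolding T orthonormal_basis_def by blast
  then have B: "orthonormal_basis (range ?E) B" unfolding B_def T by (rule someI)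
  have "laplace_beltrami M f (\<Phi> 0) = (\<Sum>b\<in>B. levi_civita M Y (\<Phi> 0) b \<bullet> b)"
    by (simp add: laplace_beltrami_def riemannian_divergence_def B_def Y_def)
  also have "\<dots> = (\<Sum>i\<in>Basis. Q i \<bullet> i)"
    by (rule orthonormal_trace[OF B lE iso lc lQ])
  finally show "laplace_beltrami M f (\<Phi> 0) = (\<Sum>i\<in>Basis. hess ?F 0 i i)" by (simp add: Qi)
qed

section \<open>Quadratic changes of coordinates\<close>

definition quadmap :: "'a::real_normed_vector \<Rightarrow> ('a \<Rightarrow> 'a) \<Rightarrow> ('a \<Rightarrow> 'a \<Rightarrow> 'a) \<Rightarrow> 'a \<Rightarrow> 'a" where
  "quadmap u L \<beta> v = u + L v + \<beta> v v"

text \<open>Bundles what Taylor estimates of a pullback require: bounds by a single \<open>K\<close>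
  on the coefficients and values in a fixed set \<open>S\<close>. Constants extracted from
  \<open>F\<close>, \<open>S\<close> and \<open>K\<close> then serve all base points and
  coefficients at once.\<close>

definition quadmap_adm :: "real \<Rightarrow> 'a::real_normed_vector set \<Rightarrow> real \<Rightarrow> 'a \<Rightarrow> ('a \<Rightarrow> 'a) \<Rightarrow> ('a \<Rightarrow> 'a \<Rightarrow> 'a) \<Rightarrow> bool" where
  "quadmap_adm K S \<rho> u L \<beta> \<longleftrightarrow> u \<in> S \<and> bounded_linear L \<and> bounded_bilinear \<beta> \<and>
     (\<forall>s. norm (L s) \<le> K * norm s) \<and> (\<forall>s t. norm (\<beta> s t) \<le> K * norm s * norm t) \<and>
     0 < \<rho> \<and> \<rho> \<le> 1 \<and> (\<forall>v\<in>ball 0 \<rho>. quadmap u L \<beta> v \<in> S)"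

lemma quadmap_has_derivative:
  assumes "bounded_linear L" "bounded_bilinear \<beta>"
  shows "(quadmap u L \<beta> has_derivative (\<lambda>s. L s + (\<beta> v s + \<beta> s v))) (at v)"
  unfolding quadmap_def[abs_def]
  by (auto intro!: derivative_eq_intros bounded_linear_imp_has_derivative[OF assms(1)]
      bounded_bilinear.FDERIV[OF assms(2)])

lemma quadmap_Ck:
  assumes "bounded_linear L" "bounded_bilinear \<beta>" "open U"
  shows "Ck_on k U (quadmap u L \<beta>)"
  unfolding quadmap_def[abs_def]
  by (intro Ck_on_add Ck_on_const Ck_on_linear Ck_on_quadratic assms)

lemma quadmap_adm_bounds:
  assumes adm: "quadmap_adm K S \<rho> u L \<beta>" and v: "norm v < \<rho>"
  shows "norm (quadmap u L \<beta> v - u) \<le> 2 * K * norm v" "K \<ge> 0 \<Longrightarrow> norm (\<beta> v v) \<le> K * norm v ^ 2"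
    "norm (\<beta> v s + \<beta> s v) \<le> 2 * K * norm v * norm s"
    "K \<ge> 0 \<Longrightarrow> norm (L s + (\<beta> v s + \<beta> s v)) \<le> 3 * K * norm s"
proof -
  have b: "norm (L s) \<le> K * norm s" "norm (\<beta> s t) \<le> K * norm s * norm t" "\<rho> \<le> 1" for s t
    using adm by (auto simp: quadmap_adm_def)
  have v1: "norm v \<le> 1" using v b by simp
  have K: "0 \<le> K * norm v" by (rule order_trans[OF norm_ge_zero b(1)])
  have "norm (\<beta> v v) \<le> K * norm v * 1" 
    using order_trans[OF b(2)[of v v] mult_left_mono[OF v1 K]] .
  then show "norm (quadmap u L \<beta> v - u) \<le> 2 * K * norm v"
    using b(1)[of v] norm_triangle_ineq[of "L v" "\<beta> v v"] by (simp add: quadmap_def)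
  show "norm (\<beta> v v) \<le> K * norm v ^ 2" using b(2)[of v v] by (simp add: power2_eq_square)
  show 3: "norm (\<beta> v s + \<beta> s v) \<le> 2 * K * norm v * norm s"
    using b(2)[of v s] b(2)[of s v] norm_triangle_ineq[of "\<beta> v s" "\<beta> s v"] by (simp add: algebra_simps)
  assume "K \<ge> 0"
  then have "2 * K * norm v * norm s \<le> 2 * K * 1 * norm s" using v1 by (intro mult_mono) auto
  then show "norm (L s + (\<beta> v s + \<beta> s v)) \<le> 3 * K * norm s"
    using 3 b(1)[of s] norm_triangle_ineq[of "L s" "\<beta> v s + \<beta> s v"] by simp
qed

lemma pullback_derivative:
  fixes F :: "'a::euclidean_space \<Rightarrow> 'b::real_normed_vector"
  assumes F: "Ck_on (Suc k) V F" "S \<subseteq> V" and adm: "quadmap_adm K S \<rho> u L \<beta>" and v: "norm v < \<rho>"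
  shows "((F \<circ> quadmap u L \<beta>) has_derivative
      (\<lambda>s. frechet_derivative F (at (quadmap u L \<beta> v)) (L s + (\<beta> v s + \<beta> s v)))) (at v)"
    "frechet_derivative (F \<circ> quadmap u L \<beta>) (at v) s =
       frechet_derivative F (at (quadmap u L \<beta> v)) (L s + (\<beta> v s + \<beta> s v))"
proof -
  have bl: "bounded_linear L" "bounded_bilinear \<beta>" and qV: "quadmap u L \<beta> v \<in> V"
    using adm v F by (auto simp: quadmap_adm_def)
  show 1: "((F \<circ> quadmap u L \<beta>) has_derivative
      (\<lambda>s. frechet_derivative F (at (quadmap u L \<beta> v)) (L s + (\<beta> v s + \<beta> s v)))) (at v)"
    using diff_chain_at[OF quadmap_has_derivative[OF bl] Ck_on_SucD[OF F(1) qV]] unfolding o_def .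
  show "frechet_derivative (F \<circ> quadmap u L \<beta>) (at v) s =
       frechet_derivative F (at (quadmap u L \<beta> v)) (L s + (\<beta> v s + \<beta> s v))"
    unfolding frechet_derivative_at[OF 1, symmetric] by (rule refl)
qed

lemma pullback_C2:
  fixes F :: "'a::euclidean_space \<Rightarrow> 'b::real_normed_vector"
  assumes F: "Ck_on (Suc (Suc k)) V F" "open V" "compact S" "convex S" "S \<subseteq> V" and K: "K \<ge> 0"
  obtains C where "C \<ge> 0"
    "\<And>u L \<beta> \<rho> v. quadmap_adm K S \<rho> u L \<beta> \<Longrightarrow> norm v < \<rho> \<Longrightarrow>
      norm ((F \<circ> quadmap u L \<beta>) v - (F \<circ> quadmap u L \<beta>) 0 - frechet_derivative (F \<circ> quadmap u L \<beta>) (at 0) v)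
      \<le> C * norm v ^ 2"
    "\<And>u L \<beta> \<rho> s. quadmap_adm K S \<rho> u L \<beta> \<Longrightarrow> norm (frechet_derivative (F \<circ> quadmap u L \<beta>) (at 0) s) \<le> C * norm s"
proof -
  let ?D = "\<lambda>u. frechet_derivative F (at u)"
  obtain C where C: "C \<ge> 0" "\<And>u t. u \<in> S \<Longrightarrow> norm (?D u t) \<le> C * norm t"
    "\<And>u w. u \<in> S \<Longrightarrow> w \<in> S \<Longrightarrow> norm (F w - F u - ?D u (w - u)) \<le> C * norm (w - u) ^ 2"
    using C2_bounds[OF F] by metis
  have D0: "frechet_derivative (F \<circ> quadmap u L \<beta>) (at 0) s = ?D u (L s)" "quadmap u L \<beta> 0 = u"
    if "quadmap_adm K S \<rho> u L \<beta>" for u L \<beta> s \<rho>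
  proof -
    have "bounded_linear L" "bounded_bilinear \<beta>" using that by (auto simp: quadmap_adm_def)
    then have z: "L 0 = 0" "\<beta> 0 s = 0" "\<beta> s 0 = 0" for s
      by (simp_all add: linear_simps bounded_bilinear.zero_left bounded_bilinear.zero_right)
    then show "quadmap u L \<beta> 0 = u" by (simp add: quadmap_def)
    then show "frechet_derivative (F \<circ> quadmap u L \<beta>) (at 0) s = ?D u (L s)"
      using pullback_derivative(2)[OF F(1,5) that, of 0 s] that z by (simp add: quadmap_adm_def)
  qed
  show ?thesis
  proof (rule that[of "C * K + C * (2 * K)^2 + C * K"])
    fix u :: 'a and L \<beta> \<rho> and v :: 'a assume adm: "quadmap_adm K S \<rho> u L \<beta>"
    { fix s :: 'a
      have "norm (?D u (L s)) \<le> C * (K * norm s)"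
        using order_trans[OF C(2)[of u "L s"] mult_left_mono[OF _ C(1)]] adm by (simp add: quadmap_adm_def)
      also have "\<dots> \<le> (C * K + C * (2 * K)^2 + C * K) * norm s" using C(1) K by (simp add: algebra_simps)
      finally show "norm (frechet_derivative (F \<circ> quadmap u L \<beta>) (at 0) s) \<le> (C * K + C * (2 * K)^2 + C * K) * norm s"
        using D0(1)[OF adm] by simp }
    assume v: "norm v < \<rho>"
    let ?w = "quadmap u L \<beta> v"
    have S: "u \<in> S" "?w \<in> S" using adm v by (auto simp: quadmap_adm_def)
    have lD: "linear (?D u)" using frechet_linear[OF F(1)] S F(5) by blast
    \<comment> \<open>The linear term of the pullback is \<open>?D u (L v)\<close>; what the
      quadratic part of the map adds to the derivative of \<open>F\<close> is itself of second order
      and joins the remainder.\<close>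
    have "F ?w - F u - ?D u (L v) = (F ?w - F u - ?D u (?w - u)) + ?D u (\<beta> v v)"
      by (simp add: quadmap_def linear_add[OF lD])
    then have "norm (F ?w - F u - ?D u (L v)) \<le> norm (F ?w - F u - ?D u (?w - u)) + norm (?D u (\<beta> v v))"
      using norm_triangle_ineq by metis
    also have "\<dots> \<le> C * norm (?w - u)^2 + C * norm (\<beta> v v)" using C S by (intro add_mono) auto
    also have "\<dots> \<le> C * (2 * K * norm v) ^ 2 + C * (K * norm v ^ 2)"
      using quadmap_adm_bounds[OF adm v] K C by (intro add_mono mult_left_mono power_mono) auto
    also have "\<dots> \<le> (C * K + C * (2 * K)^2 + C * K) * norm v ^ 2"
      using C(1) K by (simp add: algebra_simps power2_eq_square)
    finally show "norm ((F \<circ> quadmap u L \<beta>) v - (F \<circ> quadmap u L \<beta>) 0 - frechet_derivative (F \<circ> quadmap u L \<beta>) (at 0) v)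
      \<le> (C * K + C * (2 * K)^2 + C * K) * norm v ^ 2" using D0[OF adm] by simp
  qed (use C K in auto)
qed

lemma taylor_from_derivative:
  fixes G :: "'a::euclidean_space \<Rightarrow> 'b::real_normed_vector"
  assumes d: "\<And>v. norm v < \<rho> \<Longrightarrow> (G has_derivative DG v) (at v)"
    and B: "bounded_bilinear B" "\<And>s t. B s t = B t s" and C: "C \<ge> 0"
    and b: "\<And>v s. norm v < \<rho> \<Longrightarrow> norm (DG v s - DG 0 s - B v s) \<le> C * norm v ^ 2 * norm s"
    and v: "norm v < \<rho>"
  shows "norm (G v - G 0 - DG 0 v - (1/2) *\<^sub>R B v v) \<le> C * norm v ^ 3"
proof -
  interpret bounded_bilinear B by fact
  have r: "norm (0::'a) < \<rho>" using v norm_ge_zero[of v] by (simp del: norm_ge_zero)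
  have bl: "bounded_linear (DG 0)" using d[OF r] has_derivative_bounded_linear by blast
  let ?G = "\<lambda>y. G y - DG 0 y - (1/2) *\<^sub>R B y y"
  have "norm (?G v - ?G 0) \<le> (C * norm v ^ 2) * norm (v - 0)"
  proof (rule differentiable_bound[OF convex_cball[of 0 "norm v"]])
    fix x assume x: "x \<in> cball (0::'a) (norm v)"
    then have xr: "norm x < \<rho>" "norm x \<le> norm v" using v by auto
    have 1: "((\<lambda>y. B y y) has_derivative (\<lambda>t. B x t + B t x)) (at x within cball 0 (norm v))"
      by (rule FDERIV) auto
    have "(\<lambda>t. (1/2) *\<^sub>R (B x t + B t x)) = B x"
      using B(2)[of _ x] by (auto simp: fun_eq_iff simp flip: scaleR_2)
    then have 2: "((\<lambda>y. (1/2) *\<^sub>R B y y) has_derivative B x) (at x within cball 0 (norm v))"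
      using has_derivative_scaleR_right[OF 1, of "1/2"] by simp
    show "(?G has_derivative (\<lambda>t. DG x t - DG 0 t - B x t)) (at x within cball 0 (norm v))"
      by (intro has_derivative_diff 2 bounded_linear_imp_has_derivative[OF bl] has_derivative_at_withinI[OF d[OF xr(1)]])
    show "onorm (\<lambda>t. DG x t - DG 0 t - B x t) \<le> C * norm v ^ 2"
    proof (rule onorm_bound)
      fix t :: 'a
      have "C * norm x ^ 2 * norm t \<le> C * norm v ^ 2 * norm t"
        using xr C by (intro mult_right_mono mult_left_mono power_mono) auto
      then show "norm (DG x t - DG 0 t - B x t) \<le> C * norm v ^ 2 * norm t" using b[OF xr(1), of t] by simp
    qed (use C in auto)
  qed auto
  moreover have "DG 0 0 = 0" using bl linear_simps(3) by blast
  ultimately show ?thesis by (simp add: power2_eq_square power3_eq_cube algebra_simps zero_left)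
qed

text \<open>Applying \<open>C3_bounds\<close> to the pullback directly would give a constant
  depending on \<open>u\<close>, \<open>L\<close> and \<open>\<beta>\<close>. Instead the expansion
  of \<open>F\<close> on \<open>S\<close> is composed with the quadratic map by hand, which keeps
  the constant uniform, and the Hessian of the pullback is identified afterwards.\<close>

lemma pullback_C3:
  fixes F :: "'a::euclidean_space \<Rightarrow> 'b::real_normed_vector"
  assumes F: "Ck_on (Suc (Suc (Suc k))) V F" "open V" "compact S" "convex S" "S \<subseteq> V" and K: "K \<ge> 0"
  obtains C where "C \<ge> 0"
    "\<And>u L \<beta> \<rho> v s. quadmap_adm K S \<rho> u L \<beta> \<Longrightarrow> norm v < \<rho> \<Longrightarrow>
      norm (frechet_derivative (F \<circ> quadmap u L \<beta>) (at v) s - frechet_derivative (F \<circ> quadmap u L \<beta>) (at 0) s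
         - hess (F \<circ> quadmap u L \<beta>) 0 v s) \<le> C * norm v ^ 2 * norm s"
    "\<And>u L \<beta> \<rho> v. quadmap_adm K S \<rho> u L \<beta> \<Longrightarrow> norm v < \<rho> \<Longrightarrow>
      norm ((F \<circ> quadmap u L \<beta>) v - (F \<circ> quadmap u L \<beta>) 0 - frechet_derivative (F \<circ> quadmap u L \<beta>) (at 0) v
         - (1/2) *\<^sub>R hess (F \<circ> quadmap u L \<beta>) 0 v v) \<le> C * norm v ^ 3"
    "\<And>u L \<beta> \<rho> s. quadmap_adm K S \<rho> u L \<beta> \<Longrightarrow> norm (frechet_derivative (F \<circ> quadmap u L \<beta>) (at 0) s) \<le> C * norm s"
    "\<And>u L \<beta> \<rho> s t. quadmap_adm K S \<rho> u L \<beta> \<Longrightarrow> norm (hess (F \<circ> quadmap u L \<beta>) 0 s t) \<le> C * norm s * norm t"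
    "\<And>u L \<beta> \<rho> s. quadmap_adm K S \<rho> u L \<beta> \<Longrightarrow> frechet_derivative (F \<circ> quadmap u L \<beta>) (at 0) s = frechet_derivative F (at u) (L s)"
    "\<And>u L \<beta> \<rho> s t. quadmap_adm K S \<rho> u L \<beta> \<Longrightarrow> hess (F \<circ> quadmap u L \<beta>) 0 s t
         = frechet_derivative F (at u) (\<beta> s t + \<beta> t s) + hess F u (L s) (L t)"
proof -
  let ?D = "\<lambda>u. frechet_derivative F (at u)"
  obtain C2 where C2: "C2 \<ge> 0" "\<And>u t. u \<in> S \<Longrightarrow> norm (?D u t) \<le> C2 * norm t"
    "\<And>u s t. u \<in> S \<Longrightarrow> norm (hess F u s t) \<le> C2 * norm s * norm t"
    using C2_bounds[OF F] by metis
  obtain C3 where C3: "C3 \<ge> 0" "\<And>u w t. u \<in> S \<Longrightarrow> w \<in> S \<Longrightarrow>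
      norm (?D w t - ?D u t - hess F u (w - u) t) \<le> C3 * norm (w - u) ^ 2 * norm t"
    using C3_bounds[OF F] by metis
  define C where "C = C3 * (2 * K)^2 * (3 * K) + C2 * K * (3 * K) + C2 * K * (2 * K)"
  define CC where "CC = C + C2 * K + C2 * (2 * K) + C2 * K * K"
  have C0: "C \<ge> 0" "C \<le> CC" "C2 * K \<le> CC" "C2 * (2 * K) + C2 * K * K \<le> CC" "CC \<ge> 0"
    using C2 C3 K by (auto simp: C_def CC_def)
  \<comment> \<open>The Hessian that the chain rule predicts: the second derivative of the inner map
    seen through \<open>DF\<close>, plus the Hessian of \<open>F\<close> along
    \<open>L\<close>.\<close>
  define Hh where "Hh u L \<beta> s t = ?D u (\<beta> s t + \<beta> t s) + hess F u (L s) (L t)" for u L and \<beta> :: "'a \<Rightarrow> 'a \<Rightarrow> 'a" and s t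
  have zero: "quadmap u L \<beta> 0 = u" "frechet_derivative (F \<circ> quadmap u L \<beta>) (at 0) s = ?D u (L s)"
    if adm: "quadmap_adm K S \<rho> u L \<beta>" for u L \<beta> \<rho> s
  proof -
    have "bounded_linear L" "bounded_bilinear \<beta>" using that by (auto simp: quadmap_adm_def)
    then have z: "L 0 = 0" "\<beta> 0 s = 0" "\<beta> s 0 = 0" for s
      by (simp_all add: linear_simps bounded_bilinear.zero_left bounded_bilinear.zero_right)
    then show "quadmap u L \<beta> 0 = u" by (simp add: quadmap_def)
    then show "frechet_derivative (F \<circ> quadmap u L \<beta>) (at 0) s = ?D u (L s)"
      using pullback_derivative(2)[OF F(1,5) that, of 0 s] that z by (simp add: quadmap_adm_def)
  qed
  have T1: "norm (frechet_derivative (F \<circ> quadmap u L \<beta>) (at v) s - ?D u (L s) - Hh u L \<beta> v s) \<le> C * norm v ^ 2 * norm s"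
    if adm: "quadmap_adm K S \<rho> u L \<beta>" and v: "norm v < \<rho>" for u L \<beta> \<rho> v s
  proof -
    let ?w = "quadmap u L \<beta> v" let ?t = "L s + (\<beta> v s + \<beta> s v)"
    have S: "u \<in> S" "?w \<in> S" using adm v by (auto simp: quadmap_adm_def)
    have uV: "u \<in> V" using S F(5) by blast
    have lD: "linear (?D u)" using frechet_linear[OF F(1) uV] .
    interpret H: bounded_bilinear "hess F u" using hess_bilinear[OF F(1) uV] .
    note bd = quadmap_adm_bounds[OF adm v]
    have nL: "norm (L v) \<le> K * norm v" using adm by (simp add: quadmap_adm_def)
    define a1 a2 a3 where "a1 = ?D ?w ?t - ?D u ?t - hess F u (?w - u) ?t"
      and "a2 = hess F u (\<beta> v v) ?t" and "a3 = hess F u (L v) (\<beta> v s + \<beta> s v)"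
    have "?D ?w ?t - ?D u (L s) - Hh u L \<beta> v s = a1 + a2 + a3"
      by (simp add: a1_def a2_def a3_def Hh_def quadmap_def linear_add[OF lD] H.add_left H.add_right)
    then have "norm (?D ?w ?t - ?D u (L s) - Hh u L \<beta> v s) \<le> norm a1 + norm a2 + norm a3"
      by (auto intro!: norm_triangle_le add_mono)
    also have "\<dots> \<le> C3 * (2 * K * norm v) ^ 2 * (3 * K * norm s) + C2 * (K * norm v ^ 2) * (3 * K * norm s)
       + C2 * (K * norm v) * (2 * K * norm v * norm s)"
    proof (intro add_mono)
      have "norm a1 \<le> C3 * norm (?w - u) ^ 2 * norm ?t" unfolding a1_def using C3 S by blast
      also have "\<dots> \<le> C3 * (2 * K * norm v) ^ 2 * (3 * K * norm s)"
        using bd K C3 by (intro mult_mono mult_left_mono power_mono) auto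
      finally show "norm a1 \<le> C3 * (2 * K * norm v) ^ 2 * (3 * K * norm s)" .
      have "norm a2 \<le> C2 * norm (\<beta> v v) * norm ?t" unfolding a2_def using C2 S by blast
      also have "\<dots> \<le> C2 * (K * norm v ^ 2) * (3 * K * norm s)"
        using bd K C2 by (intro mult_mono mult_left_mono power_mono) auto
      finally show "norm a2 \<le> C2 * (K * norm v ^ 2) * (3 * K * norm s)" .
      have "norm a3 \<le> C2 * norm (L v) * norm (\<beta> v s + \<beta> s v)" unfolding a3_def using C2 S by blast
      also have "\<dots> \<le> C2 * (K * norm v) * (2 * K * norm v * norm s)"
        using bd nL K C2 by (intro mult_mono mult_left_mono power_mono) auto
      finally show "norm a3 \<le> C2 * (K * norm v) * (2 * K * norm v * norm s)" .
    qed
    also have "\<dots> = C * norm v ^ 2 * norm s" by (simp add: C_def algebra_simps power2_eq_square)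
    finally show ?thesis unfolding pullback_derivative(2)[OF F(1,5) adm v] .
  qed
  have CkG: "Ck_on (Suc (Suc (Suc k))) (ball 0 \<rho>) (F \<circ> quadmap u L \<beta>)" if adm: "quadmap_adm K S \<rho> u L \<beta>" for u L \<beta> \<rho>
    by (rule Ck_on_compose[OF open_ball F(2) _ quadmap_Ck F(1)])
      (use adm F(5) in \<open>auto simp: quadmap_adm_def simp del: mem_ball\<close>)
  \<comment> \<open>Both \<open>Hh\<close> and the true Hessian are linear approximations of the
    derivative of the pullback up to \<open>O(norm v ^ 2)\<close>. Their difference is linear in
    \<open>v\<close> and quadratically small, hence zero. The constant \<open>C'\<close> used here
    depends on the chart but leaves no trace in the conclusion.\<close>
  have Heq: "hess (F \<circ> quadmap u L \<beta>) 0 s t = Hh u L \<beta> s t" if adm: "quadmap_adm K S \<rho> u L \<beta>" for u L \<beta> \<rho> s t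
  proof -
    let ?G = "F \<circ> quadmap u L \<beta>"
    have r: "0 < \<rho>" using adm by (simp add: quadmap_adm_def)
    have sub: "cball 0 (\<rho>/2) \<subseteq> ball (0::'a) \<rho>" using r by (auto simp: subset_iff)
    obtain C' where C': "\<And>v t. v \<in> cball 0 (\<rho>/2) \<Longrightarrow>
      norm (frechet_derivative ?G (at v) t - frechet_derivative ?G (at 0) t - hess ?G 0 v t) \<le> C' * norm v ^ 2 * norm t"
      using C3_bounds[OF CkG[OF adm] open_ball compact_cball convex_cball sub] r
      by (metis diff_zero centre_in_cball half_gt_zero less_eq_real_def)
    interpret H: bounded_bilinear "hess ?G 0" using hess_bilinear[OF CkG[OF adm]] r by simp
    have uV: "u \<in> V" using adm F(5) by (auto simp: quadmap_adm_def)
    interpret H2: bounded_bilinear "hess F u" using hess_bilinear[OF F(1) uV] .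
    interpret b: bounded_bilinear \<beta> using adm by (simp add: quadmap_adm_def)
    interpret L: bounded_linear L using adm by (simp add: quadmap_adm_def)
    have lD: "linear (?D u)" using frechet_linear[OF F(1) uV] .
    let ?A = "\<lambda>v. hess ?G 0 v t - Hh u L \<beta> v t"
    have lA: "linear ?A"
      by (auto simp: linear_iff Hh_def H.add_left H.scaleR_left H2.add_left H2.scaleR_left b.add_left b.scaleR_left
          b.add_right b.scaleR_right L.add L.scaleR linear_add[OF lD] linear_cmul[OF lD] algebra_simps)
    have "norm (?A v - ?A 0 - 0) \<le> ((C + C') * norm t) * norm v ^ 2" if "norm v < \<rho>/2" for v
    proof -
      have v: "norm v < \<rho>" "v \<in> cball 0 (\<rho>/2)" using that r by auto
      have "norm (?A v) \<le> C * norm v ^ 2 * norm t + C' * norm v ^ 2 * norm t"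
        using T1[OF adm v(1), of t] C'[OF v(2), of t] zero(2)[OF adm, of t]
        norm_triangle_ineq4[of "frechet_derivative ?G (at v) t - ?D u (L t) - Hh u L \<beta> v t"
            "frechet_derivative ?G (at v) t - frechet_derivative ?G (at 0) t - hess ?G 0 v t"]
        by (simp add: algebra_simps)
      then show ?thesis using linear_0[OF lA] by (simp add: algebra_simps)
    qed
    then have "(?A has_derivative (\<lambda>v. 0)) (at 0)"
      by (intro has_derivative_quadratic_bound[of _ "\<rho>/2"]) (use r in \<open>auto intro: module_hom_zero\<close>)
    moreover have "(?A has_derivative ?A) (at 0)"
      using lA linear_conv_bounded_linear bounded_linear_imp_has_derivative by blast
    ultimately have "?A = (\<lambda>v. 0)" by (rule has_derivative_unique[rotated])
    then have "?A s = 0" by metis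
    then show ?thesis by simp
  qed
  have Hb: "norm (Hh u L \<beta> s t) \<le> CC * norm s * norm t" if adm: "quadmap_adm K S \<rho> u L \<beta>" for u L \<beta> \<rho> s t
  proof -
    have S: "u \<in> S" and b: "\<And>s t. norm (\<beta> s t) \<le> K * norm s * norm t" "\<And>s. norm (L s) \<le> K * norm s"
      using adm by (auto simp: quadmap_adm_def)
    have "norm (Hh u L \<beta> s t) \<le> C2 * norm (\<beta> s t + \<beta> t s) + C2 * norm (L s) * norm (L t)"
      unfolding Hh_def by (rule norm_triangle_le) (intro add_mono C2 S)
    also have "\<dots> \<le> C2 * (2 * K * norm s * norm t) + C2 * (K * norm s) * (K * norm t)"
    proof (intro add_mono mult_mono mult_left_mono b C2(1))
      show "norm (\<beta> s t + \<beta> t s) \<le> 2 * K * norm s * norm t"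
        using b(1)[of s t] b(1)[of t s] norm_triangle_ineq[of "\<beta> s t" "\<beta> t s"] by (simp add: algebra_simps)
    qed (use C2 K in auto)
    also have "\<dots> = (C2 * (2 * K) + C2 * K * K) * (norm s * norm t)" by (simp add: algebra_simps)
    also have "\<dots> \<le> CC * (norm s * norm t)" by (intro mult_right_mono C0) auto
    finally show ?thesis by (simp add: mult.assoc)
  qed
  have T1': "norm (frechet_derivative (F \<circ> quadmap u L \<beta>) (at v) s - frechet_derivative (F \<circ> quadmap u L \<beta>) (at 0) s
         - hess (F \<circ> quadmap u L \<beta>) 0 v s) \<le> CC * norm v ^ 2 * norm s"
    if adm: "quadmap_adm K S \<rho> u L \<beta>" and v: "norm v < \<rho>" for u L \<beta> \<rho> v s
  proof -
    have "C * norm v ^ 2 * norm s \<le> CC * norm v ^ 2 * norm s" by (intro mult_right_mono C0) auto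
    then show ?thesis using T1[OF adm v, of s] zero(2)[OF adm] Heq[OF adm] by simp
  qed
  show ?thesis
  proof (rule that[OF C0(5) T1'])
    fix u :: 'a and L \<beta> \<rho> and v s t :: 'a assume adm: "quadmap_adm K S \<rho> u L \<beta>"
    let ?G = "F \<circ> quadmap u L \<beta>"
    have r: "0 < \<rho>" using adm by (simp add: quadmap_adm_def)
    show "norm (hess ?G 0 s t) \<le> CC * norm s * norm t" using Heq[OF adm] Hb[OF adm] by simp
    show "frechet_derivative ?G (at 0) s = ?D u (L s)" using zero[OF adm] by simp
    show "hess ?G 0 s t = ?D u (\<beta> s t + \<beta> t s) + hess F u (L s) (L t)" using Heq[OF adm] by (simp add: Hh_def)
    have "norm (?D u (L s)) \<le> C2 * (K * norm s)"
      using order_trans[OF C2(2)[of u "L s"] mult_left_mono[OF _ C2(1)]] adm by (simp add: quadmap_adm_def)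
    also have "\<dots> \<le> CC * norm s" using mult_right_mono[OF C0(3), of "norm s"] by simp
    finally show "norm (frechet_derivative ?G (at 0) s) \<le> CC * norm s" using zero[OF adm] by simp
    assume v: "norm v < \<rho>"
    show "norm (?G v - ?G 0 - frechet_derivative ?G (at 0) v - (1/2) *\<^sub>R hess ?G 0 v v) \<le> CC * norm v ^ 3"
    proof (rule taylor_from_derivative[where DG="\<lambda>v. frechet_derivative ?G (at v)", OF _ _ _ C0(5) T1'[OF adm] v])
      show "(?G has_derivative frechet_derivative ?G (at v)) (at v)" if "norm v < \<rho>" for v
        using Ck_on_SucD[OF CkG[OF adm]] that by simp
      show "bounded_bilinear (hess ?G 0)" using hess_bilinear[OF CkG[OF adm]] r by simp
      show "hess ?G 0 s t = hess ?G 0 t s" for s t using hess_sym[OF CkG[OF adm] open_ball] r by simp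
    qed auto
  qed auto
qed

section \<open>Normal charts\<close>

lemma local_param_compose:
  fixes \<phi> :: "real^'d \<Rightarrow> real^'m" and T :: "real^'d \<Rightarrow> real^'d"
  assumes lp: "local_param M V \<phi>" and U: "open U" "T ` U \<subseteq> V" "inj_on T U"
    and T: "\<And>k. Ck_on k U T" and inj: "\<And>v. v \<in> U \<Longrightarrow> inj (frechet_derivative T (at v))"
  shows "local_param M U (\<phi> \<circ> T)"
  unfolding local_param_def
proof (intro conjI ballI)
  show "smooth_on U (\<phi> \<circ> T)"
    unfolding smooth_on_def using Ck_on_compose[OF U(1) local_paramD(1)[OF lp] U(2) T local_paramD(2)[OF lp]] by blast
  show "inj (frechet_derivative (\<phi> \<circ> T) (at v))" if v: "v \<in> U" for v
  proof -
    have "T v \<in> V" using v U by blast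
    then have "(\<phi> \<circ> T has_derivative frechet_derivative \<phi> (at (T v)) \<circ> frechet_derivative T (at v)) (at v)"
      using diff_chain_at[OF Ck_on_SucD[OF T v] local_paramD(5)[OF lp]] by blast
    then have "frechet_derivative (\<phi> \<circ> T) (at v) = frechet_derivative \<phi> (at (T v)) \<circ> frechet_derivative T (at v)"
      using frechet_derivative_at by metis
    then show ?thesis using inj_compose[OF local_paramD(4)[OF lp \<open>T v \<in> V\<close>] inj[OF v]] by simp
  qed
  have cT: "continuous_on U T" using T Ck_on_continuous by blast
  obtain g where g: "homeomorphism U (T ` U) T g"
    using invariance_of_domain_homeomorphism[OF U(1) cT _ U(3)] by auto
  have oT: "open (T ` U)" using invariance_of_domain[OF cT U(1) U(3)] .
  obtain \<psi> where \<psi>: "homeomorphism V (\<phi> ` V) \<phi> \<psi>" using lp by (auto simp: local_param_def)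
  have "homeomorphism (T ` U) (\<phi> ` T ` U) \<phi> \<psi>" using homeomorphism_of_subsets[OF \<psi> U(2) _ refl] U(2) by blast
  from homeomorphism_compose[OF g this] show "\<exists>\<psi>. homeomorphism U ((\<phi> \<circ> T) ` U) (\<phi> \<circ> T) \<psi>"
    by (metis image_comp)
  have "openin (top_of_set V) (T ` U)" using oT U(2) by (simp add: open_subset)
  then have "openin (top_of_set (\<phi> ` V)) (\<phi> ` T ` U)" using homeomorphism_imp_open_map[OF \<psi>] by blast
  then show "openin (top_of_set M) ((\<phi> \<circ> T) ` U)"
    using openin_trans local_paramD(3)[OF lp] by (metis image_comp)
qed (use U in auto)

text \<open>Leibniz's formula term by term: each product of entries differs from that of the
  identity matrix by a multiple of \<open>\<eta>\<close>.\<close>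

lemma det_near_identity:
  obtains C where "C \<ge> 0" "\<And>(A::real^'d^'d) \<eta>. 0 \<le> \<eta> \<Longrightarrow> \<eta> \<le> 1 \<Longrightarrow>
     (\<And>i j. \<bar>A $ i $ j - (if i = j then 1 else 0)\<bar> \<le> \<eta>) \<Longrightarrow> \<bar>det A - 1\<bar> \<le> C * \<eta>"
proof -
  let ?P = "{p. p permutes (UNIV::'d set)}" let ?n = "CARD('d)"
  define C where "C = real (card ?P) * (2 ^ ?n * real ?n)"
  have "\<bar>det A - 1\<bar> \<le> C * \<eta>" if \<eta>: "0 \<le> \<eta>" "\<eta> \<le> 1" and A: "\<And>i j. \<bar>A $ i $ j - (if i = j then 1 else 0)\<bar> \<le> \<eta>"
    for A :: "real^'d^'d" and \<eta>
  proof -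
    let ?I = "mat 1 :: real^'d^'d"
    have I: "?I $ i $ j = (if i = j then 1 else 0)" for i j by (simp add: mat_def)
    have 1: "\<bar>(\<Prod>i\<in>UNIV. A $ i $ p i) - (\<Prod>i\<in>UNIV. ?I $ i $ p i)\<bar> \<le> 2 ^ ?n * real ?n * \<eta>" for p
    proof -
      have b: "\<bar>A $ i $ j\<bar> \<le> 2" "\<bar>?I $ i $ j\<bar> \<le> 2" for i j using A[of i j] \<eta> I[of i j] by (auto split: if_splits)
      \<comment> \<open>\<open>norm_prod_diff\<close> wants factors of norm at most 1. Entries are
        bounded by 2, so each is halved, which is where \<open>2 ^ ?n\<close> in the constant comes
        from.\<close>
      have "norm ((\<Prod>i\<in>UNIV. A $ i $ p i / 2) - (\<Prod>i\<in>UNIV. ?I $ i $ p i / 2)) \<le> (\<Sum>i\<in>UNIV. norm (A $ i $ p i / 2 - ?I $ i $ p i / 2))"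
        by (rule norm_prod_diff) (use b in auto)
      also have "\<dots> \<le> (\<Sum>i\<in>(UNIV::'d set). \<eta>)"
        by (rule sum_mono) (use A I \<eta> in \<open>simp flip: diff_divide_distrib\<close>, smt (verit) A)
      finally have "\<bar>((\<Prod>i\<in>UNIV. A $ i $ p i) - (\<Prod>i\<in>UNIV. ?I $ i $ p i)) / 2 ^ ?n\<bar> \<le> real ?n * \<eta>"
        by (simp add: prod_dividef diff_divide_distrib)
      then show ?thesis by (simp add: field_simps abs_divide)
    qed
    have "det A - det ?I = (\<Sum>p\<in>?P. of_int (sign p) * ((\<Prod>i\<in>UNIV. A $ i $ p i) - (\<Prod>i\<in>UNIV. ?I $ i $ p i)))"
      by (simp add: det_def sum_subtractf right_diff_distrib)
    also have "\<bar>\<dots>\<bar> \<le> (\<Sum>p\<in>?P. 2 ^ ?n * real ?n * \<eta>)"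
      by (rule order_trans[OF sum_abs sum_mono]) (use 1 in \<open>auto simp: abs_mult sign_def\<close>)
    finally show ?thesis by (simp add: C_def)
  qed
  then show ?thesis using that[of C] by (simp add: C_def)
qed

text \<open>The tangential part of the second derivative at the origin vanishes, so in
  \<open>\<bar>\<Phi> v - \<Phi> 0\<bar>\<^sup>2\<close> the cubic terms disappear and chart distance and chord distance agree up to third order.\<close>

definition normal_chart :: "(real^'m) set \<Rightarrow> real \<Rightarrow> real \<Rightarrow> real \<Rightarrow> (real^'d \<Rightarrow> real^'m) \<Rightarrow> bool" where
  "normal_chart M C \<rho> r \<Phi> \<longleftrightarrow> local_param M (ball 0 \<rho>) \<Phi> \<and> 0 \<le> C \<and> 0 < \<rho> \<and> \<rho> \<le> 1 \<and> 2 * C * \<rho> \<le> 1 \<and> 0 < r \<and>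
    (\<forall>s. norm (frechet_derivative \<Phi> (at 0) s) = norm s) \<and>
    (\<forall>s t z. hess \<Phi> 0 s t \<bullet> frechet_derivative \<Phi> (at 0) z = 0) \<and>
    (\<forall>v\<in>ball 0 \<rho>. \<bar>norm (\<Phi> v - \<Phi> 0) - norm v\<bar> \<le> C * norm v ^ 3 \<and>
       \<bar>sqrt (det (metric_matrix \<Phi> v)) - 1\<bar> \<le> C * norm v ^ 2 \<and>
       norm (adjoint (frechet_derivative \<Phi> (at 0)) (\<Phi> v - \<Phi> 0) - v) \<le> C * norm v ^ 3) \<and>
    M \<inter> cball (\<Phi> 0) r \<subseteq> \<Phi> ` ball 0 \<rho>"

text \<open>For an isometric embedding the adjoint returns the coordinates of the orthogonal
  projection onto the range. It serves as an ambient, linear substitute for the inverse of a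
  chart.\<close>

lemma adjoint_isometry:
  fixes E :: "'a::euclidean_space \<Rightarrow> 'b::euclidean_space"
  assumes "linear E" "\<And>s. norm (E s) = norm s"
  shows "adjoint E (E s) = s" "norm (adjoint E y) \<le> norm y" "adjoint E y \<bullet> s = y \<bullet> E s" "linear (adjoint E)"
proof -
  show ad: "adjoint E y \<bullet> s = y \<bullet> E s" for y s using adjoint_works[OF assms(1)] by (simp add: inner_commute)
  have "adjoint E (E s) \<bullet> t = s \<bullet> t" for t using ad isometry_inner[OF assms] by simp
  then show "adjoint E (E s) = s" by (rule vector_eq_rdot[THEN iffD1, rule_format])
  show "norm (adjoint E y) \<le> norm y"
  proof (rule norm_le_inner_bound)
    show "adjoint E y \<bullet> s \<le> norm y * norm s" for s
      using norm_cauchy_schwarz[of y "E s"] assms(2)[of s] ad by simp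
  qed simp
  show "linear (adjoint E)" using adjoint_linear[OF assms(1)] .
qed

text \<open>Since \<open>a\<close> and \<open>b\<close> are orthogonal, the squared norm deviates
  from \<open>norm v ^ 2\<close> by \<open>O(norm v ^ 4)\<close> only. Dividing by the sum of both
  norms, which is at least \<open>norm v\<close>, leaves a cubic error.\<close>

lemma norm_almost_isometric:
  fixes v :: "'a::real_normed_vector" and a b R :: "'b::real_inner"
  assumes "norm a = norm v" "a \<bullet> b = 0" "norm b \<le> C * norm v ^ 2" "norm R \<le> C * norm v ^ 3" "norm v \<le> 1" "C \<ge> 0"
  shows "\<bar>norm (a + b + R) - norm v\<bar> \<le> (4 * C ^ 2 + 2 * C) * norm v ^ 3"
proof (cases "v = 0")
  case False
  let ?n = "norm v"
  have "norm (a + b + R) ^ 2 - ?n ^ 2 = b \<bullet> b + 2 * (a \<bullet> R) + 2 * (b \<bullet> R) + R \<bullet> R"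
    using assms(1,2) by (simp add: power2_norm_eq_inner inner_add_left inner_add_right inner_commute flip: assms(1))
  also have "\<bar>\<dots>\<bar> \<le> norm b * norm b + 2 * (norm a * norm R) + 2 * (norm b * norm R) + norm R * norm R"
    using Cauchy_Schwarz_ineq2[of b b] Cauchy_Schwarz_ineq2[of a R] Cauchy_Schwarz_ineq2[of b R] Cauchy_Schwarz_ineq2[of R R] by linarith
  also have "\<dots> \<le> (C * ?n^2) * (C * ?n^2) + 2 * (?n * (C * ?n^3)) + 2 * ((C * ?n^2) * (C * ?n^2)) + (C * ?n^2) * (C * ?n^2)"
  proof -
    have "?n ^ 3 \<le> ?n ^ 2" using assms(5) by (simp add: power_decreasing)
    then have R: "norm R \<le> C * ?n ^ 2" using assms(4,6) by (smt (verit) mult_left_mono)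
    show ?thesis
      by (intro add_mono mult_mono mult_left_mono) (use assms R in auto)
  qed
  also have "\<dots> = ((4 * C ^ 2 + 2 * C) * ?n ^ 3) * ?n" by (simp add: algebra_simps power2_eq_square power3_eq_cube)
  finally have 1: "\<bar>norm (a + b + R) ^ 2 - ?n ^ 2\<bar> \<le> ((4 * C ^ 2 + 2 * C) * ?n ^ 3) * ?n" .
  have "\<bar>norm (a + b + R) - ?n\<bar> * ?n \<le> \<bar>norm (a + b + R) - ?n\<bar> * (norm (a + b + R) + ?n)"
    by (intro mult_left_mono) auto
  also have "\<dots> = \<bar>norm (a + b + R) ^ 2 - ?n ^ 2\<bar>"
    by (simp add: power2_eq_square square_diff_square_factored abs_mult mult.commute)
  finally have "\<bar>norm (a + b + R) - ?n\<bar> * ?n \<le> ((4 * C ^ 2 + 2 * C) * ?n ^ 3) * ?n" using 1 by linarith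
  then show ?thesis using False by (simp add: mult_le_cancel_right)
next
  case True
  then show ?thesis using assms by simp
qed

text \<open>The quadratic correction is chosen to cancel the tangential part of the second derivative of
  \<open>\<phi>\<close> at \<open>u\<close>.\<close>

lemma normal_coordinate_change:
  fixes \<phi> :: "real^'d \<Rightarrow> real^'m"
  assumes lp: "local_param M V \<phi>" and u: "u \<in> V"
    and c: "c > 0" "\<And>s. c * norm s \<le> norm (frechet_derivative \<phi> (at u) s)"
    and C: "C \<ge> 0" "\<And>s t. norm (hess \<phi> u s t) \<le> C * norm s * norm t"
  obtains E :: "real^'d \<Rightarrow> real^'m" and L :: "real^'d \<Rightarrow> real^'d" and Q :: "real^'d \<Rightarrow> real^'d \<Rightarrow> real^'d"
    where "linear E" "\<And>s. norm (E s) = norm s" "linear L" "\<And>s. frechet_derivative \<phi> (at u) (L s) = E s"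
    "\<And>s. norm (L s) \<le> (1 / c) * norm s"
    "bounded_bilinear Q" "\<And>s t. norm (Q s t) \<le> (C / c^2) * norm s * norm t"
    "\<And>s t. Q s t = - (1/2) *\<^sub>R adjoint E (hess \<phi> u (L s) (L t))"
proof -
  let ?J = "frechet_derivative \<phi> (at u)"
  have lJ: "linear ?J" and iJ: "inj ?J" using local_paramD[OF lp] u by auto
  have "dim (range ?J) = dim (UNIV :: (real^'d) set)" using dim_image_eq[OF lJ] iJ by simp
  \<comment> \<open>Subspaces of equal dimension are isometric, so the tangent space has an
    isometric parametrization by the coordinate space; \<open>L\<close> below expresses it in terms
    of the given chart.\<close>
  then obtain E :: "real^'d \<Rightarrow> real^'m" where E: "linear E" "range E = range ?J" "\<And>s. norm (E s) = norm s"
    by (rule isometries_subspaces[OF subspace_UNIV linear_subspace_image[OF lJ subspace_UNIV] sym]) blast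
  obtain A where A: "linear A" "\<And>s. A (?J s) = s" using local_param_left_inverse[OF lp u] by blast
  define L where "L s = A (E s)" for s
  have lL: "linear L" using linear_compose[OF E(1) A(1)] by (simp add: L_def[abs_def] o_def)
  have JL: "?J (L s) = E s" for s
  proof -
    obtain a where "E s = ?J a" using E(2) by blast
    then show ?thesis using A by (simp add: L_def)
  qed
  have nL: "norm (L s) \<le> (1 / c) * norm s" for s using c(2)[of "L s"] JL E(3) c(1) by (simp add: field_simps)
  define Q where "Q s t = - (1/2) *\<^sub>R adjoint E (hess \<phi> u (L s) (L t))" for s t
  note ad = adjoint_isometry[OF E(1,3)]
  interpret H: bounded_bilinear "hess \<phi> u" using hess_bilinear[OF local_paramD(2)[OF lp] u] .
  have nQ: "norm (Q s t) \<le> (C / c^2) * norm s * norm t" for s t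
  proof -
    have "norm (Q s t) = \<bar>- (1/2)\<bar> * norm (adjoint E (hess \<phi> u (L s) (L t)))" unfolding Q_def norm_scaleR ..
    also have "\<dots> \<le> norm (hess \<phi> u (L s) (L t))"
      using ad(2)[of "hess \<phi> u (L s) (L t)"] norm_ge_zero[of "adjoint E (hess \<phi> u (L s) (L t))"] by linarith
    also have "\<dots> \<le> C * norm (L s) * norm (L t)" by (rule C(2))
    also have "\<dots> \<le> C * ((1 / c) * norm s) * ((1 / c) * norm t)" using nL C(1) c(1) by (intro mult_mono mult_left_mono) auto
    also have "\<dots> = (C / c^2) * norm s * norm t" by (simp add: power2_eq_square field_simps)
    finally show ?thesis .
  qed
  have bQ: "bounded_bilinear Q"
    unfolding bilinear_conv_bounded_bilinear[symmetric] bilinear_def Q_def[abs_def] linear_iff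
    by (simp add: linear_add[OF lL] linear_cmul[OF lL] H.add_left H.add_right H.scaleR_left H.scaleR_right
        linear_add[OF ad(4)] linear_cmul[OF ad(4)] scaleR_add_right)
  show ?thesis using that[OF E(1) E(3) lL JL nL bQ nQ Q_def] .
qed

text \<open>A normal chart is good at its centre only, so each \<open>u\<close> gets its own change
  of coordinates. The point is that \<open>K\<close>, \<open>C\<close>, the chart radius
  \<open>\<rho>\<close> and the covered radius \<open>r\<close> do not depend on \<open>u\<close> in
  \<open>U\<close>.\<close>

lemma normal_chart_exists:
  fixes \<phi> :: "real^'d \<Rightarrow> real^'m"
  assumes lp: "local_param M V \<phi>" and u0: "u0 \<in> V"
  obtains U S K C \<rho> r where "open U" "u0 \<in> U" "U \<subseteq> V" "compact S" "convex S" "S \<subseteq> V" "K \<ge> 0"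
    "\<And>u. u \<in> U \<Longrightarrow> \<exists>L \<beta>. quadmap_adm K S \<rho> u L \<beta> \<and> normal_chart M C \<rho> r (\<phi> \<circ> quadmap u L \<beta>)"
proof -
  let ?J = "\<lambda>u. frechet_derivative \<phi> (at u)"
  have oV: "open V" and Ck: "\<And>k. Ck_on k V \<phi>" using local_paramD[OF lp] by auto
  obtain e0 where e0: "e0 > 0" "cball u0 e0 \<subseteq> V" using oV u0 open_contains_cball by blast
  obtain B0 where B0: "B0 > 0" "\<And>s. B0 * norm s \<le> norm (?J u0 s)"
    using linear_inj_bounded_below_pos[OF local_paramD(6)[OF lp u0] local_paramD(4)[OF lp u0]] by blast
  obtain C0 where C0: "C0 \<ge> 0" "\<And>u t. u \<in> cball u0 e0 \<Longrightarrow> norm (?J u t) \<le> C0 * norm t"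
    "\<And>u w t. u \<in> cball u0 e0 \<Longrightarrow> w \<in> cball u0 e0 \<Longrightarrow> norm (?J w t - ?J u t) \<le> C0 * norm (w - u) * norm t"
    "\<And>u s t. u \<in> cball u0 e0 \<Longrightarrow> norm (hess \<phi> u s t) \<le> C0 * norm s * norm t"
    using C2_bounds[OF Ck oV compact_cball convex_cball e0(2)] by metis
  \<comment> \<open>Within \<open>R\<close> of \<open>u0\<close> the derivative moves by at most
    \<open>B0 / 2\<close>, so the lower bound \<open>B0\<close> at \<open>u0\<close> survives with
    half its value.\<close>
  define R where "R = min e0 (B0 / (2 * (C0 + 1)))"
  have R: "R > 0" "R \<le> e0" "C0 * R \<le> B0 / 2"
  proof -
    show "R > 0" "R \<le> e0" using e0 B0 C0 by (auto simp: R_def)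
    have "C0 * R \<le> (C0 + 1) * R" using \<open>R > 0\<close> by simp
    also have "\<dots> \<le> (C0 + 1) * (B0 / (2 * (C0 + 1)))" using C0 by (intro mult_left_mono) (auto simp: R_def)
    also have "\<dots> = B0 / 2" using C0 by (simp add: field_simps)
    finally show "C0 * R \<le> B0 / 2" .
  qed
  define S where "S = cball u0 R"
  have S: "compact S" "convex S" "S \<subseteq> V" "S \<subseteq> cball u0 e0" using e0 R by (auto simp: S_def)
  define c where "c = B0 / 2"
  have c: "c > 0" using B0 by (simp add: c_def)
  have lower: "c * norm s \<le> norm (?J u s)" if "u \<in> S" for u s
  proof -
    have "norm (?J u s - ?J u0 s) \<le> C0 * norm (u - u0) * norm s" using C0(3)[of u0 u] that S e0 by auto
    also have "\<dots> \<le> C0 * R * norm s" using that C0(1)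
      by (intro mult_right_mono mult_left_mono) (auto simp: S_def dist_norm norm_minus_commute)
    also have "\<dots> \<le> B0 / 2 * norm s" using R(3) by (intro mult_right_mono) auto
    finally show ?thesis using B0(2)[of s] norm_triangle_sub[of "?J u0 s" "?J u s"] by (simp add: c_def norm_minus_commute)
  qed
  define K' where "K' = C0 / c^2"
  define K where "K = 1 / c + K' / c"
  have K: "K' \<ge> 0" "K \<ge> 0" "1 / c \<le> K" "K' / c \<le> K" using c C0 by (auto simp: K'_def K_def)
  obtain Cp where Cp: "Cp \<ge> 0"
    "\<And>u L \<beta> \<rho> v s. quadmap_adm K S \<rho> u L \<beta> \<Longrightarrow> norm v < \<rho> \<Longrightarrow>
      norm (frechet_derivative (\<phi> \<circ> quadmap u L \<beta>) (at v) s - frechet_derivative (\<phi> \<circ> quadmap u L \<beta>) (at 0) s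
         - hess (\<phi> \<circ> quadmap u L \<beta>) 0 v s) \<le> Cp * norm v ^ 2 * norm s"
    "\<And>u L \<beta> \<rho> v. quadmap_adm K S \<rho> u L \<beta> \<Longrightarrow> norm v < \<rho> \<Longrightarrow>
      norm ((\<phi> \<circ> quadmap u L \<beta>) v - (\<phi> \<circ> quadmap u L \<beta>) 0 - frechet_derivative (\<phi> \<circ> quadmap u L \<beta>) (at 0) v
         - (1/2) *\<^sub>R hess (\<phi> \<circ> quadmap u L \<beta>) 0 v v) \<le> Cp * norm v ^ 3"
    "\<And>u L \<beta> \<rho> s. quadmap_adm K S \<rho> u L \<beta> \<Longrightarrow> norm (frechet_derivative (\<phi> \<circ> quadmap u L \<beta>) (at 0) s) \<le> Cp * norm s"
    "\<And>u L \<beta> \<rho> s t. quadmap_adm K S \<rho> u L \<beta> \<Longrightarrow> norm (hess (\<phi> \<circ> quadmap u L \<beta>) 0 s t) \<le> Cp * norm s * norm t"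
    "\<And>u L \<beta> \<rho> s. quadmap_adm K S \<rho> u L \<beta> \<Longrightarrow> frechet_derivative (\<phi> \<circ> quadmap u L \<beta>) (at 0) s = ?J u (L s)"
    "\<And>u L \<beta> \<rho> s t. quadmap_adm K S \<rho> u L \<beta> \<Longrightarrow> hess (\<phi> \<circ> quadmap u L \<beta>) 0 s t
         = ?J u (\<beta> s t + \<beta> t s) + hess \<phi> u (L s) (L t)"
    by (rule pullback_C3[OF Ck oV S(1-3) K(2)], rule that, assumption+)
  define K1 where "K1 = 4 * Cp ^ 2 + 2 * Cp"
  have K1: "K1 \<ge> 0" using Cp by (simp add: K1_def)
  obtain Cd where Cd: "Cd \<ge> 0" "\<And>(A::real^'d^'d) \<eta>. 0 \<le> \<eta> \<Longrightarrow> \<eta> \<le> 1 \<Longrightarrow>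
     (\<And>i j. \<bar>A $ i $ j - (if i = j then 1 else 0)\<bar> \<le> \<eta>) \<Longrightarrow> \<bar>det A - 1\<bar> \<le> Cd * \<eta>"
    using det_near_identity[where 'd='d] by blast
  define C where "C = K1 + Cd * K1 + Cp"
  have C: "C \<ge> 0" "K1 \<le> C" "Cd * K1 \<le> C" "Cp \<le> C" using K1 Cd Cp by (auto simp: C_def)
  \<comment> \<open>The sum of all the quantities whose product with \<open>\<rho>\<close> has to be
    at most 1: staying in \<open>S\<close>, injectivity of the quadratic map, solvability of
    \<open>v + Q v v = z\<close>, closeness of the determinant to 1, and the condition
    \<open>2 * C * \<rho> \<le> 1\<close> of \<open>normal_chart\<close>.\<close>
  define Z where "Z = 1 + 4 * K / R + 4 * K * (C0 + 1) + K' + K1 + Cd * K1 + 2 * C"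
  define \<rho> where "\<rho> = 1 / Z"
  have Zn: "4 * K / R \<ge> 0" "4 * K * (C0 + 1) \<ge> 0" "Cd * K1 \<ge> 0" using K K1 R C0 Cd by auto
  have Z: "Z \<ge> 1" using Zn K K1 C by (simp add: Z_def)
  have \<rho>: "\<rho> > 0" "\<rho> \<le> 1" using Z by (auto simp: \<rho>_def)
  have \<rho>X: "X * \<rho> \<le> 1" if "X \<le> Z" for X using that Z by (simp add: \<rho>_def)
  have \<rho>s: "4 * K / R * \<rho> \<le> 1" "4 * K * (C0 + 1) * \<rho> \<le> 1" "K' * \<rho> \<le> 1" "K1 * \<rho> \<le> 1" "Cd * K1 * \<rho> \<le> 1" "2 * C * \<rho> \<le> 1"
    by (intro \<rho>X; use Zn K K1 C in \<open>simp add: Z_def\<close>)+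
  \<comment> \<open>Since \<open>norm z \<le> (C0 + 1) * norm (L z)\<close>, a point within
    \<open>r'\<close> of \<open>u\<close> is \<open>u + L z\<close> with
    \<open>norm z \<le> \<rho> / 4\<close>.\<close>
  define r' where "r' = \<rho> / (4 * (C0 + 1))"
  have r': "r' > 0" using \<rho> C0 by (simp add: r'_def)
  obtain \<psi> where \<psi>: "homeomorphism V (\<phi> ` V) \<phi> \<psi>" using lp by (auto simp: local_param_def)
  have \<psi>\<phi>: "\<psi> (\<phi> w) = w" if "w \<in> V" for w using \<psi> that by (auto simp: homeomorphism_def)
  obtain \<eta> where \<eta>: "\<eta> > 0" "\<And>y. y \<in> M \<Longrightarrow> dist y (\<phi> u0) < \<eta> \<Longrightarrow> y \<in> \<phi> ` V \<and> dist (\<psi> y) u0 < r' / 2"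
  proof -
    obtain T where T: "open T" "\<phi> ` V = M \<inter> T" using local_paramD(3)[OF lp] by (auto simp: openin_open)
    then have "\<phi> u0 \<in> T" using u0 by blast
    then obtain d where d: "d > 0" "ball (\<phi> u0) d \<subseteq> T" using T(1) open_contains_ball by blast
    have "continuous_on (\<phi> ` V) \<psi>" using \<psi> by (auto simp: homeomorphism_def)
    then obtain d2 where d2: "d2 > 0" "\<And>y. y \<in> \<phi> ` V \<Longrightarrow> dist y (\<phi> u0) < d2 \<Longrightarrow> dist (\<psi> y) u0 < r' / 2"
      unfolding continuous_on_iff using u0 r' \<psi>\<phi>[OF u0] by (metis half_gt_zero imageI)
    show ?thesis
    proof (rule that[of "min d d2"])
      fix y assume "y \<in> M" "dist y (\<phi> u0) < min d d2"
      then have "y \<in> \<phi> ` V" using T d by (auto simp: dist_commute)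
      then show "y \<in> \<phi> ` V \<and> dist (\<psi> y) u0 < r' / 2" using d2 \<open>dist y (\<phi> u0) < min d d2\<close> by auto
    qed (use d d2 in auto)
  qed
  \<comment> \<open>The two factors 1/2 allow a change of centre from \<open>u0\<close> to any
    \<open>u\<close> in \<open>U\<close>: half of \<open>r'\<close> and of \<open>\<eta>\<close> is
    spent on the distance between centres. A point within \<open>\<eta> / 3\<close> of
    \<open>\<phi> u\<close> is then still within \<open>\<eta>\<close> of
    \<open>\<phi> u0\<close>.\<close>
  define U where "U = (ball u0 (min (R / 2) (r' / 2)) \<inter> V) \<inter> \<phi> -` ball (\<phi> u0) (\<eta> / 2)"
  have oU: "open U" unfolding U_def
  proof (rule continuous_open_preimage)
    show "continuous_on (ball u0 (min (R / 2) (r' / 2)) \<inter> V) \<phi>"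
      by (rule continuous_on_subset[OF Ck_on_continuous[OF Ck[of 0]]]) simp
  qed (use oV in auto)
  have U: "u0 \<in> U" using u0 R r' \<eta> by (auto simp: U_def)
  have main: "\<exists>L \<beta>. quadmap_adm K S \<rho> u L \<beta> \<and> normal_chart M C \<rho> (\<eta> / 3) (\<phi> \<circ> quadmap u L \<beta>)" if uU: "u \<in> U" for u
  proof -
    have uS: "u \<in> S" "norm (u - u0) < R / 2" "norm (u - u0) < r' / 2" "norm (\<phi> u - \<phi> u0) < \<eta> / 2"
      using uU R by (auto simp: U_def S_def dist_norm norm_minus_commute)
    have uV: "u \<in> V" "u \<in> cball u0 e0" using uS S by auto
    obtain E :: "real^'d \<Rightarrow> real^'m" and L :: "real^'d \<Rightarrow> real^'d" and Q :: "real^'d \<Rightarrow> real^'d \<Rightarrow> real^'d"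
      where E: "linear E" "\<And>s. norm (E s) = norm s" and L: "linear L" "\<And>s. ?J u (L s) = E s"
      "\<And>s. norm (L s) \<le> (1 / c) * norm s"
      and Q: "bounded_bilinear Q" "\<And>s t. norm (Q s t) \<le> K' * norm s * norm t"
      "\<And>s t. Q s t = - (1/2) *\<^sub>R adjoint E (hess \<phi> u (L s) (L t))"
      using normal_coordinate_change[OF lp uV(1) c lower[OF uS(1)] C0(1) C0(4)[OF uV(2)]] unfolding K'_def by metis
    note ad = adjoint_isometry[OF E]
    have Llow: "norm s \<le> (C0 + 1) * norm (L s)" for s
    proof -
      have "norm s = norm (?J u (L s))" using L(2) E(2) by simp
      also have "\<dots> \<le> C0 * norm (L s)" using C0(2) uV by blast
      finally show ?thesis by (simp add: algebra_simps) (smt (verit) norm_ge_zero)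
    qed
    have iL: "inj L" unfolding linear_injective_0[OF L(1)]
    proof (intro allI impI)
      fix s assume "L s = 0"
      then show "s = 0" using Llow[of s] by simp
    qed
    have sL: "surj L" using linear_injective_imp_surjective[OF L(1) iL] by simp
    interpret Q: bounded_bilinear Q by fact
    define \<beta> where "\<beta> s t = L (Q s t)" for s t
    have bL: "bounded_linear L" using L(1) linear_conv_bounded_linear by blast
    have bb: "bounded_bilinear \<beta>"
      unfolding bilinear_conv_bounded_bilinear[symmetric] bilinear_def \<beta>_def[abs_def] linear_iff
      by (simp add: linear_add[OF L(1)] linear_cmul[OF L(1)] Q.add_left Q.add_right Q.scaleR_left Q.scaleR_right)
    have nL: "norm (L s) \<le> K * norm s" for s
      using L(3)[of s] mult_right_mono[OF K(3), of "norm s"] by simp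
    have nb: "norm (\<beta> s t) \<le> K * norm s * norm t" for s t
    proof -
      have "norm (\<beta> s t) \<le> (1 / c) * norm (Q s t)" unfolding \<beta>_def by (rule L(3))
      also have "\<dots> \<le> (1 / c) * (K' * norm s * norm t)" using Q(2) c by (intro mult_left_mono) auto
      also have "\<dots> = K' / c * (norm s * norm t)" by simp
      also have "\<dots> \<le> K * (norm s * norm t)" by (intro mult_right_mono K) auto
      finally show ?thesis by (simp add: mult.assoc)
    qed
    let ?T = "quadmap u L \<beta>" let ?\<Phi> = "\<phi> \<circ> ?T"
    have TS: "?T v \<in> S" if v: "norm v < \<rho>" for v
    proof -
      have "norm (\<beta> v v) \<le> K * norm v * 1" 
        by (rule order_trans[OF nb mult_left_mono]) (use v \<rho>(2) K in auto)
      then have "norm (?T v - u) \<le> 2 * K * norm v" using nL[of v] norm_triangle_ineq[of "L v" "\<beta> v v"] by (simp add: quadmap_def)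
      also have "\<dots> \<le> 2 * K * \<rho>" using v K by (intro mult_left_mono) auto
      also have "\<dots> \<le> R / 2" using \<rho>s(1) R(1) by (simp add: field_simps)
      finally have "norm (?T v - u) + norm (u - u0) \<le> R" using uS(2) by simp
      then have "norm (?T v - u0) \<le> R" using norm_triangle_ineq[of "?T v - u" "u - u0"] by simp
      then show ?thesis by (simp add: S_def dist_norm norm_minus_commute)
    qed
    have adm: "quadmap_adm K S \<rho> u L \<beta>"
      unfolding quadmap_adm_def using uS bL bb nL nb \<rho> TS by auto
    have dT: "(?T has_derivative (\<lambda>s. L s + (\<beta> v s + \<beta> s v))) (at v)" for v by (rule quadmap_has_derivative[OF bL bb])
    have DT: "frechet_derivative ?T (at v) = (\<lambda>s. L s + (\<beta> v s + \<beta> s v))" for v using frechet_derivative_at[OF dT] by simp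
    \<comment> \<open>On the ball of radius \<open>\<rho>\<close> the linear part strictly dominates
      the increments and the derivative of the quadratic part; injectivity of the map and of its
      derivative both follow from this.\<close>
    have small: "2 * K * \<rho> * norm s < norm (L s)" if "s \<noteq> 0" for s
    proof -
      have "(4 * K * (C0 + 1) * \<rho>) * norm (L s) \<le> 1 * norm (L s)" by (intro mult_right_mono \<rho>s(2)) auto
      moreover have "2 * K * \<rho> * norm s \<le> 2 * K * \<rho> * ((C0 + 1) * norm (L s))" using Llow K \<rho> by (intro mult_left_mono) auto
      moreover have "2 * (2 * K * \<rho> * ((C0 + 1) * norm (L s))) = (4 * K * (C0 + 1) * \<rho>) * norm (L s)" by simp
      moreover have "norm (L s) > 0" using iL that linear_injective_0[OF L(1)] by auto
      ultimately show ?thesis by linarith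
    qed
    have injT: "inj_on ?T (ball 0 \<rho>)"
    proof (rule inj_onI, rule ccontr)
      fix a b assume ab: "a \<in> ball 0 \<rho>" "b \<in> ball 0 \<rho>" "?T a = ?T b" "a \<noteq> b"
      interpret b: bounded_bilinear \<beta> by (rule bb)
      have "L (a - b) = - (\<beta> a (a - b) + \<beta> (a - b) b)"
        using ab(3) by (simp add: quadmap_def linear_diff[OF L(1)] b.diff_left b.diff_right algebra_simps)
      then have "norm (L (a - b)) \<le> norm (\<beta> a (a - b)) + norm (\<beta> (a - b) b)" by (metis norm_minus_cancel norm_triangle_ineq)
      also have "\<dots> \<le> K * norm a * norm (a - b) + K * norm (a - b) * norm b" by (intro add_mono nb)
      also have "\<dots> \<le> K * \<rho> * norm (a - b) + K * norm (a - b) * \<rho>" using ab K \<rho> by (intro add_mono mult_mono mult_left_mono) auto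
      finally show False using small[of "a - b"] ab(4) by simp
    qed
    have injDT: "inj (frechet_derivative ?T (at v))" if v: "v \<in> ball 0 \<rho>" for v
    proof -
      have l: "linear (frechet_derivative ?T (at v))" unfolding DT using dT has_derivative_linear by blast
      show ?thesis unfolding linear_injective_0[OF l]
      proof (intro allI impI, rule ccontr)
        fix s assume s: "frechet_derivative ?T (at v) s = 0" "s \<noteq> 0"
        have "norm (L s) = norm (\<beta> v s + \<beta> s v)" using s(1) unfolding DT by (metis add_eq_0_iff norm_minus_cancel)
        also have "\<dots> \<le> 2 * K * norm v * norm s" using quadmap_adm_bounds(3)[OF adm] v by simp
        also have "\<dots> \<le> 2 * K * \<rho> * norm s" using v K by (intro mult_right_mono mult_left_mono) auto
        finally show False using small[OF s(2)] by simp
      qed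
    qed
    have lp\<Phi>: "local_param M (ball 0 \<rho>) ?\<Phi>"
      by (rule local_param_compose[OF lp open_ball _ injT quadmap_Ck[OF bL bb open_ball] injDT])
        (use TS S(3) in auto)
    have T0: "?T 0 = u" by (simp add: quadmap_def \<beta>_def Q.zero_left linear_0[OF L(1)])
    have D0: "frechet_derivative ?\<Phi> (at 0) = E" using Cp(6)[OF adm] L(2) by auto
    interpret H: bounded_bilinear "hess \<phi> u" using hess_bilinear[OF Ck uV(1)] .
    have hs: "hess \<phi> u s t = hess \<phi> u t s" for s t using hess_sym[OF Ck oV uV(1)] .
    \<comment> \<open>The correction \<open>\<beta>\<close> contributes \<open>2 * Q s t\<close>
      through the isometry \<open>E\<close>, that is, minus the orthogonal projection of the Hessian
      of \<open>\<phi>\<close> onto the tangent space. Only the normal part is left.\<close>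
    have H0: "hess ?\<Phi> 0 s t = hess \<phi> u (L s) (L t) - E (adjoint E (hess \<phi> u (L s) (L t)))" for s t
    proof -
      have "Q t s = Q s t" using Q(3) hs by simp
      then have "?J u (\<beta> s t + \<beta> t s) = E (Q s t + Q s t)"
        by (simp only: \<beta>_def L(2) linear_add[OF E(1)] linear_add[OF local_paramD(6)[OF lp uV(1)]])
      also have "Q s t + Q s t = - adjoint E (hess \<phi> u (L s) (L t))"
        unfolding Q(3) scaleR_add_left[symmetric] by simp
      also have "E (- adjoint E (hess \<phi> u (L s) (L t))) = - E (adjoint E (hess \<phi> u (L s) (L t)))" by (rule linear_neg[OF E(1)])
      finally show ?thesis using Cp(7)[OF adm] by simp
    qed
    have perp: "hess ?\<Phi> 0 s t \<bullet> E z = 0" for s t z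
      unfolding H0 using ad(3) isometry_inner[OF E] by (simp add: inner_diff_left)
    have vfacts: "\<bar>norm (?\<Phi> v - ?\<Phi> 0) - norm v\<bar> \<le> C * norm v ^ 3 \<and>
       \<bar>sqrt (det (metric_matrix ?\<Phi> v)) - 1\<bar> \<le> C * norm v ^ 2 \<and>
       norm (adjoint E (?\<Phi> v - ?\<Phi> 0) - v) \<le> C * norm v ^ 3" if v: "norm v < \<rho>" for v
    proof (intro conjI)
      have v1: "norm v \<le> 1" using v \<rho> by simp
      define R0 where "R0 = ?\<Phi> v - ?\<Phi> 0 - E v - (1/2) *\<^sub>R hess ?\<Phi> 0 v v"
      have R0: "norm R0 \<le> Cp * norm v ^ 3" using Cp(3)[OF adm v] unfolding R0_def D0 .
      define b where "b = (1/2) *\<^sub>R hess ?\<Phi> 0 v v"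
      have "norm b = norm (hess ?\<Phi> 0 v v) / 2" unfolding b_def norm_scaleR by simp
      moreover have "norm (hess ?\<Phi> 0 v v) \<le> Cp * norm v ^ 2" using Cp(5)[OF adm, of v v] by (simp add: power2_eq_square)
      ultimately have nbb: "norm b \<le> Cp * norm v ^ 2" using norm_ge_zero[of b] by linarith
      have dec: "?\<Phi> v - ?\<Phi> 0 = E v + b + R0" by (simp add: R0_def b_def)
      have Eb: "E v \<bullet> b = 0" using perp[of v v v] by (simp add: b_def inner_commute)
      have "\<bar>norm (?\<Phi> v - ?\<Phi> 0) - norm v\<bar> \<le> K1 * norm v ^ 3"
        unfolding dec K1_def by (rule norm_almost_isometric[OF E(2) Eb nbb R0 v1 Cp(1)])
      also have "\<dots> \<le> C * norm v ^ 3" by (intro mult_right_mono C) auto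
      finally show "\<bar>norm (?\<Phi> v - ?\<Phi> 0) - norm v\<bar> \<le> C * norm v ^ 3" .
      have "adjoint E b = 0"
      proof -
        have "adjoint E b \<bullet> s = 0 \<bullet> s" for s unfolding ad(3) using perp[of v v s] by (simp add: b_def)
        then show ?thesis by (rule vector_eq_rdot[THEN iffD1, rule_format])
      qed
      then have "adjoint E (?\<Phi> v - ?\<Phi> 0) - v = adjoint E R0" unfolding dec linear_add[OF ad(4)] ad(1) by simp
      then have "norm (adjoint E (?\<Phi> v - ?\<Phi> 0) - v) \<le> Cp * norm v ^ 3" using ad(2)[of R0] R0 by simp
      also have "\<dots> \<le> C * norm v ^ 3" by (intro mult_right_mono C) auto
      finally show "norm (adjoint E (?\<Phi> v - ?\<Phi> 0) - v) \<le> C * norm v ^ 3" .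
      let ?D = "frechet_derivative ?\<Phi> (at v)" let ?G = "metric_matrix ?\<Phi> v"
      have iso: "\<bar>?D a \<bullet> ?D b - a \<bullet> b\<bar> \<le> K1 * norm v ^ 2 * (norm a * norm b)" for a b
        unfolding K1_def
      proof (rule almost_isometry[of E "hess ?\<Phi> 0 v"])
        show "norm (?D a - E a - hess ?\<Phi> 0 v a) \<le> Cp * norm v ^ 2 * norm a" for a
          using Cp(2)[OF adm v] unfolding D0 .
      qed (rule isometry_inner[OF E] perp Cp(1) v1 Cp(5)[OF adm] norm_ge_zero)+
      have v2: "X * norm v ^ 2 \<le> 1" if "X * \<rho> \<le> 1" "X \<ge> 0" for X
      proof -
        have "norm v ^ 2 \<le> norm v" using v1 by (simp add: power2_eq_square mult_left_le)
        then have "X * norm v ^ 2 \<le> X * \<rho>" using v that by (intro mult_left_mono) auto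
        then show ?thesis using that by simp
      qed
      have "\<bar>?G $ i $ j - (if i = j then 1 else 0)\<bar> \<le> K1 * norm v ^ 2" for i j
        using iso[of "axis i 1" "axis j 1"] by (cases "i = j") (simp_all add: metric_matrix_def inner_axis_axis)
      then have d1: "\<bar>det ?G - 1\<bar> \<le> Cd * (K1 * norm v ^ 2)"
        by (intro Cd) (use K1 v2[OF \<rho>s(4)] in auto)
      moreover have "Cd * K1 * norm v ^ 2 \<le> 1" using v2[OF \<rho>s(5)] K1 Cd by simp
      ultimately have "det ?G \<ge> 0" by (simp add: mult.assoc)
      then have "\<bar>sqrt (det ?G) - 1\<bar> * 1 \<le> \<bar>sqrt (det ?G) - 1\<bar> * (sqrt (det ?G) + 1)" by (intro mult_left_mono) auto
      also have "\<dots> = \<bar>(sqrt (det ?G) - 1) * (sqrt (det ?G) + 1)\<bar>" using \<open>det ?G \<ge> 0\<close> by (simp add: abs_mult)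
      also have "\<dots> = \<bar>det ?G - 1\<bar>" using \<open>det ?G \<ge> 0\<close> by (simp add: algebra_simps)
      also have "\<dots> \<le> Cd * K1 * norm v ^ 2" using d1 by (simp add: mult.assoc)
      also have "\<dots> \<le> C * norm v ^ 2" by (intro mult_right_mono C) auto
      finally show "\<bar>sqrt (det ?G) - 1\<bar> \<le> C * norm v ^ 2" by simp
    qed
    have cover: "M \<inter> cball (?\<Phi> 0) (\<eta> / 3) \<subseteq> ?\<Phi> ` ball 0 \<rho>"
    proof
      fix y assume y: "y \<in> M \<inter> cball (?\<Phi> 0) (\<eta> / 3)"
      have "dist y (\<phi> u) \<le> \<eta> / 3" using y T0 by (simp add: dist_commute)
      moreover have "dist (\<phi> u) (\<phi> u0) < \<eta> / 2" using uS(4) by (simp add: dist_norm)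
      ultimately have "dist y (\<phi> u0) < \<eta>" using dist_triangle[of y "\<phi> u0" "\<phi> u"] \<eta>(1) by linarith
      then obtain w where w: "w \<in> V" "y = \<phi> w" "dist w u0 < r' / 2" using \<eta>(2)[of y] y \<psi>\<phi> by auto
      have wu: "norm (w - u) < r'" using w(3) uS(3) norm_triangle_ineq[of "w - u0" "u0 - u"] by (simp add: dist_norm norm_minus_commute)
      obtain z where z: "w - u = L z" using sL by (metis surjD)
      have nz: "norm z \<le> \<rho> / 4"
      proof -
        have "norm z \<le> (C0 + 1) * norm (w - u)" using Llow[of z] z by simp
        also have "\<dots> \<le> (C0 + 1) * r'" using wu C0 by (intro mult_left_mono) auto
        also have "\<dots> = \<rho> / 4"
        proof -
          have "C0 + 1 \<noteq> 0" using C0(1) by simp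
          then show ?thesis by (simp only: r'_def) (simp add: divide_simps)
        qed
        finally show ?thesis .
      qed
      \<comment> \<open>The map is \<open>u + L (v + Q v v)\<close>, so hitting
        \<open>w = u + L z\<close> amounts to inverting a perturbation of the identity. Brouwer's
        theorem does this on an explicit ball, independent of \<open>u\<close>, where invariance of
        domain would only give some neighbourhood.\<close>
      have "\<exists>v\<in>cball 0 (\<rho>/2). v + Q v v = z"
      proof (rule brouwer_surjective_cball[where S="cball 0 (\<rho>/4)"])
        show "continuous_on (cball 0 (\<rho>/2)) (\<lambda>v. v + Q v v)"
          by (intro continuous_intros bounded_bilinear.continuous_on[OF Q(1)])
        fix x y :: "real^'d" assume xy: "x \<in> cball 0 (\<rho>/4)" "y \<in> cball 0 (\<rho>/2)"
        have "norm (Q y y) \<le> K' * norm y * norm y" by (rule Q(2))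
        also have "\<dots> \<le> K' * (\<rho>/2) * (\<rho>/2)" using xy K \<rho> by (intro mult_mono mult_left_mono) auto
        also have "\<dots> = (K' * \<rho>) * (\<rho>/4)" by simp
        also have "\<dots> \<le> 1 * (\<rho>/4)" using \<rho>s(3) \<rho> by (intro mult_right_mono) auto
        finally have "norm (x - Q y y) \<le> \<rho>/2" using xy norm_triangle_ineq4[of x "Q y y"] by simp
        then show "x + (y - (y + Q y y)) \<in> cball 0 (\<rho>/2)" by simp
      qed (use \<rho> nz in auto)
      then obtain v where v: "v \<in> cball 0 (\<rho>/2)" "v + Q v v = z" by blast
      then have "?T v = w" using z by (simp add: quadmap_def \<beta>_def linear_add[OF L(1)] flip: v(2)) (simp add: algebra_simps)
      then show "y \<in> ?\<Phi> ` ball 0 \<rho>" using v \<rho> w(2) by (intro image_eqI[of _ _ v]) auto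
    qed
    have "normal_chart M C \<rho> (\<eta> / 3) ?\<Phi>"
      unfolding normal_chart_def D0 using lp\<Phi> E(2) perp vfacts cover C(1) \<rho> \<rho>s(6) \<eta>(1) by auto
    then show ?thesis using adm by blast
  qed
  show ?thesis
    by (rule that[OF oU U _ S(1-3) K(2) main]) (auto simp: U_def)
qed

section \<open>Integration over balls and charts\<close>

lemma prod_Basis_vec: "(\<Prod>b\<in>(Basis::(real^'n) set). f b) = (\<Prod>k\<in>UNIV. f (axis k 1))"
proof -
  have B: "(Basis::(real^'n) set) = (\<lambda>k. axis k 1) ` UNIV" by (auto simp: Basis_vec_def)
  have i: "inj (\<lambda>k. axis k 1 :: real^'n)" by (auto simp: inj_on_def axis_eq_axis)
  show ?thesis unfolding B prod.reindex[OF i] by (simp add: o_def)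
qed

lemma sum_Basis_vec: "(\<Sum>b\<in>(Basis::(real^'n) set). f b) = (\<Sum>k\<in>UNIV. f (axis k 1))"
proof -
  have B: "(Basis::(real^'n) set) = (\<lambda>k. axis k 1) ` UNIV" by (auto simp: Basis_vec_def)
  have i: "inj (\<lambda>k. axis k 1 :: real^'n)" by (auto simp: inj_on_def axis_eq_axis)
  show ?thesis unfolding B sum.reindex[OF i] by (simp add: o_def)
qed

section \<open>Coordinate symmetries of Lebesgue measure and moments of round balls\<close>

definition swap_coords :: "'n \<Rightarrow> 'n \<Rightarrow> real^'n \<Rightarrow> real^'n::finite" where
  "swap_coords i j v = (\<chi> k. v $ Transposition.transpose i j k)"

lemma swap_coords_nth: "swap_coords i j v $ k = v $ Transposition.transpose i j k"
  by (simp add: swap_coords_def)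

lemma norm_swap_coords [simp]: "norm (swap_coords i j v) = norm v"
proof -
  have "(\<Sum>k\<in>UNIV. (v $ Transposition.transpose i j k)\<^sup>2) = (\<Sum>k\<in>UNIV. (v $ k)\<^sup>2)"
    by (rule sum.reindex_bij_betw[of "Transposition.transpose i j" UNIV UNIV "\<lambda>k. (v $ k)\<^sup>2"]) (simp add: bij_swap)
  then show ?thesis by (simp add: norm_vec_def L2_set_def swap_coords_nth)
qed

lemma swap_coords_measurable [measurable]: "swap_coords i j \<in> borel_measurable borel"
proof -
  have "linear (swap_coords i j)" by (auto simp: linear_iff swap_coords_def vec_eq_iff)
  then show ?thesis using linear_continuous_on linear_conv_bounded_linear borel_measurable_continuous_onI by blast
qed

lemma distr_swap_coords: "distr lborel borel (swap_coords i j) = (lborel :: (real^'n) measure)"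
proof (rule lborel_eqI[symmetric])
  let ?T = "swap_coords i j"
  fix l u :: "real^'n" assume le: "\<And>b. b \<in> Basis \<Longrightarrow> l \<bullet> b \<le> u \<bullet> b"
  have lek: "l $ k \<le> u $ k" for k using le[of "axis k 1"] by (simp add: inner_axis axis_in_Basis_iff)
  have pre: "?T -` box l u = box (?T l) (?T u)"
  proof -
    have "(\<forall>k. P (Transposition.transpose i j k)) \<longleftrightarrow> (\<forall>k. P k)" for P by (metis transpose_involutory)
    from this[of "\<lambda>k. l $ Transposition.transpose i j k < _ $ k \<and> _ $ k < u $ Transposition.transpose i j k"]
    show ?thesis by (auto simp: mem_box_cart swap_coords_nth)
  qed
  have "emeasure (distr lborel borel ?T) (box l u) = emeasure lborel (box (?T l) (?T u))"
    by (subst emeasure_distr) (auto simp: pre)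
  also have "\<dots> = (\<Prod>b\<in>Basis. (?T u - ?T l) \<bullet> b)"
    by (rule emeasure_lborel_box) (use lek in \<open>auto simp: Basis_vec_def inner_axis swap_coords_nth\<close>)
  also have "(\<Prod>b\<in>Basis. (?T u - ?T l) \<bullet> b) = (\<Prod>k\<in>UNIV. (u - l) $ Transposition.transpose i j k)"
    by (simp add: prod_Basis_vec inner_axis swap_coords_nth)
  also have "\<dots> = (\<Prod>k\<in>UNIV. (u - l) $ k)"
    by (rule prod.reindex_bij_betw[of "Transposition.transpose i j" UNIV UNIV "\<lambda>k. (u - l) $ k"]) (simp add: bij_swap)
  also have "\<dots> = (\<Prod>b\<in>Basis. (u - l) \<bullet> b)" by (simp add: prod_Basis_vec inner_axis)
  finally show "emeasure (distr lborel borel ?T) (box l u) = (\<Prod>b\<in>Basis. (u - l) \<bullet> b)" .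
qed simp

definition reflect_coord :: "'n \<Rightarrow> real^'n \<Rightarrow> real^'n::finite" where
  "reflect_coord i v = (\<chi> k. if k = i then - v $ k else v $ k)"

lemma reflect_coord_nth: "reflect_coord i v $ k = (if k = i then - v $ k else v $ k)"
  by (simp add: reflect_coord_def)

lemma distr_reflect_coord: "distr lborel borel (reflect_coord i) = (lborel :: (real^'n) measure)"
proof -
  let ?c = "\<lambda>j::real^'n. if j = axis i 1 then - 1 else 1 :: real"
  have T: "(\<lambda>x::real^'n. 0 + (\<Sum>j\<in>Basis. (?c j * (x \<bullet> j)) *\<^sub>R j)) = reflect_coord i"
  proof
    fix x :: "real^'n"
    show "0 + (\<Sum>j\<in>Basis. (?c j * (x \<bullet> j)) *\<^sub>R j) = reflect_coord i x"
    proof (rule vec_eq_iff[THEN iffD2, rule_format])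
      fix k
      have "(0 + (\<Sum>j\<in>Basis. (?c j * (x \<bullet> j)) *\<^sub>R j)) $ k = (\<Sum>j\<in>UNIV. ((if j = i then - 1 else 1) * x $ j) * (axis j 1 $ k))"
        by (simp add: sum_Basis_vec inner_axis axis_eq_axis)
      also have "\<dots> = (\<Sum>j\<in>UNIV. if j = k then (if j = i then - 1 else 1) * x $ j else 0)"
        by (rule sum.cong) (auto simp: axis_def)
      finally show "(0 + (\<Sum>j\<in>Basis. (?c j * (x \<bullet> j)) *\<^sub>R j)) $ k = reflect_coord i x $ k"
        by (simp add: reflect_coord_nth)
    qed
  qed
  have "lborel = density (distr lborel borel (reflect_coord i)) (\<lambda>_. ennreal (\<Prod>j\<in>(Basis::(real^'n) set). \<bar>?c j\<bar>))"
    using lborel_affine_euclidean[of ?c 0] unfolding T by simp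
  also have "(\<Prod>j\<in>(Basis::(real^'n) set). \<bar>?c j\<bar>) = 1" by (rule prod.neutral) auto
  finally show ?thesis by (simp add: density_1)
qed

lemma norm_reflect_coord [simp]: "norm (reflect_coord i v) = norm v"
  by (auto simp: norm_vec_def L2_set_def reflect_coord_def intro!: sum.cong arg_cong[where f=sqrt])

lemma reflect_coord_measurable [measurable]: "reflect_coord i \<in> borel_measurable borel"
proof -
  have "linear (reflect_coord i)" by (auto simp: linear_iff reflect_coord_def vec_eq_iff)
  then show ?thesis using linear_continuous_on linear_conv_bounded_linear borel_measurable_continuous_onI by blast
qed

lemma lborel_integral_scale:
  fixes f :: "'a::euclidean_space \<Rightarrow> real"
  assumes [measurable]: "f \<in> borel_measurable borel" and c: "c \<noteq> 0"
  shows "(\<integral>v. f v \<partial>lborel) = \<bar>c\<bar> ^ DIM('a) * (\<integral>v. f (c *\<^sub>R v) \<partial>lborel)"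
proof -
  have "(\<integral>v. f v \<partial>lborel) = (\<integral>v. f v \<partial>density (distr lborel borel (\<lambda>x. 0 + c *\<^sub>R x)) (\<lambda>_. ennreal (\<bar>c\<bar> ^ DIM('a))))"
    using lborel_affine[OF c, of "0::'a"] by simp
  also have "\<dots> = (\<integral>v. \<bar>c\<bar> ^ DIM('a) *\<^sub>R f v \<partial>distr lborel borel (\<lambda>x. 0 + c *\<^sub>R x))"
    by (subst integral_density) auto
  also have "\<dots> = (\<integral>v. \<bar>c\<bar> ^ DIM('a) *\<^sub>R f (0 + c *\<^sub>R v) \<partial>lborel)"
    by (subst integral_distr) auto
  finally show ?thesis by simp
qed

lemma integrable_cball:
  fixes g :: "'a::euclidean_space \<Rightarrow> real"
  assumes "continuous_on UNIV g"
  shows "integrable lborel (\<lambda>v. indicator (cball 0 r) v * g v)"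
proof -
  have "integrable lborel (\<lambda>v. indicator (cball 0 r) v *\<^sub>R g v)"
    by (rule borel_integrable_compact[OF compact_cball]) (use assms continuous_on_subset in blast)
  then show ?thesis by simp
qed

lemma indicator_cball_norm: "indicator (cball 0 r) v = (if norm v \<le> r then 1 else 0 :: real)"
  by (simp add: indicator_def)

lemma integral_cball_linear:
  fixes l :: "'a::euclidean_space \<Rightarrow> real"
  assumes "linear l"
  shows "(\<integral>v. indicator (cball 0 r) v * l v \<partial>lborel) = 0"
proof -
  have [measurable]: "l \<in> borel_measurable borel"
    using assms linear_continuous_on linear_conv_bounded_linear borel_measurable_continuous_onI by blast
  have "(\<integral>v. indicator (cball 0 r) v * l v \<partial>lborel) = (\<integral>v. indicator (cball 0 r) v * l (- v) \<partial>lborel)"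
    using lborel_integral_scale[of "\<lambda>v. indicator (cball 0 r) v * l v" "-1"] by (simp add: indicator_cball_norm)
  then show ?thesis by (simp add: linear_neg[OF assms])
qed

text \<open>Reflecting one coordinate changes the sign of the mixed moments, and swapping two
  coordinates equates the pure ones, whose sum is the moment of the squared norm.\<close>

lemma integral_cball_coords:
  fixes r :: real
  shows "(\<integral>v. indicator (cball 0 r) v * (v $ i * v $ j) \<partial>(lborel :: (real^'d) measure)) =
     (if i = j then (\<integral>v. indicator (cball 0 r) v * (norm v)\<^sup>2 \<partial>(lborel :: (real^'d) measure)) / CARD('d) else 0)"
proof -
  let ?I = "\<lambda>i j. (\<integral>v. indicator (cball 0 r) v * (v $ i * v $ j) \<partial>(lborel :: (real^'d) measure))"
  have m[measurable]: "(\<lambda>v::real^'d. v $ i) \<in> borel_measurable borel" for i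
    by (intro borel_measurable_continuous_onI continuous_intros)
  have off: "?I i j = 0" if "i \<noteq> j" for i j
  proof -
    have "?I i j = (\<integral>v. indicator (cball 0 r) v * (v $ i * v $ j) \<partial>(distr lborel borel (reflect_coord i)))"
      by (simp add: distr_reflect_coord)
    also have "\<dots> = (\<integral>v. indicator (cball 0 r) (reflect_coord i v) * (reflect_coord i v $ i * reflect_coord i v $ j) \<partial>lborel)"
      by (rule integral_distr) (measurable; simp add: measurable_lborel1)+
    also have "\<dots> = (\<integral>v. - (indicator (cball 0 r) v * (v $ i * v $ j)) \<partial>lborel)"
      using that by (intro Bochner_Integration.integral_cong) (auto simp: indicator_cball_norm reflect_coord_nth)
    also have "\<dots> = - ?I i j" by simp
    finally show ?thesis by simp
  qed
  have diag: "?I i i = ?I j j" for i j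
  proof -
    have "?I i i = (\<integral>v. indicator (cball 0 r) v * (v $ i * v $ i) \<partial>(distr lborel borel (swap_coords i j)))"
      by (simp add: distr_swap_coords)
    also have "\<dots> = (\<integral>v. indicator (cball 0 r) (swap_coords i j v) * (swap_coords i j v $ i * swap_coords i j v $ i) \<partial>lborel)"
      by (rule integral_distr) (measurable; simp add: measurable_lborel1)+
    also have "\<dots> = ?I j j"
      by (intro Bochner_Integration.integral_cong) (auto simp: indicator_cball_norm swap_coords_nth)
    finally show ?thesis .
  qed
  have "(\<integral>v. indicator (cball 0 r) v * (norm v)\<^sup>2 \<partial>(lborel :: (real^'d) measure)) = (\<Sum>k\<in>UNIV. ?I k k)"
  proof -
    have "(\<lambda>v::real^'d. indicator (cball 0 r) v * (norm v)\<^sup>2) = (\<lambda>v. \<Sum>k\<in>UNIV. indicator (cball 0 r) v * (v $ k * v $ k))"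
      by (auto simp: fun_eq_iff norm_vec_def L2_set_def sum_nonneg sum_distrib_left power2_eq_square)
    then show ?thesis
      by (simp only:) (rule Bochner_Integration.integral_sum, intro integrable_cball continuous_intros)
  qed
  also have "\<dots> = (\<Sum>k\<in>(UNIV::'d set). ?I i i)" by (intro sum.cong diag refl)
  also have "\<dots> = CARD('d) * ?I i i" by simp
  finally show ?thesis using off by simp
qed

text \<open>Rescaling to the unit ball, where the integrand is the one in
  \<open>limit_const\<close>; the division by the dimension in that constant matches the one in
  \<open>integral_cball_coords\<close>.\<close>

lemma integral_cball_norm_square:
  assumes r: "r > 0"
  shows "(\<integral>v. indicator (cball 0 r) v * (norm v)\<^sup>2 \<partial>(lborel :: (real^'d) measure)) / CARD('d)
     = limit_const TYPE('d) * r ^ (CARD('d) + 2)"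
proof -
  let ?f = "\<lambda>v::real^'d. indicator (cball 0 r) v * (norm v)\<^sup>2"
  have m: "?f \<in> borel_measurable borel"
    by (intro borel_measurable_times borel_measurable_indicator borel_measurable_continuous_onI continuous_intros) simp
  have "(\<integral>v. ?f v \<partial>lborel) = r ^ CARD('d) * (\<integral>v. ?f (r *\<^sub>R v) \<partial>lborel)"
    using lborel_integral_scale[of ?f r, OF m] r by simp
  also have "(\<integral>v. ?f (r *\<^sub>R v) \<partial>lborel) = (\<integral>v. r\<^sup>2 * (kernel (norm v) * (norm v)\<^sup>2) \<partial>(lborel :: (real^'d) measure))"
    using r by (intro Bochner_Integration.integral_cong) (auto simp: indicator_cball_norm kernel_def indicator_def power_mult_distrib field_simps)
  also have "\<dots> = r\<^sup>2 * (CARD('d) * limit_const TYPE('d))" by (simp add: limit_const_def)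
  finally show ?thesis by (simp add: power_add power2_eq_square)
qed

lemma integral_cball_bilinear:
  fixes B :: "real^'d \<Rightarrow> real^'d \<Rightarrow> real"
  assumes B: "bounded_bilinear B" and r: "r > 0"
  shows "(\<integral>v. indicator (cball 0 r) v * B v v \<partial>lborel) = (\<Sum>i\<in>Basis. B i i) * limit_const TYPE('d) * r ^ (CARD('d) + 2)"
proof -
  interpret bounded_bilinear B by fact
  let ?J = "limit_const TYPE('d) * r ^ (CARD('d) + 2)"
  have exp: "B v v = (\<Sum>i\<in>UNIV. \<Sum>j\<in>UNIV. B (axis i 1) (axis j 1) * (v $ i * v $ j))" for v
  proof -
    have v: "v = (\<Sum>i\<in>UNIV. v $ i *\<^sub>R axis i 1)"
      using euclidean_representation[of v, symmetric] by (simp add: sum_Basis_vec inner_axis)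
    have "B v v = B (\<Sum>i\<in>UNIV. v $ i *\<^sub>R axis i 1) (\<Sum>j\<in>UNIV. v $ j *\<^sub>R axis j 1)" using v by metis
    also have "\<dots> = (\<Sum>i\<in>UNIV. B (v $ i *\<^sub>R axis i 1) (\<Sum>j\<in>UNIV. v $ j *\<^sub>R axis j 1))" by (rule sum_left)
    also have "\<dots> = (\<Sum>i\<in>UNIV. \<Sum>j\<in>UNIV. B (v $ i *\<^sub>R axis i 1) (v $ j *\<^sub>R axis j 1))" by (simp only: sum_right)
    finally show ?thesis by (simp add: scaleR_left scaleR_right ac_simps)
  qed
  have "(\<integral>v. indicator (cball 0 r) v * B v v \<partial>lborel) =
     (\<integral>v. (\<Sum>i\<in>UNIV. \<Sum>j\<in>UNIV. B (axis i 1) (axis j 1) * (indicator (cball 0 r) v * (v $ i * v $ j))) \<partial>lborel)"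
    by (intro Bochner_Integration.integral_cong) (auto simp: exp sum_distrib_left ac_simps)
  also have "\<dots> = (\<Sum>i\<in>UNIV. \<Sum>j\<in>UNIV. B (axis i 1) (axis j 1) * (\<integral>v. indicator (cball 0 r) v * (v $ i * v $ j) \<partial>lborel))"
  proof -
    have i: "integrable lborel (\<lambda>v::real^'d. indicator (cball 0 r) v * (v $ i * v $ j))" for i j
      by (intro integrable_cball continuous_intros)
    show ?thesis
      by (subst Bochner_Integration.integral_sum, intro Bochner_Integration.integrable_sum integrable_mult_right i,
          intro sum.cong refl, subst Bochner_Integration.integral_sum, intro integrable_mult_right i) simp
  qed
  also have "\<dots> = (\<Sum>i\<in>UNIV. \<Sum>j\<in>UNIV. if i = j then B (axis i 1) (axis j 1) * ?J else 0)"
    by (intro sum.cong refl) (simp add: integral_cball_coords integral_cball_norm_square[OF r])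
  also have "\<dots> = (\<Sum>i\<in>UNIV. B (axis i 1) (axis i 1) * ?J)" by simp
  finally show ?thesis by (simp add: sum_Basis_vec sum_distrib_right mult.assoc)
qed

lemma power_diff_le:
  fixes a b :: real
  assumes "0 \<le> b" "b \<le> a"
  shows "a ^ n - b ^ n \<le> real n * (a - b) * a ^ (n - 1)"
proof (induction n)
  case (Suc n)
  have "a ^ Suc n - b ^ Suc n = a * (a ^ n - b ^ n) + (a - b) * b ^ n" by (simp add: algebra_simps)
  also have "\<dots> \<le> a * (real n * (a - b) * a ^ (n - 1)) + (a - b) * a ^ n"
    using assms Suc by (intro add_mono mult_left_mono power_mono) auto
  also have "\<dots> = real (Suc n) * (a - b) * a ^ (Suc n - 1)"
    by (cases n) (auto simp: algebra_simps)
  finally show ?case .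
qed simp

text \<open>The factor \<open>2 ^ DIM('a)\<close> collects the width \<open>2 * \<eta>\<close> and
  the power of \<open>r + \<eta> \<le> 2 * r\<close>.\<close>

lemma measure_annulus:
  fixes r \<eta> :: real
  assumes "0 \<le> \<eta>" "\<eta> \<le> r"
  shows "measure lborel (cball (0::'a::euclidean_space) (r + \<eta>) - ball 0 (r - \<eta>))
     \<le> unit_ball_vol (DIM('a)) * real DIM('a) * 2 ^ DIM('a) * \<eta> * r ^ (DIM('a) - 1)"
proof -
  let ?d = "DIM('a)"
  obtain k where k: "?d = Suc k" using DIM_positive[where 'a='a] gr0_implies_Suc by blast
  have "measure lborel (cball (0::'a) (r + \<eta>) - ball 0 (r - \<eta>))
     = measure lborel (cball (0::'a) (r + \<eta>)) - measure lborel (ball (0::'a) (r - \<eta>))"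
    by (rule measure_Diff) (use assms in \<open>auto simp: emeasure_cball\<close>)
  also have "\<dots> = unit_ball_vol ?d * ((r + \<eta>) ^ ?d - (r - \<eta>) ^ ?d)"
    using assms by (simp add: content_cball content_ball algebra_simps)
  also have "\<dots> \<le> unit_ball_vol ?d * (real ?d * ((r + \<eta>) - (r - \<eta>)) * (r + \<eta>) ^ (?d - 1))"
    using assms by (intro mult_left_mono power_diff_le) auto
  also have "\<dots> \<le> unit_ball_vol ?d * (real ?d * ((r + \<eta>) - (r - \<eta>)) * (2 * r) ^ (?d - 1))"
    using assms by (intro mult_left_mono power_mono) auto
  also have "\<dots> = unit_ball_vol ?d * real ?d * 2 ^ ?d * \<eta> * r ^ (?d - 1)"
    unfolding k by (simp add: power_mult_distrib algebra_simps)
  finally show ?thesis .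
qed

text \<open>\<open>S\<close> is a slightly deformed ball. Over the round ball the odd part
  \<open>l\<close> integrates to zero and \<open>B\<close> yields its trace. The cubic remainder
  costs \<open>r^3\<close> times the volume; where \<open>S\<close> and the round ball differ, the
  integrand has size \<open>r\<close> on a shell of volume about \<open>\<eta> * r^(d-1)\<close>.
  With \<open>\<eta>\<close> of order \<open>r^3\<close> both errors are
  \<open>O(r^(d+3))\<close>.\<close>

lemma ball_integral_estimate:
  obtains Cd where "Cd \<ge> 0" "\<And>(\<Psi>::real^'d \<Rightarrow> real) S r \<eta> l B K.
     0 < r \<Longrightarrow> r \<le> 1 \<Longrightarrow> 0 \<le> \<eta> \<Longrightarrow> \<eta> \<le> r \<Longrightarrow> S \<in> sets borel \<Longrightarrow> S \<subseteq> cball 0 (r + \<eta>) \<Longrightarrow> cball 0 (r - \<eta>) \<subseteq> S \<Longrightarrow>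
     (\<lambda>v. indicator S v * \<Psi> v) \<in> borel_measurable borel \<Longrightarrow> linear l \<Longrightarrow> bounded_bilinear B \<Longrightarrow> 0 \<le> K \<Longrightarrow>
     (\<And>v. \<bar>l v\<bar> \<le> K * norm v) \<Longrightarrow> (\<And>v. \<bar>B v v\<bar> \<le> K * norm v ^ 2) \<Longrightarrow>
     (\<And>v. v \<in> S \<Longrightarrow> \<bar>\<Psi> v - l v - B v v\<bar> \<le> K * norm v ^ 3) \<Longrightarrow>
     \<bar>(\<integral>v. indicator S v * \<Psi> v \<partial>lborel) - (\<Sum>i\<in>Basis. B i i) * limit_const TYPE('d) * r ^ (CARD('d) + 2)\<bar>
       \<le> K * Cd * (r ^ (CARD('d) + 3) + \<eta> * r ^ CARD('d))"
proof -
  let ?d = "CARD('d)"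
  let ?w = "unit_ball_vol (real ?d)"
  define Cd where "Cd = 8 * ?w * 2 ^ ?d + 6 * (?w * real ?d * 2 ^ ?d)"
  have w: "?w \<ge> 0" by (simp add: unit_ball_vol_nonneg)
  have "\<bar>(\<integral>v. indicator S v * \<Psi> v \<partial>lborel) - (\<Sum>i\<in>Basis. B i i) * limit_const TYPE('d) * r ^ (?d + 2)\<bar>
       \<le> K * Cd * (r ^ (?d + 3) + \<eta> * r ^ ?d)"
    if r: "0 < r" "r \<le> 1" and \<eta>: "0 \<le> \<eta>" "\<eta> \<le> r" and S: "S \<in> sets borel" "S \<subseteq> cball 0 (r + \<eta>)" "cball 0 (r - \<eta>) \<subseteq> S"
    and m: "(\<lambda>v. indicator S v * \<Psi> v) \<in> borel_measurable borel" and l: "linear l" and B: "bounded_bilinear B" and K: "0 \<le> K"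
    and lb: "\<And>v. \<bar>l v\<bar> \<le> K * norm v" and Bb: "\<And>v. \<bar>B v v\<bar> \<le> K * norm v ^ 2"
    and \<Psi>: "\<And>v. v \<in> S \<Longrightarrow> \<bar>\<Psi> v - l v - B v v\<bar> \<le> K * norm v ^ 3"
    for \<Psi> :: "real^'d \<Rightarrow> real" and S r \<eta> l B K
  proof -
    let ?A = "cball (0::real^'d) (r + \<eta>) - ball 0 (r - \<eta>)"
    let ?m = "\<lambda>v. indicator (cball 0 r) v * l v + indicator (cball 0 r) v * B v v"
    \<comment> \<open>Everything happens in \<open>norm v \<le> 2 * r\<close>: the cubic remainder
      is there at most \<open>8 * K * r ^ 3\<close>, and on the shell \<open>l\<close> and
      \<open>B\<close> together are at most \<open>2 * K * r + 4 * K * r\<close>, using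
      \<open>r \<le> 1\<close>.\<close>
    let ?g = "\<lambda>v. (8 * K * r ^ 3) * indicator (cball 0 (2 * r)) v + (6 * K * r) * indicator ?A v :: real"
    have cl: "continuous_on UNIV l" using l linear_continuous_on linear_conv_bounded_linear by blast
    have cB: "continuous_on UNIV (\<lambda>v. B v v)" using bounded_bilinear.continuous_on[OF B continuous_on_id continuous_on_id] .
    have im: "integrable lborel ?m" by (intro Bochner_Integration.integrable_add integrable_cball cl cB)
    have intm: "(\<integral>v. ?m v \<partial>lborel) = (\<Sum>i\<in>Basis. B i i) * limit_const TYPE('d) * r ^ (?d + 2)"
      by (subst Bochner_Integration.integral_add)
        (auto intro!: integrable_cball cl cB simp: integral_cball_linear[OF l] integral_cball_bilinear[OF B r(1)])
    have fA: "emeasure lborel ?A < \<infinity>"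
      by (rule le_less_trans[OF emeasure_mono[of _ "cball 0 (r + \<eta>)"]]) (use r \<eta> in \<open>auto simp: emeasure_cball\<close>)
    have fC: "emeasure lborel (cball (0::real^'d) (2 * r)) < \<infinity>" using r by (simp add: emeasure_cball)
    have ig: "integrable lborel ?g"
      by (intro Bochner_Integration.integrable_add integrable_mult_right integrable_real_indicator fA fC) auto
    have pb: "\<bar>indicator S v * \<Psi> v - ?m v\<bar> \<le> ?g v" for v
    proof -
      have A: "v \<in> ?A \<longleftrightarrow> norm v \<le> r + \<eta> \<and> \<not> norm v < r - \<eta>" by auto
      have n2: "norm v \<le> 2 * r \<Longrightarrow> K * norm v ^ 3 \<le> 8 * K * r ^ 3"
        using mult_left_mono[OF power_mono[of "norm v" "2 * r" 3] K] r by (simp add: power_mult_distrib algebra_simps)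
      have n3: "norm v \<le> 2 * r \<Longrightarrow> \<bar>l v\<bar> + \<bar>B v v\<bar> \<le> 6 * K * r"
      proof -
        assume n: "norm v \<le> 2 * r"
        have "\<bar>l v\<bar> \<le> K * (2 * r)" using lb[of v] mult_left_mono[OF n K] by linarith
        moreover have "\<bar>B v v\<bar> \<le> K * (2 * r) ^ 2" using Bb[of v] mult_left_mono[OF power_mono[OF n norm_ge_zero, of 2] K] by linarith
        moreover have "K * (2 * r) ^ 2 \<le> 4 * K * r" using r K mult_left_mono[of "r * r" r "4 * K"] by (simp add: power2_eq_square mult_left_le)
        ultimately show ?thesis by linarith
      qed
      have g0: "0 \<le> 8 * K * r ^ 3" "0 \<le> 6 * K * r" using K r by auto
      show ?thesis
      proof (cases "v \<in> S")
        case True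
        then have n: "norm v \<le> r + \<eta>" "norm v \<le> 2 * r" using S(2) \<eta> by auto
        have a: "\<bar>\<Psi> v - l v - B v v\<bar> \<le> 8 * K * r ^ 3" using \<Psi>[OF True] n2[OF n(2)] by simp
        show ?thesis
        proof (cases "norm v \<le> r")
          case True
          then show ?thesis using a g0 \<open>v \<in> S\<close> n by (auto simp: indicator_def)
        next
          case False
          then have "v \<in> ?A" using A n \<eta> by auto
          then show ?thesis using a n3[OF n(2)] \<open>v \<in> S\<close> n False by (auto simp: indicator_def)
        qed
      next
        case False
        then have n: "\<not> norm v \<le> r - \<eta>" using S(3) by auto
        show ?thesis
        proof (cases "norm v \<le> r")
          case True
          then have "v \<in> ?A" "norm v \<le> 2 * r" using A n \<eta> r by auto
          then show ?thesis using n3 False True g0 by (auto simp: indicator_def)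
        next
          case False
          then show ?thesis using \<open>v \<notin> S\<close> g0 by (auto simp: indicator_def)
        qed
      qed
    qed
    have iD: "integrable lborel (\<lambda>v. indicator S v * \<Psi> v - ?m v)"
    proof (rule Bochner_Integration.integrable_bound[OF ig])
      show "(\<lambda>v. indicator S v * \<Psi> v - ?m v) \<in> borel_measurable lborel"
        using m borel_measurable_integrable[OF im] by simp
      show "AE v in lborel. norm (indicator S v * \<Psi> v - ?m v) \<le> norm (?g v)"
        using pb by (intro AE_I2) (smt (verit) real_norm_def)
    qed
    have iS: "integrable lborel (\<lambda>v. indicator S v * \<Psi> v)"
      using Bochner_Integration.integrable_add[OF iD im] by simp
    define X where "X = (\<integral>v. indicator S v * \<Psi> v \<partial>lborel) - (\<Sum>i\<in>Basis. B i i) * limit_const TYPE('d) * r ^ (?d + 2)"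
    have X: "X = (\<integral>v. indicator S v * \<Psi> v - ?m v \<partial>lborel)"
      unfolding X_def by (subst Bochner_Integration.integral_diff[OF iS im]) (simp only: intm)
    define R where "R = r ^ (?d - 1)"
    have R: "r ^ ?d = r * R" "r ^ (?d + 3) = r ^ 3 * (r * R)"
    proof -
      show "r ^ ?d = r * R" using zero_less_card_finite[where 'a='d] unfolding R_def by (metis power_eq_if less_irrefl)
      then show "r ^ (?d + 3) = r ^ 3 * (r * R)" by (simp add: power_add)
    qed
    have "\<bar>X\<bar> \<le> (\<integral>v. ?g v \<partial>lborel)"
      unfolding X using Bochner_Integration.integral_norm_bound_integral[OF iD ig] pb by simp
    also have "\<dots> = (8 * K * r ^ 3) * measure lborel (cball (0::real^'d) (2 * r)) + (6 * K * r) * measure lborel ?A"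
      by (subst Bochner_Integration.integral_add)
        (auto intro!: integrable_mult_right integrable_real_indicator fA fC)
    also have "\<dots> \<le> (8 * K * r ^ 3) * (?w * (2 * r) ^ ?d) + (6 * K * r) * (?w * real ?d * 2 ^ ?d * \<eta> * r ^ (?d - 1))"
    proof (intro add_mono mult_left_mono)
      show "measure lborel (cball (0::real^'d) (2 * r)) \<le> ?w * (2 * r) ^ ?d" using r by (simp add: content_cball)
      show "measure lborel ?A \<le> ?w * real ?d * 2 ^ ?d * \<eta> * r ^ (?d - 1)" using measure_annulus[OF \<eta>, where 'a="real^'d"] by simp
    qed (use K r in auto)
    also have "\<dots> = K * (8 * ?w * 2 ^ ?d) * (r ^ 3 * (r * R)) + K * (6 * (?w * real ?d * 2 ^ ?d)) * (\<eta> * (r * R))"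
      unfolding R_def[symmetric] power_mult_distrib R(1) by (simp add: algebra_simps)
    also have "\<dots> \<le> K * Cd * (r ^ 3 * (r * R)) + K * Cd * (\<eta> * (r * R))"
      using w K r \<eta> by (intro add_mono mult_right_mono mult_left_mono) (auto simp: Cd_def R_def)
    finally show ?thesis unfolding X_def[symmetric] R by (simp add: algebra_simps)
  qed
  then show ?thesis using that[of Cd] w by (auto simp: Cd_def)
qed

section \<open>Transfer of integrals against the Riemannian volume to a chart\<close>

lemma local_param_density_continuous:
  fixes \<phi> :: "real^'d \<Rightarrow> real^'m"
  assumes lp: "local_param M V \<phi>"
  shows "continuous_on V (\<lambda>u. sqrt (det (metric_matrix \<phi> u)))"
proof -
  have c: "continuous_on V (\<lambda>u. frechet_derivative \<phi> (at u) v)" for v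
    using Ck_on_continuous[OF Ck_on_deriv[OF local_paramD(2)[OF lp, of "Suc 0"]]] .
  show ?thesis unfolding det_def metric_matrix_def
    by (simp) (intro continuous_intros c)
qed

text \<open>\<open>riemannian_volume\<close> prescribes the measure of sets inside a chart. This is
  upgraded to integrals by showing that \<open>\<mu>\<close> restricted to \<open>A\<close> is the
  image of a weighted Lebesgue measure; being an identity of measures, it holds for every measurable
  \<open>g\<close>, integrable or not. The \<open>max 0\<close> is there because \<open>sqrt\<close>
  of a negative real is negative while \<open>ennreal\<close> truncates it to 0.\<close>

lemma riemannian_volume_chart:
  fixes \<phi> :: "real^'d \<Rightarrow> real^'m" and g :: "real^'m \<Rightarrow> real"
  assumes rv: "riemannian_volume TYPE('d) M \<mu>" and lp: "local_param M V \<phi>"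
    and v0: "v0 \<in> V" and A: "A \<in> sets \<mu>" "A \<subseteq> \<phi> ` V" and g: "g \<in> borel_measurable \<mu>"
  shows "{v\<in>V. \<phi> v \<in> A} \<in> sets borel"
    "(\<lambda>v. indicator {v\<in>V. \<phi> v \<in> A} v * (g (\<phi> v) * max 0 (sqrt (det (metric_matrix \<phi> v))))) \<in> borel_measurable borel"
    "(\<integral>x. indicator A x * g x \<partial>\<mu>) =
       (\<integral>v. indicator {v\<in>V. \<phi> v \<in> A} v * (g (\<phi> v) * max 0 (sqrt (det (metric_matrix \<phi> v)))) \<partial>lborel)"
proof -
  have sp: "space \<mu> = M" and st: "sets \<mu> = sets (restrict_space borel M)" using rv by (auto simp: riemannian_volume_def)
  have oV: "open V" and cont: "continuous_on V \<phi>" using local_paramD(1,2)[OF lp] Ck_on_continuous by auto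
  let ?w = "\<lambda>v. max 0 (sqrt (det (metric_matrix \<phi> v)))"
  define w where "w v = (if v \<in> V then ?w v else 0)" for v
  have mw[measurable]: "w \<in> borel_measurable borel"
    unfolding w_def[abs_def]
    by (rule borel_measurable_continuous_on_if)
      (use oV local_param_density_continuous[OF lp] in \<open>auto intro!: continuous_intros\<close>)
    \<comment> \<open>Outside \<open>V\<close> the chart has arbitrary values; sending these points
      to \<open>\<phi> v0\<close> gives a map that is measurable everywhere and takes values in
      \<open>M\<close>.\<close>
    define \<phi>' where "\<phi>' v = (if v \<in> V then \<phi> v else \<phi> v0)" for v
    have rng: "\<phi>' v \<in> M" for v using local_paramD(7)[OF lp] v0 by (auto simp: \<phi>'_def)
    have "\<phi>' \<in> borel_measurable borel" unfolding \<phi>'_def[abs_def]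
      by (rule borel_measurable_continuous_on_if) (use oV cont in auto)
    then have "\<phi>' \<in> measurable borel (restrict_space borel M)" using rng by (intro measurable_restrict_space2) auto
    then have m\<phi>[measurable]: "\<phi>' \<in> measurable borel \<mu>" using measurable_cong_sets[OF refl st] by blast
    have pre: "{v\<in>V. \<phi> v \<in> B} = V \<inter> (\<phi>' -` B)" for B by (auto simp: \<phi>'_def)
    have preM: "{v\<in>V. \<phi> v \<in> B} \<in> sets borel" if "B \<in> sets \<mu>" for B
      unfolding pre using measurable_sets[OF m\<phi> that] oV by auto
    let ?S = "{v\<in>V. \<phi> v \<in> A}"
    have mS[measurable]: "?S \<in> sets borel" by (rule preM[OF A(1)])
    show "?S \<in> sets borel" by (rule mS)
    let ?N = "distr (density lborel (\<lambda>v. ennreal (indicator ?S v * w v))) \<mu> \<phi>'"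
    have eq: "density \<mu> (\<lambda>x. ennreal (indicator A x)) = ?N"
    proof (rule measure_eqI)
      fix B assume "B \<in> sets (density \<mu> (\<lambda>x. ennreal (indicator A x)))"
      then have B: "B \<in> sets \<mu>" by simp
      have "emeasure ?N B = (\<integral>\<^sup>+v. ennreal (indicator ?S v * w v) * indicator (\<phi>' -` B) v \<partial>lborel)"
        using B measurable_sets[OF m\<phi> B] by (simp add: emeasure_distr emeasure_density)
      also have "\<dots> = (\<integral>\<^sup>+v\<in>{v\<in>V. \<phi> v \<in> A \<inter> B}. ennreal (sqrt (det (metric_matrix \<phi> v))) \<partial>lborel)"
        by (intro nn_integral_cong) (auto simp: indicator_def w_def \<phi>'_def max_def ennreal_neg split: if_splits)
      also have "\<dots> = emeasure \<mu> (A \<inter> B)"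
      proof -
        have "A \<inter> B \<in> sets \<mu>" "A \<inter> B \<subseteq> \<phi> ` V" using A B by auto
        then show ?thesis using rv[unfolded riemannian_volume_def] lp by simp
      qed
      also have "\<dots> = emeasure (density \<mu> (\<lambda>x. ennreal (indicator A x))) B"
        using A B by (simp add: emeasure_density ennreal_indicator nn_integral_indicator flip: indicator_inter_arith)
      finally show "emeasure (density \<mu> (\<lambda>x. ennreal (indicator A x))) B = emeasure ?N B" by simp
    qed simp
    note [measurable] = g A(1)
    have "(\<lambda>v. indicator ?S v * (g (\<phi>' v) * w v)) \<in> borel_measurable borel" by measurable
    also have "(\<lambda>v. indicator ?S v * (g (\<phi>' v) * w v)) = (\<lambda>v. indicator ?S v * (g (\<phi> v) * ?w v))"
      by (auto simp: fun_eq_iff indicator_def \<phi>'_def w_def)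
    finally show "(\<lambda>v. indicator ?S v * (g (\<phi> v) * ?w v)) \<in> borel_measurable borel" .
    have "(\<integral>x. indicator A x * g x \<partial>\<mu>) = (\<integral>x. g x \<partial>density \<mu> (\<lambda>x. ennreal (indicator A x)))"
      by (subst integral_density) auto
    also have "\<dots> = (\<integral>v. g (\<phi>' v) \<partial>density lborel (\<lambda>v. ennreal (indicator ?S v * w v)))"
      unfolding eq by (rule integral_distr) auto
    also have "\<dots> = (\<integral>v. (indicator ?S v * w v) *\<^sub>R g (\<phi>' v) \<partial>lborel)"
    proof (rule integral_density)
      show "(\<lambda>v. indicator ?S v * w v) \<in> borel_measurable lborel" by measurable
    qed (auto simp: w_def)
    also have "\<dots> = (\<integral>v. indicator ?S v * (g (\<phi> v) * ?w v) \<partial>lborel)"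
      by (intro Bochner_Integration.integral_cong) (auto simp: indicator_def \<phi>'_def w_def)
    finally show "(\<integral>x. indicator A x * g x \<partial>\<mu>) = (\<integral>v. indicator ?S v * (g (\<phi> v) * ?w v) \<partial>lborel)" .
qed

section \<open>Expansions in normal charts\<close>

lemma Ck_manifold_continuous:
  fixes f :: "real^'m \<Rightarrow> real"
  assumes sm: "smooth_submanifold TYPE('d::finite) M" and f: "Ck_manifold TYPE('d) k M f"
  shows "continuous_on M f"
  unfolding continuous_on_eq_continuous_within
proof
  fix x assume "x \<in> M"
  then obtain V and \<phi> :: "real^'d \<Rightarrow> real^'m" where lp: "local_param M V \<phi>" and x: "x \<in> \<phi> ` V"
    using sm unfolding smooth_submanifold_def by blast
  have "Ck_on k V (f \<circ> \<phi>)" using f lp unfolding Ck_manifold_def by blast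
  then have c1: "continuous_on V (f \<circ> \<phi>)" by (rule Ck_on_continuous)
  obtain \<psi> where \<psi>: "homeomorphism V (\<phi> ` V) \<phi> \<psi>" using lp by (auto simp: local_param_def)
  have "continuous_on (\<phi> ` V) ((f \<circ> \<phi>) \<circ> \<psi>)"
    by (rule continuous_on_compose) (use \<psi> c1 in \<open>auto simp: homeomorphism_def\<close>)
  then have "continuous_on (\<phi> ` V) f"
    by (rule continuous_on_eq) (use \<psi> in \<open>auto simp: homeomorphism_def\<close>)
  then have "continuous (at x within \<phi> ` V) f"
    unfolding continuous_on_eq_continuous_within using x by blast
  moreover obtain T where T: "open T" "\<phi> ` V = M \<inter> T" using local_paramD(3)[OF lp] by (auto simp: openin_open)
  moreover have "at x within M \<inter> T = at x within M"
    by (rule at_within_nhd[of x T]) (use T x in auto)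
  ultimately show "continuous (at x within M) f" by metis
qed

lemma riemannian_volume_sets:
  assumes "riemannian_volume TYPE('d::finite) M \<mu>"
  shows "space \<mu> = M" "B \<in> sets borel \<Longrightarrow> M \<inter> B \<in> sets \<mu>"
    "continuous_on M (f :: _ \<Rightarrow> real) \<Longrightarrow> f \<in> borel_measurable \<mu>"
proof -
  show "space \<mu> = M" using assms by (auto simp: riemannian_volume_def)
  have st: "sets \<mu> = sets (restrict_space borel M)" using assms by (auto simp: riemannian_volume_def)
  show "B \<in> sets borel \<Longrightarrow> M \<inter> B \<in> sets \<mu>" unfolding st by (auto simp: sets_restrict_space)
  show "continuous_on M f \<Longrightarrow> f \<in> borel_measurable \<mu>"
    using borel_measurable_continuous_on_restrict measurable_cong_sets[OF st refl] by blast
qed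

text \<open>\<open>a\<close>, \<open>P\<close> and \<open>w\<close> stand for the increment of
  \<open>f\<close>, the density and the volume factor at distance \<open>n\<close> from the centre.
  The terms of order 1 and 2 in the product are \<open>l * p0\<close> and
  \<open>q * p0 + l * \<pi>\<close>; since \<open>a\<close> has no constant term, \<open>P\<close>
  is needed to second order only and \<open>w\<close> contributes nothing before order 3. The
  constant is \<open>6 + 9\<close>, from terms with \<open>K^2\<close> and with
  \<open>K^3\<close>.\<close>

lemma product_expansion:
  fixes n K :: real
  assumes n: "0 \<le> n" "n \<le> 1" and K: "K \<ge> 1" and l: "\<bar>l\<bar> \<le> K * n" and q: "\<bar>q\<bar> \<le> K * n ^ 2"
    and a: "\<bar>a - l - q\<bar> \<le> K * n ^ 3" and p0: "\<bar>p0\<bar> \<le> K" and \<pi>: "\<bar>\<pi>\<bar> \<le> K * n" and P: "\<bar>P - p0 - \<pi>\<bar> \<le> K * n ^ 2"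
    and w: "\<bar>w - 1\<bar> \<le> K * n ^ 2"
  shows "\<bar>a * P * w - l * p0 - (q * p0 + l * \<pi>)\<bar> \<le> 15 * K ^ 3 * n ^ 3"
proof -
  have n2: "n ^ 2 \<le> n" "n ^ 3 \<le> n" "n ^ 3 \<le> n ^ 2" "n ^ 4 \<le> n ^ 3" using n
    by (auto simp: power2_eq_square power3_eq_cube power4_eq_xxxx mult_left_le mult_le_one intro: mult_left_le_one_le)
  have K0: "K \<ge> 0" using K by simp
  have Kn: "K * n \<le> K" "K * n ^ 2 \<le> K * n" "K * n ^ 3 \<le> K * n"
    using mult_left_mono[OF n(2) K0] mult_left_mono[OF n2(1) K0] mult_left_mono[OF n2(2) K0] by simp_all
  define R1 R2 R3 where "R1 = a - l - q" and "R2 = P - p0 - \<pi>" and "R3 = w - 1"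
  have b: "\<bar>R1\<bar> \<le> K * n ^ 3" "\<bar>R2\<bar> \<le> K * n ^ 2" "\<bar>R3\<bar> \<le> K * n ^ 2" using a P w by (auto simp: R1_def R2_def R3_def)
  have Pb: "\<bar>P\<bar> \<le> 3 * K" using P p0 \<pi> Kn by linarith
  have ab: "\<bar>a\<bar> \<le> 3 * K * n" using a l q Kn by linarith
  have eq: "a * P * w - l * p0 - (q * p0 + l * \<pi>) = l * R2 + q * \<pi> + q * R2 + R1 * P + a * P * R3"
    by (simp add: R1_def R2_def R3_def algebra_simps)
  have mm: "\<bar>x * y\<bar> \<le> X * Y" if "\<bar>x\<bar> \<le> X" "\<bar>y\<bar> \<le> Y" for x y X Y :: real
    unfolding abs_mult using that by (intro mult_mono) auto
  have t1: "\<bar>l * R2\<bar> \<le> K * n * (K * n ^ 2)" by (rule mm[OF l b(2)])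
  have t2: "\<bar>q * \<pi>\<bar> \<le> K * n ^ 2 * (K * n)" by (rule mm[OF q \<pi>])
  have t3: "\<bar>q * R2\<bar> \<le> K * n ^ 2 * (K * n)" by (rule mm[OF q]) (use b(2) Kn in linarith)
  have t4: "\<bar>R1 * P\<bar> \<le> K * n ^ 3 * (3 * K)" by (rule mm[OF b(1) Pb])
  have t5: "\<bar>a * P * R3\<bar> \<le> 3 * K * n * (3 * K) * (K * n ^ 2)" by (rule mm[OF mm[OF ab Pb] b(3)])
  have "\<bar>a * P * w - l * p0 - (q * p0 + l * \<pi>)\<bar> \<le> 6 * (K ^ 2 * n ^ 3) + 9 * (K ^ 3 * n ^ 3)"
    unfolding eq using t1 t2 t3 t4 t5 by (simp add: power2_eq_square power3_eq_cube algebra_simps)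
  also have "\<dots> \<le> 6 * (K ^ 3 * n ^ 3) + 9 * (K ^ 3 * n ^ 3)"
    using K n by (intro add_mono mult_left_mono mult_right_mono power_increasing) auto
  finally show ?thesis by simp
qed

text \<open>\<open>p\<close> is expanded one order less than \<open>f\<close>, because it is always
  multiplied by an increment of \<open>f\<close>.\<close>

definition chart_bounds :: "real \<Rightarrow> real \<Rightarrow> (real^'d \<Rightarrow> real^'m) \<Rightarrow> (real^'m \<Rightarrow> real) \<Rightarrow> (real^'m \<Rightarrow> real) \<Rightarrow> bool" where
  "chart_bounds C \<rho> \<Phi> p f \<longleftrightarrow>
    (\<forall>v. norm v < \<rho> \<longrightarrow>
      \<bar>p (\<Phi> v) - p (\<Phi> 0) - frechet_derivative (p \<circ> \<Phi>) (at 0) v\<bar> \<le> C * norm v ^ 2 \<and>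
      \<bar>f (\<Phi> v) - f (\<Phi> 0) - frechet_derivative (f \<circ> \<Phi>) (at 0) v - 1/2 * hess (f \<circ> \<Phi>) 0 v v\<bar> \<le> C * norm v ^ 3) \<and>
    (\<forall>s t. \<bar>frechet_derivative (p \<circ> \<Phi>) (at 0) s\<bar> \<le> C * norm s \<and>
       \<bar>frechet_derivative (f \<circ> \<Phi>) (at 0) s\<bar> \<le> C * norm s \<and> \<bar>hess (f \<circ> \<Phi>) 0 s t\<bar> \<le> C * norm s * norm t)"

lemma normal_chart_mono:
  "normal_chart M C \<rho> r \<Phi> \<Longrightarrow> \<Phi> 0 \<in> M"
  unfolding normal_chart_def using local_paramD(7)[of M "ball 0 \<rho>" \<Phi> 0] by auto

text \<open>Every point near \<open>x0\<close> is the centre of its own normal chart, with all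
  constants shared by the neighbourhood; this is the form to which a compactness argument
  applies.\<close>

lemma chart_family:
  fixes p f :: "real^'m \<Rightarrow> real"
  assumes sm: "smooth_submanifold TYPE('d::finite) M" and p: "Ck_manifold TYPE('d) 2 M p" and f: "Ck_manifold TYPE('d) 3 M f"
    and x0: "x0 \<in> M"
  obtains W C \<rho> r C' where "open W" "x0 \<in> W" "C' \<ge> 0"
    "\<And>x. x \<in> M \<inter> W \<Longrightarrow> \<exists>\<Phi> :: real^'d \<Rightarrow> real^'m. \<Phi> 0 = x \<and> normal_chart M C \<rho> r \<Phi> \<and> chart_bounds C' \<rho> \<Phi> p f"
proof -
  obtain V and \<phi> :: "real^'d \<Rightarrow> real^'m" where lp: "local_param M V \<phi>" and x: "x0 \<in> \<phi> ` V"
    using sm x0 unfolding smooth_submanifold_def by blast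
  then obtain u0 where u0: "u0 \<in> V" "x0 = \<phi> u0" by blast
  have oV: "open V" using local_paramD(1)[OF lp] .
  have Cp: "Ck_on (Suc (Suc 0)) V (p \<circ> \<phi>)"
    using p lp unfolding Ck_manifold_def numeral_2_eq_2 by blast
  have Cf: "Ck_on (Suc (Suc (Suc 0))) V (f \<circ> \<phi>)"
    using f lp unfolding Ck_manifold_def numeral_3_eq_3 by blast
  obtain U S K C \<rho> r where U: "open U" "u0 \<in> U" "U \<subseteq> V" and S: "compact S" "convex S" "S \<subseteq> V" and K: "K \<ge> 0"
    and ch: "\<And>u. u \<in> U \<Longrightarrow> \<exists>L \<beta>. quadmap_adm K S \<rho> u L \<beta> \<and> normal_chart M C \<rho> r (\<phi> \<circ> quadmap u L \<beta>)"
    by (rule normal_chart_exists[OF lp u0(1)], rule that, assumption+)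
  obtain C1 where C1: "C1 \<ge> 0"
    "\<And>u L \<beta> \<rho> v. quadmap_adm K S \<rho> u L \<beta> \<Longrightarrow> norm v < \<rho> \<Longrightarrow>
      norm (((p \<circ> \<phi>) \<circ> quadmap u L \<beta>) v - ((p \<circ> \<phi>) \<circ> quadmap u L \<beta>) 0 - frechet_derivative ((p \<circ> \<phi>) \<circ> quadmap u L \<beta>) (at 0) v)
      \<le> C1 * norm v ^ 2"
    "\<And>u L \<beta> \<rho> s. quadmap_adm K S \<rho> u L \<beta> \<Longrightarrow> norm (frechet_derivative ((p \<circ> \<phi>) \<circ> quadmap u L \<beta>) (at 0) s) \<le> C1 * norm s"
    by (rule pullback_C2[OF Cp oV S K], rule that, assumption+)
  obtain C2 where C2: "C2 \<ge> 0"
    "\<And>u L \<beta> \<rho> v. quadmap_adm K S \<rho> u L \<beta> \<Longrightarrow> norm v < \<rho> \<Longrightarrow>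
      norm (((f \<circ> \<phi>) \<circ> quadmap u L \<beta>) v - ((f \<circ> \<phi>) \<circ> quadmap u L \<beta>) 0 - frechet_derivative ((f \<circ> \<phi>) \<circ> quadmap u L \<beta>) (at 0) v
         - (1/2) *\<^sub>R hess ((f \<circ> \<phi>) \<circ> quadmap u L \<beta>) 0 v v) \<le> C2 * norm v ^ 3"
    "\<And>u L \<beta> \<rho> s. quadmap_adm K S \<rho> u L \<beta> \<Longrightarrow> norm (frechet_derivative ((f \<circ> \<phi>) \<circ> quadmap u L \<beta>) (at 0) s) \<le> C2 * norm s"
    "\<And>u L \<beta> \<rho> s t. quadmap_adm K S \<rho> u L \<beta> \<Longrightarrow> norm (hess ((f \<circ> \<phi>) \<circ> quadmap u L \<beta>) 0 s t) \<le> C2 * norm s * norm t"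
    by (rule pullback_C3[OF Cf oV S K], rule that, assumption+)
  define C' where "C' = C1 + C2"
  have le: "C1 * a \<le> C' * a" "C2 * a \<le> C' * a" if "a \<ge> 0" for a
    unfolding C'_def using C1(1) C2(1) that by (auto intro!: mult_right_mono)
  have "openin (top_of_set M) (\<phi> ` U)"
  proof -
    obtain \<psi> where \<psi>: "homeomorphism V (\<phi> ` V) \<phi> \<psi>" using lp by (auto simp: local_param_def)
    have "openin (top_of_set (\<phi> ` V)) (\<phi> ` U)" using homeomorphism_imp_open_map[OF \<psi>] U by (simp add: open_subset)
    then show ?thesis using openin_trans local_paramD(3)[OF lp] by blast
  qed
  then obtain W where W: "open W" "\<phi> ` U = M \<inter> W" by (auto simp: openin_open)
  show ?thesis
  proof (rule that[OF W(1)])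
    show "x0 \<in> W" using W u0 U by blast
    show "C' \<ge> 0" using C1 C2 by (simp add: C'_def)
    fix x assume "x \<in> M \<inter> W"
    then obtain u where u: "u \<in> U" "x = \<phi> u" using W(2) by blast
    obtain L \<beta> where adm: "quadmap_adm K S \<rho> u L \<beta>" and nc: "normal_chart M C \<rho> r (\<phi> \<circ> quadmap u L \<beta>)"
      using ch[OF u(1)] by blast
    let ?\<Phi> = "\<phi> \<circ> quadmap u L \<beta>"
    have "bounded_linear L" "bounded_bilinear \<beta>" using adm by (auto simp: quadmap_adm_def)
    then have "quadmap u L \<beta> 0 = u" by (simp add: quadmap_def linear_simps bounded_bilinear.zero_left)
    then have 0: "?\<Phi> 0 = x" using u by simp
    have "chart_bounds C' \<rho> ?\<Phi> p f" unfolding chart_bounds_def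
    proof (intro conjI allI impI)
      fix v :: "real^'d" assume v: "norm v < \<rho>"
      show "\<bar>p (?\<Phi> v) - p (?\<Phi> 0) - frechet_derivative (p \<circ> ?\<Phi>) (at 0) v\<bar> \<le> C' * norm v ^ 2"
        by (rule order_trans[OF _ le(1)]) (use C1(2)[OF adm v] in \<open>simp_all add: o_assoc\<close>)
      show "\<bar>f (?\<Phi> v) - f (?\<Phi> 0) - frechet_derivative (f \<circ> ?\<Phi>) (at 0) v - 1/2 * hess (f \<circ> ?\<Phi>) 0 v v\<bar> \<le> C' * norm v ^ 3"
        by (rule order_trans[OF _ le(2)]) (use C2(2)[OF adm v] in \<open>simp_all add: o_assoc\<close>)
    next
      fix s t :: "real^'d"
      show "\<bar>frechet_derivative (p \<circ> ?\<Phi>) (at 0) s\<bar> \<le> C' * norm s"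
        by (rule order_trans[OF _ le(1)]) (use C1(3)[OF adm] in \<open>simp_all add: o_assoc\<close>)
      show "\<bar>frechet_derivative (f \<circ> ?\<Phi>) (at 0) s\<bar> \<le> C' * norm s"
        by (rule order_trans[OF _ le(2)]) (use C2(3)[OF adm] in \<open>simp_all add: o_assoc\<close>)
      have "\<bar>hess (f \<circ> ?\<Phi>) 0 s t\<bar> \<le> C' * (norm s * norm t)"
        by (rule order_trans[OF _ le(2)]) (use C2(4)[OF adm, of s t] in \<open>simp_all add: o_assoc mult.assoc\<close>)
      then show "\<bar>hess (f \<circ> ?\<Phi>) 0 s t\<bar> \<le> C' * norm s * norm t" by (simp add: mult.assoc)
    qed
    then show "\<exists>\<Phi> :: real^'d \<Rightarrow> real^'m. \<Phi> 0 = x \<and> normal_chart M C \<rho> r \<Phi> \<and> chart_bounds C' \<rho> \<Phi> p f"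
      using 0 nc by blast
  qed
qed

text \<open>The condition \<open>2 * C * \<rho> \<le> 1\<close> keeps the cubic error below half of
  \<open>norm v\<close>, so chart distance and chord distance are comparable, and the error may be
  stated in terms of either. It also keeps the volume factor between 1/2 and 2.\<close>

lemma normal_chart_radius:
  fixes \<Phi> :: "real^'d \<Rightarrow> real^'m"
  assumes nc: "normal_chart M C \<rho> r \<Phi>" and v: "norm v < \<rho>"
  shows "\<Phi> v \<in> M" "C * norm v ^ 3 \<le> norm v / 2" "norm v \<le> 2 * norm (\<Phi> v - \<Phi> 0)"
    "\<bar>norm (\<Phi> v - \<Phi> 0) - norm v\<bar> \<le> 8 * C * norm (\<Phi> v - \<Phi> 0) ^ 3"
    "max 0 (sqrt (det (metric_matrix \<Phi> v))) = sqrt (det (metric_matrix \<Phi> v))"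
    "1/2 \<le> sqrt (det (metric_matrix \<Phi> v))" "sqrt (det (metric_matrix \<Phi> v)) \<le> 2"
proof -
  have lp: "local_param M (ball 0 \<rho>) \<Phi>" and C: "0 \<le> C" "2 * C * \<rho> \<le> 1" and \<rho>: "0 < \<rho>" "\<rho> \<le> 1"
    using nc by (auto simp: normal_chart_def)
  show "\<Phi> v \<in> M" using local_paramD(7)[OF lp] v by simp
  have 1: "\<bar>norm (\<Phi> v - \<Phi> 0) - norm v\<bar> \<le> C * norm v ^ 3" "\<bar>sqrt (det (metric_matrix \<Phi> v)) - 1\<bar> \<le> C * norm v ^ 2"
    using nc v by (auto simp: normal_chart_def)
  have "norm v ^ 2 \<le> \<rho>"
  proof -
    have "norm v ^ 2 \<le> \<rho> * 1" unfolding power2_eq_square using v \<rho> by (intro mult_mono) auto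
    then show ?thesis by simp
  qed
  then have Cv: "C * norm v ^ 2 \<le> 1/2" using mult_left_mono[of "norm v ^ 2" \<rho> C] C by linarith
  have "C * norm v ^ 3 = (C * norm v ^ 2) * norm v" by (simp add: power2_eq_square power3_eq_cube)
  also have "\<dots> \<le> 1/2 * norm v" using Cv by (intro mult_right_mono) auto
  finally show 2: "C * norm v ^ 3 \<le> norm v / 2" by simp
  show 3: "norm v \<le> 2 * norm (\<Phi> v - \<Phi> 0)" using 1 2 by linarith
  have "C * norm v ^ 3 \<le> C * (2 * norm (\<Phi> v - \<Phi> 0)) ^ 3" using 3 C by (intro mult_left_mono power_mono) auto
  then show "\<bar>norm (\<Phi> v - \<Phi> 0) - norm v\<bar> \<le> 8 * C * norm (\<Phi> v - \<Phi> 0) ^ 3"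
    using 1 by (simp add: power_mult_distrib)
  show "1/2 \<le> sqrt (det (metric_matrix \<Phi> v))" "sqrt (det (metric_matrix \<Phi> v)) \<le> 2" using 1(2) Cv by linarith+
  then show "max 0 (sqrt (det (metric_matrix \<Phi> v))) = sqrt (det (metric_matrix \<Phi> v))" by linarith
qed

text \<open>Written as the trace of the quadratic part of \<open>(f - f x) * p\<close> in the chart,
  which is how the limit emerges from \<open>ball_integral_estimate\<close>.\<close>

lemma chart_limit_operator:
  fixes \<Phi> :: "real^'d \<Rightarrow> real^'m"
  assumes nc: "normal_chart M C \<rho> r \<Phi>" and p: "Ck_manifold TYPE('d) 2 M p" and f: "Ck_manifold TYPE('d) 3 M f"
  shows "limit_operator TYPE('d) M p f (\<Phi> 0) = limit_const TYPE('d) *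
    (\<Sum>i\<in>Basis. 1/2 * p (\<Phi> 0) * hess (f \<circ> \<Phi>) 0 i i + frechet_derivative (f \<circ> \<Phi>) (at 0) i * frechet_derivative (p \<circ> \<Phi>) (at 0) i)"
proof -
  let ?E = "frechet_derivative \<Phi> (at 0)"
  have lp: "local_param M (ball 0 \<rho>) \<Phi>" and \<rho>: "0 < \<rho>" and iso: "\<And>s. norm (?E s) = norm s"
    and perp: "\<And>s t z. hess \<Phi> 0 s t \<bullet> ?E z = 0"
    using nc by (auto simp: normal_chart_def)
  have z: "0 \<in> ball (0::real^'d) \<rho>" using \<rho> by simp
  have cf: "Ck_on 3 (ball 0 \<rho>) (f \<circ> \<Phi>)" and cp: "Ck_on 2 (ball 0 \<rho>) (p \<circ> \<Phi>)"
    using f p lp unfolding Ck_manifold_def by blast+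
  have cf1: "Ck_on 1 (ball 0 \<rho>) (f \<circ> \<Phi>)" and cp1: "Ck_on 1 (ball 0 \<rho>) (p \<circ> \<Phi>)"
    using Ck_on_mono[OF cf, of 1] Ck_on_mono[OF cp, of 1] by auto
  have lf: "linear (frechet_derivative (f \<circ> \<Phi>) (at 0))" and lp': "linear (frechet_derivative (p \<circ> \<Phi>) (at 0))"
    using frechet_linear[OF cf1[unfolded One_nat_def] z] frechet_linear[OF cp1[unfolded One_nat_def] z] by auto
  have "riemannian_gradient M p (\<Phi> 0) \<bullet> riemannian_gradient M f (\<Phi> 0) =
     (\<Sum>i\<in>Basis. frechet_derivative (p \<circ> \<Phi>) (at 0) i *\<^sub>R i) \<bullet> (\<Sum>i\<in>Basis. frechet_derivative (f \<circ> \<Phi>) (at 0) i *\<^sub>R i)"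
    unfolding riemannian_gradient_normal_chart[OF lp z iso perp cp1] riemannian_gradient_normal_chart[OF lp z iso perp cf1]
    by (rule isometry_inner[OF local_paramD(6)[OF lp z] iso])
  also have "\<dots> = frechet_derivative (p \<circ> \<Phi>) (at 0) (\<Sum>i\<in>Basis. frechet_derivative (f \<circ> \<Phi>) (at 0) i *\<^sub>R i)"
    by (rule inner_sum_Basis[OF lp'])
  also have "\<dots> = (\<Sum>i\<in>Basis. frechet_derivative (f \<circ> \<Phi>) (at 0) i * frechet_derivative (p \<circ> \<Phi>) (at 0) i)"
    by (simp add: linear_sum[OF lp'] linear_cmul[OF lp'])
  finally show ?thesis unfolding limit_operator_def laplace_beltrami_normal_chart[OF lp z iso perp cf]
    by (simp add: sum.distrib sum_distrib_left algebra_simps)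
qed

lemma ball_integral_chart:
  fixes \<Phi> :: "real^'d \<Rightarrow> real^'m" and g :: "real^'m \<Rightarrow> real"
  assumes rv: "riemannian_volume TYPE('d) M \<mu>" and nc: "normal_chart M C \<rho> r0 \<Phi>"
    and g: "g \<in> borel_measurable \<mu>" and T: "T \<in> sets borel" "T \<subseteq> cball (\<Phi> 0) r0"
  shows "{v \<in> ball 0 \<rho>. \<Phi> v \<in> T} \<in> sets borel"
    "(\<lambda>v. indicator {v \<in> ball 0 \<rho>. \<Phi> v \<in> T} v * (g (\<Phi> v) * sqrt (det (metric_matrix \<Phi> v)))) \<in> borel_measurable borel"
    "(\<integral>y. indicator T y * g y \<partial>\<mu>) =
      (\<integral>v. indicator {v \<in> ball 0 \<rho>. \<Phi> v \<in> T} v * (g (\<Phi> v) * sqrt (det (metric_matrix \<Phi> v))) \<partial>lborel)"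
proof -
  have lp: "local_param M (ball 0 \<rho>) \<Phi>" and cov: "M \<inter> cball (\<Phi> 0) r0 \<subseteq> \<Phi> ` ball 0 \<rho>" and \<rho>: "0 < \<rho>"
    using nc by (auto simp: normal_chart_def)
  let ?A = "M \<inter> T"
  have A: "?A \<in> sets \<mu>" "?A \<subseteq> \<Phi> ` ball 0 \<rho>" using riemannian_volume_sets(2)[OF rv T(1)] T(2) cov by auto
  have z: "0 \<in> ball (0::real^'d) \<rho>" using \<rho> by simp
  note R = riemannian_volume_chart[OF rv lp z A g]
  have S: "{v \<in> ball 0 \<rho>. \<Phi> v \<in> ?A} = {v \<in> ball 0 \<rho>. \<Phi> v \<in> T}" using local_paramD(7)[OF lp] by auto
  have eq: "(\<lambda>v. indicator {v \<in> ball 0 \<rho>. \<Phi> v \<in> T} v * (g (\<Phi> v) * max 0 (sqrt (det (metric_matrix \<Phi> v))))) =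
      (\<lambda>v. indicator {v \<in> ball 0 \<rho>. \<Phi> v \<in> T} v * (g (\<Phi> v) * sqrt (det (metric_matrix \<Phi> v))))"
    using normal_chart_radius(5)[OF nc] by (auto simp: fun_eq_iff indicator_def)
  show "{v \<in> ball 0 \<rho>. \<Phi> v \<in> T} \<in> sets borel" using R(1) unfolding S .
  show "(\<lambda>v. indicator {v \<in> ball 0 \<rho>. \<Phi> v \<in> T} v * (g (\<Phi> v) * sqrt (det (metric_matrix \<Phi> v)))) \<in> borel_measurable borel"
    using R(2) unfolding S eq .
  have "(\<integral>y. indicator T y * g y \<partial>\<mu>) = (\<integral>y. indicator ?A y * g y \<partial>\<mu>)"
    by (intro Bochner_Integration.integral_cong) (auto simp: indicator_def riemannian_volume_sets(1)[OF rv])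
  then show "(\<integral>y. indicator T y * g y \<partial>\<mu>) =
      (\<integral>v. indicator {v \<in> ball 0 \<rho>. \<Phi> v \<in> T} v * (g (\<Phi> v) * sqrt (det (metric_matrix \<Phi> v))) \<partial>lborel)"
    using R(3) unfolding S eq by simp
qed

text \<open>The preimage of a chord ball lies between round balls whose radii differ from
  \<open>s\<close> by \<open>8 * C * s ^ 3\<close>. The bound \<open>s \<le> \<rho> / 16\<close>
  yields \<open>C * s \<le> 1/32\<close>, so this error is at most a quarter of
  \<open>s\<close>.\<close>

lemma chart_preimage_ball:
  fixes \<Phi> :: "real^'d \<Rightarrow> real^'m"
  assumes nc: "normal_chart M C \<rho> r0 \<Phi>" and s: "0 < s" "s \<le> \<rho> / 16"
  defines "S \<equiv> {v \<in> ball 0 \<rho>. \<Phi> v \<in> cball (\<Phi> 0) s}"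
  shows "8 * C * s ^ 3 \<le> s / 4" "S \<subseteq> cball 0 (s + 8 * C * s ^ 3)" "cball 0 (s - 8 * C * s ^ 3) \<subseteq> S"
proof -
  have C: "0 \<le> C" "2 * C * \<rho> \<le> 1" and \<rho>: "0 < \<rho>" "\<rho> \<le> 1" using nc by (auto simp: normal_chart_def)
  have s1: "s \<le> 1" using s \<rho> by simp
  have "C * s \<le> C * (\<rho> / 16)" using s C by (intro mult_left_mono) auto
  then have Cs: "C * s \<le> 1 / 32" using C by simp
  have "C * s * (s * s) \<le> 1/32 * (s * 1)" using Cs s s1 C by (intro mult_mono) auto
  then show 1: "8 * C * s ^ 3 \<le> s / 4" by (simp add: power3_eq_cube mult.assoc)
  show "S \<subseteq> cball 0 (s + 8 * C * s ^ 3)"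
  proof
    fix v assume v: "v \<in> S"
    then have v': "norm v < \<rho>" "norm (\<Phi> v - \<Phi> 0) \<le> s" by (auto simp: S_def dist_norm norm_minus_commute)
    have "8 * C * norm (\<Phi> v - \<Phi> 0) ^ 3 \<le> 8 * C * s ^ 3" using v' C by (intro mult_left_mono power_mono) auto
    then show "v \<in> cball 0 (s + 8 * C * s ^ 3)" using normal_chart_radius(4)[OF nc v'(1)] v'(2) by simp
  qed
  show "cball 0 (s - 8 * C * s ^ 3) \<subseteq> S"
  proof
    fix v :: "real^'d" assume "v \<in> cball 0 (s - 8 * C * s ^ 3)"
    then have n: "norm v \<le> s - 8 * C * s ^ 3" by simp
    have p: "0 \<le> C * s ^ 3" using C s by simp
    then have n': "norm v \<le> s" using n by simp
    then have v: "norm v < \<rho>" using s \<rho> by simp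
    have "C * norm v ^ 3 \<le> C * s ^ 3" using n' C by (intro mult_left_mono power_mono) auto
    moreover have "\<bar>norm (\<Phi> v - \<Phi> 0) - norm v\<bar> \<le> C * norm v ^ 3" using nc v by (auto simp: normal_chart_def)
    ultimately have "norm (\<Phi> v - \<Phi> 0) \<le> s" using n p by linarith
    then show "v \<in> S" using v by (auto simp: S_def dist_norm norm_minus_commute)
  qed
qed

text \<open>\<open>ball_integral_estimate\<close> with \<open>\<eta> = 8 * C * s ^ 3\<close>. The
  constant depends on the chart only through \<open>C\<close>, \<open>C'\<close> and the bound on
  \<open>p\<close>, so it is the same for all charts of a family.\<close>

lemma chart_bias:
  fixes p f :: "real^'m \<Rightarrow> real"
  assumes sm: "smooth_submanifold TYPE('d::finite) M" and rv: "riemannian_volume TYPE('d) M \<mu>"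
    and p: "Ck_manifold TYPE('d) 2 M p" and f: "Ck_manifold TYPE('d) 3 M f" and pb: "\<And>x. x \<in> M \<Longrightarrow> \<bar>p x\<bar> \<le> p_max"
    and C': "C' \<ge> 0"
  obtains K where "K \<ge> 0" "\<And>(\<Phi>::real^'d \<Rightarrow> real^'m) s. normal_chart M C \<rho> r0 \<Phi> \<Longrightarrow> chart_bounds C' \<rho> \<Phi> p f \<Longrightarrow> 0 < s \<Longrightarrow> s \<le> \<rho> / 16 \<Longrightarrow> s \<le> r0 \<Longrightarrow>
     \<bar>(\<integral>y. indicator (cball (\<Phi> 0) s) y * ((f y - f (\<Phi> 0)) * p y) \<partial>\<mu>) - s ^ (CARD('d) + 2) * limit_operator TYPE('d) M p f (\<Phi> 0)\<bar>
       \<le> K * s ^ (CARD('d) + 3)"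
proof (rule ball_integral_estimate[where 'd='d], goal_cases)
  case (1 Cd)
  note Cd = 1(2) and est = 1(3)
  define k where "k = 1 + \<bar>C\<bar> + C' + \<bar>p_max\<bar>"
  have k: "k \<ge> 1" "C \<le> k" "C' \<le> k" "p_max \<le> k" "k \<ge> 0" using C' by (auto simp: k_def)
  define K0 where "K0 = 15 * k ^ 3"
  define K where "K = K0 * Cd * (1 + 8 * \<bar>C\<bar>)"
  have kk: "k \<le> k * k" "k * k \<le> k ^ 3" using k by (auto simp: power3_eq_cube intro: mult_right_mono[of 1 k "k*k", simplified])
  have K0: "K0 \<ge> 0" "2 * (k * k) \<le> K0" "k \<le> K0"
    unfolding K0_def using k kk by linarith+
  show ?thesis
  proof (rule that[of K])
    show "K \<ge> 0" using K0 Cd by (simp add: K_def)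
    fix \<Phi> :: "real^'d \<Rightarrow> real^'m" and s
    assume nc: "normal_chart M C \<rho> r0 \<Phi>" and cb: "chart_bounds C' \<rho> \<Phi> p f" and s: "0 < s" "s \<le> \<rho> / 16" "s \<le> r0"
    have lp: "local_param M (ball 0 \<rho>) \<Phi>" and C: "0 \<le> C" and \<rho>: "0 < \<rho>" "\<rho> \<le> 1" using nc by (auto simp: normal_chart_def)
    have z: "0 \<in> ball (0::real^'d) \<rho>" using \<rho> by simp
    let ?F = "f \<circ> \<Phi>" let ?P = "p \<circ> \<Phi>"
    let ?l = "frechet_derivative ?F (at 0)" let ?\<pi> = "frechet_derivative ?P (at 0)" let ?H = "hess ?F 0"
    have cf: "Ck_on (Suc (Suc (Suc 0))) (ball 0 \<rho>) ?F" and cp: "Ck_on (Suc (Suc 0)) (ball 0 \<rho>) ?P"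
      using f p lp unfolding Ck_manifold_def numeral_2_eq_2 numeral_3_eq_3 by blast+
    have ll: "linear ?l" and l\<pi>: "linear ?\<pi>" using frechet_linear[OF cf z] frechet_linear[OF cp z] .
    interpret H: bounded_bilinear ?H using hess_bilinear[OF cf z] .
    define l where "l v = ?l v * p (\<Phi> 0)" for v
    \<comment> \<open>The second-order part of the increment of \<open>f\<close> times
      \<open>p\<close>: the Hessian of \<open>f\<close> against \<open>p\<close> at the centre, and
      the first derivatives of \<open>f\<close> and \<open>p\<close> against each other. Its trace
      is the limit operator up to \<open>limit_const\<close>.\<close>
    define B where "B s t = 1/2 * p (\<Phi> 0) * ?H s t + ?l s * ?\<pi> t" for s t
    define \<Psi> where "\<Psi> v = (f (\<Phi> v) - f (\<Phi> 0)) * p (\<Phi> v) * sqrt (det (metric_matrix \<Phi> v))" for v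
    let ?S = "{v \<in> ball 0 \<rho>. \<Phi> v \<in> cball (\<Phi> 0) s}"
    note S = chart_preimage_ball[OF nc s(1,2)]
    have mp: "p \<in> borel_measurable \<mu>" and mf: "f \<in> borel_measurable \<mu>"
      using riemannian_volume_sets(3)[OF rv Ck_manifold_continuous[OF sm]] p f by blast+
    have mg: "(\<lambda>y. (f y - f (\<Phi> 0)) * p y) \<in> borel_measurable \<mu>" using mp mf by measurable
    have T: "cball (\<Phi> 0) s \<in> sets borel" "cball (\<Phi> 0) s \<subseteq> cball (\<Phi> 0) r0" using s by auto
    note bi = ball_integral_chart[OF rv nc mg T]
    have \<Psi>eq: "(\<lambda>v. indicator ?S v * ((f (\<Phi> v) - f (\<Phi> 0)) * p (\<Phi> v) * sqrt (det (metric_matrix \<Phi> v)))) = (\<lambda>v. indicator ?S v * \<Psi> v)"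
      by (simp add: \<Psi>_def)
    have l_lin: "linear l" by (auto simp: l_def linear_iff linear_add[OF ll] linear_cmul[OF ll] algebra_simps)
    have B_bil: "bounded_bilinear B"
      unfolding bilinear_conv_bounded_bilinear[symmetric] bilinear_def B_def[abs_def] linear_iff
      by (simp add: linear_add[OF ll] linear_cmul[OF ll] linear_add[OF l\<pi>] linear_cmul[OF l\<pi>]
          H.add_left H.add_right H.scaleR_left H.scaleR_right algebra_simps)
    have pP: "\<bar>p (\<Phi> 0)\<bar> \<le> k" using pb[OF normal_chart_mono[OF nc]] k by linarith
    have lb: "\<bar>?l v\<bar> \<le> k * norm v" for v
      using cb k(3) mult_right_mono[of C' k "norm v"] unfolding chart_bounds_def by (meson norm_ge_zero order_trans)
    have \<pi>b: "\<bar>?\<pi> v\<bar> \<le> k * norm v" for v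
      using cb k(3) mult_right_mono[of C' k "norm v"] unfolding chart_bounds_def by (meson norm_ge_zero order_trans)
    have Hb: "\<bar>1/2 * ?H v v\<bar> \<le> k * norm v ^ 2" for v
    proof -
      have "\<bar>?H v v\<bar> \<le> C' * norm v * norm v" using cb unfolding chart_bounds_def by blast
      also have "\<dots> \<le> k * norm v ^ 2" unfolding power2_eq_square mult.assoc by (intro mult_right_mono k) auto
      finally show ?thesis by simp
    qed
    have "\<bar>(\<integral>v. indicator ?S v * \<Psi> v \<partial>lborel) - (\<Sum>i\<in>Basis. B i i) * limit_const TYPE('d) * s ^ (CARD('d) + 2)\<bar>
       \<le> K0 * Cd * (s ^ (CARD('d) + 3) + (8 * C * s ^ 3) * s ^ CARD('d))"
    proof (rule est[where B=B and l=l])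
      show "0 < s" "s \<le> 1" "0 \<le> 8 * C * s ^ 3" "8 * C * s ^ 3 \<le> s" using s \<rho> C S(1) by auto
      show "?S \<in> sets borel" by (rule bi(1))
      show "(\<lambda>v. indicator ?S v * \<Psi> v) \<in> borel_measurable borel" using bi(2) unfolding \<Psi>eq .
      show "\<bar>l v\<bar> \<le> K0 * norm v" for v
      proof -
        have "\<bar>l v\<bar> \<le> (k * norm v) * k" unfolding l_def abs_mult by (intro mult_mono lb pP) (use k in auto)
        also have "\<dots> = (k * k) * norm v" by simp
        also have "\<dots> \<le> K0 * norm v"
        proof (rule mult_right_mono)
          show "k * k \<le> K0" using K0(2) kk(1) k(5) by linarith
        qed simp
        finally show ?thesis .
      qed
      show "\<bar>B v v\<bar> \<le> K0 * norm v ^ 2" for v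
      proof -
        have "\<bar>B v v\<bar> \<le> \<bar>p (\<Phi> 0)\<bar> * \<bar>1/2 * ?H v v\<bar> + \<bar>?l v\<bar> * \<bar>?\<pi> v\<bar>"
          unfolding B_def by (rule order_trans[OF abs_triangle_ineq]) (simp add: abs_mult)
        also have "\<dots> \<le> k * (k * norm v ^ 2) + (k * norm v) * (k * norm v)"
          by (intro add_mono mult_mono pP Hb lb \<pi>b) (use k in auto)
        also have "\<dots> = 2 * (k * k) * norm v ^ 2" by (simp add: power2_eq_square)
        also have "\<dots> \<le> K0 * norm v ^ 2" by (intro mult_right_mono K0) auto
        finally show ?thesis .
      qed
      show "\<bar>\<Psi> v - l v - B v v\<bar> \<le> K0 * norm v ^ 3" if "v \<in> ?S" for v
      proof -
        have v: "norm v < \<rho>" using that by simp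
        have le3: "C' * norm v ^ 2 \<le> k * norm v ^ 2" "C' * norm v ^ 3 \<le> k * norm v ^ 3" "C * norm v ^ 2 \<le> k * norm v ^ 2"
          by (intro mult_right_mono k; simp)+
        have "\<bar>(f (\<Phi> v) - f (\<Phi> 0)) * p (\<Phi> v) * sqrt (det (metric_matrix \<Phi> v)) - ?l v * p (\<Phi> 0) - ((1/2 * ?H v v) * p (\<Phi> 0) + ?l v * ?\<pi> v)\<bar> \<le> 15 * k ^ 3 * norm v ^ 3"
        proof (rule product_expansion)
          show "norm v \<le> 1" using v \<rho> by simp
          have "\<bar>f (\<Phi> v) - f (\<Phi> 0) - ?l v - 1/2 * ?H v v\<bar> \<le> C' * norm v ^ 3" using cb v unfolding chart_bounds_def by blast
          then show "\<bar>f (\<Phi> v) - f (\<Phi> 0) - ?l v - 1/2 * ?H v v\<bar> \<le> k * norm v ^ 3" using le3 by linarith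
          have "\<bar>p (\<Phi> v) - p (\<Phi> 0) - ?\<pi> v\<bar> \<le> C' * norm v ^ 2" using cb v unfolding chart_bounds_def by blast
          then show "\<bar>p (\<Phi> v) - p (\<Phi> 0) - ?\<pi> v\<bar> \<le> k * norm v ^ 2" using le3 by linarith
          have "\<bar>sqrt (det (metric_matrix \<Phi> v)) - 1\<bar> \<le> C * norm v ^ 2" using nc v by (auto simp: normal_chart_def)
          then show "\<bar>sqrt (det (metric_matrix \<Phi> v)) - 1\<bar> \<le> k * norm v ^ 2" using le3 by linarith
        qed (use lb \<pi>b Hb pP k in auto)
        then show ?thesis by (simp add: \<Psi>_def l_def B_def K0_def algebra_simps)
      qed
    qed (use S l_lin B_bil K0 in auto)
    also have "K0 * Cd * (s ^ (CARD('d) + 3) + (8 * C * s ^ 3) * s ^ CARD('d)) = K * s ^ (CARD('d) + 3)"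
      using C by (simp add: K_def power_add algebra_simps)
    also have "(\<integral>v. indicator ?S v * \<Psi> v \<partial>lborel) = (\<integral>y. indicator (cball (\<Phi> 0) s) y * ((f y - f (\<Phi> 0)) * p y) \<partial>\<mu>)"
      unfolding bi(3) \<Psi>eq ..
    also have "(\<Sum>i\<in>Basis. B i i) * limit_const TYPE('d) * s ^ (CARD('d) + 2) = s ^ (CARD('d) + 2) * limit_operator TYPE('d) M p f (\<Phi> 0)"
      unfolding chart_limit_operator[OF nc p f] B_def by simp
    finally show "\<bar>(\<integral>y. indicator (cball (\<Phi> 0) s) y * ((f y - f (\<Phi> 0)) * p y) \<partial>\<mu>) - s ^ (CARD('d) + 2) * limit_operator TYPE('d) M p f (\<Phi> 0)\<bar>
       \<le> K * s ^ (CARD('d) + 3)" .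
  qed
qed

text \<open>Turns the expansion of \<open>f\<close> in the chart into a polynomial in the ambient
  increment \<open>y - x\<close>, whose coordinates are test functions independent of
  \<open>f\<close> and of any chart. This is possible because the adjoint of
  \<open>D\<Phi>(0)\<close> recovers \<open>v\<close> from \<open>y - x\<close> up to a cubic error
  \<open>e\<close>.\<close>

lemma chart_taylor:
  fixes p f :: "real^'m \<Rightarrow> real"
  assumes f: "Ck_manifold TYPE('d::finite) 3 M f" and C': "C' \<ge> 0"
  obtains K where "K \<ge> 0" "\<And>(\<Phi>::real^'d \<Rightarrow> real^'m). normal_chart M C \<rho> r0 \<Phi> \<Longrightarrow> chart_bounds C' \<rho> \<Phi> p f \<Longrightarrow>
    \<exists>\<alpha> \<beta>. linear \<alpha> \<and> bounded_bilinear \<beta> \<and> (\<forall>z. \<bar>\<alpha> z\<bar> \<le> K * norm z) \<and> (\<forall>y z. \<bar>\<beta> y z\<bar> \<le> K * norm y * norm z) \<and>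
      (\<forall>y\<in>M. dist y (\<Phi> 0) \<le> r0 \<and> dist y (\<Phi> 0) \<le> 1 \<longrightarrow> \<bar>f y - f (\<Phi> 0) - \<alpha> (y - \<Phi> 0) - \<beta> (y - \<Phi> 0) (y - \<Phi> 0)\<bar> \<le> K * norm (y - \<Phi> 0) ^ 3)"
proof -
  define K where "K = C' * 8 + C' * (8 * \<bar>C\<bar>) + C' * (8 * \<bar>C\<bar>) * 3 + C'"
  have K: "K \<ge> 0" "C' \<le> K" using C' by (auto simp: K_def)
  show ?thesis
  proof (rule that[OF K(1)])
    fix \<Phi> :: "real^'d \<Rightarrow> real^'m" assume nc: "normal_chart M C \<rho> r0 \<Phi>" and cb: "chart_bounds C' \<rho> \<Phi> p f"
    have lp: "local_param M (ball 0 \<rho>) \<Phi>" and cov: "M \<inter> cball (\<Phi> 0) r0 \<subseteq> \<Phi> ` ball 0 \<rho>" and C: "0 \<le> C" and \<rho>: "0 < \<rho>" "\<rho> \<le> 1"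
      using nc by (auto simp: normal_chart_def)
    have z: "0 \<in> ball (0::real^'d) \<rho>" using \<rho> by simp
    let ?F = "f \<circ> \<Phi>" let ?l = "frechet_derivative ?F (at 0)" let ?H = "hess ?F 0"
    let ?A = "adjoint (frechet_derivative \<Phi> (at 0))"
    have iso: "\<And>s. norm (frechet_derivative \<Phi> (at 0) s) = norm s" using nc by (simp add: normal_chart_def)
    note ad = adjoint_isometry[OF local_paramD(6)[OF lp z] iso]
    have cf: "Ck_on (Suc (Suc (Suc 0))) (ball 0 \<rho>) ?F"
      using f lp unfolding Ck_manifold_def numeral_3_eq_3 by blast
    have ll: "linear ?l" using frechet_linear[OF cf z] .
    interpret H: bounded_bilinear ?H using hess_bilinear[OF cf z] .
    define \<alpha> where "\<alpha> z = ?l (?A z)" for z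
    define \<beta> where "\<beta> y z = 1/2 * ?H (?A y) (?A z)" for y z
    have lb: "\<bar>?l v\<bar> \<le> C' * norm v" and Hb: "\<bar>?H v w\<bar> \<le> C' * norm v * norm w" for v w
      using cb unfolding chart_bounds_def by blast+
    have a1: "linear \<alpha>" using linear_compose[OF ad(4) ll] by (simp add: \<alpha>_def[abs_def] o_def)
    have b1: "bounded_bilinear \<beta>"
      unfolding bilinear_conv_bounded_bilinear[symmetric] bilinear_def \<beta>_def[abs_def] linear_iff
      by (simp add: linear_add[OF ad(4)] linear_cmul[OF ad(4)] H.add_left H.add_right H.scaleR_left H.scaleR_right algebra_simps)
    have a2: "\<bar>\<alpha> z\<bar> \<le> K * norm z" for z
    proof -
      have "\<bar>\<alpha> z\<bar> \<le> C' * norm (?A z)" unfolding \<alpha>_def by (rule lb)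
      also have "\<dots> \<le> K * norm z" using ad(2) K C' by (intro mult_mono) auto
      finally show ?thesis .
    qed
    have b2: "\<bar>\<beta> y z\<bar> \<le> K * norm y * norm z" for y z
    proof -
      have "\<bar>\<beta> y z\<bar> \<le> \<bar>?H (?A y) (?A z)\<bar>" unfolding \<beta>_def by simp
      also have "\<dots> \<le> C' * norm (?A y) * norm (?A z)" by (rule Hb)
      also have "\<dots> \<le> K * norm y * norm z" using ad(2) K C' by (intro mult_mono) auto
      finally show ?thesis .
    qed
    have c: "\<bar>f y - f (\<Phi> 0) - \<alpha> (y - \<Phi> 0) - \<beta> (y - \<Phi> 0) (y - \<Phi> 0)\<bar> \<le> K * norm (y - \<Phi> 0) ^ 3"
      if y: "y \<in> M" "dist y (\<Phi> 0) \<le> r0" "dist y (\<Phi> 0) \<le> 1" for y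
    proof -
      have "y \<in> M \<inter> cball (\<Phi> 0) r0" using y by (simp add: dist_commute)
      then obtain v where v: "norm v < \<rho>" "y = \<Phi> v" using cov by auto
      define n where "n = norm (y - \<Phi> 0)"
      have n: "0 \<le> n" "n \<le> 1" using y by (auto simp: n_def dist_norm)
      have v2: "norm v \<le> 2 * n" using normal_chart_radius(3)[OF nc v(1)] v by (simp add: n_def)
      define e where "e = ?A (y - \<Phi> 0) - v"
      have vc: "norm v ^ 3 \<le> 8 * n ^ 3" using power_mono[OF v2, of 3] by (simp add: power_mult_distrib)
      have "norm e \<le> C * norm v ^ 3" using nc v by (auto simp: normal_chart_def e_def)
      also have "\<dots> \<le> C * (8 * n ^ 3)" using vc C by (intro mult_left_mono) auto
      finally have ne: "norm e \<le> 8 * C * n ^ 3" by simp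
      have nA: "norm (?A (y - \<Phi> 0)) \<le> n" unfolding n_def by (rule ad(2))
      have Ae: "?A (y - \<Phi> 0) = v + e" by (simp add: e_def)
      have t1: "\<bar>f y - f (\<Phi> 0) - ?l v - 1/2 * ?H v v\<bar> \<le> C' * 8 * n ^ 3"
      proof -
        have "\<bar>f y - f (\<Phi> 0) - ?l v - 1/2 * ?H v v\<bar> \<le> C' * norm v ^ 3" using cb v unfolding chart_bounds_def by blast
        also have "\<dots> \<le> C' * (8 * n ^ 3)" using vc C' by (intro mult_left_mono) auto
        finally show ?thesis by simp
      qed
      have t2: "\<bar>?l e\<bar> \<le> C' * (8 * \<bar>C\<bar>) * n ^ 3"
      proof -
        have "\<bar>?l e\<bar> \<le> C' * norm e" by (rule lb)
        also have "\<dots> \<le> C' * (8 * C * n ^ 3)" using ne C' by (intro mult_left_mono) auto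
        finally show ?thesis using C by simp
      qed
      \<comment> \<open>Replacing \<open>v\<close> by \<open>v + e\<close> in both slots of the
        quadratic form produces exactly these two terms, each with a factor \<open>e\<close> of
        third order.\<close>
      have t3: "\<bar>?H v e + ?H e (?A (y - \<Phi> 0))\<bar> \<le> C' * (8 * \<bar>C\<bar>) * 3 * n ^ 3"
      proof -
        have "\<bar>?H v e + ?H e (?A (y - \<Phi> 0))\<bar> \<le> C' * norm v * norm e + C' * norm e * norm (?A (y - \<Phi> 0))"
          using Hb[of v e] Hb[of e "?A (y - \<Phi> 0)"] by linarith
        also have "\<dots> \<le> C' * 2 * (8 * C * n ^ 3) + C' * (8 * C * n ^ 3) * 1"
          using v2 n ne nA C' C by (intro add_mono mult_mono mult_left_mono) auto
        finally show ?thesis using C by (simp add: ac_simps)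
      qed
      have tri: "\<bar>a - b - 1/2 * c\<bar> \<le> A + B + D" if "\<bar>a\<bar> \<le> A" "\<bar>b\<bar> \<le> B" "\<bar>c\<bar> \<le> D" for a b c A B D :: real
        using that by linarith
      have "f y - f (\<Phi> 0) - \<alpha> (y - \<Phi> 0) - \<beta> (y - \<Phi> 0) (y - \<Phi> 0) =
        (f y - f (\<Phi> 0) - ?l v - 1/2 * ?H v v) - ?l e - 1/2 * (?H v e + ?H e (?A (y - \<Phi> 0)))"
        unfolding \<alpha>_def \<beta>_def Ae linear_add[OF ll] H.add_left H.add_right by (simp add: algebra_simps)
      then have "\<bar>f y - f (\<Phi> 0) - \<alpha> (y - \<Phi> 0) - \<beta> (y - \<Phi> 0) (y - \<Phi> 0)\<bar> \<le> C' * 8 * n ^ 3 + C' * (8 * \<bar>C\<bar>) * n ^ 3 + C' * (8 * \<bar>C\<bar>) * 3 * n ^ 3"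
        using tri[OF t1 t2 t3] by simp
      also have "\<dots> \<le> K * n ^ 3" using C' n by (simp add: K_def algebra_simps)
      finally show ?thesis by (simp add: n_def)
    qed
    show "\<exists>\<alpha> \<beta>. linear \<alpha> \<and> bounded_bilinear \<beta> \<and> (\<forall>z. \<bar>\<alpha> z\<bar> \<le> K * norm z) \<and> (\<forall>y z. \<bar>\<beta> y z\<bar> \<le> K * norm y * norm z) \<and>
      (\<forall>y\<in>M. dist y (\<Phi> 0) \<le> r0 \<and> dist y (\<Phi> 0) \<le> 1 \<longrightarrow> \<bar>f y - f (\<Phi> 0) - \<alpha> (y - \<Phi> 0) - \<beta> (y - \<Phi> 0) (y - \<Phi> 0)\<bar> \<le> K * norm (y - \<Phi> 0) ^ 3)"
      using a1 a2 b1 b2 c by blast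
  qed
qed

section \<open>Uniform expansions on compact submanifolds\<close>

lemma chart_mass_bounds:
  fixes \<Phi> :: "real^'d \<Rightarrow> real^'m" and p :: "real^'m \<Rightarrow> real"
  assumes rv: "riemannian_volume TYPE('d) M \<mu>" and nc: "normal_chart M C \<rho> r0 \<Phi>"
    and mp: "p \<in> borel_measurable \<mu>" and pb: "\<And>x. x \<in> M \<Longrightarrow> p_min \<le> p x \<and> p x \<le> p_max" and pm: "0 < p_min"
    and T: "T \<in> sets borel" "T \<subseteq> cball (\<Phi> 0) r0" and B: "B \<in> sets borel" "emeasure lborel B < \<infinity>"
  shows "{v \<in> ball 0 \<rho>. \<Phi> v \<in> T} \<subseteq> B \<Longrightarrow> (\<integral>y. indicator T y * p y \<partial>\<mu>) \<le> 2 * p_max * measure lborel B"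
    "B \<subseteq> {v \<in> ball 0 \<rho>. \<Phi> v \<in> T} \<Longrightarrow> p_min / 2 * measure lborel B \<le> (\<integral>y. indicator T y * p y \<partial>\<mu>)"
proof -
  let ?S = "{v \<in> ball 0 \<rho>. \<Phi> v \<in> T}"
  let ?\<Psi> = "\<lambda>v. p (\<Phi> v) * sqrt (det (metric_matrix \<Phi> v))"
  note bi = ball_integral_chart[OF rv nc mp T]
  have b: "p_min / 2 \<le> ?\<Psi> v" "?\<Psi> v \<le> 2 * p_max" if "v \<in> ?S" for v
  proof -
    have v: "norm v < \<rho>" using that by simp
    have P: "p_min \<le> p (\<Phi> v)" "p (\<Phi> v) \<le> p_max" using pb[OF normal_chart_radius(1)[OF nc v]] by auto
    note w = normal_chart_radius(6,7)[OF nc v]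
    have "p_min * (1/2) \<le> ?\<Psi> v" by (rule mult_mono) (use P w pm in linarith)+
    then show "p_min / 2 \<le> ?\<Psi> v" by simp
    have "?\<Psi> v \<le> p_max * 2" by (rule mult_mono) (use P w pm in linarith)+
    then show "?\<Psi> v \<le> 2 * p_max" by simp
  qed
  have fb: "emeasure lborel (ball (0::real^'d) \<rho>) < \<infinity>"
    using nc by (simp add: emeasure_ball normal_chart_def)
  have iS: "integrable lborel (\<lambda>v. indicator ?S v * ?\<Psi> v)"
  proof (rule Bochner_Integration.integrable_bound)
    show "integrable lborel (\<lambda>v. 2 * p_max * indicator (ball (0::real^'d) \<rho>) v)"
      by (intro integrable_mult_right integrable_real_indicator fb) auto
    show "(\<lambda>v. indicator ?S v * ?\<Psi> v) \<in> borel_measurable lborel" using bi(2) by simp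
    show "AE v in lborel. norm (indicator ?S v * ?\<Psi> v) \<le> norm (2 * p_max * indicator (ball (0::real^'d) \<rho>) v)"
    proof (rule AE_I2)
      fix v :: "real^'d"
      show "norm (indicator ?S v * ?\<Psi> v) \<le> norm (2 * p_max * indicator (ball (0::real^'d) \<rho>) v)"
      proof (cases "v \<in> ?S")
        case True
        then show ?thesis using b[OF True] pm by (simp del: mem_Collect_eq add: indicator_def) auto
      next
        case False
        then have "indicator ?S v = (0::real)" by (simp add: indicator_def)
        then show ?thesis by simp
      qed
    qed
  qed
  have iB: "integrable lborel (\<lambda>v. c * indicator B v)" for c :: real
    by (intro integrable_mult_right integrable_real_indicator) (use B in auto)
  have iBv: "(\<integral>v. c * indicator B v \<partial>lborel) = c * measure lborel B" for c :: real using B by simp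
  have pmx: "0 < p_max" using pb[OF normal_chart_mono[OF nc]] pm by linarith
  { assume sub: "?S \<subseteq> B"
    have "(\<integral>v. indicator ?S v * ?\<Psi> v \<partial>lborel) \<le> (\<integral>v. (2 * p_max) * indicator B v \<partial>lborel)"
    proof (rule integral_mono[OF iS iB])
      fix v :: "real^'d"
      show "indicator ?S v * ?\<Psi> v \<le> (2 * p_max) * indicator B v"
        using b(2)[of v] sub pmx by (cases "v \<in> ?S") (auto simp: indicator_def)
    qed
    then show "(\<integral>y. indicator T y * p y \<partial>\<mu>) \<le> 2 * p_max * measure lborel B" unfolding bi(3) iBv . }
  { assume sub: "B \<subseteq> ?S"
    have "(\<integral>v. (p_min / 2) * indicator B v \<partial>lborel) \<le> (\<integral>v. indicator ?S v * ?\<Psi> v \<partial>lborel)"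
    proof (rule integral_mono[OF iB iS])
      fix v :: "real^'d"
      show "(p_min / 2) * indicator B v \<le> indicator ?S v * ?\<Psi> v"
        using b(1)[of v] sub pm by (cases "v \<in> ?S") (auto simp: indicator_def)
    qed
    then show "p_min / 2 * measure lborel B \<le> (\<integral>y. indicator T y * p y \<partial>\<mu>)" unfolding bi(3) iBv . }
qed

text \<open>Regularity of ball masses together with a bound on thin shells. The summand
  \<open>s ^ (d + 2)\<close> accounts for charts distorting radii by \<open>O(s^3)\<close>: even a
  shell of zero thickness is only known to lie in one of thickness \<open>O(s^3)\<close> in the
  chart.\<close>

definition mass_bounds :: "(real^'m) measure \<Rightarrow> (real^'m \<Rightarrow> real) \<Rightarrow> nat \<Rightarrow> real \<Rightarrow> real \<Rightarrow> real^'m \<Rightarrow> bool" where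
  "mass_bounds \<mu> p d K r x \<longleftrightarrow> (\<forall>s. 0 < s \<and> s \<le> r \<longrightarrow>
     (\<integral>y. indicator (cball x s) y * p y \<partial>\<mu>) \<le> K * s ^ d \<and>
     s ^ d \<le> K * (\<integral>y. indicator (cball x s) y * p y \<partial>\<mu>) \<and>
     (\<forall>\<eta>. 0 \<le> \<eta> \<and> \<eta> \<le> s / 2 \<longrightarrow>
        (\<integral>y. indicator {y. \<bar>dist y x - s\<bar> \<le> \<eta>} y * p y \<partial>\<mu>) \<le> K * (s ^ (d - 1) * \<eta> + s ^ (d + 2))))"

lemma chart_mass:
  fixes p :: "real^'m \<Rightarrow> real"
  assumes rv: "riemannian_volume TYPE('d::finite) M \<mu>"
    and mp: "p \<in> borel_measurable \<mu>" and pb: "\<And>x. x \<in> M \<Longrightarrow> p_min \<le> p x \<and> p x \<le> p_max" and pm: "0 < p_min"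
  obtains K where "\<And>\<Phi>::real^'d \<Rightarrow> real^'m. normal_chart M C \<rho> r0 \<Phi> \<Longrightarrow> mass_bounds \<mu> p CARD('d) K (min (\<rho> / 16) (r0 / 2)) (\<Phi> 0)"
proof -
  let ?d = "CARD('d)" let ?w = "unit_ball_vol (real ?d)"
  have w: "?w > 0" by simp
  define c1 where "c1 = 2 * \<bar>p_max\<bar> * ?w * 2 ^ ?d"
  define c2 where "c2 = 2 * 2 ^ ?d / (p_min * ?w)"
  define c3 where "c3 = 2 * \<bar>p_max\<bar> * (?w * real ?d * 2 ^ ?d) * (1 + 64 * \<bar>C\<bar>)"
  define K where "K = c1 + c2 + c3"
  have c: "c1 \<ge> 0" "c2 > 0" "c3 \<ge> 0" using w pm by (auto simp: c1_def c2_def c3_def)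
  then have K: "c1 \<le> K" "c2 \<le> K" "c3 \<le> K" by (auto simp: K_def)
  have "mass_bounds \<mu> p ?d K (min (\<rho> / 16) (r0 / 2)) (\<Phi> 0)" if nc: "normal_chart M C \<rho> r0 \<Phi>" for \<Phi> :: "real^'d \<Rightarrow> real^'m"
    unfolding mass_bounds_def
  proof (intro allI impI conjI)
    fix s :: real assume "0 < s \<and> s \<le> min (\<rho> / 16) (r0 / 2)"
    then have s: "0 < s" "s \<le> \<rho> / 16" "2 * s \<le> r0" by auto
    have C: "0 \<le> C" "2 * C * \<rho> \<le> 1" and \<rho>: "0 < \<rho>" "\<rho> \<le> 1" using nc by (auto simp: normal_chart_def)
    have pmx: "0 < p_max" using pb[OF normal_chart_mono[OF nc]] pm by linarith
    let ?I = "(\<integral>y. indicator (cball (\<Phi> 0) s) y * p y \<partial>\<mu>)"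
    note S = chart_preimage_ball[OF nc s(1,2)]
    have C3: "0 \<le> 8 * C * s ^ 3" using C s by simp
    have T: "cball (\<Phi> 0) s \<in> sets borel" "cball (\<Phi> 0) s \<subseteq> cball (\<Phi> 0) r0" using s by auto
    have "?I \<le> 2 * p_max * measure lborel (cball (0::real^'d) (2 * s))"
    proof (rule chart_mass_bounds(1)[OF rv nc mp pb pm T])
      show "emeasure lborel (cball (0::real^'d) (2 * s)) < \<infinity>" using s by (simp add: emeasure_cball)
      have "cball (0::real^'d) (s + 8 * C * s ^ 3) \<subseteq> cball 0 (2 * s)" using S(1) s by (simp add: subset_cball)
      then show "{v \<in> ball 0 \<rho>. \<Phi> v \<in> cball (\<Phi> 0) s} \<subseteq> cball 0 (2 * s)" using S(2) by (rule order_trans[rotated])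
    qed auto
    also have "\<dots> = c1 * s ^ ?d" using s pmx by (simp add: content_cball c1_def power_mult_distrib)
    also have "\<dots> \<le> K * s ^ ?d" using s by (intro mult_right_mono K) auto
    finally show "?I \<le> K * s ^ ?d" .
    have low: "p_min / 2 * measure lborel (cball (0::real^'d) (s / 2)) \<le> ?I"
    proof (rule chart_mass_bounds(2)[OF rv nc mp pb pm T])
      show "emeasure lborel (cball (0::real^'d) (s / 2)) < \<infinity>" using s by (simp add: emeasure_cball)
      have "cball (0::real^'d) (s / 2) \<subseteq> cball 0 (s - 8 * C * s ^ 3)" using S(1) s by (simp add: subset_cball)
      then show "cball 0 (s / 2) \<subseteq> {v \<in> ball 0 \<rho>. \<Phi> v \<in> cball (\<Phi> 0) s}" using S(3) by (rule order_trans)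
    qed auto
    have "s ^ ?d = c2 * (p_min / 2 * measure lborel (cball (0::real^'d) (s / 2)))"
    proof -
      have "?w \<noteq> 0" using w by linarith
      then show ?thesis using s pm by (simp add: content_cball c2_def power_divide)
    qed
    also have "\<dots> \<le> c2 * ?I" using low c by (intro mult_left_mono) auto
    also have "\<dots> \<le> K * ?I"
    proof (intro mult_right_mono K)
      have "0 \<le> p_min / 2 * measure lborel (cball (0::real^'d) (s / 2))" using pm by simp
      then show "0 \<le> ?I" using low by linarith
    qed
    finally show "s ^ ?d \<le> K * ?I" .
    fix \<eta> :: real assume \<eta>: "0 \<le> \<eta> \<and> \<eta> \<le> s / 2"
    let ?T = "{y. \<bar>dist y (\<Phi> 0) - s\<bar> \<le> \<eta>}"
    have "?T = cball (\<Phi> 0) (s + \<eta>) - ball (\<Phi> 0) (s - \<eta>)" by (auto simp: dist_commute)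
    then have T: "?T \<in> sets borel" "?T \<subseteq> cball (\<Phi> 0) r0" using s \<eta> by (auto simp: dist_commute)
    \<comment> \<open>Chord and chart radius differ by at most \<open>8 * C\<close> times the cube
      of the chord, and points of the shell have chord at most \<open>2 * s\<close>; hence
      \<open>8 * 8 = 64\<close>.\<close>
    define \<eta>' where "\<eta>' = \<eta> + 64 * C * s ^ 3"
    have Cs: "64 * C * s ^ 3 \<le> s / 8"
    proof -
      have "C * s \<le> C * (\<rho> / 16)" using s C by (intro mult_left_mono) auto
      then have Cs: "C * s \<le> 1 / 32" using C by simp
      have "C * s * (s * s) \<le> 1/32 * (s * (1/16))" using Cs s \<rho> C by (intro mult_mono) auto
      then show ?thesis by (simp add: power3_eq_cube mult.assoc)
    qed
    have \<eta>': "0 \<le> \<eta>'" "\<eta>' \<le> s" using \<eta> Cs s C by (auto simp: \<eta>'_def)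
    let ?B = "cball (0::real^'d) (s + \<eta>') - ball 0 (s - \<eta>')"
    have "(\<integral>y. indicator ?T y * p y \<partial>\<mu>) \<le> 2 * p_max * measure lborel ?B"
    proof (rule chart_mass_bounds(1)[OF rv nc mp pb pm T])
      show "emeasure lborel ?B < \<infinity>"
        by (rule le_less_trans[OF emeasure_mono[of _ "cball 0 (s + \<eta>')"]]) (use s \<eta>' in \<open>auto simp: emeasure_cball\<close>)
      show "{v \<in> ball 0 \<rho>. \<Phi> v \<in> ?T} \<subseteq> ?B"
      proof
        fix v assume "v \<in> {v \<in> ball 0 \<rho>. \<Phi> v \<in> ?T}"
        then have v: "norm v < \<rho>" "\<bar>norm (\<Phi> v - \<Phi> 0) - s\<bar> \<le> \<eta>" by (auto simp: dist_norm)
        then have "norm (\<Phi> v - \<Phi> 0) \<le> 2 * s" using \<eta> by linarith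
        then have "8 * C * norm (\<Phi> v - \<Phi> 0) ^ 3 \<le> 8 * C * (2 * s) ^ 3" using C by (intro mult_left_mono power_mono) auto
        then have "\<bar>norm (\<Phi> v - \<Phi> 0) - norm v\<bar> \<le> 64 * C * s ^ 3" using normal_chart_radius(4)[OF nc v(1)] by (simp add: power_mult_distrib)
        then show "v \<in> ?B" using v(2) by (auto simp: \<eta>'_def)
      qed
    qed auto
    also have "\<dots> \<le> 2 * p_max * (?w * real ?d * 2 ^ ?d * \<eta>' * s ^ (?d - 1))"
      using measure_annulus[OF \<eta>', where 'a="real^'d"] pmx by (intro mult_left_mono) auto
    also have "\<dots> \<le> 2 * p_max * (?w * real ?d * 2 ^ ?d * ((1 + 64 * C) * (\<eta> + s ^ 3)) * s ^ (?d - 1))"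
    proof -
      have "\<eta>' \<le> (1 + 64 * C) * (\<eta> + s ^ 3)" using C s \<eta> by (simp add: \<eta>'_def algebra_simps)
      then show ?thesis using pmx w s by (intro mult_left_mono mult_right_mono) auto
    qed
    also have "\<dots> = c3 * (s ^ (?d - 1) * \<eta> + s ^ (?d - 1) * s ^ 3)" using pmx C by (simp add: c3_def algebra_simps)
    also have "s ^ (?d - 1) * s ^ 3 = s ^ (?d + 2)"
      using zero_less_card_finite[where 'a='d] by (simp flip: power_add)
    also have "c3 * (s ^ (?d - 1) * \<eta> + s ^ (?d + 2)) \<le> K * (s ^ (?d - 1) * \<eta> + s ^ (?d + 2))"
      using s \<eta> by (intro mult_right_mono K) auto
    finally show "(\<integral>y. indicator ?T y * p y \<partial>\<mu>) \<le> K * (s ^ (?d - 1) * \<eta> + s ^ (?d + 2))" .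
  qed
  then show ?thesis using that by blast
qed

text \<open>A finite subcover, with the largest constant and the smallest radius. The property has
  to be preserved when the constant grows and the radius shrinks.\<close>

lemma compact_uniform:
  fixes P :: "real \<Rightarrow> real \<Rightarrow> 'a::metric_space \<Rightarrow> bool"
  assumes M: "compact M"
    and loc: "\<And>x0. x0 \<in> M \<Longrightarrow> \<exists>W C r. open W \<and> x0 \<in> W \<and> 0 < r \<and> (\<forall>x\<in>M \<inter> W. P C r x)"
    and mono: "\<And>C C' r r' x. P C r x \<Longrightarrow> C \<le> C' \<Longrightarrow> 0 < r' \<Longrightarrow> r' \<le> r \<Longrightarrow> P C' r' x"
  obtains C r where "0 < C" "0 < r" "r \<le> 1" "\<And>x. x \<in> M \<Longrightarrow> P C r x"
proof -
  have "\<forall>x0\<in>M. \<exists>W C r. open W \<and> x0 \<in> W \<and> 0 < r \<and> (\<forall>x\<in>M \<inter> W. P C r x)" using loc by blast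
  then obtain W C r where W: "\<And>x0. x0 \<in> M \<Longrightarrow> open (W x0) \<and> x0 \<in> W x0 \<and> 0 < r x0 \<and> (\<forall>x\<in>M \<inter> W x0. P (C x0) (r x0) x)"
    by metis
  have "M \<subseteq> (\<Union>x0\<in>M. W x0)" using W by blast
  then obtain F where F: "F \<subseteq> M" "finite F" "M \<subseteq> (\<Union>x0\<in>F. W x0)"
    using compactE_image[OF M, of M W] W by blast
  define C' where "C' = Max (insert 1 (C ` F))" 
  define r' where "r' = Min (insert 1 (r ` F))"
  have C': "1 \<le> C'" "\<And>x0. x0 \<in> F \<Longrightarrow> C x0 \<le> C'" using F by (auto simp: C'_def)
  have r': "0 < r'" "r' \<le> 1" "\<And>x0. x0 \<in> F \<Longrightarrow> r' \<le> r x0" using F W by (auto simp: r'_def)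
  have "P C' r' x" if x: "x \<in> M" for x
  proof -
    obtain x0 where "x0 \<in> F" "x \<in> W x0" using F x by blast
    then show ?thesis using mono[of "C x0" "r x0" x C' r'] W[of x0] F C' r' x by blast
  qed
  then show ?thesis using that[of C' r'] C' r' by auto
qed

text \<open>The first clause is the bias, the second the ambient Taylor expansion. The coefficients
  may vary with \<open>x\<close> in any manner; only their size is uniform, which suffices since the
  tests do not involve them.\<close>

definition local_expansion :: "(real^'m) set \<Rightarrow> (real^'m) measure \<Rightarrow> (real^'m \<Rightarrow> real) \<Rightarrow> (real^'m \<Rightarrow> real) \<Rightarrow> nat \<Rightarrow> (real^'m \<Rightarrow> real) \<Rightarrow> real \<Rightarrow> real \<Rightarrow> real^'m \<Rightarrow> bool" where
  "local_expansion M \<mu> p f d A K r x \<longleftrightarrow>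
    (\<forall>s. 0 < s \<and> s \<le> r \<longrightarrow> \<bar>(\<integral>y. indicator (cball x s) y * ((f y - f x) * p y) \<partial>\<mu>) - s ^ (d + 2) * A x\<bar> \<le> K * s ^ (d + 3)) \<and>
    (\<exists>\<alpha> \<beta>. linear \<alpha> \<and> bounded_bilinear \<beta> \<and> (\<forall>z. \<bar>\<alpha> z\<bar> \<le> K * norm z) \<and> (\<forall>y z. \<bar>\<beta> y z\<bar> \<le> K * norm y * norm z) \<and>
      (\<forall>y\<in>M. dist y x \<le> r \<longrightarrow> \<bar>f y - f x - \<alpha> (y - x) - \<beta> (y - x) (y - x)\<bar> \<le> K * norm (y - x) ^ 3))"

lemma uniform_mass_bounds:
  fixes p :: "real^'m \<Rightarrow> real"
  assumes M: "compact M" and sm: "smooth_submanifold TYPE('d::finite) M" and rv: "riemannian_volume TYPE('d) M \<mu>"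
    and p: "Ck_manifold TYPE('d) 2 M p" and pm: "0 < p_min" and pb: "\<forall>x\<in>M. p_min \<le> p x \<and> p x \<le> p_max"
  obtains K r where "0 < K" "0 < r" "r \<le> 1" "\<And>x. x \<in> M \<Longrightarrow> mass_bounds \<mu> p CARD('d) K r x"
proof (rule compact_uniform[OF M])
  have mp: "p \<in> borel_measurable \<mu>" using riemannian_volume_sets(3)[OF rv Ck_manifold_continuous[OF sm p]] .
  \<comment> \<open>Nonnegativity of the masses is what makes the lower bound in
    \<open>mass_bounds\<close> survive an increase of the constant.\<close>
  have Ip: "0 \<le> (\<integral>y. indicator T y * p y \<partial>\<mu>)" for T
  proof (rule Bochner_Integration.integral_nonneg)
    fix y assume "y \<in> space \<mu>"
    then have "0 \<le> p y" using pb pm riemannian_volume_sets(1)[OF rv] by fastforce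
    then show "0 \<le> indicator T y * p y" by simp
  qed
  show "\<exists>W C r. open W \<and> x0 \<in> W \<and> 0 < r \<and> (\<forall>x\<in>M \<inter> W. mass_bounds \<mu> p CARD('d) C r x)" if x0: "x0 \<in> M" for x0
  proof -
    \<comment> \<open>Masses involve no function \<open>f\<close>, so the charts of
      \<open>chart_family\<close> are requested for the zero function.\<close>
    have z: "Ck_manifold TYPE('d) 3 M (\<lambda>_. 0)"
      unfolding Ck_manifold_def o_def
    proof (intro allI impI)
      fix V and \<phi> :: "real^'d \<Rightarrow> real^'m" assume "local_param M V \<phi>"
      then show "Ck_on 3 V (\<lambda>x. 0)" using Ck_on_const[OF local_paramD(1)] by blast
    qed
    obtain W C \<rho> r C' where W: "open W" "x0 \<in> W" and ch: "\<And>x. x \<in> M \<inter> W \<Longrightarrow> \<exists>\<Phi> :: real^'d \<Rightarrow> real^'m. \<Phi> 0 = x \<and> normal_chart M C \<rho> r \<Phi> \<and> chart_bounds C' \<rho> \<Phi> p (\<lambda>_. 0)"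
      by (rule chart_family[OF sm p z x0]) (rule that; assumption)
    obtain K where K: "\<And>\<Phi>::real^'d \<Rightarrow> real^'m. normal_chart M C \<rho> r \<Phi> \<Longrightarrow> mass_bounds \<mu> p CARD('d) K (min (\<rho> / 16) (r / 2)) (\<Phi> 0)"
    proof (rule chart_mass[OF rv mp _ pm, of p_max C \<rho> r])
      show "p_min \<le> p x \<and> p x \<le> p_max" if "x \<in> M" for x using pb that by blast
    qed (rule that)
    have "0 < min (\<rho> / 16) (r / 2)" using ch[of x0] x0 W by (auto simp: normal_chart_def)
    moreover have "mass_bounds \<mu> p CARD('d) K (min (\<rho> / 16) (r / 2)) x" if "x \<in> M \<inter> W" for x
      using ch[OF that] K by blast
    ultimately show ?thesis using W by blast
  qed
  show "mass_bounds \<mu> p CARD('d) C' r' x" if "mass_bounds \<mu> p CARD('d) C r x" "C \<le> C'" "0 < r'" "r' \<le> r" for C C' r r' x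
    unfolding mass_bounds_def
  proof (intro allI impI conjI)
    fix s assume s: "0 < s \<and> s \<le> r'"
    then have s': "0 < s \<and> s \<le> r" using that by simp
    note b = that(1)[unfolded mass_bounds_def, rule_format, OF s']
    show "(\<integral>y. indicator (cball x s) y * p y \<partial>\<mu>) \<le> C' * s ^ CARD('d)"
      by (rule order_trans[OF conjunct1[OF b] mult_right_mono[OF that(2)]]) (use s in simp)
    show "s ^ CARD('d) \<le> C' * (\<integral>y. indicator (cball x s) y * p y \<partial>\<mu>)"
      by (rule order_trans[OF conjunct1[OF conjunct2[OF b]] mult_right_mono[OF that(2) Ip]])
    fix \<eta> assume \<eta>: "0 \<le> \<eta> \<and> \<eta> \<le> s / 2"
    show "(\<integral>y. indicator {y. \<bar>dist y x - s\<bar> \<le> \<eta>} y * p y \<partial>\<mu>) \<le> C' * (s ^ (CARD('d) - 1) * \<eta> + s ^ (CARD('d) + 2))"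
      by (rule order_trans[OF conjunct2[OF conjunct2[OF b], rule_format, OF \<eta>] mult_right_mono[OF that(2)]]) (use s \<eta> in simp)
  qed
qed (rule that; assumption)

lemma uniform_local_expansion:
  fixes p f :: "real^'m \<Rightarrow> real"
  assumes M: "compact M" and sm: "smooth_submanifold TYPE('d::finite) M" and rv: "riemannian_volume TYPE('d) M \<mu>"
    and p: "Ck_manifold TYPE('d) 2 M p" and pm: "0 < p_min" and pb: "\<forall>x\<in>M. p_min \<le> p x \<and> p x \<le> p_max"
    and f: "Ck_manifold TYPE('d) 3 M f"
  obtains K r where "0 < K" "0 < r" "r \<le> 1" "\<And>x. x \<in> M \<Longrightarrow> local_expansion M \<mu> p f CARD('d) (limit_operator TYPE('d) M p f) K r x"
proof (rule compact_uniform[OF M])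
  let ?A = "limit_operator TYPE('d) M p f"
  have pa: "\<bar>p x\<bar> \<le> p_max" if "x \<in> M" for x using pb pm that by fastforce
  show "local_expansion M \<mu> p f CARD('d) ?A C' r' x" if lx: "local_expansion M \<mu> p f CARD('d) ?A C r x" "C \<le> C'" "0 < r'" "r' \<le> r" for C C' r r' x
  proof -
    obtain \<alpha> \<beta> where ab0: "linear \<alpha> \<and> bounded_bilinear \<beta> \<and> (\<forall>z. \<bar>\<alpha> z\<bar> \<le> C * norm z) \<and> (\<forall>y z. \<bar>\<beta> y z\<bar> \<le> C * norm y * norm z) \<and>
      (\<forall>y\<in>M. dist y x \<le> r \<longrightarrow> \<bar>f y - f x - \<alpha> (y - x) - \<beta> (y - x) (y - x)\<bar> \<le> C * norm (y - x) ^ 3)"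
      using conjunct2[OF lx(1)[unfolded local_expansion_def]] by (elim exE)
    have ab: "linear \<alpha>" "bounded_bilinear \<beta>" "\<And>z. \<bar>\<alpha> z\<bar> \<le> C * norm z" "\<And>y z. \<bar>\<beta> y z\<bar> \<le> C * norm y * norm z"
      "\<And>y. y \<in> M \<Longrightarrow> dist y x \<le> r \<Longrightarrow> \<bar>f y - f x - \<alpha> (y - x) - \<beta> (y - x) (y - x)\<bar> \<le> C * norm (y - x) ^ 3"
      using ab0 by auto
    have le: "C * a \<le> C' * a" if "a \<ge> 0" for a using \<open>C \<le> C'\<close> that by (rule mult_right_mono)
    show ?thesis unfolding local_expansion_def
    proof (intro conjI allI impI exI[of _ \<alpha>] exI[of _ \<beta>] ballI ab(1,2))
      fix s assume s: "0 < s \<and> s \<le> r'"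
      then have s': "0 < s \<and> s \<le> r" using that by simp
      show "\<bar>(\<integral>y. indicator (cball x s) y * ((f y - f x) * p y) \<partial>\<mu>) - s ^ (CARD('d) + 2) * ?A x\<bar> \<le> C' * s ^ (CARD('d) + 3)"
        by (rule order_trans[OF conjunct1[OF lx(1)[unfolded local_expansion_def], rule_format, OF s'] le]) (use s in simp)
    next
      fix z show "\<bar>\<alpha> z\<bar> \<le> C' * norm z" by (rule order_trans[OF ab(3) le]) simp
    next
      fix y z show "\<bar>\<beta> y z\<bar> \<le> C' * norm y * norm z"
        using order_trans[OF ab(4)[of y z, unfolded mult.assoc] le] by (simp add: mult.assoc)
    next
      fix y assume "y \<in> M" "dist y x \<le> r'"
      then show "\<bar>f y - f x - \<alpha> (y - x) - \<beta> (y - x) (y - x)\<bar> \<le> C' * norm (y - x) ^ 3"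
        using order_trans[OF ab(5)[of y] le] that by simp
    qed
  qed
  show "\<exists>W C r. open W \<and> x0 \<in> W \<and> 0 < r \<and> (\<forall>x\<in>M \<inter> W. local_expansion M \<mu> p f CARD('d) ?A C r x)" if x0: "x0 \<in> M" for x0
  proof -
    obtain W C \<rho> r C' where W: "open W" "x0 \<in> W" and C': "C' \<ge> 0" and ch: "\<And>x. x \<in> M \<inter> W \<Longrightarrow> \<exists>\<Phi> :: real^'d \<Rightarrow> real^'m. \<Phi> 0 = x \<and> normal_chart M C \<rho> r \<Phi> \<and> chart_bounds C' \<rho> \<Phi> p f"
      by (rule chart_family[OF sm p f x0]) (rule that; assumption)
    obtain K1 where K1: "K1 \<ge> 0" "\<And>(\<Phi>::real^'d \<Rightarrow> real^'m) s. normal_chart M C \<rho> r \<Phi> \<Longrightarrow> chart_bounds C' \<rho> \<Phi> p f \<Longrightarrow> 0 < s \<Longrightarrow> s \<le> \<rho> / 16 \<Longrightarrow> s \<le> r \<Longrightarrow>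
     \<bar>(\<integral>y. indicator (cball (\<Phi> 0) s) y * ((f y - f (\<Phi> 0)) * p y) \<partial>\<mu>) - s ^ (CARD('d) + 2) * ?A (\<Phi> 0)\<bar>
       \<le> K1 * s ^ (CARD('d) + 3)"
    proof (rule chart_bias[OF sm rv p f _ C', of p_max C \<rho> r], goal_cases)
      case (1 x)
      then show ?case using pa by blast
    next
      case (2 K)
      show ?case by (rule 2(1)[OF 2(2)]) (rule 2(3))
    qed
    obtain K2 where K2: "K2 \<ge> 0" "\<And>(\<Phi>::real^'d \<Rightarrow> real^'m). normal_chart M C \<rho> r \<Phi> \<Longrightarrow> chart_bounds C' \<rho> \<Phi> p f \<Longrightarrow>
    \<exists>\<alpha> \<beta>. linear \<alpha> \<and> bounded_bilinear \<beta> \<and> (\<forall>z. \<bar>\<alpha> z\<bar> \<le> K2 * norm z) \<and> (\<forall>y z. \<bar>\<beta> y z\<bar> \<le> K2 * norm y * norm z) \<and>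
      (\<forall>y\<in>M. dist y (\<Phi> 0) \<le> r \<and> dist y (\<Phi> 0) \<le> 1 \<longrightarrow> \<bar>f y - f (\<Phi> 0) - \<alpha> (y - \<Phi> 0) - \<beta> (y - \<Phi> 0) (y - \<Phi> 0)\<bar> \<le> K2 * norm (y - \<Phi> 0) ^ 3)"
    proof (rule chart_taylor[OF f C', of C \<rho> r p], goal_cases)
      case (1 K)
      show ?case by (rule 1(1)[OF 1(2)]) (rule 1(3))
    qed
    define R where "R = min (min (\<rho> / 16) r) 1"
    have R: "0 < R" using ch[of x0] x0 W by (auto simp: R_def normal_chart_def)
    have "local_expansion M \<mu> p f CARD('d) ?A (K1 + K2) R x" if x: "x \<in> M \<inter> W" for x
    proof -
      obtain \<Phi> :: "real^'d \<Rightarrow> real^'m" where \<Phi>: "\<Phi> 0 = x" "normal_chart M C \<rho> r \<Phi>" "chart_bounds C' \<rho> \<Phi> p f" using ch[OF x] by blast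
      have le: "K1 * a \<le> (K1 + K2) * a" "K2 * a \<le> (K1 + K2) * a" if "a \<ge> 0" for a using K1(1) K2(1) that by (auto intro: mult_right_mono)
      obtain \<alpha> \<beta> where ab0: "linear \<alpha> \<and> bounded_bilinear \<beta> \<and> (\<forall>z. \<bar>\<alpha> z\<bar> \<le> K2 * norm z) \<and> (\<forall>y z. \<bar>\<beta> y z\<bar> \<le> K2 * norm y * norm z) \<and>
        (\<forall>y\<in>M. dist y x \<le> r \<and> dist y x \<le> 1 \<longrightarrow> \<bar>f y - f x - \<alpha> (y - x) - \<beta> (y - x) (y - x)\<bar> \<le> K2 * norm (y - x) ^ 3)"
        using K2(2)[OF \<Phi>(2,3)] unfolding \<Phi>(1) by (elim exE)
      have ab: "linear \<alpha>" "bounded_bilinear \<beta>" "\<And>z. \<bar>\<alpha> z\<bar> \<le> K2 * norm z" "\<And>y z. \<bar>\<beta> y z\<bar> \<le> K2 * norm y * norm z"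
        "\<And>y. y \<in> M \<Longrightarrow> dist y x \<le> r \<and> dist y x \<le> 1 \<Longrightarrow> \<bar>f y - f x - \<alpha> (y - x) - \<beta> (y - x) (y - x)\<bar> \<le> K2 * norm (y - x) ^ 3"
        using ab0 by auto
      show ?thesis unfolding local_expansion_def
      proof (intro conjI allI impI exI[of _ \<alpha>] exI[of _ \<beta>] ballI ab(1,2))
        fix s assume s: "0 < s \<and> s \<le> R"
        show "\<bar>(\<integral>y. indicator (cball x s) y * ((f y - f x) * p y) \<partial>\<mu>) - s ^ (CARD('d) + 2) * ?A x\<bar> \<le> (K1 + K2) * s ^ (CARD('d) + 3)"
          by (rule order_trans[OF K1(2)[OF \<Phi>(2,3), unfolded \<Phi>(1)] le(1)]) (use s in \<open>auto simp: R_def\<close>)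
      next
        fix z show "\<bar>\<alpha> z\<bar> \<le> (K1 + K2) * norm z" by (rule order_trans[OF ab(3) le(2)]) simp
      next
        fix y z show "\<bar>\<beta> y z\<bar> \<le> (K1 + K2) * norm y * norm z"
          using order_trans[OF ab(4)[of y z, unfolded mult.assoc] le(2)] by (simp add: mult.assoc)
      next
        fix y assume "y \<in> M" "dist y x \<le> R"
        then show "\<bar>f y - f x - \<alpha> (y - x) - \<beta> (y - x) (y - x)\<bar> \<le> (K1 + K2) * norm (y - x) ^ 3"
          using order_trans[OF ab(5)[of y] le(2)] by (simp add: R_def)
      qed
    qed
    then show ?thesis using W R by blast
  qed
qed (rule that; assumption)

section \<open>Concentration\<close>

text \<open>Both sides are compared after multiplication by \<open>1 - z\<close>: the left becomes
  at most 1, and the right becomes \<open>1 + z^2 * (1 - 2 * z)\<close>.\<close>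

lemma exp_le_quadratic:
  fixes z :: real
  assumes "z \<le> 1/2" shows "exp z \<le> 1 + z + 2 * z\<^sup>2"
proof -
  have "1 - z \<le> exp (- z)" using exp_ge_add_one_self[of "- z"] by simp
  then have "exp z * (1 - z) \<le> exp z * exp (- z)" by (intro mult_left_mono) auto
  also have "\<dots> = 1" by (simp flip: exp_add)
  also have "1 \<le> 1 + z\<^sup>2 * (1 - 2 * z)" using assms by simp
  also have "\<dots> = (1 + z + 2 * z\<^sup>2) * (1 - z)" by (simp add: algebra_simps power2_eq_square)
  finally show ?thesis using assms by (simp add: mult_le_cancel_right)
qed

text \<open>Markov's inequality for the exponential moment. The parameter \<open>l\<close> is left
  free, to be optimized when the size of the variance relative to \<open>ln n\<close> is
  known.\<close>

lemma bernstein_upper_tail: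
  fixes X :: "'i \<Rightarrow> 'w \<Rightarrow> 's" and g p :: "'s \<Rightarrow> real"
  assumes P: "prob_space P" and ind: "prob_space.indep_vars P (\<lambda>_. \<mu>) X I" and I: "finite I"
    and dist: "\<And>i. i \<in> I \<Longrightarrow> distributed P \<mu> (X i) (\<lambda>x. ennreal (p x))"
    and p: "\<And>x. x \<in> space \<mu> \<Longrightarrow> 0 \<le> p x" and g: "g \<in> borel_measurable \<mu>" "\<And>x. x \<in> space \<mu> \<Longrightarrow> \<bar>g x\<bar> \<le> 1"
    and l: "0 < l" "l \<le> 1/2" and v: "(\<integral>x. p x * (g x)\<^sup>2 \<partial>\<mu>) \<le> v"
  shows "measure P {\<omega> \<in> space P. real (card I) * (\<integral>x. p x * g x \<partial>\<mu>) + t \<le> (\<Sum>i\<in>I. g (X i \<omega>))}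
     \<le> exp (- l * t + 2 * real (card I) * l\<^sup>2 * v)"
proof -
  interpret prob_space P by fact
  let ?e = "\<integral>x. p x * g x \<partial>\<mu>" let ?n = "real (card I)"
  have mX[measurable]: "X i \<in> measurable P \<mu>" if "i \<in> I" for i using dist[OF that] distributed_measurable by blast
  have inS: "X i \<omega> \<in> space \<mu>" if "i \<in> I" "\<omega> \<in> space P" for i \<omega> using measurable_space[OF mX] that by blast
  have mg: "(\<lambda>\<omega>. g (X i \<omega>)) \<in> borel_measurable P" if "i \<in> I" for i using measurable_compose[OF mX[OF that] g(1)] .
  have ib: "integrable P h" if "h \<in> borel_measurable P" "\<And>\<omega>. \<omega> \<in> space P \<Longrightarrow> \<bar>h \<omega>\<bar> \<le> B" for h :: "'w \<Rightarrow> real" and B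
    by (rule integrable_const_bound[of _ B]) (use that in auto)
  have ev: "expectation (\<lambda>\<omega>. g (X i \<omega>)) = ?e" "expectation (\<lambda>\<omega>. (g (X i \<omega>))\<^sup>2) \<le> v" if i: "i \<in> I" for i
  proof -
    show "expectation (\<lambda>\<omega>. g (X i \<omega>)) = ?e" using distributed_integral[OF dist[OF i] g(1) p] by simp
    have "(\<lambda>x. (g x)\<^sup>2) \<in> borel_measurable \<mu>" using g(1) by measurable
    then show "expectation (\<lambda>\<omega>. (g (X i \<omega>))\<^sup>2) \<le> v" using distributed_integral[OF dist[OF i] _ p, of "\<lambda>x. (g x)\<^sup>2"] v by simp
  qed
  have lg: "\<bar>l * g (X i \<omega>)\<bar> \<le> 1/2" if "i \<in> I" "\<omega> \<in> space P" for i \<omega>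
  proof -
    have "\<bar>l * g (X i \<omega>)\<bar> \<le> 1/2 * 1" unfolding abs_mult using g(2)[OF inS[OF that]] l by (intro mult_mono) auto
    then show ?thesis by simp
  qed
  have ie: "integrable P (\<lambda>\<omega>. exp (l * g (X i \<omega>)))" if i: "i \<in> I" for i
  proof (rule ib[of _ "exp (1/2)"])
    show "(\<lambda>\<omega>. exp (l * g (X i \<omega>))) \<in> borel_measurable P" using mg[OF i] by measurable
    show "\<bar>exp (l * g (X i \<omega>))\<bar> \<le> exp (1/2)" if "\<omega> \<in> space P" for \<omega>
      unfolding abs_exp_cancel exp_le_cancel_iff using lg[OF i that] by linarith
  qed
  have mgf: "expectation (\<lambda>\<omega>. exp (l * g (X i \<omega>))) \<le> exp (l * ?e + 2 * l\<^sup>2 * v)" if i: "i \<in> I" for i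
  proof -
    have i1: "integrable P (\<lambda>\<omega>. g (X i \<omega>))" by (rule ib[of _ 1]) (use mg[OF i] g(2) inS[OF i] in auto)
    have i2: "integrable P (\<lambda>\<omega>. (g (X i \<omega>))\<^sup>2)"
      by (rule ib[of _ 1]) (use mg[OF i] g(2) inS[OF i] in \<open>auto simp: abs_square_le_1\<close>)
    have "expectation (\<lambda>\<omega>. exp (l * g (X i \<omega>))) \<le> expectation (\<lambda>\<omega>. 1 + l * g (X i \<omega>) + 2 * l\<^sup>2 * (g (X i \<omega>))\<^sup>2)"
    proof (rule integral_mono)
      fix \<omega> assume \<omega>: "\<omega> \<in> space P"
      have "l * g (X i \<omega>) \<le> 1/2" using lg[OF i \<omega>] by simp
      from exp_le_quadratic[OF this] show "exp (l * g (X i \<omega>)) \<le> 1 + l * g (X i \<omega>) + 2 * l\<^sup>2 * (g (X i \<omega>))\<^sup>2"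
        by (simp add: power_mult_distrib)
    qed (use ie[OF i] i1 i2 in auto)
    also have "\<dots> = 1 + l * ?e + 2 * l\<^sup>2 * expectation (\<lambda>\<omega>. (g (X i \<omega>))\<^sup>2)"
      using i1 i2 ev(1)[OF i] by (simp add: prob_space)
    also have "\<dots> \<le> 1 + l * ?e + 2 * l\<^sup>2 * v" using ev(2)[OF i] by (intro add_left_mono mult_left_mono) auto
    also have "\<dots> \<le> exp (l * ?e + 2 * l\<^sup>2 * v)" using exp_ge_add_one_self[of "l * ?e + 2 * l\<^sup>2 * v"] by (simp only: add.assoc)
    finally show ?thesis .
  qed
  have ind': "indep_vars (\<lambda>_. borel) (\<lambda>i \<omega>. exp (l * g (X i \<omega>))) I"
    using indep_vars_compose2[OF ind, of "\<lambda>_ x. exp (l * g x)" "\<lambda>_. borel"] g(1) by simp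
  let ?u = "\<lambda>\<omega>. \<Prod>i\<in>I. exp (l * g (X i \<omega>))"
  have iu: "integrable P ?u" by (rule indep_vars_integrable[OF I ind' ie])
  have "expectation ?u = (\<Prod>i\<in>I. expectation (\<lambda>\<omega>. exp (l * g (X i \<omega>))))"
    by (rule indep_vars_lebesgue_integral[OF I ind' ie])
  also have "\<dots> \<le> (\<Prod>i\<in>I. exp (l * ?e + 2 * l\<^sup>2 * v))" by (rule prod_mono) (use mgf in \<open>auto intro!: integral_nonneg\<close>)
  also have "\<dots> = exp (?n * (l * ?e + 2 * l\<^sup>2 * v))" by (simp add: exp_of_nat_mult)
  finally have Eu: "expectation ?u \<le> exp (?n * (l * ?e + 2 * l\<^sup>2 * v))" .
  have "{\<omega> \<in> space P. ?n * ?e + t \<le> (\<Sum>i\<in>I. g (X i \<omega>))} = {\<omega> \<in> space P. exp (l * (?n * ?e + t)) \<le> ?u \<omega>}"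
    using l by (simp add: exp_sum[OF I, symmetric] sum_distrib_left[symmetric])
  then have "measure P {\<omega> \<in> space P. ?n * ?e + t \<le> (\<Sum>i\<in>I. g (X i \<omega>))} = measure P {\<omega> \<in> space P. exp (l * (?n * ?e + t)) \<le> ?u \<omega>}" by simp
  also have "\<dots> \<le> expectation ?u / exp (l * (?n * ?e + t))"
    by (rule integral_Markov_inequality_measure[OF iu sets.empty_sets]) (auto intro!: prod_nonneg)
  also have "\<dots> \<le> exp (?n * (l * ?e + 2 * l\<^sup>2 * v)) / exp (l * (?n * ?e + t))" by (intro divide_right_mono Eu) auto
  also have "\<dots> = exp (- l * t + 2 * ?n * l\<^sup>2 * v)" by (simp add: exp_diff[symmetric] algebra_simps)
  finally show ?thesis .
qed

text \<open>A union bound over polynomially many tests followed by Borel-Cantelli. The condition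
  \<open>4 * ln n \<le> n * w n\<close> places the deviations in the Gaussian regime of Bernstein's
  bound, where only the variance matters. The constant \<open>A\<close> is not random.\<close>

lemma uniform_concentration:
  fixes X :: "nat \<Rightarrow> 'w \<Rightarrow> 's" and p :: "'s \<Rightarrow> real" and F :: "nat \<Rightarrow> ('s \<Rightarrow> real) set" and w :: "nat \<Rightarrow> real"
  assumes P: "prob_space P" and ind: "prob_space.indep_vars P (\<lambda>_. \<mu>) X {1..}"
    and dist: "\<And>i. i \<ge> 1 \<Longrightarrow> distributed P \<mu> (X i) (\<lambda>x. ennreal (p x))"
    and p: "\<And>x. x \<in> space \<mu> \<Longrightarrow> 0 \<le> p x"
    and F: "\<forall>\<^sub>F n in sequentially. finite (F n) \<and> real (card (F n)) \<le> c * real n ^ q"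
    and w: "\<forall>\<^sub>F n in sequentially. 0 < w n \<and> 4 * ln (real n) \<le> real n * w n"
    and g: "\<forall>\<^sub>F n in sequentially. \<forall>g\<in>F n. g \<in> borel_measurable \<mu> \<and> (\<forall>x\<in>space \<mu>. \<bar>g x\<bar> \<le> 1) \<and> (\<integral>x. p x * (g x)\<^sup>2 \<partial>\<mu>) \<le> \<sigma> * w n"
  shows "\<exists>A. AE \<omega> in P. \<forall>\<^sub>F n in sequentially. \<forall>g\<in>F n.
     \<bar>(\<Sum>i=1..n. g (X i \<omega>)) - real n * (\<integral>x. p x * g x \<partial>\<mu>)\<bar> \<le> A * sqrt (real n * w n * ln (real n))"
proof -
  interpret prob_space P by fact
  \<comment> \<open>With the \<open>l\<close> chosen below, the exponent becomes
    \<open>(2 * \<sigma> - A) * ln n\<close>. This \<open>A\<close> makes it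
    \<open>- (q + 2) * ln n\<close>, so that \<open>n^q\<close> tests still leave a summable
    \<open>n^(-2)\<close>.\<close>
  define A where "A = 2 * \<sigma> + real q + 2"
  let ?t = "\<lambda>n. A * sqrt (real n * w n * ln (real n))"
  let ?bad = "\<lambda>n g. {\<omega> \<in> space P. real n * (\<integral>x. p x * g x \<partial>\<mu>) + ?t n \<le> (\<Sum>i=1..n. g (X i \<omega>))}"
  \<comment> \<open>Negated tests are included so that lower tails are upper tails too.\<close>
  define G where "G n = F n \<union> (\<lambda>g x. - g x) ` F n" for n
  define ok where "ok n \<longleftrightarrow> 2 \<le> n \<and> finite (F n) \<and> real (card (F n)) \<le> c * real n ^ q \<and> 0 < w n \<and> 4 * ln (real n) \<le> real n * w n
     \<and> (\<forall>g\<in>F n. g \<in> borel_measurable \<mu> \<and> (\<forall>x\<in>space \<mu>. \<bar>g x\<bar> \<le> 1) \<and> (\<integral>x. p x * (g x)\<^sup>2 \<partial>\<mu>) \<le> \<sigma> * w n)" for n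
  have ev: "\<forall>\<^sub>F n in sequentially. ok n"
    using F w g eventually_ge_at_top[of 2] unfolding ok_def by eventually_elim auto
  \<comment> \<open>Empty for the finitely many \<open>n\<close> at which the eventual hypotheses
    may fail, so that it is an event for every \<open>n\<close>.\<close>
  define B where "B n = (if ok n then (\<Union>g\<in>G n. ?bad n g) else {})" for n
  have mX: "X i \<in> measurable P \<mu>" if "i \<ge> 1" for i using dist[OF that] distributed_measurable by blast
  have bound: "?bad n g \<in> events \<and> prob (?bad n g) \<le> real n powr (- real q - 2)" if n: "ok n" and gG: "g \<in> G n" for n g
  proof
    have gp: "g \<in> borel_measurable \<mu>" "\<And>x. x \<in> space \<mu> \<Longrightarrow> \<bar>g x\<bar> \<le> 1" "(\<integral>x. p x * (g x)\<^sup>2 \<partial>\<mu>) \<le> \<sigma> * w n"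
      using n gG by (auto simp: ok_def G_def)
    have "(\<lambda>\<omega>. \<Sum>i=1..n. g (X i \<omega>)) \<in> borel_measurable P"
      by (intro borel_measurable_sum measurable_compose[OF mX gp(1)]) auto
    then show "?bad n g \<in> events" by measurable
    have L: "ln (real n) > 0" and n0: "real n > 0" and wn: "w n > 0" "4 * ln (real n) \<le> real n * w n"
      using n by (auto simp: ok_def)
    \<comment> \<open>Balances the two terms of the exponent at the order of \<open>ln n\<close>;
      \<open>l \<le> 1/2\<close> is precisely the hypothesis on \<open>w\<close>.\<close>
    define l where "l = sqrt (ln (real n) / (real n * w n))"
    have nw: "real n * w n > 0" using n0 wn by simp
    have l: "0 < l" "l \<le> 1/2"
    proof -
      show "0 < l" using L nw by (simp add: l_def)
      have "ln (real n) / (real n * w n) \<le> (1/2)\<^sup>2" using wn nw by (simp add: field_simps power2_eq_square)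
      then show "l \<le> 1/2" unfolding l_def by (intro real_le_lsqrt) (use L nw in auto)
    qed
    have lt: "l * ?t n = A * ln (real n)"
    proof -
      have "l * sqrt (real n * w n * ln (real n)) = sqrt (ln (real n) / (real n * w n) * (real n * w n * ln (real n)))"
        unfolding l_def by (rule real_sqrt_mult[symmetric])
      also have "ln (real n) / (real n * w n) * (real n * w n * ln (real n)) = (ln (real n))\<^sup>2"
      proof -
        have "x / q * (q * x) = x\<^sup>2" if "q > 0" for x q :: real using that by (simp add: power2_eq_square)
        from this[OF nw] show ?thesis .
      qed
      also have "sqrt ((ln (real n))\<^sup>2) = ln (real n)" using L by simp
      finally have ls: "l * sqrt (real n * w n * ln (real n)) = ln (real n)" .
      show ?thesis unfolding mult.left_commute[of l A] ls ..
    qed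
    have l2: "real n * l\<^sup>2 * (\<sigma> * w n) = \<sigma> * ln (real n)"
    proof -
      have "l\<^sup>2 = ln (real n) / (real n * w n)" unfolding l_def by (rule real_sqrt_pow2) (use L nw in simp)
      moreover have "w n \<noteq> 0" "real n \<noteq> 0" using n0 wn by auto
      ultimately show ?thesis by (simp add: divide_simps ac_simps)
    qed
    have "prob (?bad n g) \<le> exp (- l * ?t n + 2 * real n * l\<^sup>2 * (\<sigma> * w n))"
      using bernstein_upper_tail[OF P indep_vars_subset[OF ind, of "{1..n}"] finite_atLeastAtMost dist p gp(1,2) l gp(3), of "?t n"] by auto
    also have "- l * ?t n + 2 * real n * l\<^sup>2 * (\<sigma> * w n) = (- real q - 2) * ln (real n)"
      using lt l2 by (simp add: A_def algebra_simps)
    also have "exp ((- real q - 2) * ln (real n)) = real n powr (- real q - 2)" using n0 by (simp add: powr_def)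
    finally show "prob (?bad n g) \<le> real n powr (- real q - 2)" .
  qed
  have finG: "finite (G n)" and cardG: "real (card (G n)) \<le> 2 * c * real n ^ q" if "ok n" for n
  proof -
    show "finite (G n)" using that by (auto simp: ok_def G_def)
    have "card (G n) \<le> card (F n) + card ((\<lambda>g x. - g x) ` F n)" unfolding G_def by (rule card_Un_le)
    also have "\<dots> \<le> 2 * card (F n)" using card_image_le[of "F n" "\<lambda>g x. - g x"] that by (simp add: ok_def)
    finally show "real (card (G n)) \<le> 2 * c * real n ^ q" using that by (simp add: ok_def)
  qed
  have mB: "B n \<in> events" for n
  proof (cases "ok n")
    case True
    have "(\<Union>g\<in>G n. ?bad n g) \<in> events"
      by (rule sets.finite_UN[OF finG[OF True]]) (use bound[OF True] in blast)
    then show ?thesis using True unfolding B_def by simp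
  qed (simp add: B_def)
  have pB: "prob (B n) \<le> 2 * c * (1 / real n ^ 2)" if n: "ok n" for n
  proof -
    have n0: "real n > 0" using n by (auto simp: ok_def)
    have "prob (B n) \<le> (\<Sum>g\<in>G n. prob (?bad n g))"
      unfolding B_def using n bound finG by (auto intro!: finite_measure_subadditive_finite)
    also have "\<dots> \<le> (\<Sum>g\<in>G n. real n powr (- real q - 2))" by (rule sum_mono) (use bound[OF n] in blast)
    also have "\<dots> = real (card (G n)) * real n powr (- real q - 2)" by simp
    also have "\<dots> \<le> (2 * c * real n ^ q) * real n powr (- real q - 2)" by (intro mult_right_mono cardG n) auto
    also have "real n powr (- real q - 2) = 1 / (real n ^ q * real n ^ 2)"
      using n0 by (simp add: powr_diff powr_minus powr_realpow divide_simps)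
    finally show ?thesis using n0 by simp
  qed
  have "summable (\<lambda>n. prob (B n))"
  proof (rule summable_comparison_test_ev)
    show "\<forall>\<^sub>F n in sequentially. norm (prob (B n)) \<le> 2 * c * (1 / real n ^ 2)"
      using ev by eventually_elim (use pB in auto)
    show "summable (\<lambda>n. 2 * c * (1 / real n ^ 2))"
      by (intro summable_mult) (use inverse_power_summable[of 2, where 'a=real] in \<open>simp add: inverse_eq_divide\<close>)
  qed
  then have "AE \<omega> in P. \<forall>\<^sub>F n in sequentially. \<omega> \<in> space P - B n"
    by (intro borel_cantelli_AE1 mB) (auto simp: emeasure_eq_measure)
  then have "AE \<omega> in P. \<forall>\<^sub>F n in sequentially. \<forall>g\<in>F n.
     \<bar>(\<Sum>i=1..n. g (X i \<omega>)) - real n * (\<integral>x. p x * g x \<partial>\<mu>)\<bar> \<le> ?t n"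
  proof eventually_elim
    case (elim \<omega>)
    then show ?case using ev
    proof eventually_elim
      case (elim n)
      then have \<omega>: "\<omega> \<in> space P" "\<And>g. g \<in> G n \<Longrightarrow> \<omega> \<notin> ?bad n g" by (auto simp: B_def)
      show ?case
      proof
        fix g assume g: "g \<in> F n"
        have 1: "\<omega> \<notin> ?bad n g" using \<omega>(2) g by (auto simp: G_def)
        have 2: "\<omega> \<notin> ?bad n (\<lambda>x. - g x)" using \<omega>(2)[of "\<lambda>x. - g x"] g by (auto simp: G_def)
        show "\<bar>(\<Sum>i=1..n. g (X i \<omega>)) - real n * (\<integral>x. p x * g x \<partial>\<mu>)\<bar> \<le> ?t n"
          using 1 2 \<omega>(1) by (simp add: sum_negf abs_le_iff)
      qed
    qed
  qed
  then show ?thesis by blast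
qed

section \<open>Sampling from a law with regular ball masses\<close>

text \<open>The interface between geometry and probability: from here on nothing about
  \<open>M\<close> is used except how much mass balls and thin shells carry.\<close>

locale regular_law = prob_space \<nu> for \<nu> :: "(real^'m) measure" +
  fixes M :: "(real^'m) set" and d :: nat and K r0 :: real
  assumes space_law: "space \<nu> = M" and sets_law: "sets \<nu> = sets (restrict_space borel M)"
    and K: "K \<ge> 1" and r0: "0 < r0" and d: "d \<ge> 1"
    and mass_upper: "\<And>x s. x \<in> M \<Longrightarrow> 0 < s \<Longrightarrow> s \<le> r0 \<Longrightarrow> measure \<nu> (M \<inter> cball x s) \<le> K * s ^ d"
    and mass_lower: "\<And>x s. x \<in> M \<Longrightarrow> 0 < s \<Longrightarrow> s \<le> r0 \<Longrightarrow> s ^ d \<le> K * measure \<nu> (M \<inter> cball x s)"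
    and mass_annulus: "\<And>x s \<eta>. x \<in> M \<Longrightarrow> 0 < s \<Longrightarrow> s \<le> r0 \<Longrightarrow> 0 \<le> \<eta> \<Longrightarrow> \<eta> \<le> s / 2 \<Longrightarrow>
      measure \<nu> (M \<inter> {y. \<bar>dist y x - s\<bar> \<le> \<eta>}) \<le> K * (s ^ (d - 1) * \<eta> + s ^ (d + 2))"

begin

lemma in_sets: "B \<in> sets borel \<Longrightarrow> M \<inter> B \<in> sets \<nu>"
  unfolding sets_law by (auto simp: sets_restrict_space)

lemma measurable_law: "g \<in> borel_measurable borel \<Longrightarrow> g \<in> borel_measurable \<nu>"
  using measurable_restrict_space1[of g borel borel M] measurable_cong_sets[OF sets_law refl] by blast

lemma annulus_borel: "{y::real^'m. \<bar>dist y x - s\<bar> \<le> \<eta>} \<in> sets borel"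
  by (intro borel_closed closed_Collect_le continuous_intros)

text \<open>A separated set of maximal cardinality is a net. Its balls of radius
  \<open>\<delta> / 3\<close> are disjoint and each has mass at least
  \<open>(\<delta> / 3)^d / K\<close>, which bounds the cardinality and so guarantees that a maximum
  exists.\<close>

lemma ex_net:
  assumes \<delta>: "0 < \<delta>" "\<delta> \<le> r0"
  obtains N where "finite N" "N \<subseteq> M" "real (card N) \<le> K * (3 / \<delta>) ^ d" "\<And>x. x \<in> M \<Longrightarrow> \<exists>y\<in>N. dist x y \<le> \<delta>"
proof -
  define sep where "sep S \<longleftrightarrow> finite S \<and> S \<subseteq> M \<and> (\<forall>x\<in>S. \<forall>y\<in>S. x \<noteq> y \<longrightarrow> dist x y > \<delta>)" for S
  have bound: "real (card S) \<le> K * (3 / \<delta>) ^ d" if "sep S" for S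
  proof -
    let ?A = "\<lambda>x. M \<inter> cball x (\<delta> / 3)"
    have S: "finite S" "S \<subseteq> M" using that by (auto simp: sep_def)
    have disj: "disjoint_family_on ?A S"
      unfolding disjoint_family_on_def
    proof (intro ballI impI, rule ccontr)
      fix x y assume xy: "x \<in> S" "y \<in> S" "x \<noteq> y" "?A x \<inter> ?A y \<noteq> {}"
      then obtain z where "dist x z \<le> \<delta> / 3" "dist y z \<le> \<delta> / 3" by auto
      then have "dist x y \<le> \<delta>" using dist_triangle2[of x y z] \<delta> by linarith
      moreover have "dist x y > \<delta>" using that xy(1-3) unfolding sep_def by blast
      ultimately show False by simp
    qed
    have "real (card S) * ((\<delta> / 3) ^ d / K) = (\<Sum>x\<in>S. (\<delta> / 3) ^ d / K)" by simp
    also have "\<dots> \<le> (\<Sum>x\<in>S. measure \<nu> (?A x))"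
    proof (rule sum_mono)
      fix x assume "x \<in> S"
      then show "(\<delta> / 3) ^ d / K \<le> measure \<nu> (?A x)" using mass_lower[of x "\<delta> / 3"] S \<delta> K by (auto simp: field_simps)
    qed
    also have "\<dots> = measure \<nu> (\<Union>x\<in>S. ?A x)"
      by (rule finite_measure_finite_Union[OF S(1) _ disj, symmetric]) (auto intro!: in_sets)
    also have "\<dots> \<le> 1" by (rule prob_le_1)
    finally have "real (card S) * ((\<delta> / 3) ^ d / K) \<le> 1" .
    then show ?thesis using \<delta> K by (simp add: field_simps)
  qed
  have "sep {}" by (simp add: sep_def)
  moreover have "\<forall>S. sep S \<longrightarrow> card S \<le> nat \<lfloor>K * (3 / \<delta>) ^ d\<rfloor>" using bound by (simp add: le_nat_floor)
  ultimately obtain S where S: "sep S" "\<And>T. sep T \<Longrightarrow> card T \<le> card S"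
    using ex_has_greatest_nat[of sep "{}" card] by (metis less_Suc_eq_le)
  show ?thesis
  proof (rule that[of S])
    show "finite S" "S \<subseteq> M" "real (card S) \<le> K * (3 / \<delta>) ^ d" using S bound by (auto simp: sep_def)
    fix x assume x: "x \<in> M"
    show "\<exists>y\<in>S. dist x y \<le> \<delta>"
    proof (rule ccontr)
      assume n: "\<not> (\<exists>y\<in>S. dist x y \<le> \<delta>)"
      then have xS: "x \<notin> S" using \<delta> by force
      have "sep (insert x S)" using S(1) n x by (auto simp: sep_def dist_commute not_le)
      then have "card (insert x S) \<le> card S" by (rule S(2))
      then show False using xS S(1) by (simp add: sep_def)
    qed
  qed
qed

end

text \<open>The constant is \<open>h\<close> rather than 1 so that every moment is \<open>O(h)\<close> on a ball of radius
  \<open>O(h)\<close>; all test functions then have variance \<open>O(h\<^sup>d\<^sup>+\<^sup>2)\<close>.\<close>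

definition moments :: "real \<Rightarrow> (real^'m \<Rightarrow> real) set" where
  "moments h = (\<lambda>a z. z $ a) ` UNIV \<union> (\<lambda>(a, b) z. z $ a * z $ b) ` UNIV \<union> {\<lambda>z. h}"

lemma finite_moments: "finite (moments h :: (real^'m \<Rightarrow> real) set)"
  by (simp add: moments_def)

lemma card_moments: "card (moments h :: (real^'m \<Rightarrow> real) set) \<le> CARD('m) + CARD('m) * CARD('m) + 1"
proof -
  have "card ((\<lambda>a z. z $ a) ` UNIV :: (real^'m \<Rightarrow> real) set) \<le> CARD('m)" by (rule card_image_le) simp
  moreover have "card ((\<lambda>(a, b) z. z $ a * z $ b) ` UNIV :: (real^'m \<Rightarrow> real) set) \<le> CARD('m \<times> 'm)" by (rule card_image_le) simp
  ultimately show ?thesis unfolding moments_def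
    by (intro order_trans[OF card_Un_le] add_mono)
      (auto simp: UNIV_Times_UNIV[symmetric] card_cartesian_product simp del: UNIV_Times_UNIV)
qed

lemma moments_measurable: "g \<in> moments h \<Longrightarrow> g \<in> borel_measurable borel"
  unfolding moments_def by (auto intro!: borel_measurable_continuous_onI continuous_intros)

lemma moments_bound:
  assumes g: "g \<in> moments h" and z: "norm z \<le> c * h" "c * h \<le> 1" "1 \<le> c" "0 \<le> h"
  shows "\<bar>g z\<bar> \<le> c * h"
proof -
  have a: "\<bar>z $ a\<bar> \<le> c * h" "\<bar>z $ a\<bar> \<le> 1" for a using component_le_norm_cart[of z a] z by linarith+
  have "\<bar>z $ a * z $ b\<bar> \<le> c * h" for a b
  proof -
    have "\<bar>z $ a * z $ b\<bar> \<le> (c * h) * 1" unfolding abs_mult using a by (intro mult_mono) (use z in auto)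
    then show ?thesis by simp
  qed
  moreover have "\<bar>h\<bar> \<le> c * h" using z by (simp add: mult_le_cancel_right1)
  ultimately show ?thesis using g a unfolding moments_def by auto
qed

lemma moments_lipschitz:
  assumes g: "g \<in> moments h" and z: "norm z \<le> 1" "norm z' \<le> 1"
  shows "\<bar>g z - g z'\<bar> \<le> 2 * norm (z - z')"
proof -
  have a: "\<bar>z $ a - z' $ a\<bar> \<le> norm (z - z')" for a using component_le_norm_cart[of "z - z'" a] by simp
  have o: "\<bar>z $ a\<bar> \<le> 1" "\<bar>z' $ a\<bar> \<le> 1" for a using component_le_norm_cart[of z a] component_le_norm_cart[of z' a] z by linarith+
  have "\<bar>z $ a * z $ b - z' $ a * z' $ b\<bar> \<le> 2 * norm (z - z')" for a b
  proof -
    have "z $ a * z $ b - z' $ a * z' $ b = (z $ a - z' $ a) * z $ b + z' $ a * (z $ b - z' $ b)" by (simp add: algebra_simps)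
    then have "\<bar>z $ a * z $ b - z' $ a * z' $ b\<bar> \<le> \<bar>z $ a - z' $ a\<bar> * \<bar>z $ b\<bar> + \<bar>z' $ a\<bar> * \<bar>z $ b - z' $ b\<bar>"
      by (metis abs_mult abs_triangle_ineq)
    also have "\<dots> \<le> norm (z - z') * 1 + 1 * norm (z - z')" using a o by (intro add_mono mult_mono) auto
    finally show ?thesis by simp
  qed
  moreover have "\<bar>z $ a - z' $ a\<bar> \<le> 2 * norm (z - z')" for a using a[of a] norm_ge_zero[of "z - z'"] by linarith
  ultimately show ?thesis using g unfolding moments_def by auto
qed

definition ball_test :: "real^'m \<Rightarrow> real \<Rightarrow> (real^'m \<Rightarrow> real) \<Rightarrow> real^'m \<Rightarrow> real" where
  "ball_test x s g y = indicator (cball x s) y * g (y - x)"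

definition annulus_test :: "real^'m \<Rightarrow> real \<Rightarrow> real \<Rightarrow> real^'m \<Rightarrow> real" where
  "annulus_test x s \<eta> = indicator {y. \<bar>dist y x - s\<bar> \<le> \<eta>}"

text \<open>A grid of mesh \<open>h ^ 3\<close>. The lower end is \<open>a * h / 2\<close> so that a
  radius of at least \<open>a * h\<close> stays in the grid after being rounded down.\<close>

definition radii :: "real \<Rightarrow> real \<Rightarrow> real \<Rightarrow> real set" where
  "radii a b h = {s. (\<exists>l::nat. s = real l * h ^ 3) \<and> a * h / 2 \<le> s \<and> s \<le> b * h}"

text \<open>Moving centre and radius to a net of mesh \<open>h\<^sup>3\<close> changes the ball only inside an annulus of width
  \<open>3 h\<^sup>3\<close>, whose sampled mass must be controlled too.\<close>

definition tests :: "(real^'m) set \<Rightarrow> real \<Rightarrow> real \<Rightarrow> real \<Rightarrow> (real^'m \<Rightarrow> real) set" where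
  "tests N a b h = (\<lambda>(x, s, g). ball_test x s g) ` (N \<times> radii a b h \<times> moments h) \<union>
     (\<lambda>(x, s). annulus_test x s (3 * h ^ 3)) ` (N \<times> radii a b h)"

lemma radii_card:
  assumes h: "0 < h" "h \<le> 1" and b: "1 \<le> b"
  shows "finite (radii a b h)" "real (card (radii a b h)) \<le> 2 * b * (1 / h) ^ 2"
proof -
  let ?L = "nat \<lfloor>b / h ^ 2\<rfloor>"
  have sub: "radii a b h \<subseteq> (\<lambda>l. real l * h ^ 3) ` {..?L}"
  proof
    fix s assume "s \<in> radii a b h"
    then obtain l :: nat where l: "s = real l * h ^ 3" "s \<le> b * h" by (auto simp: radii_def)
    have "real l * h ^ 3 = (real l * h ^ 2) * h" by (simp add: power2_eq_square power3_eq_cube)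
    then have "(real l * h ^ 2) * h \<le> b * h" using l by linarith
    then have "real l * h ^ 2 \<le> b" by (rule mult_right_le_imp_le) (use h in simp)
    then have "real l \<le> b / h ^ 2" using h by (simp add: field_simps)
    then have "l \<le> ?L" by (simp add: le_nat_floor)
    then show "s \<in> (\<lambda>l. real l * h ^ 3) ` {..?L}" using l by auto
  qed
  then show "finite (radii a b h)" using finite_surj by blast
  have "card (radii a b h) \<le> Suc ?L" using surj_card_le[OF _ sub] by simp
  then have "real (card (radii a b h)) \<le> real (Suc ?L)" using of_nat_mono by blast
  also have "\<dots> \<le> b / h ^ 2 + 1"
  proof -
    have "0 \<le> b / h ^ 2" using b h by simp
    then show ?thesis by simp
  qed
  also have "1 \<le> b / h ^ 2"
  proof -
    have "h ^ 2 \<le> 1" using h by (simp add: power_le_one)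
    then show ?thesis using b h by (simp add: field_simps)
  qed
  finally show "real (card (radii a b h)) \<le> 2 * b * (1 / h) ^ 2" by (simp add: power_divide)
qed

lemma tests_card:
  fixes N :: "(real^'m) set"
  assumes h: "0 < h" "h \<le> 1" and b: "1 \<le> b" and N: "finite N"
  shows "finite (tests N a b h)"
    "real (card (tests N a b h)) \<le> real (card N) * (2 * b * (1 / h) ^ 2) * real (CARD('m) + CARD('m) * CARD('m) + 2)"
proof -
  note R = radii_card[OF h b, of a]
  show "finite (tests N a b h)" unfolding tests_def using N R finite_moments by auto
  have "card (tests N a b h) \<le> card (N \<times> radii a b h \<times> (moments h :: (real^'m \<Rightarrow> real) set)) + card (N \<times> radii a b h)"
    unfolding tests_def by (intro order_trans[OF card_Un_le] add_mono card_image_le) (use N R finite_moments in auto)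
  also have "\<dots> = card N * card (radii a b h) * (card (moments h :: (real^'m \<Rightarrow> real) set) + 1)"
    by (simp add: card_cartesian_product algebra_simps)
  also have "\<dots> \<le> card N * card (radii a b h) * (CARD('m) + CARD('m) * CARD('m) + 2)"
    using card_moments[of h, where 'm='m] by (intro mult_left_mono) auto
  finally have "real (card (tests N a b h)) \<le> real (card N) * real (card (radii a b h)) * real (CARD('m) + CARD('m) * CARD('m) + 2)"
    by (metis of_nat_le_iff of_nat_mult)
  also have "\<dots> \<le> real (card N) * (2 * b * (1 / h) ^ 2) * real (CARD('m) + CARD('m) * CARD('m) + 2)"
    using R by (intro mult_right_mono mult_left_mono) auto
  finally show "real (card (tests N a b h)) \<le> real (card N) * (2 * b * (1 / h) ^ 2) * real (CARD('m) + CARD('m) * CARD('m) + 2)" .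
qed

text \<open>\<open>12 * h \<le> a\<close> makes the half-width \<open>3 * h ^ 3\<close> of a shell
  at most half of any radius of the grid, as \<open>mass_annulus\<close> requires. The bounds on
  \<open>2 * b * h\<close> keep moments on the balls below 1 and the radii within the range of the
  mass bounds.\<close>

definition small_scale :: "real \<Rightarrow> real \<Rightarrow> real \<Rightarrow> real \<Rightarrow> bool" where
  "small_scale r0 a b h \<longleftrightarrow> 0 < a \<and> a \<le> 1 \<and> 1 \<le> b \<and> 0 < h \<and> 12 * h \<le> a \<and> 2 * b * h \<le> 1 \<and> 2 * b * h \<le> r0"

lemma small_scaleD:
  assumes "small_scale r0 a b h"
  shows "0 < h" "h \<le> 1" "h ^ 3 \<le> h" "6 * h ^ 3 \<le> a * h / 2" "h ^ 3 \<le> a * h / 2" "2 * b * h \<le> 1" "b * h + h ^ 3 \<le> 2 * b * h" "0 < a" "1 \<le> b" "a \<le> 1"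
    "2 * b * h \<le> r0" "s \<in> radii a b h \<Longrightarrow> 0 < s \<and> s \<le> b * h \<and> s \<le> r0 \<and> 3 * h ^ 3 \<le> s / 2"
proof -
  show h: "0 < h" "h \<le> 1" and ab: "0 < a" "1 \<le> b" "a \<le> 1" "2 * b * h \<le> 1" "2 * b * h \<le> r0" using assms by (auto simp: small_scale_def)
  have "12 * h * h \<le> a * h" using assms by (auto simp: small_scale_def intro!: mult_right_mono)
  moreover have "h ^ 3 \<le> h * h" using h by (simp add: power3_eq_cube mult_left_le)
  ultimately show 6: "6 * h ^ 3 \<le> a * h / 2" by linarith
  show "h ^ 3 \<le> a * h / 2" using 6 h zero_le_power[of h 3] by linarith
  show h3: "h ^ 3 \<le> h" using \<open>h ^ 3 \<le> h * h\<close> h mult_left_le[of h h] by linarith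
  have "h \<le> b * h" using ab h by (simp add: mult_le_cancel_right1)
  then show "b * h + h ^ 3 \<le> 2 * b * h" using h3 by linarith
  show "0 < s \<and> s \<le> b * h \<and> s \<le> r0 \<and> 3 * h ^ 3 \<le> s / 2" if "s \<in> radii a b h"
  proof -
    have s: "a * h / 2 \<le> s" "s \<le> b * h" using that by (auto simp: radii_def)
    have "0 < a * h" "0 \<le> b * h" using ab h by simp_all
    then show ?thesis using s 6 ab by linarith
  qed
qed

text \<open>Two different reasons lead to the same variance \<open>O(h^(d+2))\<close>: a moment has
  squared size \<open>h^2\<close> on a ball of mass \<open>h^d\<close>, while the indicator of a
  shell is of size 1 on a mass of order \<open>h^(d-1) * h^3\<close>. The 4 is \<open>3 + 1\<close>,
  from the two terms of \<open>mass_annulus\<close>.\<close>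

lemma (in regular_law) tests_bounds:
  assumes s: "small_scale r0 a b h" and N: "N \<subseteq> M" and t: "t \<in> tests N a b h"
  shows "t \<in> borel_measurable borel" "\<bar>t y\<bar> \<le> 1" "expectation (\<lambda>y. (t y)\<^sup>2) \<le> (4 * K * b ^ (d + 2)) * h ^ (d + 2)"
proof -
  note S = small_scaleD[OF s]
  have hd: "0 \<le> h ^ (d + 2)" "b ^ d \<le> b ^ (d + 2)" "b ^ (d - 1) \<le> b ^ (d + 2)"
    using S power_increasing[of d "d + 2" b] power_increasing[of "d - 1" "d + 2" b] by simp_all
  consider x r g where "x \<in> N" "r \<in> radii a b h" "g \<in> moments h" "t = ball_test x r g"
    | x r where "x \<in> N" "r \<in> radii a b h" "t = annulus_test x r (3 * h ^ 3)"
    using t by (auto simp: tests_def)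
  then have "t \<in> borel_measurable borel \<and> (\<forall>y. \<bar>t y\<bar> \<le> 1) \<and> expectation (\<lambda>y. (t y)\<^sup>2) \<le> (4 * K * b ^ (d + 2)) * h ^ (d + 2)"
  proof cases
    case 1
    have r: "0 < r" "r \<le> b * h" "r \<le> r0" using S(12)[OF 1(2)] by auto
    have m: "t \<in> borel_measurable borel"
      unfolding 1(4) ball_test_def[abs_def] using moments_measurable[OF 1(3)]
      by (intro borel_measurable_times borel_measurable_indicator measurable_compose[OF _ moments_measurable[OF 1(3)]]) auto
    have tb: "\<bar>t y\<bar> \<le> b * h * indicator (cball x r) y" for y
    proof (cases "y \<in> cball x r")
      case True
      then have "norm (y - x) \<le> b * h" using r by (simp add: dist_norm norm_minus_commute)
      then have "\<bar>g (y - x)\<bar> \<le> b * h" by (rule moments_bound[OF 1(3)]) (use S in auto)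
      then show ?thesis using True by (simp add: 1(4) ball_test_def)
    qed (simp add: 1(4) ball_test_def)
    have bh: "0 \<le> b * h" "b * h \<le> 1" using S by auto
    have t1: "\<bar>t y\<bar> \<le> 1" for y using tb[of y] bh by (cases "y \<in> cball x r") (simp_all add: indicator_def)
    have "expectation (\<lambda>y. (t y)\<^sup>2) \<le> expectation (\<lambda>y. (b * h)\<^sup>2 * indicator (M \<inter> cball x r) y)"
    proof (rule integral_mono)
      show "integrable \<nu> (\<lambda>y. (t y)\<^sup>2)"
        by (rule integrable_const_bound[of _ 1]) (use measurable_law[OF m] t1 in \<open>auto simp: abs_square_le_1\<close>)
      show "integrable \<nu> (\<lambda>y. (b * h)\<^sup>2 * indicator (M \<inter> cball x r) y)"
        by (intro integrable_mult_right integrable_real_indicator in_sets) (auto simp: emeasure_eq_measure)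
      fix y assume "y \<in> space \<nu>"
      then show "(t y)\<^sup>2 \<le> (b * h)\<^sup>2 * indicator (M \<inter> cball x r) y"
        using power_mono[OF tb[of y], of 2] space_law by (auto simp: indicator_def split: if_splits)
    qed
    also have "\<dots> = (b * h)\<^sup>2 * measure \<nu> (M \<inter> cball x r)"
      using in_sets[of "cball x r"] space_law by (simp add: Int_assoc) (simp add: Int_commute)
    also have "\<dots> \<le> (b * h)\<^sup>2 * (K * (b * h) ^ d)"
    proof (rule mult_left_mono)
      have "measure \<nu> (M \<inter> cball x r) \<le> K * r ^ d" using mass_upper[OF _ r(1,3)] 1(1) N by blast
      also have "\<dots> \<le> K * (b * h) ^ d" using r K by (intro mult_left_mono power_mono) auto
      finally show "measure \<nu> (M \<inter> cball x r) \<le> K * (b * h) ^ d" .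
    qed simp
    also have "\<dots> = (1 * K * b ^ (d + 2)) * h ^ (d + 2)" by (simp add: power_mult_distrib power_add power2_eq_square)
    also have "\<dots> \<le> (4 * K * b ^ (d + 2)) * h ^ (d + 2)" using K S by (intro mult_right_mono) auto
    finally show ?thesis using m t1 by blast
  next
    case 2
    have r: "0 < r" "r \<le> b * h" "r \<le> r0" "3 * h ^ 3 \<le> r / 2" using S(12)[OF 2(2)] by auto
    let ?T = "{y. \<bar>dist y x - r\<bar> \<le> 3 * h ^ 3}"
    have m: "t \<in> borel_measurable borel" unfolding 2(3) annulus_test_def using annulus_borel by auto
    have t1: "\<bar>t y\<bar> \<le> 1" for y by (simp add: 2(3) annulus_test_def indicator_def)
    have "expectation (\<lambda>y. (t y)\<^sup>2) = expectation (\<lambda>y. indicator (M \<inter> ?T) y)"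
      by (intro Bochner_Integration.integral_cong) (auto simp: 2(3) annulus_test_def indicator_def space_law)
    also have "\<dots> = measure \<nu> (M \<inter> ?T)" using space_law by (simp add: Int_ac)
    also have "\<dots> \<le> K * (r ^ (d - 1) * (3 * h ^ 3) + r ^ (d + 2))"
      using mass_annulus[OF _ r(1,3) _ r(4)] 2(1) N S by auto
    also have "\<dots> \<le> K * ((b * h) ^ (d - 1) * (3 * h ^ 3) + (b * h) ^ (d + 2))"
      using r K S by (intro mult_left_mono add_mono mult_right_mono power_mono) auto
    also have "(b * h) ^ (d - 1) * (3 * h ^ 3) = 3 * b ^ (d - 1) * h ^ (d + 2)"
    proof -
      have "h ^ (d - 1) * h ^ 3 = h ^ (d + 2)" using d by (simp flip: power_add)
      then show ?thesis by (simp add: power_mult_distrib)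
    qed
    also have "K * (3 * b ^ (d - 1) * h ^ (d + 2) + (b * h) ^ (d + 2)) \<le> K * (3 * b ^ (d + 2) * h ^ (d + 2) + (b * h) ^ (d + 2))"
      using K S hd by (intro mult_left_mono add_right_mono mult_right_mono) auto
    also have "\<dots> = (4 * K * b ^ (d + 2)) * h ^ (d + 2)" by (simp add: power_mult_distrib algebra_simps)
    finally show ?thesis using m t1 by blast
  qed
  then show "t \<in> borel_measurable borel" "\<bar>t y\<bar> \<le> 1" "expectation (\<lambda>y. (t y)\<^sup>2) \<le> (4 * K * b ^ (d + 2)) * h ^ (d + 2)" by auto
qed

lemma ball_test_in_tests: "x \<in> N \<Longrightarrow> s \<in> radii a b h \<Longrightarrow> g \<in> moments h \<Longrightarrow> ball_test x s g \<in> tests N a b h"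
  unfolding tests_def by (rule UnI1, rule image_eqI[of _ _ "(x, s, g)"]) auto

lemma annulus_test_in_tests: "x \<in> N \<Longrightarrow> s \<in> radii a b h \<Longrightarrow> annulus_test x s (3 * h ^ 3) \<in> tests N a b h"
  unfolding tests_def by (rule UnI2, rule image_eqI[of _ _ "(x, s)"]) auto

section \<open>Deterministic consequences of a sampling bound\<close>

context regular_law

begin

text \<open>Everything that is required of a realization \<open>Y\<close> at one \<open>n\<close>:
  its tests over a net deviate by at most \<open>s\<close> from their means. No probability is
  involved in what is derived from it.\<close>

definition sampling_bound :: "nat \<Rightarrow> (nat \<Rightarrow> real^'m) \<Rightarrow> (real^'m) set \<Rightarrow> real \<Rightarrow> real \<Rightarrow> real \<Rightarrow> real \<Rightarrow> bool" where
  "sampling_bound n Y N a b h s \<longleftrightarrow> small_scale r0 a b h \<and> N \<subseteq> M \<and> (\<forall>x\<in>M. \<exists>y\<in>N. dist x y \<le> h ^ 3) \<and> 0 \<le> s \<and>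
     (\<forall>t\<in>tests N a b h. \<bar>(\<Sum>i=1..n. t (Y i)) - real n * expectation t\<bar> \<le> s)"

text \<open>The 4 multiplies \<open>s\<close>: once for the test over the net and three times for
  the comparison of sampled sums. The other two terms are twice the expected cost of the comparison,
  since it is paid both by the sample sum and by the expectation.\<close>

definition err_const :: "real \<Rightarrow> real" where
  "err_const b = 4 + 4 * K * b ^ d + 16 * K * b ^ (d + 3)"

lemma ball_test_measurable: "g \<in> moments h \<Longrightarrow> ball_test x r g \<in> borel_measurable borel"
  unfolding ball_test_def[abs_def]
  by (intro borel_measurable_times borel_measurable_indicator measurable_compose[OF _ moments_measurable]) auto

lemma ball_test_bounded:
  assumes s: "small_scale r0 a b h" and r: "r \<le> b * h" and g: "g \<in> moments h"
  shows "\<bar>ball_test x r g y\<bar> \<le> 1"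
proof -
  note S = small_scaleD[OF s]
  show ?thesis
  proof (cases "y \<in> cball x r")
    case True
    have bh: "b * h \<le> 1" "0 \<le> b * h" using S by auto
    have "norm (y - x) \<le> b * h" using r True by (simp add: dist_norm norm_minus_commute)
    then have "\<bar>g (y - x)\<bar> \<le> b * h" by (rule moments_bound[OF g]) (use S in auto)
    then show ?thesis using True bh by (simp add: ball_test_def)
  qed (simp add: ball_test_def)
qed

lemma ball_test_integrable:
  assumes s: "small_scale r0 a b h" and r: "r \<le> b * h" and g: "g \<in> moments h"
  shows "integrable \<nu> (ball_test x r g)"
  by (rule integrable_const_bound[of _ 1])
    (use measurable_law[OF ball_test_measurable[OF g]] ball_test_bounded[OF assms] in auto)

lemma expectation_const_test:
  "expectation (ball_test x r (\<lambda>z. h)) = h * measure \<nu> (M \<inter> cball x r)"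
proof -
  have "expectation (ball_test x r (\<lambda>z. h)) = expectation (\<lambda>y. h * indicator (M \<inter> cball x r) y)"
    by (intro Bochner_Integration.integral_cong) (auto simp: ball_test_def indicator_def space_law)
  then show ?thesis using space_law by (simp add: Int_ac)
qed

lemma const_moment: "(\<lambda>z. h) \<in> moments h"
  by (simp add: moments_def)

text \<open>Passes from net centres and grid radii to all centres and radii. The difference of the
  two ball tests is dominated by tests of the family itself, so its sampled sum is controlled by the
  same hypothesis.\<close>

lemma sampling_error:
  assumes sb: "sampling_bound n Y N a b h s" and x: "x \<in> M" and r: "a * h \<le> r" "r \<le> b * h" and g: "g \<in> moments h"
  shows "\<bar>(\<Sum>i=1..n. ball_test x r g (Y i)) - real n * expectation (ball_test x r g)\<bar> \<le> err_const b * (real n * h ^ (d + 3) + s)"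
proof -
  have ss: "small_scale r0 a b h" and N: "N \<subseteq> M" and net: "\<exists>y\<in>N. dist x y \<le> h ^ 3" and s0: "0 \<le> s"
    and conc: "\<And>t. t \<in> tests N a b h \<Longrightarrow> \<bar>(\<Sum>i=1..n. t (Y i)) - real n * expectation t\<bar> \<le> s"
    using sb x by (auto simp: sampling_bound_def)
  note S = small_scaleD[OF ss]
  let ?\<delta> = "h ^ 3"
  have \<delta>: "?\<delta> > 0" using S by simp
  obtain z where z: "z \<in> N" "dist x z \<le> ?\<delta>" using net by blast
  have zM: "z \<in> M" using z N by blast
  have ah: "0 < a * h" using S by simp
  \<comment> \<open>The radius is rounded down to the grid, losing less than
    \<open>h ^ 3\<close>.\<close>
  define l where "l = nat \<lfloor>r / ?\<delta>\<rfloor>"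
  define q where "q = real l * ?\<delta>"
  have q: "q \<le> r" "r < q + ?\<delta>"
  proof -
    have rd: "0 \<le> r / ?\<delta>" using r ah \<delta> by simp
    have "real l \<le> r / ?\<delta>" "r / ?\<delta> < real l + 1" using rd unfolding l_def by linarith+
    then show "q \<le> r" "r < q + ?\<delta>" using \<delta> by (auto simp: q_def field_simps)
  qed
  have qR: "q \<in> radii a b h" using q r S(5) by (auto simp: radii_def q_def intro!: exI[of _ l])
  note Q = S(12)[OF qR]
  let ?T = "ball_test x r g" let ?Tz = "ball_test z q g" let ?U = "ball_test z q (\<lambda>_. h)" let ?V = "annulus_test z q (3 * ?\<delta>)"
  have tin: "?Tz \<in> tests N a b h" "?U \<in> tests N a b h" "?V \<in> tests N a b h"
    using ball_test_in_tests[OF z(1) qR g] ball_test_in_tests[OF z(1) qR const_moment] annulus_test_in_tests[OF z(1) qR] by auto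
  have U01: "?U y \<ge> 0" "?V y \<ge> 0" for y using S by (auto simp: ball_test_def annulus_test_def)
  \<comment> \<open>On the intersection of the two balls the moment changes by its Lipschitz
    constant 2 times \<open>h ^ 3\<close>, which is \<open>2 * h ^ 2 * ?U\<close> because
    \<open>?U\<close> has the value \<open>h\<close> there. Points in just one of the balls lie in
    the shell \<open>?V\<close>, and the moment is at most \<open>2 * b * h\<close>.\<close>
  let ?D = "\<lambda>y. 2 * h ^ 2 * ?U y + 2 * b * h * ?V y"
  have pw: "\<bar>?T y - ?Tz y\<bar> \<le> ?D y" for y
  proof -
    have dxz: "dist y z \<le> dist y x + ?\<delta>" "dist y x \<le> dist y z + ?\<delta>"
      using dist_triangle[of y z x] dist_triangle[of y x z] z(2) by (simp_all add: dist_commute)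
    have D0: "0 \<le> 2 * h ^ 2 * ?U y" "0 \<le> 2 * b * h * ?V y" using U01[of y] S by simp_all
    have gb: "\<bar>g w\<bar> \<le> 2 * b * h" if "norm w \<le> 2 * b * h" for w
      using moments_bound[OF g, of w "2 * b"] that S by simp
    have bh: "b * h \<le> 2 * b * h" using S by simp
    show ?thesis
    proof (cases "dist y x \<le> r")
      case True
      show ?thesis
      proof (cases "dist y z \<le> q")
        case True2: True
        have U: "?U y = h" using True2 by (simp add: ball_test_def dist_commute)
        have n1: "norm (y - x) \<le> 1" "norm (y - z) \<le> 1" using True True2 r Q S(6) bh by (simp_all add: dist_norm)
        have "\<bar>?T y - ?Tz y\<bar> = \<bar>g (y - x) - g (y - z)\<bar>" using True True2 by (simp add: ball_test_def dist_commute)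
        also have "\<dots> \<le> 2 * norm ((y - x) - (y - z))" by (rule moments_lipschitz[OF g n1])
        also have "\<dots> \<le> 2 * ?\<delta>" using z(2) by (simp add: dist_norm norm_minus_commute)
        also have "\<dots> = 2 * h ^ 2 * ?U y" unfolding U by (simp add: power3_eq_cube power2_eq_square)
        finally show ?thesis using D0 by linarith
      next
        case False
        have "\<bar>dist y z - q\<bar> \<le> 3 * ?\<delta>" using False dxz True q by linarith
        then have V: "?V y = 1" by (simp add: annulus_test_def)
        have "\<bar>?T y - ?Tz y\<bar> = \<bar>g (y - x)\<bar>" using True False by (simp add: ball_test_def dist_commute)
        also have "\<dots> \<le> 2 * b * h" by (rule gb) (use True r bh in \<open>simp add: dist_norm\<close>)
        finally show ?thesis using D0 V by simp
      qed
    next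
      case False
      show ?thesis
      proof (cases "dist y z \<le> q")
        case True
        have "\<bar>dist y z - q\<bar> \<le> 3 * ?\<delta>" using False dxz True q \<delta> by linarith
        then have V: "?V y = 1" by (simp add: annulus_test_def)
        have "\<bar>?T y - ?Tz y\<bar> = \<bar>g (y - z)\<bar>" using True False by (simp add: ball_test_def dist_commute)
        also have "\<dots> \<le> 2 * b * h" by (rule gb) (use True Q bh in \<open>simp add: dist_norm\<close>)
        finally show ?thesis using D0 V by simp
      next
        case f: False
        then show ?thesis using False D0 by (simp add: ball_test_def dist_commute)
      qed
    qed
  qed
  have iT: "integrable \<nu> ?T" using ball_test_integrable[OF ss r(2) g] .
  have iTz: "integrable \<nu> ?Tz" and iU: "integrable \<nu> ?U" using ball_test_integrable[OF ss _ g] ball_test_integrable[OF ss _ const_moment] Q by auto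
  note tb = tests_bounds[OF ss N]
  have iV: "integrable \<nu> ?V"
    by (rule integrable_const_bound[of _ 1]) (use measurable_law[OF tb(1)[OF tin(3)]] tb(2)[OF tin(3)] in auto)
  have EU: "expectation ?U \<le> K * b ^ d * h ^ (d + 1)"
  proof -
    have "measure \<nu> (M \<inter> cball z q) \<le> K * q ^ d" using mass_upper[OF zM] Q by blast
    also have "\<dots> \<le> K * (b * h) ^ d" using Q K by (intro mult_left_mono power_mono) auto
    finally have "h * measure \<nu> (M \<inter> cball z q) \<le> h * (K * (b * h) ^ d)" using S by (intro mult_left_mono) auto
    then show ?thesis unfolding expectation_const_test by (simp add: power_mult_distrib algebra_simps)
  qed
  have EV: "expectation ?V \<le> 4 * K * b ^ (d + 2) * h ^ (d + 2)"
  proof -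
    have "(\<lambda>y. (?V y)\<^sup>2) = ?V" by (auto simp: annulus_test_def indicator_def fun_eq_iff)
    then show ?thesis using tb(3)[OF tin(3)] by (simp only:)
  qed
  define c where "c = real n * h ^ (d + 3)"
  have E: "real n * (2 * h ^ 2 * expectation ?U + 2 * b * h * expectation ?V) \<le> (2 * K * b ^ d + 8 * K * b ^ (d + 3)) * c"
  proof -
    have "2 * h ^ 2 * expectation ?U + 2 * b * h * expectation ?V \<le> 2 * h ^ 2 * (K * b ^ d * h ^ (d + 1)) + 2 * b * h * (4 * K * b ^ (d + 2) * h ^ (d + 2))"
      using EU EV S by (intro add_mono mult_left_mono) auto
    also have "\<dots> = (2 * K * b ^ d + 8 * K * b ^ (d + 3)) * h ^ (d + 3)"
      by (simp add: power_add power2_eq_square power3_eq_cube algebra_simps)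
    finally have "real n * (2 * h ^ 2 * expectation ?U + 2 * b * h * expectation ?V) \<le> real n * ((2 * K * b ^ d + 8 * K * b ^ (d + 3)) * h ^ (d + 3))"
      by (rule mult_left_mono) simp
    then show ?thesis by (simp add: c_def algebra_simps)
  qed
  have sumD: "\<bar>(\<Sum>i=1..n. ?T (Y i)) - (\<Sum>i=1..n. ?Tz (Y i))\<bar> \<le> 2 * h ^ 2 * (real n * expectation ?U + s) + 2 * b * h * (real n * expectation ?V + s)"
  proof -
    have "\<bar>(\<Sum>i=1..n. ?T (Y i)) - (\<Sum>i=1..n. ?Tz (Y i))\<bar> \<le> (\<Sum>i=1..n. ?D (Y i))"
      unfolding sum_subtractf[symmetric] by (rule order_trans[OF sum_abs sum_mono]) (use pw in blast)
    also have "\<dots> = 2 * h ^ 2 * (\<Sum>i=1..n. ?U (Y i)) + 2 * b * h * (\<Sum>i=1..n. ?V (Y i))"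
      by (simp add: sum.distrib sum_distrib_left)
    also have "\<dots> \<le> 2 * h ^ 2 * (real n * expectation ?U + s) + 2 * b * h * (real n * expectation ?V + s)"
    proof (intro add_mono mult_left_mono)
      show "(\<Sum>i=1..n. ?U (Y i)) \<le> real n * expectation ?U + s" using conc[OF tin(2)] by linarith
      show "(\<Sum>i=1..n. ?V (Y i)) \<le> real n * expectation ?V + s" using conc[OF tin(3)] by linarith
    qed (use S in auto)
    finally show ?thesis .
  qed
  have ED: "\<bar>expectation ?T - expectation ?Tz\<bar> \<le> 2 * h ^ 2 * expectation ?U + 2 * b * h * expectation ?V"
  proof -
    have "\<bar>expectation (\<lambda>y. ?T y - ?Tz y)\<bar> \<le> expectation ?D"
      using Bochner_Integration.integral_norm_bound_integral[of \<nu> "\<lambda>y. ?T y - ?Tz y" ?D] iT iTz iU iV pw by simp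
    then show ?thesis using iT iTz iU iV by simp
  qed
  have nED: "\<bar>real n * expectation ?T - real n * expectation ?Tz\<bar> \<le> real n * (2 * h ^ 2 * expectation ?U + 2 * b * h * expectation ?V)"
    using mult_left_mono[OF ED, of "real n"] by (simp add: abs_mult right_diff_distrib[symmetric])
  have sc: "2 * h ^ 2 * s + 2 * b * h * s \<le> 3 * s"
  proof -
    have "h ^ 2 \<le> 1" using S by (simp add: power_le_one)
    then have "2 * h ^ 2 * s \<le> 2 * s" using s0 mult_right_mono[of "h ^ 2" 1 s] by simp
    moreover have "2 * b * h * s \<le> 1 * s" using S(6) s0 by (intro mult_right_mono) auto
    ultimately show ?thesis by linarith
  qed
  have sumD': "\<bar>(\<Sum>i=1..n. ?T (Y i)) - (\<Sum>i=1..n. ?Tz (Y i))\<bar> \<le> real n * (2 * h ^ 2 * expectation ?U + 2 * b * h * expectation ?V) + (2 * h ^ 2 * s + 2 * b * h * s)"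
    using sumD by (simp add: algebra_simps)
  have "\<bar>(\<Sum>i=1..n. ?T (Y i)) - real n * expectation ?T\<bar> \<le> 4 * s + 2 * ((2 * K * b ^ d + 8 * K * b ^ (d + 3)) * c)"
    using conc[OF tin(1)] sumD' nED E sc by linarith
  also have "\<dots> \<le> err_const b * (c + s)"
  proof -
    have "0 \<le> 4 * c" "0 \<le> (4 * K * b ^ d + 16 * K * b ^ (d + 3)) * s" using S K s0 by (simp_all add: c_def)
    then show ?thesis by (simp add: err_const_def algebra_simps)
  qed
  finally show ?thesis by (simp add: c_def)
qed

lemma ball_count:
  "(\<Sum>i=1..n. of_bool (norm (x - Y i) \<le> r)) * h = (\<Sum>i=1..n. ball_test x r (\<lambda>_. h) (Y i))"
  by (simp add: sum_distrib_right ball_test_def indicator_def dist_norm of_bool_def if_distrib cong: if_cong)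

text \<open>At radius \<open>a * h\<close> the expected count is at most \<open>k / 4\<close>, at
  radius \<open>b * h\<close> at least \<open>2 * k\<close>, and fluctuations are at most
  \<open>k / 4\<close>; monotonicity of the count confines the infimum. The factor \<open>h\<close>
  in the error hypothesis is the value of the constant moment through which points are
  counted.\<close>

lemma knn_radius_bounds:
  assumes sb: "sampling_bound n Y N a b h s" and x: "x \<in> M"
    and k: "real k = real n * h ^ d" "0 < k" and a: "4 * K * a ^ d \<le> 1" and b: "2 * K \<le> b ^ d"
    and err: "err_const b * (real n * h ^ (d + 3) + s) \<le> h * real k / 4"
  shows "a * h \<le> knn_radius Y n k x" "knn_radius Y n k x \<le> b * h"
proof -
  have ss: "small_scale r0 a b h" using sb by (simp add: sampling_bound_def)
  note S = small_scaleD[OF ss]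
  let ?c = "\<lambda>r. (\<Sum>i=1..n. of_bool (norm (x - Y i) \<le> r)) :: real"
  have mono: "?c r \<le> ?c r'" if "r \<le> r'" for r r' by (rule sum_mono) (use that in auto)
  have ab: "a * h \<le> b * h" "0 < a * h" "0 < b * h" using S by auto
  have bhr: "b * h \<le> r0" "a * h \<le> r0" using S ab by linarith+
  have est: "\<bar>?c r - real n * measure \<nu> (M \<inter> cball x r)\<bar> \<le> real k / 4" if r: "a * h \<le> r" "r \<le> b * h" for r
  proof -
    have "\<bar>?c r * h - real n * (h * measure \<nu> (M \<inter> cball x r))\<bar> \<le> h * real k / 4"
      using order_trans[OF sampling_error[OF sb x r const_moment] err] unfolding ball_count[symmetric] expectation_const_test .
    moreover have "?c r * h - real n * (h * measure \<nu> (M \<inter> cball x r)) = h * (?c r - real n * measure \<nu> (M \<inter> cball x r))"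
      by (simp add: algebra_simps)
    ultimately have "\<bar>h\<bar> * \<bar>?c r - real n * measure \<nu> (M \<inter> cball x r)\<bar> \<le> h * (real k / 4)"
      by (simp add: abs_mult)
    then have "h * \<bar>?c r - real n * measure \<nu> (M \<inter> cball x r)\<bar> \<le> h * (real k / 4)" using S(1) by simp
    then show ?thesis using S(1) by simp
  qed
  have k0: "0 < real k" using k(2) by simp
  have lo: "?c (a * h) < real k"
  proof -
    have "measure \<nu> (M \<inter> cball x (a * h)) \<le> K * (a * h) ^ d" using mass_upper[OF x ab(2) bhr(2)] .
    then have "real n * measure \<nu> (M \<inter> cball x (a * h)) \<le> real n * (K * (a * h) ^ d)" by (rule mult_left_mono) simp
    also have "\<dots> = (K * a ^ d) * real k" unfolding k by (simp add: power_mult_distrib)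
    also have "\<dots> \<le> 1/4 * real k" using a by (intro mult_right_mono) auto
    finally show ?thesis using est[OF order_refl ab(1)] k0 by linarith
  qed
  have hi: "real k \<le> ?c (b * h)"
  proof -
    have "(b * h) ^ d \<le> K * measure \<nu> (M \<inter> cball x (b * h))" using mass_lower[OF x ab(3) bhr(1)] .
    then have "real n * (b * h) ^ d \<le> real n * (K * measure \<nu> (M \<inter> cball x (b * h)))" by (rule mult_left_mono) simp
    moreover have "real n * (b * h) ^ d = b ^ d * real k" unfolding k by (simp add: power_mult_distrib)
    moreover have "2 * K * real k \<le> b ^ d * real k" using b by (intro mult_right_mono) auto
    moreover have "real n * (K * measure \<nu> (M \<inter> cball x (b * h))) = K * (real n * measure \<nu> (M \<inter> cball x (b * h)))"
      "2 * K * real k = K * (2 * real k)" by simp_all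
    ultimately have "K * (2 * real k) \<le> K * (real n * measure \<nu> (M \<inter> cball x (b * h)))" by linarith
    then have "2 * real k \<le> real n * measure \<nu> (M \<inter> cball x (b * h))" using K by simp
    then show ?thesis using est[OF ab(1) order_refl] k0 by linarith
  qed
  let ?A = "{r. r \<ge> 0 \<and> ?c r \<ge> real k}"
  have bA: "b * h \<in> ?A" using hi ab by simp
  have low: "a * h \<le> r" if "r \<in> ?A" for r using mono[of r "a * h"] lo that by force
  show "a * h \<le> knn_radius Y n k x" unfolding knn_radius_def using bA low by (intro cInf_greatest) auto
  show "knn_radius Y n k x \<le> b * h" unfolding knn_radius_def
    by (rule cInf_lower[OF bA]) (rule bdd_belowI[of _ 0], simp)
qed

end

section \<open>From moments to arbitrary functions and to the kNN Laplacian\<close>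

lemma linear_components:
  fixes \<alpha> :: "real^'m \<Rightarrow> real"
  assumes "linear \<alpha>" shows "\<alpha> z = (\<Sum>a\<in>UNIV. \<alpha> (axis a 1) * z $ a)"
proof -
  have "z = (\<Sum>a\<in>UNIV. z $ a *\<^sub>R axis a 1)"
    using euclidean_representation[of z, symmetric] by (simp add: sum_Basis_vec inner_axis)
  then have "\<alpha> z = \<alpha> (\<Sum>a\<in>UNIV. z $ a *\<^sub>R axis a 1)" by metis
  also have "\<dots> = (\<Sum>a\<in>UNIV. \<alpha> (axis a 1) * z $ a)" by (simp add: linear_sum[OF assms] linear_cmul[OF assms] mult.commute)
  finally show ?thesis .
qed

lemma bilinear_components:
  fixes \<beta> :: "real^'m \<Rightarrow> real^'m \<Rightarrow> real"
  assumes "bounded_bilinear \<beta>" shows "\<beta> z z = (\<Sum>a\<in>UNIV. \<Sum>b\<in>UNIV. \<beta> (axis a 1) (axis b 1) * (z $ a * z $ b))"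
proof -
  interpret bounded_bilinear \<beta> by fact
  have l: "linear (\<lambda>y. \<beta> y z)" "linear (\<beta> x)" for x
    by (rule bounded_linear.linear[OF bounded_linear_left] bounded_linear.linear[OF bounded_linear_right])+
  have "\<beta> z z = (\<Sum>a\<in>UNIV. \<beta> (axis a 1) z * z $ a)" by (rule linear_components[OF l(1)])
  also have "\<dots> = (\<Sum>a\<in>UNIV. (\<Sum>b\<in>UNIV. \<beta> (axis a 1) (axis b 1) * z $ b) * z $ a)"
    by (intro sum.cong refl arg_cong2[where f="(*)"] linear_components[OF l(2)])
  finally show ?thesis by (simp add: sum_distrib_left ac_simps)
qed

context regular_law

begin

text \<open>The expansion of \<open>f\<close> splits its increment into a combination of moments,
  with coefficients bounded by \<open>C\<close>, and a cubic remainder. The remainder is a different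
  function for each \<open>f\<close> and cannot be a test, but it is dominated by a multiple of the
  constant moment, which is one.\<close>

lemma expansion_sampling_error:
  fixes f :: "real^'m \<Rightarrow> real" and C a b h s :: real
  assumes sb: "sampling_bound n Y N a b h s" and x: "x \<in> M" and r: "a * h \<le> r" "r \<le> b * h" and Y: "\<And>i. i \<in> {1..n} \<Longrightarrow> Y i \<in> M"
    and mf: "f \<in> borel_measurable \<nu>" and \<alpha>: "linear \<alpha>" "\<And>z. \<bar>\<alpha> z\<bar> \<le> C * norm z"
    and \<beta>: "bounded_bilinear \<beta>" "\<And>y z. \<bar>\<beta> y z\<bar> \<le> C * norm y * norm z" and C: "0 \<le> C"
    and ex: "\<And>y. y \<in> M \<Longrightarrow> dist y x \<le> r \<Longrightarrow> \<bar>f y - f x - \<alpha> (y - x) - \<beta> (y - x) (y - x)\<bar> \<le> C * norm (y - x) ^ 3"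
  shows "\<bar>(\<Sum>i=1..n. indicator (cball x r) (Y i) * (f (Y i) - f x)) - real n * expectation (\<lambda>y. indicator (cball x r) y * (f y - f x))\<bar>
    \<le> C * (CARD('m) + CARD('m)^2 + b ^ 3) * (err_const b * (real n * h ^ (d + 3) + s)) + 2 * C * K * b ^ (d + 3) * (real n * h ^ (d + 3))"
proof -
  have ss: "small_scale r0 a b h" using sb by (simp add: sampling_bound_def)
  note S = small_scaleD[OF ss]
  have r0': "0 < r" "r \<le> 1" "r \<le> r0"
  proof -
    have "0 < a * h" "0 \<le> b * h" using S by simp_all
    then show "0 < r" "r \<le> 1" "r \<le> r0" using r S(6,11) by linarith+
  qed
  define err where "err = err_const b * (real n * h ^ (d + 3) + s)"
  let ?L = "\<lambda>a. ball_test x r (\<lambda>z. z $ a)" and ?Q = "\<lambda>a b. ball_test x r (\<lambda>z. z $ a * z $ b)" and ?U = "ball_test x r (\<lambda>_. h)"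
  have mom: "(\<lambda>z. z $ a) \<in> moments h" "(\<lambda>z. z $ a * z $ b) \<in> moments h" for a b :: 'm
    by (auto simp: moments_def intro: image_eqI[of _ _ "(a, b)"])
  let ?\<Delta> = "\<lambda>t. (\<Sum>i=1..n. t (Y i)) - real n * expectation t"
  have e: "\<bar>?\<Delta> (?L a)\<bar> \<le> err" "\<bar>?\<Delta> (?Q a b)\<bar> \<le> err" "\<bar>?\<Delta> ?U\<bar> \<le> err" for a b
    unfolding err_def by (intro sampling_error[OF sb x r] mom const_moment)+
  have iL: "integrable \<nu> (?L a)" and iQ: "integrable \<nu> (?Q a b)" and iU: "integrable \<nu> ?U" for a b
    by (intro ball_test_integrable[OF ss r(2)] mom const_moment)+
  define G where "G y = indicator (cball x r) y * (f y - f x)" for y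
  define lin where "lin y = (\<Sum>a\<in>UNIV. \<alpha> (axis a 1) * ?L a y) + (\<Sum>a\<in>UNIV. \<Sum>b\<in>UNIV. \<beta> (axis a 1) (axis b 1) * ?Q a b y)" for y
  have linI: "lin y = indicator (cball x r) y * (\<alpha> (y - x) + \<beta> (y - x) (y - x))" for y
    unfolding arg_cong2[OF linear_components[OF \<alpha>(1), of "y - x"] bilinear_components[OF \<beta>(1), of "y - x"], of "(+)"] lin_def
    unfolding ball_test_def distrib_left sum_distrib_left by (intro arg_cong2[where f="(+)"] sum.cong refl) (simp_all only: ac_simps)
  define R where "R y = G y - lin y" for y
  \<comment> \<open>The remainder is at most \<open>C * r ^ 3\<close> on the ball, where
    \<open>?U\<close> equals \<open>h\<close>; hence the division. As \<open>r\<close> is of order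
    \<open>h\<close>, this factor is \<open>O(h^2)\<close>.\<close>
  let ?c = "C * r ^ 3 / h"
  have c0: "0 \<le> ?c" using C r0' S by simp
  have Rb: "\<bar>R y\<bar> \<le> ?c * ?U y" if y: "y \<in> M" for y
  proof (cases "dist y x \<le> r")
    case True
    have "R y = f y - f x - \<alpha> (y - x) - \<beta> (y - x) (y - x)" using True by (simp add: R_def G_def linI dist_commute)
    then have "\<bar>R y\<bar> \<le> C * norm (y - x) ^ 3" using ex[OF y True] by simp
    also have "\<dots> \<le> C * r ^ 3" using True C by (intro mult_left_mono power_mono) (auto simp: dist_norm)
    also have "\<dots> = ?c * ?U y" using True S by (simp add: ball_test_def dist_commute)
    finally show ?thesis .
  qed (simp add: R_def G_def linI ball_test_def dist_commute)
  have ilin: "integrable \<nu> lin"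
    unfolding lin_def[abs_def] by (intro Bochner_Integration.integrable_add Bochner_Integration.integrable_sum integrable_mult_right iL iQ)
  have mG: "G \<in> borel_measurable \<nu>"
    unfolding G_def[abs_def]
    by (intro borel_measurable_times borel_measurable_diff measurable_law mf borel_measurable_indicator borel_measurable_const) auto
  have iR: "integrable \<nu> R"
  proof (rule Bochner_Integration.integrable_bound)
    show "integrable \<nu> (\<lambda>y. ?c * ?U y)" by (intro integrable_mult_right iU)
    show "R \<in> borel_measurable \<nu>" unfolding R_def[abs_def] using mG borel_measurable_integrable[OF ilin] by measurable
    show "AE y in \<nu>. norm (R y) \<le> norm (?c * ?U y)"
    proof (rule AE_I2)
      fix y assume "y \<in> space \<nu>"
      then have "\<bar>R y\<bar> \<le> ?c * ?U y" using Rb space_law by blast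
      then show "norm (R y) \<le> norm (?c * ?U y)" unfolding real_norm_def by linarith
    qed
  qed
  have GR: "G y = lin y + R y" for y by (simp add: R_def)
  have EG: "expectation G = expectation lin + expectation R"
    unfolding GR[abs_def] by (rule Bochner_Integration.integral_add[OF ilin iR])
  have Elin: "expectation lin = (\<Sum>a\<in>UNIV. \<alpha> (axis a 1) * expectation (?L a)) + (\<Sum>a\<in>UNIV. \<Sum>b\<in>UNIV. \<beta> (axis a 1) (axis b 1) * expectation (?Q a b))"
    unfolding lin_def[abs_def] by (simp add: iL iQ)
  have Slin: "(\<Sum>i=1..n. lin (Y i)) = (\<Sum>a\<in>UNIV. \<alpha> (axis a 1) * (\<Sum>i=1..n. ?L a (Y i))) + (\<Sum>a\<in>UNIV. \<Sum>b\<in>UNIV. \<beta> (axis a 1) (axis b 1) * (\<Sum>i=1..n. ?Q a b (Y i)))"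
  proof -
    have "(\<Sum>i=1..n. lin (Y i)) = (\<Sum>i=1..n. \<Sum>a\<in>UNIV. \<alpha> (axis a 1) * ?L a (Y i)) + (\<Sum>i=1..n. \<Sum>a\<in>UNIV. \<Sum>b\<in>UNIV. \<beta> (axis a 1) (axis b 1) * ?Q a b (Y i))"
      by (simp add: lin_def sum.distrib)
    also have "(\<Sum>i=1..n. \<Sum>a\<in>UNIV. \<alpha> (axis a 1) * ?L a (Y i)) = (\<Sum>a\<in>UNIV. \<alpha> (axis a 1) * (\<Sum>i=1..n. ?L a (Y i)))"
      by (subst sum.swap) (simp add: sum_distrib_left)
    also have "(\<Sum>i=1..n. \<Sum>a\<in>UNIV. \<Sum>b\<in>UNIV. \<beta> (axis a 1) (axis b 1) * ?Q a b (Y i)) = (\<Sum>a\<in>UNIV. \<Sum>b\<in>UNIV. \<beta> (axis a 1) (axis b 1) * (\<Sum>i=1..n. ?Q a b (Y i)))"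
      by (rule trans[OF sum.swap], intro sum.cong refl, rule trans[OF sum.swap]) (simp add: sum_distrib_left)
    finally show ?thesis .
  qed
  have \<Delta>lin: "?\<Delta> lin = (\<Sum>a\<in>UNIV. \<alpha> (axis a 1) * ?\<Delta> (?L a)) + (\<Sum>a\<in>UNIV. \<Sum>b\<in>UNIV. \<beta> (axis a 1) (axis b 1) * ?\<Delta> (?Q a b))"
    unfolding Elin Slin by (simp add: right_diff_distrib sum_subtractf distrib_left sum_distrib_left ac_simps)
  have err0: "0 \<le> err" using e(3) by linarith
  have "\<bar>?\<Delta> lin\<bar> \<le> (\<Sum>a\<in>(UNIV::'m set). C * err) + (\<Sum>a\<in>(UNIV::'m set). \<Sum>b\<in>(UNIV::'m set). C * err)"
    unfolding \<Delta>lin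
  proof (intro order_trans[OF abs_triangle_ineq] add_mono order_trans[OF sum_abs] sum_mono)
    fix a b :: 'm
    show "\<bar>\<alpha> (axis a 1) * ?\<Delta> (?L a)\<bar> \<le> C * err" unfolding abs_mult
      using \<alpha>(2)[of "axis a 1"] e(1)[of a] C by (intro mult_mono) (auto simp: norm_axis_1)
    show "\<bar>\<beta> (axis a 1) (axis b 1) * ?\<Delta> (?Q a b)\<bar> \<le> C * err" unfolding abs_mult
      using \<beta>(2)[of "axis a 1" "axis b 1"] e(2)[of a b] C by (intro mult_mono) (auto simp: norm_axis_1)
  qed
  then have l: "\<bar>?\<Delta> lin\<bar> \<le> C * (CARD('m) + CARD('m)^2) * err" by (simp add: algebra_simps power2_eq_square)
  have EU: "expectation ?U \<le> K * b ^ d * h ^ (d + 1)"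
  proof -
    have "measure \<nu> (M \<inter> cball x r) \<le> K * r ^ d" using mass_upper[OF x] r0' by blast
    also have "\<dots> \<le> K * (b * h) ^ d" using r r0' K by (intro mult_left_mono power_mono) auto
    finally have "h * measure \<nu> (M \<inter> cball x r) \<le> h * (K * (b * h) ^ d)" using S by (intro mult_left_mono) auto
    then show ?thesis unfolding expectation_const_test by (simp add: power_mult_distrib algebra_simps)
  qed
  have cb: "?c \<le> C * b ^ 3 * h ^ 2"
  proof -
    have "C * r ^ 3 \<le> C * (b * h) ^ 3" using r r0' C by (intro mult_left_mono power_mono) auto
    then show ?thesis using S by (simp add: power_mult_distrib field_simps power2_eq_square power3_eq_cube)
  qed
  have cb1: "?c \<le> C * b ^ 3"
  proof -
    have "h ^ 2 \<le> 1" using S by (simp add: power_le_one)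
    then have "C * b ^ 3 * h ^ 2 \<le> C * b ^ 3 * 1" using C S by (intro mult_left_mono) auto
    then show ?thesis using cb by simp
  qed
  have "\<bar>?\<Delta> R\<bar> \<le> \<bar>\<Sum>i=1..n. R (Y i)\<bar> + real n * \<bar>expectation R\<bar>"
    using abs_triangle_ineq4[of "\<Sum>i=1..n. R (Y i)" "real n * expectation R"] by (simp add: abs_mult)
  also have "\<dots> \<le> ?c * (\<Sum>i=1..n. ?U (Y i)) + real n * (?c * expectation ?U)"
  proof (intro add_mono mult_left_mono)
    show "\<bar>\<Sum>i=1..n. R (Y i)\<bar> \<le> ?c * (\<Sum>i=1..n. ?U (Y i))"
      unfolding sum_distrib_left by (rule order_trans[OF sum_abs sum_mono]) (use Rb Y in blast)
    have "norm (expectation R) \<le> expectation (\<lambda>y. ?c * ?U y)"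
      by (rule Bochner_Integration.integral_norm_bound_integral[OF iR]) (use Rb space_law iU in \<open>auto intro!: integrable_mult_right\<close>)
    then show "\<bar>expectation R\<bar> \<le> ?c * expectation ?U" by simp
  qed simp
  also have "\<dots> \<le> ?c * (real n * expectation ?U + err) + real n * (?c * expectation ?U)"
    using e(3) c0 by (intro add_right_mono mult_left_mono) linarith+
  also have "\<dots> = ?c * err + 2 * (?c * (real n * expectation ?U))" by (simp add: algebra_simps)
  also have "\<dots> \<le> C * b ^ 3 * err + 2 * ((C * b ^ 3 * h ^ 2) * (real n * (K * b ^ d * h ^ (d + 1))))"
  proof -
    have EU0: "0 \<le> expectation ?U" unfolding expectation_const_test using S by simp
    have "real n * expectation ?U \<le> real n * (K * b ^ d * h ^ (d + 1))" using EU by (rule mult_left_mono) simp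
    then have "?c * (real n * expectation ?U) \<le> (C * b ^ 3 * h ^ 2) * (real n * (K * b ^ d * h ^ (d + 1)))"
      by (rule mult_mono[OF cb]) (use C S EU0 in auto)
    then show ?thesis using mult_right_mono[OF cb1 err0] by linarith
  qed
  also have "2 * ((C * b ^ 3 * h ^ 2) * (real n * (K * b ^ d * h ^ (d + 1)))) = 2 * C * K * b ^ (d + 3) * (real n * h ^ (d + 3))"
    by (simp add: power_add power2_eq_square power3_eq_cube)
  finally have RR: "\<bar>?\<Delta> R\<bar> \<le> C * b ^ 3 * err + 2 * C * K * b ^ (d + 3) * (real n * h ^ (d + 3))" .
  have "?\<Delta> G = ?\<Delta> lin + ?\<Delta> R" unfolding EG by (simp add: GR sum.distrib algebra_simps)
  then have "\<bar>?\<Delta> G\<bar> \<le> C * (CARD('m) + CARD('m)^2) * err + (C * b ^ 3 * err + 2 * C * K * b ^ (d + 3) * (real n * h ^ (d + 3)))"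
    using l RR by linarith
  also have "\<dots> = C * (CARD('m) + CARD('m)^2 + b ^ 3) * err + 2 * C * K * b ^ (d + 3) * (real n * h ^ (d + 3))"
    by (simp add: algebra_simps)
  finally show ?thesis unfolding G_def err_def .
qed

lemma knn_laplacian_sum:
  assumes "0 < knn_radius Y n k x"
  shows "knn_laplacian d Y n k f x = (\<Sum>i=1..n. indicator (cball x (knn_radius Y n k x)) (Y i) * (f (Y i) - f x)) / (real n * knn_radius Y n k x ^ (d + 2))"
proof -
  let ?R = "knn_radius Y n k x"
  have "kernel (norm (Y i - x) / ?R) = indicator (cball x ?R) (Y i)" for i
    using assms by (simp add: kernel_def indicator_def dist_norm norm_minus_commute)
  then show ?thesis by (simp add: knn_laplacian_def)
qed

text \<open>The radius is a function of the sample, yet \<open>expansion_sampling_error\<close> and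
  the bias hold for all radii between \<open>a * h\<close> and \<open>b * h\<close> simultaneously,
  so it may simply be inserted. Its lower bound controls the normalization, its upper bound the
  bias.\<close>

lemma knn_laplacian_error:
  fixes f :: "real^'m \<Rightarrow> real" and C a b h s :: real
  assumes sb: "sampling_bound n Y N a b h s" and x: "x \<in> M" and Y: "\<And>i. i \<in> {1..n} \<Longrightarrow> Y i \<in> M"
    and n: "0 < n" and k: "real k = real n * h ^ d" "0 < k" and a: "4 * K * a ^ d \<le> 1" and b: "2 * K \<le> b ^ d"
    and err: "err_const b * (real n * h ^ (d + 3) + s) \<le> h * real k / 4"
    and mf: "f \<in> borel_measurable \<nu>" and \<alpha>: "linear \<alpha>" "\<And>z. \<bar>\<alpha> z\<bar> \<le> C * norm z"
    and \<beta>: "bounded_bilinear \<beta>" "\<And>y z. \<bar>\<beta> y z\<bar> \<le> C * norm y * norm z" and C: "0 \<le> C"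
    and ex: "\<And>y. y \<in> M \<Longrightarrow> dist y x \<le> r1 \<Longrightarrow> \<bar>f y - f x - \<alpha> (y - x) - \<beta> (y - x) (y - x)\<bar> \<le> C * norm (y - x) ^ 3"
    and bias: "\<And>r. 0 < r \<Longrightarrow> r \<le> r1 \<Longrightarrow> \<bar>expectation (\<lambda>y. indicator (cball x r) y * (f y - f x)) - r ^ (d + 2) * A\<bar> \<le> C * r ^ (d + 3)"
    and r1: "b * h \<le> r1"
  shows "\<bar>knn_laplacian d Y n k f x - A\<bar>
    \<le> (C * (CARD('m) + CARD('m)^2 + b ^ 3) * err_const b + 2 * C * K * b ^ (d + 3)) / a ^ (d + 2) * (h + s / (real n * h ^ (d + 2))) + C * b * h"
proof -
  let ?R = "knn_radius Y n k x"
  define c1 where "c1 = C * (CARD('m) + CARD('m)^2 + b ^ 3) * err_const b"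
  define c2 where "c2 = 2 * C * K * b ^ (d + 3)"
  have ss: "small_scale r0 a b h" and s0: "0 \<le> s" using sb by (auto simp: sampling_bound_def)
  note S = small_scaleD[OF ss]
  have R: "a * h \<le> ?R" "?R \<le> b * h" using knn_radius_bounds[OF sb x k a b err] .
  have R0: "0 < ?R" using R(1) S mult_pos_pos[of a h] by linarith
  have e0: "0 \<le> err_const b" using K S by (simp add: err_const_def)
  have c0: "0 \<le> c1" "0 \<le> c2" using C S e0 K by (auto simp: c1_def c2_def)
  have nh: "0 < real n * h ^ (d + 2)" "0 < real n" using n S by auto
  define \<Sigma> where "\<Sigma> = (\<Sum>i=1..n. indicator (cball x ?R) (Y i) * (f (Y i) - f x))"
  define I where "I = expectation (\<lambda>y. indicator (cball x ?R) y * (f y - f x))"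
  have "\<bar>\<Sigma> - real n * I\<bar> \<le> c1 * (real n * h ^ (d + 3) + s) + c2 * (real n * h ^ (d + 3))"
    using expansion_sampling_error[OF sb x R Y mf \<alpha> \<beta> C ex] R r1 unfolding \<Sigma>_def I_def c1_def c2_def
    by (simp add: mult.assoc)
  also have "\<dots> \<le> c1 * (real n * h ^ (d + 3) + s) + c2 * (real n * h ^ (d + 3) + s)"
    using c0 s0 by (intro add_left_mono mult_left_mono) auto
  also have "\<dots> = (c1 + c2) * ((h + s / (real n * h ^ (d + 2))) * (real n * h ^ (d + 2)))"
  proof -
    have "(h + s / q) * q = h * q + s" if "q > 0" for q :: real using that by (simp add: field_simps)
    from this[OF nh(1)] show ?thesis by (simp add: power_add power3_eq_cube power2_eq_square algebra_simps)
  qed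
  finally have 1: "\<bar>\<Sigma> - real n * I\<bar> \<le> (c1 + c2) * ((h + s / (real n * h ^ (d + 2))) * (real n * h ^ (d + 2)))" .
  have Rp: "a ^ (d + 2) * h ^ (d + 2) \<le> ?R ^ (d + 2)" unfolding power_mult_distrib[symmetric] using R S by (intro power_mono) auto
  have nR: "0 < real n * ?R ^ (d + 2)" using nh R0 by simp
  have hs: "0 \<le> h + s / (real n * h ^ (d + 2))" using S s0 nh by (simp add: add_nonneg_nonneg)
  have 2: "\<bar>\<Sigma> - real n * I\<bar> / (real n * ?R ^ (d + 2)) \<le> (c1 + c2) / a ^ (d + 2) * (h + s / (real n * h ^ (d + 2)))"
  proof -
    have "\<bar>\<Sigma> - real n * I\<bar> / (real n * ?R ^ (d + 2)) \<le> (c1 + c2) * ((h + s / (real n * h ^ (d + 2))) * (real n * h ^ (d + 2))) / (real n * (a ^ (d + 2) * h ^ (d + 2)))"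
      by (intro frac_le 1 mult_left_mono Rp) (use c0 hs nh S in auto)
    also have "\<dots> = (c1 + c2) / a ^ (d + 2) * (h + s / (real n * h ^ (d + 2)))" using nh S by simp
    finally show ?thesis .
  qed
  have 3: "\<bar>I / ?R ^ (d + 2) - A\<bar> \<le> C * b * h"
  proof -
    have "\<bar>I - ?R ^ (d + 2) * A\<bar> \<le> C * ?R ^ (d + 3)" unfolding I_def using bias R0 R r1 by simp
    moreover have "I - ?R ^ (d + 2) * A = ?R ^ (d + 2) * (I / ?R ^ (d + 2) - A)" using R0 by (simp add: field_simps)
    moreover have "C * ?R ^ (d + 3) = ?R ^ (d + 2) * (C * ?R)" by (simp add: power_add power3_eq_cube power2_eq_square)
    ultimately have "?R ^ (d + 2) * \<bar>I / ?R ^ (d + 2) - A\<bar> \<le> ?R ^ (d + 2) * (C * ?R)" using R0 by (simp add: abs_mult)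
    then have "\<bar>I / ?R ^ (d + 2) - A\<bar> \<le> C * ?R" using R0 by (simp add: mult_le_cancel_left_pos)
    also have "\<dots> \<le> C * (b * h)" using R C by (intro mult_left_mono) auto
    finally show ?thesis by simp
  qed
  have "knn_laplacian d Y n k f x - A = (\<Sigma> - real n * I) / (real n * ?R ^ (d + 2)) + (I / ?R ^ (d + 2) - A)"
    unfolding knn_laplacian_sum[OF R0] \<Sigma>_def[symmetric] using nR nh by (simp add: diff_divide_distrib)
  then have "\<bar>knn_laplacian d Y n k f x - A\<bar> \<le> \<bar>(\<Sigma> - real n * I) / (real n * ?R ^ (d + 2))\<bar> + \<bar>I / ?R ^ (d + 2) - A\<bar>"
    by (simp only: abs_triangle_ineq)
  then have "\<bar>knn_laplacian d Y n k f x - A\<bar> \<le> \<bar>\<Sigma> - real n * I\<bar> / (real n * ?R ^ (d + 2)) + \<bar>I / ?R ^ (d + 2) - A\<bar>"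
    unfolding abs_divide abs_of_pos[OF nR] .
  then show ?thesis using 2 3 unfolding c1_def c2_def by linarith
qed

end

section \<open>Asymptotics of the nearest neighbour scale\<close>

text \<open>Translation between \<open>k n\<close> and \<open>h n\<close>: as
  \<open>h^d = k/n\<close>, the second limit assumed in the theorem says that
  \<open>ln (n/k) / (n h^(d+2))\<close> tends to 0, and the stochastic part of the rate is the
  square root of that quotient.\<close>

lemma knn_scale:
  fixes k :: "nat \<Rightarrow> nat" and d :: nat
  assumes d: "d \<ge> 1" and k: "\<forall>n\<ge>1. 1 \<le> k n \<and> k n \<le> n"
    and h: "\<And>n. h n = (real (k n) / real n) powr (1 / real d)" and n: "n \<ge> 1"
  shows "0 < h n" "real (k n) = real n * h n ^ d"
    "ln (real n / real (k n)) = - real d * ln (h n)" "0 \<le> ln (real n / real (k n))"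
    "(real (k n) / real n) powr (- 1 - 2 / real d) = 1 / h n ^ (d + 2)"
    "sqrt (ln (real n / real (k n))) * (1 / sqrt (real (k n))) * (real n / real (k n)) powr (1 / real d)
       = sqrt (ln (real n / real (k n)) / (real n * h n ^ (d + 2)))"
proof -
  have "1 \<le> k n" "k n \<le> n" using k n by blast+
  then have kn: "0 < real (k n)" "real (k n) \<le> real n" "0 < real n" by linarith+
  let ?q = "real (k n) / real n"
  have q: "0 < ?q" by (rule divide_pos_pos[OF kn(1,3)])
  show h0: "0 < h n" unfolding h using kn by simp
  have hd: "h n ^ d = ?q"
  proof -
    have "h n ^ d = h n powr real d" using h0 by (simp add: powr_realpow)
    also have "\<dots> = ?q" using d q by (simp add: h powr_powr)
    finally show ?thesis .
  qed
  then show kh: "real (k n) = real n * h n ^ d" using kn by simp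
  have lq: "ln (real n / real (k n)) = - ln ?q" using kn by (simp add: ln_div)
  have "ln ?q = real d * ln (h n)" unfolding hd[symmetric] using h0 by (simp add: ln_realpow)
  then show "ln (real n / real (k n)) = - real d * ln (h n)" using lq by simp
  show l0: "0 \<le> ln (real n / real (k n))" using kn by (intro ln_ge_zero) (simp add: field_simps)
  have "h n ^ (d + 2) = h n powr real (d + 2)" by (rule powr_realpow[OF h0, symmetric])
  also have "\<dots> = h n powr (real d + 2)" by (simp add: add.commute)
  also have "\<dots> = ?q powr (1 + 2 / real d)" using d unfolding h powr_powr by (simp add: field_simps)
  finally have hq: "h n ^ (d + 2) = ?q powr (1 + 2 / real d)" .
  have e: "- 1 - 2 / real d = - (1 + 2 / real d)" by simp
  show "?q powr (- 1 - 2 / real d) = 1 / h n ^ (d + 2)" unfolding e powr_minus_divide by (simp only: hq)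
  have "(real n / real (k n)) powr (1 / real d) = 1 / h n"
  proof -
    have "real n / real (k n) = 1 / ?q" by simp
    then show ?thesis unfolding h using q by (simp add: powr_divide)
  qed
  moreover have "sqrt (ln (real n / real (k n)) / (real n * h n ^ (d + 2))) = sqrt (ln (real n / real (k n))) / (sqrt (real (k n)) * h n)"
  proof -
    have "real n * h n ^ (d + 2) = real (k n) * (h n)\<^sup>2" unfolding kh by (simp add: power_add power2_eq_square)
    then show ?thesis using h0 by (simp add: real_sqrt_divide real_sqrt_mult)
  qed
  ultimately show "sqrt (ln (real n / real (k n))) * (1 / sqrt (real (k n))) * (real n / real (k n)) powr (1 / real d)
       = sqrt (ln (real n / real (k n)) / (real n * h n ^ (d + 2)))" by simp
qed

lemma log_rate_bound:
  fixes k :: "nat \<Rightarrow> nat" and d :: nat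
  assumes d: "d \<ge> 1" and k: "\<forall>n\<ge>1. 1 \<le> k n \<and> k n \<le> n"
    and n: "n \<ge> 2" and ln: "ln (real n) \<le> sqrt (real n)"
    and h: "\<And>n. h n = (real (k n) / real n) powr (1 / real d)"
  shows "sqrt (ln (real n) / (real n * h n ^ (d + 2)))
    \<le> sqrt (2 * real d + 8) * (sqrt (ln (real n / real (k n)) / (real n * h n ^ (d + 2))) + h n)"
proof -
  have n1: "n \<ge> 1" using n by simp
  note S = knn_scale[OF d k h n1]
  let ?w = "real n * h n ^ (d + 2)" let ?g = "ln (real n / real (k n)) / ?w"
  have w: "0 < ?w" using S(1) n by simp
  have g: "0 \<le> ?g" using S(4) w by simp
  have L: "0 < ln (real n)" using n by simp
  have c1: "1 \<le> sqrt (2 * real d + 8)" by simp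
  show ?thesis
  proof (cases "ln (real n) \<le> real n * h n ^ (d + 4)")
    case True
    have "ln (real n) / ?w \<le> (h n)\<^sup>2" using True w by (simp add: divide_le_eq power_add power2_eq_square power4_eq_xxxx ac_simps)
    then have "sqrt (ln (real n) / ?w) \<le> h n" using S(1) by (intro real_le_lsqrt) (use L w in auto)
    also have "\<dots> \<le> 1 * (sqrt ?g + h n)" using g by simp
    also have "\<dots> \<le> sqrt (2 * real d + 8) * (sqrt ?g + h n)" using c1 g S(1) by (intro mult_right_mono) auto
    finally show ?thesis .
  next
    case False
    \<comment> \<open>Thus \<open>h^(d+4)\<close> is below \<open>n^(-1/2)\<close>; taking
      logarithms gives \<open>ln n < 2 * (d + 4) * (- ln h)\<close>, the source of the constant
      \<open>2 * d + 8\<close>.\<close>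
    have "real n * h n ^ (d + 4) < sqrt (real n)" using False ln by linarith
    then have "ln (real n * h n ^ (d + 4)) < ln (sqrt (real n))" using S(1) n by (subst ln_less_cancel_iff) auto
    then have "ln (real n) + real (d + 4) * ln (h n) < ln (real n) / 2"
      using S(1) n by (simp add: ln_mult ln_realpow ln_sqrt)
    then have a: "ln (real n) < 2 * real (d + 4) * (- ln (h n))" by (simp add: algebra_simps)
    have "- ln (h n) > 0" using a L by (simp add: zero_less_mult_iff) (smt (verit) mult_nonneg_nonneg of_nat_0_le_iff mult_nonneg_nonpos)
    then have "- ln (h n) \<le> real d * (- ln (h n))" using d by (simp add: mult_le_cancel_right1)
    moreover have "real d * (- ln (h n)) = - real d * ln (h n)" by simp
    ultimately have "- ln (h n) \<le> ln (real n / real (k n))" using S(3) by linarith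
    then have "2 * real (d + 4) * (- ln (h n)) \<le> 2 * real (d + 4) * ln (real n / real (k n))"
      by (intro mult_left_mono) auto
    then have "ln (real n) \<le> (2 * real d + 8) * ln (real n / real (k n))" using a by simp
    then have "ln (real n) / ?w \<le> (2 * real d + 8) * ln (real n / real (k n)) / ?w" using w by (intro divide_right_mono) auto
    then have "sqrt (ln (real n) / ?w) \<le> sqrt ((2 * real d + 8) * ?g)" by simp
    also have "\<dots> = sqrt (2 * real d + 8) * sqrt ?g" by (rule real_sqrt_mult)
    also have "\<dots> \<le> sqrt (2 * real d + 8) * (sqrt ?g + h n)" using S(1) by (intro mult_left_mono) auto
    finally show ?thesis .
  qed
qed

text \<open>The hypothesis controls the quotient with \<open>ln (n/k)\<close>, whereas the union
  bound costs \<open>ln n\<close>. Domination of \<open>lam\<close> by the claimed rate also yields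
  that \<open>lam\<close> tends to 0, without which Bernstein's bound could not be used in the
  required regime.\<close>

lemma knn_asymptotics:
  fixes k :: "nat \<Rightarrow> nat" and d :: nat
  assumes d: "d \<ge> 1" and k: "\<forall>n\<ge>1. 1 \<le> k n \<and> k n \<le> n"
    and l1: "(\<lambda>n. real (k n) / real n) \<longlonglongrightarrow> 0"
    and l2: "(\<lambda>n. 1 / real n * (real (k n) / real n) powr (- 1 - 2 / real d) * ln (real (k n) / real n)) \<longlonglongrightarrow> 0"
    and h: "\<And>n. h n = (real (k n) / real n) powr (1 / real d)"
    and lam: "\<And>n. lam n = sqrt (ln (real n) / (real n * h n ^ (d + 2)))"
  shows "h \<longlonglongrightarrow> 0" "lam \<longlonglongrightarrow> 0"
    "\<forall>\<^sub>F n in sequentially. lam n \<le> sqrt (2 * real d + 8) * (sqrt (ln (real n / real (k n)) / (real n * h n ^ (d + 2))) + h n)"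
proof -
  have "((\<lambda>n. (real (k n) / real n) powr (1 / real d)) \<longlongrightarrow> 0 powr (1 / real d)) sequentially"
    by (rule tendsto_powr2[OF l1 tendsto_const]) (use d in auto)
  then show h0: "h \<longlonglongrightarrow> 0" by (simp add: h[abs_def])
  let ?g = "\<lambda>n. ln (real n / real (k n)) / (real n * h n ^ (d + 2))"
  have ev1: "\<forall>\<^sub>F n in sequentially. n \<ge> (1::nat)" by (rule eventually_ge_at_top)
  have "\<forall>\<^sub>F n in sequentially. - (1 / real n * (real (k n) / real n) powr (- 1 - 2 / real d) * ln (real (k n) / real n)) = ?g n"
    using ev1
  proof eventually_elim
    case (elim n)
    have kn: "0 < real (k n)" "0 < real n" using k[rule_format, OF elim] elim by auto
    have l: "ln (real (k n) / real n) = - ln (real n / real (k n))" using kn by (simp add: ln_div)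
    have e: "(real (k n) / real n) powr (- 1 - 2 / real d) = 1 / h n ^ (d + 2)" by (rule knn_scale(5)[OF d k h elim])
    show ?case unfolding e l by simp
  qed
  moreover have "(\<lambda>n. - (1 / real n * (real (k n) / real n) powr (- 1 - 2 / real d) * ln (real (k n) / real n))) \<longlonglongrightarrow> - 0"
    by (rule tendsto_minus[OF l2])
  ultimately have "?g \<longlonglongrightarrow> 0" using Lim_transform_eventually by fastforce
  then have "(\<lambda>n. sqrt (2 * real d + 8) * (sqrt (?g n) + h n)) \<longlonglongrightarrow> sqrt (2 * real d + 8) * (sqrt 0 + 0)"
    by (intro tendsto_intros h0)
  then have up: "(\<lambda>n. sqrt (2 * real d + 8) * (sqrt (?g n) + h n)) \<longlonglongrightarrow> 0" by simp
  have "\<forall>\<^sub>F n in sequentially. ln (real n) \<le> sqrt (real n)"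
    by real_asymp
  with eventually_ge_at_top[of "2::nat"]
  show ev: "\<forall>\<^sub>F n in sequentially. lam n \<le> sqrt (2 * real d + 8) * (sqrt (?g n) + h n)"
  proof eventually_elim
    case (elim n)
    then show ?case unfolding lam using log_rate_bound[OF d k _ _ h] by blast
  qed
  show "lam \<longlonglongrightarrow> 0"
  proof (rule tendsto_sandwich[OF _ ev tendsto_const up])
    show "\<forall>\<^sub>F n in sequentially. 0 \<le> lam n" using ev1
    proof eventually_elim
      case (elim n)
      then show ?case using knn_scale(1)[OF d k h elim] by (simp add: lam)
    qed
  qed
qed

section \<open>The law of the sample as a regular law, and assembly of the theorem\<close>

lemma density_regular_law:
  fixes p :: "real^'m \<Rightarrow> real"
  assumes rv: "riemannian_volume TYPE('d::finite) M \<mu>"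
    and mp: "p \<in> borel_measurable \<mu>" and p0: "\<And>x. x \<in> M \<Longrightarrow> 0 \<le> p x" and p1: "(\<integral>\<^sup>+x. ennreal (p x) \<partial>\<mu>) = 1"
    and mb: "\<And>x. x \<in> M \<Longrightarrow> mass_bounds \<mu> p CARD('d) K r x" and K: "0 < K" and r: "0 < r"
  shows "regular_law (density \<mu> (\<lambda>x. ennreal (p x))) M CARD('d) (K + 1) r"
    "g \<in> borel_measurable \<mu> \<Longrightarrow> (\<integral>x. g x \<partial>density \<mu> (\<lambda>x. ennreal (p x))) = (\<integral>x. p x * g x \<partial>\<mu>)"
proof -
  let ?\<nu> = "density \<mu> (\<lambda>x. ennreal (p x))"
  have sp: "space \<mu> = M" using riemannian_volume_sets(1)[OF rv] .
  have ae: "AE x in \<mu>. 0 \<le> p x" by (rule AE_I2) (use sp p0 in auto)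
  show int: "(\<integral>x. g x \<partial>?\<nu>) = (\<integral>x. p x * g x \<partial>\<mu>)" if "g \<in> borel_measurable \<mu>" for g :: "_ \<Rightarrow> real"
    using integral_real_density[OF mp ae that] .
  interpret \<nu>: prob_space ?\<nu>
  proof (rule prob_spaceI)
    have "emeasure ?\<nu> (space ?\<nu>) = (\<integral>\<^sup>+x. ennreal (p x) * indicator (space \<mu>) x \<partial>\<mu>)"
      using mp by (simp add: emeasure_density)
    also have "\<dots> = (\<integral>\<^sup>+x. ennreal (p x) \<partial>\<mu>)" by (intro nn_integral_cong) simp
    finally show "emeasure ?\<nu> (space ?\<nu>) = 1" using p1 by simp
  qed
  have ms: "measure ?\<nu> (M \<inter> B) = (\<integral>y. indicator B y * p y \<partial>\<mu>)" if B: "B \<in> sets borel" for B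
  proof -
    have A: "M \<inter> B \<in> sets \<mu>" by (rule riemannian_volume_sets(2)[OF rv B])
    have "measure ?\<nu> (M \<inter> B) = (\<integral>x. indicator (M \<inter> B) x \<partial>?\<nu>)" using sp by (simp add: Int_ac)
    also have "\<dots> = (\<integral>x. p x * indicator (M \<inter> B) x \<partial>\<mu>)" using A by (intro int) simp
    also have "\<dots> = (\<integral>y. indicator B y * p y \<partial>\<mu>)"
      by (intro Bochner_Integration.integral_cong) (auto simp: indicator_def sp)
    finally show ?thesis .
  qed
  have an: "{y::real^'m. \<bar>dist y x - s\<bar> \<le> \<eta>} \<in> sets borel" for x s \<eta>
    by (intro borel_closed closed_Collect_le continuous_intros)
  show "regular_law ?\<nu> M CARD('d) (K + 1) r"
  proof
    show "space ?\<nu> = M" "sets ?\<nu> = sets (restrict_space borel M)" using rv by (auto simp: riemannian_volume_def)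
    \<comment> \<open>The constant is raised by 1 to meet the lower bound 1 that the locale
      demands.\<close>
    show "1 \<le> K + 1" "0 < r" "1 \<le> CARD('d)" using K r by (auto simp: Suc_le_eq)
    fix x :: "real^'m" and s :: real assume x: "x \<in> M" and s: "0 < s" "s \<le> r"
    note b = mb[OF x, unfolded mass_bounds_def, rule_format, OF conjI[OF s]]
    have cb: "cball x s \<in> sets borel" by simp
    have sd: "0 \<le> s ^ CARD('d)" using s by simp
    show "measure ?\<nu> (M \<inter> cball x s) \<le> (K + 1) * s ^ CARD('d)"
      using b sd unfolding ms[OF cb] by (simp add: algebra_simps)
    have "s ^ CARD('d) \<le> K * measure ?\<nu> (M \<inter> cball x s)" using b unfolding ms[OF cb] by simp
    also have "\<dots> \<le> (K + 1) * measure ?\<nu> (M \<inter> cball x s)" by (intro mult_right_mono) auto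
    finally show "s ^ CARD('d) \<le> (K + 1) * measure ?\<nu> (M \<inter> cball x s)" .
    fix \<eta> :: real assume \<eta>: "0 \<le> \<eta>" "\<eta> \<le> s / 2"
    have "measure ?\<nu> (M \<inter> {y. \<bar>dist y x - s\<bar> \<le> \<eta>}) \<le> K * (s ^ (CARD('d) - 1) * \<eta> + s ^ (CARD('d) + 2))"
      using b \<eta> unfolding ms[OF an] by blast
    also have "\<dots> \<le> (K + 1) * (s ^ (CARD('d) - 1) * \<eta> + s ^ (CARD('d) + 2))" using s \<eta> by (intro mult_right_mono) auto
    finally show "measure ?\<nu> (M \<inter> {y. \<bar>dist y x - s\<bar> \<le> \<eta>}) \<le> (K + 1) * (s ^ (CARD('d) - 1) * \<eta> + s ^ (CARD('d) + 2))" .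
  qed
qed

text \<open>A net of mesh \<open>h^3\<close> has \<open>O(h^(-3d))\<close> points and the grid of
  radii \<open>O(h^(-2))\<close>; with \<open>1/h \<le> n\<close> the number of tests is polynomial
  in \<open>n\<close>, of degree \<open>3 * d + 2\<close>.\<close>

lemma (in regular_law) net_tests:
  assumes ss: "small_scale r0 a b h" and n: "1 / h \<le> real n"
  obtains N where "N \<subseteq> M" "\<And>x. x \<in> M \<Longrightarrow> \<exists>y\<in>N. dist x y \<le> h ^ 3" "finite (tests N a b h)"
    "real (card (tests N a b h)) \<le> (K * 3 ^ d * (2 * b) * real (CARD('m) + CARD('m) * CARD('m) + 2)) * real n ^ (3 * d + 2)"
proof -
  note S = small_scaleD[OF ss]
  have h: "0 < h ^ 3" "h ^ 3 \<le> r0"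
  proof -
    have "h ^ 3 \<le> b * h" using S(1,3,9) mult_right_mono[of 1 b h] by linarith
    moreover have "0 \<le> b * h" using S by simp
    ultimately show "h ^ 3 \<le> r0" using S(11) by linarith
  qed (use S in simp)
  obtain N where N: "finite N" "N \<subseteq> M" "real (card N) \<le> K * (3 / h ^ 3) ^ d" "\<And>x. x \<in> M \<Longrightarrow> \<exists>y\<in>N. dist x y \<le> h ^ 3"
    using ex_net[OF h] by metis
  let ?m = "real (CARD('m) + CARD('m) * CARD('m) + 2)"
  note T = tests_card[OF S(1,2,9) N(1), of a]
  have "real (card (tests N a b h)) \<le> real (card N) * (2 * b * (1 / h) ^ 2) * ?m" by (rule T(2))
  also have "\<dots> \<le> (K * (3 / h ^ 3) ^ d) * (2 * b * (1 / h) ^ 2) * ?m"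
    using N(3) S by (intro mult_right_mono) auto
  also have "\<dots> = (K * 3 ^ d * (2 * b) * ?m) * (1 / h) ^ (3 * d + 2)"
  proof -
    have "(3 / h ^ 3) ^ d = 3 ^ d * (1 / h) ^ (3 * d)" by (simp add: power_divide power_mult)
    then show ?thesis by (simp only: power_add mult.assoc mult.commute mult.left_commute)
  qed
  also have "\<dots> \<le> (K * 3 ^ d * (2 * b) * ?m) * real n ^ (3 * d + 2)"
    using n S K by (intro mult_left_mono power_mono) auto
  finally show ?thesis using that[OF N(2,4) T(1)] by blast
qed

theorem theorem1p3:
  fixes M :: "(real^'m) set"
    and \<mu> :: "(real^'m) measure"
    and p :: "real^'m \<Rightarrow> real"
    and p_min p_max :: real
    and P :: "'w measure"
    and X :: "nat \<Rightarrow> 'w \<Rightarrow> real^'m"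
    and k :: "nat \<Rightarrow> nat"
  assumes "compact M"
    and "smooth_submanifold TYPE('d::finite) M"
    and "riemannian_volume TYPE('d) M \<mu>"
    and "Ck_manifold TYPE('d) 2 M p"
    and "0 < p_min"
    and "\<forall>x\<in>M. p_min \<le> p x \<and> p x \<le> p_max"
    and "(\<integral>\<^sup>+x. ennreal (p x) \<partial>\<mu>) = 1"
    and "prob_space P"
    and "prob_space.indep_vars P (\<lambda>_. \<mu>) X {1..}"
    and "\<forall>i\<ge>1. distributed P \<mu> (X i) (\<lambda>x. ennreal (p x))"
    and "\<forall>n\<ge>1. 1 \<le> k n \<and> k n \<le> n"
    and "(\<lambda>n. real (k n) / real n) \<longlonglongrightarrow> 0"
    and "(\<lambda>n. 1 / real n * (real (k n) / real n) powr (- 1 - 2 / real CARD('d))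
               * ln (real (k n) / real n)) \<longlonglongrightarrow> 0"
  shows "AE \<omega> in P. \<forall>f. Ck_manifold TYPE('d) 3 M f \<longrightarrow>
           (\<exists>C. \<forall>\<^sub>F n in sequentially.
              (SUP x\<in>M. ereal \<bar>knn_laplacian CARD('d) (\<lambda>i. X i \<omega>) n (k n) f x
                                 - limit_operator TYPE('d) M p f x\<bar>)
              \<le> ereal (C * (sqrt (ln (real n / real (k n))) * (1 / sqrt (real (k n)))
                               * (real n / real (k n)) powr (1 / real CARD('d))
                             + (real (k n) / real n) powr (1 / real CARD('d)))))"
proof -
  let ?d = "CARD('d)"
  have d: "?d \<ge> 1" by (simp add: Suc_le_eq)
  have sp: "space \<mu> = M" using riemannian_volume_sets(1)[OF assms(3)] .
  have mp: "p \<in> borel_measurable \<mu>"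
    using riemannian_volume_sets(3)[OF assms(3) Ck_manifold_continuous[OF assms(2,4)]] .
  have p0: "0 \<le> p x" if "x \<in> M" for x using assms(5,6) that by fastforce
  obtain K0 r where K0: "0 < K0" "0 < r" "r \<le> 1" "\<And>x. x \<in> M \<Longrightarrow> mass_bounds \<mu> p ?d K0 r x"
    using uniform_mass_bounds[OF assms(1-6)] by blast
  define \<nu> where "\<nu> = density \<mu> (\<lambda>x. ennreal (p x))"
  define K where "K = K0 + 1"
  interpret L: regular_law \<nu> M ?d K r
    unfolding \<nu>_def K_def by (rule density_regular_law(1)[OF assms(3) mp p0 assms(7) K0(4,1,2)])
  have E: "L.expectation g = (\<integral>x. p x * g x \<partial>\<mu>)" if "g \<in> borel_measurable \<mu>" for g
    unfolding \<nu>_def by (rule density_regular_law(2)[OF assms(3) mp p0 assms(7) K0(4,1,2) that])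
  have m\<nu>: "g \<in> borel_measurable \<nu> \<longleftrightarrow> g \<in> borel_measurable \<mu>" for g :: "_ \<Rightarrow> real" by (simp add: \<nu>_def)
  \<comment> \<open>Because \<open>K \<ge> 1\<close> and the dimension is at least 1,
    \<open>a^d \<le> a\<close> and \<open>b^d \<ge> b\<close>; these values therefore meet the two
    conditions of \<open>knn_radius_bounds\<close>.\<close>
  define a where "a = 1 / (4 * K)"
  define b where "b = 2 * K"
  have K1: "K \<ge> 1" by (rule L.K)
  have ab: "0 < a" "a \<le> 1" "1 \<le> b" using K1 by (auto simp: a_def b_def field_simps)
  have ad: "4 * K * a ^ ?d \<le> 1"
  proof -
    have "a ^ ?d \<le> a ^ 1" using ab d by (intro power_decreasing) auto
    then have "4 * K * a ^ ?d \<le> 4 * K * a" using K1 by simp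
    then show ?thesis using K1 by (simp add: a_def)
  qed
  have bd: "2 * K \<le> b ^ ?d" using power_increasing[OF d ab(3)] by (simp add: b_def)
  define h where "h n = (real (k n) / real n) powr (1 / real ?d)" for n
  define lam where "lam n = sqrt (ln (real n) / (real n * h n ^ (?d + 2)))" for n
  note asy = knn_asymptotics[OF d assms(11-13) h_def lam_def]
  note sc = knn_scale[OF d assms(11) h_def]
  have hpos: "\<forall>\<^sub>F n in sequentially. 3 \<le> n \<and> 0 < h n"
    using eventually_ge_at_top[of "3::nat"] by eventually_elim (use sc(1) in auto)
  have hsmall: "\<forall>\<^sub>F n in sequentially. small_scale r a b (h n)"
  proof -
    define e where "e = min (a / 12) (min (1 / (2 * b)) (r / (2 * b)))"
    have e: "0 < e" using ab K0 by (simp add: e_def)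
    have "\<forall>\<^sub>F n in sequentially. h n < e" using order_tendstoD(2)[OF asy(1) e] .
    then show ?thesis using hpos
    proof eventually_elim
      case (elim n)
      then have "h n < a / 12" "h n < 1 / (2 * b)" "h n < r / (2 * b)" by (auto simp: e_def)
      then have "12 * h n \<le> a" "2 * b * h n \<le> 1" "2 * b * h n \<le> r" using ab by (auto simp: field_simps)
      then show ?case using ab elim unfolding small_scale_def by auto
    qed
  qed
  have lsmall: "\<forall>\<^sub>F n in sequentially. lam n < 1/2" using order_tendstoD(2)[OF asy(2), of "1/2"] by simp
  \<comment> \<open>Squaring \<open>lam n < 1/2\<close> is exactly the condition of
    \<open>uniform_concentration\<close> on the variance scale.\<close>
  have wbig: "\<forall>\<^sub>F n in sequentially. 0 < h n ^ (?d + 2) \<and> 4 * ln (real n) \<le> real n * h n ^ (?d + 2)"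
    using lsmall hpos
  proof eventually_elim
    case (elim n)
    have w: "0 < h n ^ (?d + 2)" "0 < real n * h n ^ (?d + 2)" using elim by simp_all
    have "0 \<le> ln (real n) / (real n * h n ^ (?d + 2))" using elim w by (intro divide_nonneg_pos) auto
    then have "ln (real n) / (real n * h n ^ (?d + 2)) = (lam n)\<^sup>2" unfolding lam_def by simp
    also have "\<dots> \<le> (1/2)\<^sup>2" using elim(1) \<open>0 \<le> ln (real n) / _\<close> unfolding lam_def by (intro power_mono) auto
    finally have "ln (real n) \<le> 1/4 * (real n * h n ^ (?d + 2))" using w by (simp add: divide_le_eq power2_eq_square)
    then show ?case using w by simp
  qed
  \<comment> \<open>For \<open>n \<ge> 3\<close> one has \<open>ln n \<ge> 1\<close>, so
    \<open>n * h \<ge> n * h^(d+2) \<ge> 4\<close>.\<close>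
  have nbig: "\<forall>\<^sub>F n in sequentially. 1 / h n \<le> real n"
    using wbig hsmall hpos
  proof eventually_elim
    case (elim n)
    note S = small_scaleD[OF elim(2)]
    have "exp 1 \<le> (3::real)" by (rule exp_le)
    then have "exp 1 \<le> real n" using elim(3) by linarith
    then have "1 \<le> ln (real n)" using elim(3) by (subst ln_ge_iff) auto
    moreover have "h n ^ (?d + 2) \<le> h n ^ 1" using S by (intro power_decreasing) auto
    then have "real n * h n ^ (?d + 2) \<le> real n * h n" by (intro mult_left_mono) auto
    ultimately have "1 \<le> real n * h n" using elim(1) by linarith
    then show ?case using S by (simp add: divide_le_eq)
  qed
  define c where "c = K * 3 ^ ?d * (2 * b) * real (CARD('m) + CARD('m) * CARD('m) + 2)"
  define good where "good n N \<longleftrightarrow> N \<subseteq> M \<and> (\<forall>x\<in>M. \<exists>y\<in>N. dist x y \<le> h n ^ 3) \<and> finite (tests N a b (h n)) \<and>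
      real (card (tests N a b (h n))) \<le> c * real n ^ (3 * ?d + 2)" for n and N :: "(real^'m) set"
  \<comment> \<open>The nets depend on \<open>n\<close> alone and are fixed before any realization,
    as the union bound requires.\<close>
  define N where "N n = (SOME N. good n N)" for n
  have N: "\<forall>\<^sub>F n in sequentially. good n (N n)"
    using hsmall nbig
  proof eventually_elim
    case (elim n)
    obtain N' where "N' \<subseteq> M" "\<And>x. x \<in> M \<Longrightarrow> \<exists>y\<in>N'. dist x y \<le> h n ^ 3" "finite (tests N' a b (h n))"
      "real (card (tests N' a b (h n))) \<le> c * real n ^ (3 * ?d + 2)"
      unfolding c_def by (rule L.net_tests[OF elim]) blast
    then have "good n N'" unfolding good_def by blast
    then show ?case unfolding N_def by (rule someI)
  qed
  have "\<exists>A. AE \<omega> in P. \<forall>\<^sub>F n in sequentially. \<forall>g\<in>tests (N n) a b (h n).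
     \<bar>(\<Sum>i=1..n. g (X i \<omega>)) - real n * (\<integral>x. p x * g x \<partial>\<mu>)\<bar> \<le> A * sqrt (real n * h n ^ (?d + 2) * ln (real n))"
  proof (rule uniform_concentration[OF assms(8,9)])
    show "distributed P \<mu> (X i) (\<lambda>x. ennreal (p x))" if "i \<ge> 1" for i using assms(10) that by blast
    show "0 \<le> p x" if "x \<in> space \<mu>" for x using p0 that sp by blast
    show "\<forall>\<^sub>F n in sequentially. finite (tests (N n) a b (h n)) \<and> real (card (tests (N n) a b (h n))) \<le> c * real n ^ (3 * ?d + 2)"
      using N by eventually_elim (auto simp: good_def)
    show "\<forall>\<^sub>F n in sequentially. 0 < h n ^ (?d + 2) \<and> 4 * ln (real n) \<le> real n * h n ^ (?d + 2)" by (rule wbig)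
    show "\<forall>\<^sub>F n in sequentially. \<forall>g\<in>tests (N n) a b (h n). g \<in> borel_measurable \<mu> \<and> (\<forall>x\<in>space \<mu>. \<bar>g x\<bar> \<le> 1) \<and>
        (\<integral>x. p x * (g x)\<^sup>2 \<partial>\<mu>) \<le> (4 * K * b ^ (?d + 2)) * h n ^ (?d + 2)"
      using N hsmall
    proof eventually_elim
      case (elim n)
      have NM: "N n \<subseteq> M" using elim(1) by (simp add: good_def)
      show ?case
      proof (intro ballI conjI)
        fix g assume g: "g \<in> tests (N n) a b (h n)"
        note tb = L.tests_bounds[OF elim(2) NM g]
        show mg: "g \<in> borel_measurable \<mu>" using L.measurable_law[OF tb(1)] m\<nu> by blast
        show "\<bar>g x\<bar> \<le> 1" for x by (rule tb(2))
        have "(\<lambda>x. (g x)\<^sup>2) \<in> borel_measurable \<mu>" using mg by measurable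
        from E[OF this] show "(\<integral>x. p x * (g x)\<^sup>2 \<partial>\<mu>) \<le> (4 * K * b ^ (?d + 2)) * h n ^ (?d + 2)" using tb(3) by simp
      qed
    qed
  qed
  then obtain A where A: "AE \<omega> in P. \<forall>\<^sub>F n in sequentially. \<forall>g\<in>tests (N n) a b (h n).
     \<bar>(\<Sum>i=1..n. g (X i \<omega>)) - real n * (\<integral>x. p x * g x \<partial>\<mu>)\<bar> \<le> A * sqrt (real n * h n ^ (?d + 2) * ln (real n))" by blast
  \<comment> \<open>The sign of \<open>A\<close> is unknown, while \<open>sampling_bound\<close>
    asks for a nonnegative deviation.\<close>
  define B where "B = \<bar>A\<bar>"
  have B0: "0 \<le> B" by (simp add: B_def)
  define s where "s n = B * sqrt (real n * h n ^ (?d + 2) * ln (real n))" for n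
  have sl: "\<forall>\<^sub>F n in sequentially. s n = B * lam n * (real n * h n ^ (?d + 2)) \<and> 0 \<le> s n \<and> 0 \<le> lam n"
    using hpos
  proof eventually_elim
    case (elim n)
    have L: "0 \<le> ln (real n)" and q: "0 < real n * h n ^ (?d + 2)" using elim by auto
    have gen: "sqrt (q * l) = sqrt (l / q) * q" if "0 < q" "0 \<le> l" for q l :: real
    proof -
      have "sqrt (l / q) * q = sqrt (l / q) * sqrt (q\<^sup>2)" using that by simp
      also have "\<dots> = sqrt (l / q * q\<^sup>2)" by (rule real_sqrt_mult[symmetric])
      also have "l / q * q\<^sup>2 = q * l" using that by (simp add: power2_eq_square)
      finally show ?thesis ..
    qed
    have "0 \<le> ln (real n) / (real n * h n ^ (?d + 2))" using L q by (rule divide_nonneg_pos)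
    then have "0 \<le> lam n" unfolding lam_def by (rule real_sqrt_ge_zero)
    moreover have "0 \<le> s n" unfolding s_def
      by (rule mult_nonneg_nonneg[OF B0 real_sqrt_ge_zero[OF mult_nonneg_nonneg[OF less_imp_le[OF q] L]]])
    ultimately show ?case unfolding s_def lam_def gen[OF q L] by (simp only: mult.assoc simp_thms)
  qed
  \<comment> \<open>Relative to \<open>h * k = n * h^(d+1)\<close> the two errors are
    \<open>h^2\<close> and \<open>B * lam * h\<close>, both tending to 0; eventually the sum is
    below the quarter that confines the radius.\<close>
  have errs: "\<forall>\<^sub>F n in sequentially. L.err_const b * (real n * h n ^ (?d + 3) + s n) \<le> h n * real (k n) / 4"
  proof -
    have "(\<lambda>n. L.err_const b * (h n * h n + B * lam n * h n)) \<longlonglongrightarrow> L.err_const b * (0 * 0 + B * 0 * 0)"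
      by (intro tendsto_intros asy(1,2))
    then have "\<forall>\<^sub>F n in sequentially. L.err_const b * (h n * h n + B * lam n * h n) < 1/4"
      by (intro order_tendstoD(2)[of _ 0]) auto
    then show ?thesis using sl hpos
    proof eventually_elim
      case (elim n)
      have n1: "n \<ge> 1" using elim by simp
      have "L.err_const b * (real n * h n ^ (?d + 3) + s n) = (h n * real (k n)) * (L.err_const b * (h n * h n + B * lam n * h n))"
        using elim(2) unfolding sc(2)[OF n1] by (simp add: power_add power2_eq_square power3_eq_cube algebra_simps)
      also have "\<dots> \<le> (h n * real (k n)) * (1/4)" using elim by (intro mult_left_mono) auto
      finally show ?case by simp
    qed
  qed
  show ?thesis
    using A AE_space
  proof eventually_elim
    case (elim \<omega>)
    have Xin: "X i \<omega> \<in> M" if "i \<ge> 1" for i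
    proof -
      have "X i \<in> measurable P \<mu>" using assms(10) that distributed_measurable by blast
      then show ?thesis using measurable_space elim(2) sp by metis
    qed
    have sb: "\<forall>\<^sub>F n in sequentially. L.sampling_bound n (\<lambda>i. X i \<omega>) (N n) a b (h n) (s n)"
      using elim(1) N hsmall sl
    proof eventually_elim
      case (elim n)
      show ?case unfolding L.sampling_bound_def
      proof (intro conjI ballI)
        fix t assume t: "t \<in> tests (N n) a b (h n)"
        have mt: "t \<in> borel_measurable \<mu>"
          using L.measurable_law[OF L.tests_bounds(1)[OF elim(3) _ t]] m\<nu> elim(2) unfolding good_def by blast
        have "0 \<le> sqrt (real n * h n ^ (?d + 2) * ln (real n))"
          using small_scaleD(1)[OF elim(3)] by (cases n) (auto intro!: mult_nonneg_nonneg)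
        then have "A * sqrt (real n * h n ^ (?d + 2) * ln (real n)) \<le> s n"
          unfolding s_def B_def by (intro mult_right_mono) auto
        then show "\<bar>(\<Sum>i=1..n. t (X i \<omega>)) - real n * L.expectation t\<bar> \<le> s n"
          using elim(1) t unfolding E[OF mt] by fastforce
      qed (use elim in \<open>auto simp: good_def\<close>)
    qed
    show ?case
    proof (intro allI impI)
      \<comment> \<open>The realization is already fixed: the exceptional null set was determined by
        the tests and does not depend on \<open>f\<close>.\<close>
      fix f :: "real^'m \<Rightarrow> real" assume f: "Ck_manifold TYPE('d) 3 M f"
      let ?A = "limit_operator TYPE('d) M p f"
      obtain C r1 where C: "0 < C" "0 < r1" "r1 \<le> 1" "\<And>x. x \<in> M \<Longrightarrow> local_expansion M \<mu> p f ?d ?A C r1 x"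
        using uniform_local_expansion[OF assms(1-6) f] by blast
      have mf: "f \<in> borel_measurable \<mu>"
        using riemannian_volume_sets(3)[OF assms(3) Ck_manifold_continuous[OF assms(2) f]] .
      define c1 where "c1 = (C * (CARD('m) + CARD('m)^2 + b ^ 3) * L.err_const b + 2 * C * K * b ^ (?d + 3)) / a ^ (?d + 2)"
      have c1: "0 \<le> c1" using C(1) K1 ab by (auto simp: c1_def L.err_const_def intro!: divide_nonneg_pos add_nonneg_nonneg mult_nonneg_nonneg)
      define c2 where "c2 = sqrt (2 * real ?d + 8)"
      \<comment> \<open>The first term converts \<open>lam\<close> into the claimed rate at the cost
        \<open>c2\<close>; the other two collect the errors proportional to
        \<open>h\<close>.\<close>
      define C' where "C' = (c1 * B) * c2 + c1 + C * b"
      have hr1: "\<forall>\<^sub>F n in sequentially. b * h n < r1"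
      proof -
        have "(\<lambda>n. b * h n) \<longlonglongrightarrow> b * 0" by (intro tendsto_intros asy(1))
        then show ?thesis using C(2) by (intro order_tendstoD(2)[of _ 0]) auto
      qed
      have "\<forall>\<^sub>F n in sequentially.
              (SUP x\<in>M. ereal \<bar>knn_laplacian ?d (\<lambda>i. X i \<omega>) n (k n) f x - ?A x\<bar>)
              \<le> ereal (C' * (sqrt (ln (real n / real (k n))) * (1 / sqrt (real (k n)))
                               * (real n / real (k n)) powr (1 / real ?d)
                             + (real (k n) / real n) powr (1 / real ?d)))"
        using sb errs sl hpos hr1 asy(3)
      proof eventually_elim
        case (elim n)
        have n1: "n \<ge> 1" using elim by simp
        let ?g = "sqrt (ln (real n / real (k n)) / (real n * h n ^ (?d + 2)))"
        have q: "0 < real n * h n ^ (?d + 2)" using elim by simp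
        have g0: "0 \<le> ?g" using sc(4)[OF n1] q by simp
        have bound: "\<bar>knn_laplacian ?d (\<lambda>i. X i \<omega>) n (k n) f x - ?A x\<bar> \<le> C' * (?g + h n)" if x: "x \<in> M" for x
        proof -
          note le = C(4)[OF x, unfolded local_expansion_def]
          obtain \<alpha> \<beta> where ab0: "linear \<alpha> \<and> bounded_bilinear \<beta> \<and> (\<forall>z. \<bar>\<alpha> z\<bar> \<le> C * norm z) \<and> (\<forall>y z. \<bar>\<beta> y z\<bar> \<le> C * norm y * norm z) \<and>
            (\<forall>y\<in>M. dist y x \<le> r1 \<longrightarrow> \<bar>f y - f x - \<alpha> (y - x) - \<beta> (y - x) (y - x)\<bar> \<le> C * norm (y - x) ^ 3)"
            using conjunct2[OF le] by (elim exE)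
          have "\<bar>knn_laplacian ?d (\<lambda>i. X i \<omega>) n (k n) f x - ?A x\<bar> \<le> c1 * (h n + s n / (real n * h n ^ (?d + 2))) + C * b * h n"
            unfolding c1_def
          proof (rule L.knn_laplacian_error[where \<alpha>=\<alpha> and \<beta>=\<beta> and ?r1.0=r1, OF elim(1) x])
            show "X i \<omega> \<in> M" if "i \<in> {1..n}" for i using Xin that by simp
            show "0 < n" "0 < k n" using n1 assms(11)[rule_format, OF n1] by auto
            show "real (k n) = real n * h n ^ ?d" by (rule sc(2)[OF n1])
            show "4 * K * a ^ ?d \<le> 1" "2 * K \<le> b ^ ?d" by (rule ad, rule bd)
            show "L.err_const b * (real n * h n ^ (?d + 3) + s n) \<le> h n * real (k n) / 4" by (rule elim(2))
            show "f \<in> borel_measurable \<nu>" using mf m\<nu> by blast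
            show "b * h n \<le> r1" using elim by simp
            show "\<bar>L.expectation (\<lambda>y. indicator (cball x t) y * (f y - f x)) - t ^ (?d + 2) * ?A x\<bar> \<le> C * t ^ (?d + 3)"
              if t: "0 < t" "t \<le> r1" for t
            proof -
              have "(\<lambda>y. indicator (cball x t) y :: real) \<in> borel_measurable borel" by (intro borel_measurable_indicator) simp
              then have "(\<lambda>y. indicator (cball x t) y :: real) \<in> borel_measurable \<mu>" using L.measurable_law m\<nu> by blast
              then have "(\<lambda>y. indicator (cball x t) y * (f y - f x)) \<in> borel_measurable \<mu>"
                by (intro borel_measurable_times borel_measurable_diff mf borel_measurable_const)
              from E[OF this] have "L.expectation (\<lambda>y. indicator (cball x t) y * (f y - f x)) = (\<integral>y. indicator (cball x t) y * ((f y - f x) * p y) \<partial>\<mu>)"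
                by (simp only: mult.assoc mult.commute mult.left_commute)
              then show ?thesis using conjunct1[OF le, rule_format, of t] t by (simp only: simp_thms)
            qed
          qed (use ab0 C in auto)
          also have "s n / (real n * h n ^ (?d + 2)) = B * lam n"
            using elim(3) q by (simp only: nonzero_mult_div_cancel_right[OF less_imp_neq[OF q, symmetric]])
          also have "c1 * (h n + B * lam n) + C * b * h n \<le> C' * (?g + h n)"
          proof -
            have "(c1 * B) * lam n \<le> (c1 * B) * (c2 * (?g + h n))"
              using elim(6) c1 B0 unfolding c2_def by (intro mult_left_mono) auto
            moreover have "(c1 + C * b) * h n \<le> (c1 + C * b) * (?g + h n)"
              using g0 c1 C(1) ab by (intro mult_left_mono) auto
            ultimately show ?thesis by (simp add: C'_def algebra_simps)
          qed
          finally show ?thesis .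
        qed
        show ?case unfolding sc(6)[OF n1] h_def[symmetric]
          by (rule SUP_least) (use bound in simp)
      qed
      then show "\<exists>C. \<forall>\<^sub>F n in sequentially.
              (SUP x\<in>M. ereal \<bar>knn_laplacian ?d (\<lambda>i. X i \<omega>) n (k n) f x - ?A x\<bar>)
              \<le> ereal (C * (sqrt (ln (real n / real (k n))) * (1 / sqrt (real (k n)))
                               * (real n / real (k n)) powr (1 / real ?d)
                             + (real (k n) / real n) powr (1 / real ?d)))" by blast
    qed
  qed
qed

end
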